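(* Let $n=1$, $0<a<1$, $0\le\delta<1$, and $s\in\mathbb{R}$. If $$\max\left\{\tfrac14,\delta\right\}\cdot a<s,$$ then for every $f\in H^s(\mathbb{R})$, $$S^af(x,t)-f(x)=o(|t|^\delta)\quad\text{as } t\to 0,\qquad \text{for a.e. } x\in\mathbb{R}. \tag{$*$}$$ Conversely, if $( * )$ holds for all $f\in H^s(\mathbb{R})$, then $\max\{\tfrac14,\delta\}\cdot a\le s$.
   Context: $H^s(\mathbb{R})$ is the inhomogeneous $L^2$-based Sobolev space of order $s$. With $\hat f(\xi)=\int_{\mathbb{R}}e^{-ix\xi}f(x)\,dx$, the Schrödinger type operator is (formally) defined by $$S^af(x,t)=e^{it(-\Delta)^{a/2}}f(x)=\frac{1}{2\pi}\int_{\mathbb{R}}e^{i(x\xi+t|\xi|^a)}\hat f(\xi)\,d\xi ,$$ where for general $f\in H^s(\mathbb{R})$ the integral is understood as an inverse Fourier transform in the usual extended sense. The statement $S^af(x,t)-f(x)=o(|t|^\delta)$ as $t\to0$ means $\lim_{t\to0}|t|^{-\delta}\,(S^af(x,t)-f(x))=0$. *)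

theory Defs
  imports "HOL-Analysis.Analysis"
begin

section \<open>Schwartz functions and tempered distributions on the real line\<close>

definition vderiv :: "(real \<Rightarrow> complex) \<Rightarrow> real \<Rightarrow> complex"
  where "vderiv \<phi> = (\<lambda>x. vector_derivative \<phi> (at x))"

definition schwartz :: "(real \<Rightarrow> complex) set"
  where "schwartz = {\<phi>.
    (\<forall>m x. (vderiv ^^ m) \<phi> differentiable (at x)) \<and>
    (\<forall>k m. bounded (range (\<lambda>x. \<bar>x\<bar> ^ k * norm ((vderiv ^^ m) \<phi> x))))}"

definition schwartz_seminorm :: "nat \<Rightarrow> nat \<Rightarrow> (real \<Rightarrow> complex) \<Rightarrow> real"
  where "schwartz_seminorm k m \<phi> = (SUP x. \<bar>x\<bar> ^ k * norm ((vderiv ^^ m) \<phi> x))"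

definition test_functions :: "(real \<Rightarrow> complex) set"
  where "test_functions = {\<phi> \<in> schwartz. \<exists>R. \<forall>x. \<bar>x\<bar> > R \<longrightarrow> \<phi> x = 0}"

text \<open>A distribution is modelled as a functional on all functions; only its values on the
  Schwartz space are ever used.\<close>

definition tempered_distribution :: "((real \<Rightarrow> complex) \<Rightarrow> complex) \<Rightarrow> bool"
  where "tempered_distribution u \<longleftrightarrow>
    (\<forall>\<phi>\<in>schwartz. \<forall>\<psi>\<in>schwartz. u (\<lambda>x. \<phi> x + \<psi> x) = u \<phi> + u \<psi>) \<and>
    (\<forall>c. \<forall>\<phi>\<in>schwartz. u (\<lambda>x. c * \<phi> x) = c * u \<phi>) \<and>
    (\<exists>C N. \<forall>\<phi>\<in>schwartz. norm (u \<phi>) \<le> C * (\<Sum>k\<le>N. \<Sum>m\<le>N. schwartz_seminorm k m \<phi>))"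

text \<open>The distribution \<open>u\<close> is the locally integrable function \<open>g\<close>. Such a \<open>g\<close> is determined
  by \<open>u\<close> up to a null set.\<close>

definition represents :: "((real \<Rightarrow> complex) \<Rightarrow> complex) \<Rightarrow> (real \<Rightarrow> complex) \<Rightarrow> bool"
  where "represents u g \<longleftrightarrow>
    g \<in> borel_measurable borel \<and>
    (\<forall>R. set_integrable lborel {-R..R} g) \<and>
    (\<forall>\<phi>\<in>test_functions. u \<phi> = (LINT x|lborel. g x * \<phi> x))"


section \<open>Fourier transform and Sobolev spaces\<close>

definition fourier :: "(real \<Rightarrow> complex) \<Rightarrow> real \<Rightarrow> complex"
  where "fourier \<phi> \<xi> = (LINT x|lborel. exp (- \<i> * of_real (x * \<xi>)) * \<phi> x)"

definition fourier_dist :: "((real \<Rightarrow> complex) \<Rightarrow> complex) \<Rightarrow> (real \<Rightarrow> complex) \<Rightarrow> complex"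
  where "fourier_dist f = (\<lambda>\<phi>. f (fourier \<phi>))"

definition sobolev :: "real \<Rightarrow> ((real \<Rightarrow> complex) \<Rightarrow> complex) set"
  where "sobolev s = {f. tempered_distribution f \<and>
    (\<exists>g. represents (fourier_dist f) g \<and>
         integrable lborel (\<lambda>\<xi>. (1 + \<xi>\<^sup>2) powr s * (norm (g \<xi>))\<^sup>2))}"

text \<open>The Fourier transform as a function, for those \<open>f\<close> whose distributional Fourier
  transform is one (in particular on every Sobolev space). It is unique only up to a null set,
  but enters below only under integrals.\<close>

definition fourier_fun :: "((real \<Rightarrow> complex) \<Rightarrow> complex) \<Rightarrow> real \<Rightarrow> complex"
  where "fourier_fun f = (SOME g. represents (fourier_dist f) g)"


section \<open>The Schroedinger type operator\<close>

definition schroedinger_trunc ::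
    "real \<Rightarrow> ((real \<Rightarrow> complex) \<Rightarrow> complex) \<Rightarrow> real \<Rightarrow> real \<Rightarrow> real \<Rightarrow> complex"
  where "schroedinger_trunc a f x t N = 1 / (2 * of_real pi) *
    (LINT \<xi>:{-N..N}|lborel.
       exp (\<i> * of_real (x * \<xi> + t * \<bar>\<xi>\<bar> powr a)) * fourier_fun f \<xi>)"

text \<open>The Fourier inversion integral need not converge absolutely. It is read as the limit of
  the integrals over \<open>[-N, N]\<close>. The L2 definition fixes the solution at each time only up to a
  null set depending on \<open>t\<close>, which is not enough for a limit over all real \<open>t\<close> at almost
  every \<open>x\<close>. For \<open>f\<close> in L2 and any fixed \<open>t\<close> the limit below exists for almost every \<open>x\<close> and
  agrees with the L2 definition there, by Carleson's theorem.\<close>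

definition schroedinger_defined ::
    "real \<Rightarrow> ((real \<Rightarrow> complex) \<Rightarrow> complex) \<Rightarrow> real \<Rightarrow> real \<Rightarrow> bool"
  where "schroedinger_defined a f x t \<longleftrightarrow> (\<exists>l. (schroedinger_trunc a f x t \<longlongrightarrow> l) at_top)"

definition schroedinger ::
    "real \<Rightarrow> ((real \<Rightarrow> complex) \<Rightarrow> complex) \<Rightarrow> real \<Rightarrow> real \<Rightarrow> complex"
  where "schroedinger a f x t = Lim at_top (schroedinger_trunc a f x t)"

text \<open>The pointwise value of \<open>f\<close> only makes sense if the distribution \<open>f\<close> is a function \<open>f0\<close>;
  this is automatic for Sobolev order at least 0. The choice of \<open>f0\<close> is immaterial, since it is
  unique up to a null set.\<close>

definition converges_ae_with_rate ::
    "real \<Rightarrow> real \<Rightarrow> ((real \<Rightarrow> complex) \<Rightarrow> complex) \<Rightarrow> bool"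
  where "converges_ae_with_rate a \<delta> f \<longleftrightarrow>
    (\<exists>f0. represents f f0 \<and>
      (AE x in lborel.
        (\<forall>\<^sub>F t in at 0. schroedinger_defined a f x t) \<and>
        ((\<lambda>t. of_real (\<bar>t\<bar> powr (-\<delta>)) * (schroedinger a f x t - f0 x)) \<longlongrightarrow> 0) (at 0)))"

end

theory Submission
  imports Defs "HOL-Probability.Probability"
begin

text \<open>On the Fourier side the operator multiplies by \<open>cis (t |\<xi>| powr a)\<close>. For the sufficiency the
  Fourier transform of \<open>f\<close> is cut into dyadic pieces. On a piece at frequency \<open>L\<close>, van der Corput's
  second derivative test bounds the oscillatory kernel, and a linearised \<open>TT*\<close> argument turns the
  kernel bound into a local \<open>L\<^sup>1\<close> estimate for the supremum over all times in a short interval and over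
  all truncations of the frequency integral. Splitting \<open>t\<close> at \<open>L powr (- a)\<close> and dyadically above it
  shows that the maximal functions of \<open>|t| powr (- \<delta>) (S f(t) - f)\<close> of the pieces are summable if
  \<open>s > max (1/4) \<delta> * a\<close>, so the rate follows from dominated convergence for series.

  For the necessity, frequency packets with rapidly increasing frequencies are added up. If
  \<open>s < \<delta> a\<close>, a single packet at frequency \<open>N\<close> moves by more than \<open>|t| powr \<delta>\<close> at time \<open>\<pi> N powr (- a)\<close>.
  If \<open>s < a / 4\<close>, the packets are combs of about \<open>N powr (a / 2)\<close> teeth, whose evolution focuses,
  for every \<open>x\<close> in the unit interval, at some time from a finite set.\<close>

text \<open>The exponent \<open>1/4\<close> comes from the second derivative test. On a shell at
  frequency \<open>L = 2 ^ k\<close>, with times within \<rho> of each other, the kernel is of order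
  sqrt (L / |x|) for |x| up to 2 \<rho> L powr (a - 1). Its mass there is of order sqrt (\<rho> L
  powr a), and \<open>TT*\<close> takes one more square root. A time block |t| ~ 2 powr (- j),
  weighted by 2 powr (j \<delta>), therefore costs 2 powr (j \<delta> + (a k - j) / 4). For j
  between 0 and a k the exponent lies between a k / 4 and a k \<delta>, so the worse endpoint
  decides.

  The solution is a limit of truncated integrals, and this limit has to exist at almost every x for
  all small t at once. Hence the truncation is a parameter of every maximal function. In the kernel
  it merely shortens the interval of integration, and van der Corput bounds do not depend on the
  length.

  For the necessity a single bad function is needed. Each new packet is chosen so small that it
  stays summable at the test times of all earlier packets, and is tested at times so short that the
  earlier packets hardly move.\<close>

section \<open>Iterated derivatives and smooth functions on the line\<close>

primrec ndiff :: "nat \<Rightarrow> (real \<Rightarrow> complex) \<Rightarrow> bool" where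
  "ndiff 0 f = True"
| "ndiff (Suc m) f = ((\<forall>x. f differentiable (at x)) \<and> ndiff m (vderiv f))"

lemma vderiv_eqI: "(\<And>x. (f has_vector_derivative f' x) (at x)) \<Longrightarrow> vderiv f = f'"
  by (auto simp: vderiv_def fun_eq_iff intro!: vector_derivative_at)

lemma has_vderiv: "f differentiable (at x) \<Longrightarrow> (f has_vector_derivative vderiv f x) (at x)"
  by (simp add: vderiv_def vector_derivative_works)

text \<open>\<open>funpow\<close> adds the new derivative on the outside, whereas
  \<open>ndiff\<close> recurses through the innermost one. Moving it inside lets the inductions on
  m, with the function generalised, apply the sum, product and chain rules first.\<close>

lemma funpow_vderiv_Suc: "(vderiv ^^ Suc m) f = (vderiv ^^ m) (vderiv f)"
  by (simp add: funpow_Suc_right del: funpow.simps)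

lemma ndiff_SucI:
  assumes "\<And>x. (f has_vector_derivative f' x) (at x)" "ndiff m f'"
  shows "ndiff (Suc m) f"
  using assms vderiv_eqI[of f f'] by (auto intro: differentiableI_vector)

lemma ndiff_Suc_D: "ndiff (Suc m) f \<Longrightarrow> ndiff m f"
  by (induction m arbitrary: f) auto

lemma ndiff_pred: "\<forall>x. f differentiable (at x) \<Longrightarrow> ndiff m (vderiv f) \<Longrightarrow> ndiff m f"
  by (rule ndiff_Suc_D) simp

lemma ndiff_funpow_differentiable:
  "ndiff (Suc m) f \<Longrightarrow> (vderiv ^^ m) f differentiable (at x)"
proof (induction m arbitrary: f)
  case (Suc m)
  then show ?case by (simp add: funpow_vderiv_Suc del: funpow.simps)
qed simp

lemma ndiff_of_funpow:
  "(\<And>j x. (vderiv ^^ j) f differentiable (at x)) \<Longrightarrow> ndiff m f"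
proof (induction m arbitrary: f)
  case (Suc m)
  have "\<And>j x. (vderiv ^^ j) (vderiv f) differentiable (at x)"
    using Suc.prems[of "Suc j" for j] by (simp add: funpow_vderiv_Suc del: funpow.simps)
  moreover have "\<And>x. f differentiable (at x)"
    using Suc.prems[of 0] by simp
  ultimately show ?case using Suc.IH by simp
qed simp

definition smooth :: "(real \<Rightarrow> complex) \<Rightarrow> bool" where
  "smooth f \<longleftrightarrow> (\<forall>m. ndiff m f)"

lemma smooth_iff: "smooth f \<longleftrightarrow> (\<forall>m x. (vderiv ^^ m) f differentiable (at x))"
  using ndiff_funpow_differentiable ndiff_of_funpow unfolding smooth_def by metis

lemma smooth_differentiable: "smooth f \<Longrightarrow> f differentiable (at x)"
  using smooth_iff[of f] by (metis funpow_0)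

lemma smooth_vderiv: "smooth f \<Longrightarrow> smooth (vderiv f)"
  unfolding smooth_def by (metis ndiff.simps(2))

lemma smooth_funpow_vderiv: "smooth f \<Longrightarrow> smooth ((vderiv ^^ m) f)"
  by (induction m) (auto intro: smooth_vderiv)

lemma smooth_has_vderiv: "smooth f \<Longrightarrow> (f has_vector_derivative vderiv f x) (at x)"
  by (intro has_vderiv smooth_differentiable)

lemma smooth_continuous: "smooth f \<Longrightarrow> continuous_on A f"
  by (meson continuous_at_imp_continuous_on differentiable_imp_continuous_within smooth_differentiable)

lemma vderiv_const: "vderiv (\<lambda>x. c) = (\<lambda>x. 0)"
  by (rule vderiv_eqI) (auto intro!: derivative_eq_intros)

lemma ndiff_const: "ndiff m (\<lambda>x. c)"
proof (induction m arbitrary: c)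
  case (Suc m)
  show ?case by (rule ndiff_SucI[where f'="\<lambda>x. 0"]) (auto intro: Suc)
qed simp

lemma vderiv_add:
  assumes "\<And>x. f differentiable (at x)" "\<And>x. g differentiable (at x)"
  shows "vderiv (\<lambda>x. f x + g x) = (\<lambda>x. vderiv f x + vderiv g x)"
  by (rule vderiv_eqI) (intro has_vector_derivative_add has_vderiv assms)

lemma vderiv_mult:
  assumes "\<And>x. f differentiable (at x)" "\<And>x. g differentiable (at x)"
  shows "vderiv (\<lambda>x. f x * g x) = (\<lambda>x. f x * vderiv g x + vderiv f x * g x)"
  by (rule vderiv_eqI) (intro has_vector_derivative_mult has_vderiv assms)

lemma ndiff_add: "ndiff m f \<Longrightarrow> ndiff m g \<Longrightarrow> ndiff m (\<lambda>x. f x + g x)"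
  by (induction m arbitrary: f g) (auto simp: vderiv_add)

lemma funpow_vderiv_add:
  "ndiff m f \<Longrightarrow> ndiff m g \<Longrightarrow>
   (vderiv ^^ m) (\<lambda>x. f x + g x) = (\<lambda>x. (vderiv ^^ m) f x + (vderiv ^^ m) g x)"
proof (induction m arbitrary: f g)
  case (Suc m)
  then show ?case by (simp add: funpow_vderiv_Suc vderiv_add del: funpow.simps)
qed simp

lemma ndiff_mult: "ndiff m f \<Longrightarrow> ndiff m g \<Longrightarrow> ndiff m (\<lambda>x. f x * g x)"
proof (induction m arbitrary: f g)
  case (Suc m)
  have "ndiff m (\<lambda>x. f x * vderiv g x + vderiv f x * g x)"
    using Suc.prems by (intro ndiff_add Suc.IH) (auto intro: ndiff_pred)
  then show ?case
    using Suc.prems by (auto simp: vderiv_mult intro!: differentiable_mult)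
qed simp

lemma funpow_vderiv_cmult:
  "ndiff m f \<Longrightarrow> (vderiv ^^ m) (\<lambda>x. c * f x) = (\<lambda>x. c * (vderiv ^^ m) f x)"
proof (induction m arbitrary: f)
  case (Suc m)
  then show ?case
    by (simp add: funpow_vderiv_Suc vderiv_mult vderiv_const del: funpow.simps)
qed simp

lemma vderiv_affine:
  assumes "\<And>x. f differentiable (at x)"
  shows "vderiv (\<lambda>x. f (c * x + d)) = (\<lambda>x. of_real c * vderiv f (c * x + d))"
proof (rule vderiv_eqI)
  fix x
  have 1: "((\<lambda>x. c * x + d) has_vector_derivative c) (at x)"
    by (auto intro!: derivative_eq_intros)
  have "(f \<circ> (\<lambda>x. c * x + d) has_vector_derivative (c *\<^sub>R vderiv f (c * x + d))) (at x)"
    by (rule vector_diff_chain_at[OF 1 has_vderiv[OF assms]])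
  then show "((\<lambda>x. f (c * x + d)) has_vector_derivative of_real c * vderiv f (c * x + d)) (at x)"
    by (simp add: o_def scaleR_conv_of_real)
qed

lemma differentiable_affine:
  assumes "\<And>x. (f :: real \<Rightarrow> complex) differentiable (at x)"
  shows "(\<lambda>x. f (c * x + d)) differentiable (at x)"
  using differentiable_chain_at[of "\<lambda>x. c * x + d" x f] assms by (simp add: o_def)

lemma ndiff_affine: "ndiff m f \<Longrightarrow> ndiff m (\<lambda>x. f (c * x + d))"
proof (induction m arbitrary: f)
  case (Suc m)
  have "ndiff m (\<lambda>x. of_real c * vderiv f (c * x + d))"
    using Suc.prems by (intro ndiff_mult ndiff_const Suc.IH) auto
  then show ?case using Suc.prems by (auto simp: vderiv_affine intro: differentiable_affine)
qed simp

lemma funpow_vderiv_affine: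
  "ndiff m f \<Longrightarrow> (vderiv ^^ m) (\<lambda>x. f (c * x + d)) = (\<lambda>x. of_real c ^ m * (vderiv ^^ m) f (c * x + d))"
proof (induction m arbitrary: f)
  case (Suc m)
  have "(vderiv ^^ Suc m) (\<lambda>x. f (c * x + d)) = (vderiv ^^ m) (\<lambda>x. of_real c * vderiv f (c * x + d))"
    using Suc.prems by (simp add: funpow_vderiv_Suc vderiv_affine del: funpow.simps)
  also have "\<dots> = (\<lambda>x. of_real c * (vderiv ^^ m) (\<lambda>x. vderiv f (c * x + d)) x)"
    using Suc.prems by (intro funpow_vderiv_cmult ndiff_affine) auto
  finally show ?case
    using Suc by (simp add: funpow_vderiv_Suc mult.assoc del: funpow.simps)
qed simp

text \<open>The derivative of 1/f is a product of \<open>vderiv f\<close> and two copies of 1/f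
  itself, so the induction hypothesis for the same f suffices.\<close>

lemma ndiff_inverse:
  assumes "\<And>x. f x \<noteq> 0"
  shows "ndiff m f \<Longrightarrow> ndiff m (\<lambda>x. inverse (f x))"
proof (induction m)
  case (Suc m)
  have "((\<lambda>x. inverse (f x)) has_vector_derivative - 1 * vderiv f x * inverse (f x) * inverse (f x)) (at x)" for x
  proof -
    have "(f has_vector_derivative vderiv f x) (at x)" using Suc.prems by (auto intro: has_vderiv)
    then have "((inverse \<circ> f) has_vector_derivative vderiv f x * (- inverse (f x) * inverse (f x))) (at x)"
      using assms by (intro field_vector_diff_chain_at)
        (auto intro!: derivative_eq_intros simp: power2_eq_square)
    then show ?thesis by (simp add: o_def mult_ac)
  qed
  moreover have "ndiff m (\<lambda>x. - 1 * vderiv f x * inverse (f x) * inverse (f x))"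
    using Suc.prems by (intro ndiff_mult ndiff_const Suc.IH) (auto intro: ndiff_pred)
  ultimately show ?case by (rule ndiff_SucI)
qed simp

lemma smooth_add: "smooth f \<Longrightarrow> smooth g \<Longrightarrow> smooth (\<lambda>x. f x + g x)"
  and smooth_mult: "smooth f \<Longrightarrow> smooth g \<Longrightarrow> smooth (\<lambda>x. f x * g x)"
  and smooth_const: "smooth (\<lambda>x. c)"
  and smooth_affine: "smooth f \<Longrightarrow> smooth (\<lambda>x. f (k * x + d))"
  and smooth_inverse: "smooth f \<Longrightarrow> (\<And>x. f x \<noteq> 0) \<Longrightarrow> smooth (\<lambda>x. inverse (f x))"
  by (auto simp: smooth_def intro: ndiff_add ndiff_mult ndiff_const ndiff_affine ndiff_inverse)

lemma smooth_ndiff: "smooth f \<Longrightarrow> ndiff m f"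
  by (simp add: smooth_def)

text \<open>A crude Leibniz rule: each derivative splits a product into two, hence
  \<open>2 ^ m\<close>, and all pairs of orders up to m are kept instead of binomial
  coefficients.\<close>

lemma norm_funpow_vderiv_mult_le:
  assumes "smooth f" "smooth g"
  shows "norm ((vderiv ^^ m) (\<lambda>x. f x * g x) x) \<le>
    2 ^ m * (\<Sum>i\<le>m. \<Sum>j\<le>m. norm ((vderiv ^^ i) f x) * norm ((vderiv ^^ j) g x))"
  using assms
proof (induction m arbitrary: f g)
  case (Suc m)
  let ?d = "\<lambda>i f. norm ((vderiv ^^ i) f x)"
  let ?S = "\<Sum>i\<le>Suc m. \<Sum>j\<le>Suc m. ?d i f * ?d j g"
  have eq: "(vderiv ^^ Suc m) (\<lambda>x. f x * g x) =
     (\<lambda>x. (vderiv ^^ m) (\<lambda>x. f x * vderiv g x) x + (vderiv ^^ m) (\<lambda>x. vderiv f x * g x) x)"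
    using Suc.prems
    by (simp add: funpow_vderiv_Suc vderiv_mult smooth_differentiable funpow_vderiv_add
        smooth_ndiff smooth_mult smooth_vderiv del: funpow.simps)
  have "(\<Sum>i\<le>m. \<Sum>j\<le>m. ?d i f * ?d j (vderiv g)) = (\<Sum>i\<le>m. \<Sum>j\<in>{Suc 0..Suc m}. ?d i f * ?d j g)"
    by (simp add: funpow_vderiv_Suc[symmetric] atMost_atLeast0 sum.shift_bounds_cl_Suc_ivl
        del: funpow.simps sum.cl_ivl_Suc)
  also have "\<dots> \<le> (\<Sum>i\<le>m. \<Sum>j\<le>Suc m. ?d i f * ?d j g)"
    by (intro sum_mono sum_mono2) auto
  also have "\<dots> \<le> ?S"
    by (intro sum_mono2 sum_nonneg mult_nonneg_nonneg) auto
  finally have 1: "(\<Sum>i\<le>m. \<Sum>j\<le>m. ?d i f * ?d j (vderiv g)) \<le> ?S" .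
  have "(\<Sum>i\<le>m. \<Sum>j\<le>m. ?d i (vderiv f) * ?d j g) = (\<Sum>i\<in>{Suc 0..Suc m}. \<Sum>j\<le>m. ?d i f * ?d j g)"
    by (simp add: funpow_vderiv_Suc[symmetric] atMost_atLeast0 sum.shift_bounds_cl_Suc_ivl
        del: funpow.simps sum.cl_ivl_Suc)
  also have "\<dots> \<le> (\<Sum>i\<in>{Suc 0..Suc m}. \<Sum>j\<le>Suc m. ?d i f * ?d j g)"
    by (intro sum_mono sum_mono2) auto
  also have "\<dots> \<le> ?S"
    by (intro sum_mono2 sum_nonneg mult_nonneg_nonneg) auto
  finally have 2: "(\<Sum>i\<le>m. \<Sum>j\<le>m. ?d i (vderiv f) * ?d j g) \<le> ?S" .
  have "norm ((vderiv ^^ Suc m) (\<lambda>x. f x * g x) x) \<le> 2 ^ m * ?S + 2 ^ m * ?S"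
    unfolding eq
    by (rule norm_triangle_mono; rule order_trans[OF Suc.IH])
       (use Suc.prems 1 2 in \<open>auto intro: smooth_vderiv\<close>)
  then show ?case by simp
qed (simp add: norm_mult)

subsection \<open>Schwartz functions\<close>

lemma schwartz_iff:
  "\<phi> \<in> schwartz \<longleftrightarrow> smooth \<phi> \<and> (\<forall>k m. \<exists>C. \<forall>x. \<bar>x\<bar> ^ k * norm ((vderiv ^^ m) \<phi> x) \<le> C)"
  unfolding schwartz_def smooth_iff bounded_iff by (auto simp: abs_mult)

lemma schwartz_smooth: "\<phi> \<in> schwartz \<Longrightarrow> smooth \<phi>"
  by (simp add: schwartz_iff)

lemma schwartz_vderiv: "\<phi> \<in> schwartz \<Longrightarrow> vderiv \<phi> \<in> schwartz"
  unfolding schwartz_iff using smooth_vderiv by (metis funpow_vderiv_Suc)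

lemma schwartz_funpow_vderiv: "\<phi> \<in> schwartz \<Longrightarrow> (vderiv ^^ m) \<phi> \<in> schwartz"
  by (induction m) (auto intro: schwartz_vderiv)

lemma schwartz_decay:
  assumes "\<phi> \<in> schwartz"
  obtains C where "C > 0" "\<And>x. norm (\<phi> x) \<le> C / (1 + \<bar>x\<bar> ^ k)"
proof -
  obtain C0 where C0: "\<And>x. \<bar>x\<bar> ^ 0 * norm ((vderiv ^^ 0) \<phi> x) \<le> C0"
    using assms unfolding schwartz_iff by metis
  obtain C1 where C1: "\<And>x. \<bar>x\<bar> ^ k * norm ((vderiv ^^ 0) \<phi> x) \<le> C1"
    using assms unfolding schwartz_iff by metis
  have "norm (\<phi> x) \<le> (\<bar>C0\<bar> + \<bar>C1\<bar> + 1) / (1 + \<bar>x\<bar> ^ k)" for x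
  proof -
    have "norm (\<phi> x) * (1 + \<bar>x\<bar> ^ k) \<le> \<bar>C0\<bar> + \<bar>C1\<bar> + 1"
      using C0[of x] C1[of x] by (simp add: algebra_simps)
    moreover have "1 + \<bar>x\<bar> ^ k > 0"
      by (simp add: add_pos_nonneg)
    ultimately show ?thesis by (simp add: field_simps)
  qed
  then show ?thesis using that[of "\<bar>C0\<bar> + \<bar>C1\<bar> + 1"] by auto
qed

text \<open>Polynomial growth of degree l in a derivative of u is absorbed by using the decay of
  \<phi> with weight k + l next to weight k; the Leibniz bound reduces everything to such
  products.\<close>

lemma schwartz_mult:
  assumes "smooth u" "\<And>m. \<exists>C k. \<forall>x. norm ((vderiv ^^ m) u x) \<le> C * (1 + \<bar>x\<bar> ^ k)" "\<phi> \<in> schwartz"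
  shows "(\<lambda>x. u x * \<phi> x) \<in> schwartz"
  unfolding schwartz_iff
proof (intro conjI allI)
  show "smooth (\<lambda>x. u x * \<phi> x)" by (intro smooth_mult schwartz_smooth assms)
  fix k m
  have "\<exists>C. \<forall>x. \<bar>x\<bar> ^ k * (norm ((vderiv ^^ i) u x) * norm ((vderiv ^^ j) \<phi> x)) \<le> C" for i j
  proof -
    obtain C l where C: "\<And>x. norm ((vderiv ^^ i) u x) \<le> C * (1 + \<bar>x\<bar> ^ l)" using assms(2) by metis
    obtain C1 where C1: "\<And>x. \<bar>x\<bar> ^ k * norm ((vderiv ^^ j) \<phi> x) \<le> C1"
      using assms(3) unfolding schwartz_iff by metis
    obtain C2 where C2: "\<And>x. \<bar>x\<bar> ^ (k + l) * norm ((vderiv ^^ j) \<phi> x) \<le> C2"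
      using assms(3) unfolding schwartz_iff by metis
    have C0: "C \<ge> 0"
    proof -
      have "0 \<le> C * (1 + \<bar>0\<bar> ^ l)" using order_trans[OF norm_ge_zero C[of 0]] .
      moreover have "(0::real) < 1 + \<bar>0\<bar> ^ l" by (cases l) auto
      ultimately show ?thesis by (simp add: zero_le_mult_iff)
    qed
    have "\<bar>x\<bar> ^ k * (norm ((vderiv ^^ i) u x) * norm ((vderiv ^^ j) \<phi> x)) \<le> C * (C1 + C2)" for x
    proof -
      have "\<bar>x\<bar> ^ k * (norm ((vderiv ^^ i) u x) * norm ((vderiv ^^ j) \<phi> x))
          \<le> \<bar>x\<bar> ^ k * ((C * (1 + \<bar>x\<bar> ^ l)) * norm ((vderiv ^^ j) \<phi> x))"
        by (intro mult_left_mono mult_right_mono C) auto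
      also have "\<dots> = C * (\<bar>x\<bar> ^ k * norm ((vderiv ^^ j) \<phi> x) + \<bar>x\<bar> ^ (k + l) * norm ((vderiv ^^ j) \<phi> x))"
        by (simp add: algebra_simps power_add)
      also have "\<dots> \<le> C * (C1 + C2)" by (intro mult_left_mono add_mono C1 C2 C0)
      finally show ?thesis .
    qed
    then show ?thesis by blast
  qed
  then obtain C where C: "\<And>i j x. \<bar>x\<bar> ^ k * (norm ((vderiv ^^ i) u x) * norm ((vderiv ^^ j) \<phi> x)) \<le> C i j"
    by metis
  have "\<bar>x\<bar> ^ k * norm ((vderiv ^^ m) (\<lambda>x. u x * \<phi> x) x) \<le> 2 ^ m * (\<Sum>i\<le>m. \<Sum>j\<le>m. C i j)" for x
  proof -
    have "\<bar>x\<bar> ^ k * norm ((vderiv ^^ m) (\<lambda>x. u x * \<phi> x) x)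
      \<le> \<bar>x\<bar> ^ k * (2 ^ m * (\<Sum>i\<le>m. \<Sum>j\<le>m. norm ((vderiv ^^ i) u x) * norm ((vderiv ^^ j) \<phi> x)))"
      by (intro mult_left_mono norm_funpow_vderiv_mult_le assms(1) schwartz_smooth[OF assms(3)]) auto
    also have "\<dots> = 2 ^ m * (\<Sum>i\<le>m. \<Sum>j\<le>m. \<bar>x\<bar> ^ k * (norm ((vderiv ^^ i) u x) * norm ((vderiv ^^ j) \<phi> x)))"
      by (simp add: sum_distrib_left mult_ac)
    also have "\<dots> \<le> 2 ^ m * (\<Sum>i\<le>m. \<Sum>j\<le>m. C i j)"
      by (intro mult_left_mono sum_mono C) auto
    finally show ?thesis .
  qed
  then show "\<exists>C. \<forall>x. \<bar>x\<bar> ^ k * norm ((vderiv ^^ m) (\<lambda>x. u x * \<phi> x) x) \<le> C" by blast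
qed

lemma funpow_vderiv_0: "(vderiv ^^ m) (\<lambda>x. 0) = (\<lambda>x. 0)"
  by (induction m) (auto simp: vderiv_const)

lemma smooth_of_real: "smooth of_real"
  and funpow_vderiv_of_real: "(vderiv ^^ m) of_real = (\<lambda>x. if m = 0 then of_real x else if m = 1 then 1 else 0)"
proof -
  have d: "(of_real has_vector_derivative 1) (at x)" for x :: real
    by (auto intro!: derivative_eq_intros has_vector_derivative_of_real)
  then have v: "vderiv of_real = (\<lambda>x. 1)" by (intro vderiv_eqI)
  show "smooth of_real"
    unfolding smooth_def
  proof
    fix m
    have "ndiff (Suc m) of_real" using d by (rule ndiff_SucI) (rule ndiff_const)
    then show "ndiff m of_real" by (rule ndiff_Suc_D)
  qed
  show "(vderiv ^^ m) of_real = (\<lambda>x. if m = 0 then of_real x else if m = 1 then 1 else 0)"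
  proof (cases m)
    case (Suc n)
    show ?thesis
    proof (cases n)
      case 0
      then show ?thesis using Suc v by simp
    next
      case (Suc l)
      with \<open>m = Suc n\<close> show ?thesis
        by (simp add: funpow_vderiv_Suc v vderiv_const funpow_vderiv_0 del: funpow.simps)
    qed
  qed simp
qed

lemma schwartz_mult_id:
  assumes "\<phi> \<in> schwartz"
  shows "(\<lambda>x. of_real x * \<phi> x) \<in> schwartz"
proof (rule schwartz_mult[OF smooth_of_real _ assms])
  fix m
  show "\<exists>C k. \<forall>x. norm ((vderiv ^^ m) complex_of_real x) \<le> C * (1 + \<bar>x\<bar> ^ k)"
    by (intro exI[of _ 1] exI[of _ 1]) (auto simp: funpow_vderiv_of_real)
qed

lemma schwartz_cmult:
  assumes "\<phi> \<in> schwartz"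
  shows "(\<lambda>x. c * \<phi> x) \<in> schwartz"
proof (rule schwartz_mult[OF smooth_const _ assms])
  fix m
  have "norm ((vderiv ^^ m) (\<lambda>x. c) x) \<le> norm c * (1 + \<bar>x\<bar> ^ 0)" for x
    by (cases m) (auto simp: funpow_vderiv_Suc vderiv_const funpow_vderiv_0 simp del: funpow.simps(2))
  then show "\<exists>C k. \<forall>x. norm ((vderiv ^^ m) (\<lambda>x. c) x) \<le> C * (1 + \<bar>x\<bar> ^ k)" by blast
qed

lemma schwartz_reflect:
  assumes "\<phi> \<in> schwartz"
  shows "(\<lambda>x. \<phi> (- x)) \<in> schwartz"
proof -
  have eq: "(vderiv ^^ m) (\<lambda>x. \<phi> (- x)) = (\<lambda>x. (- 1) ^ m * (vderiv ^^ m) \<phi> (- x))" for m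
    using funpow_vderiv_affine[of m \<phi> "-1" 0] assms by (simp add: smooth_ndiff schwartz_smooth)
  have "smooth (\<lambda>x. \<phi> (- x))" using smooth_affine[of \<phi> "-1" 0] assms by (simp add: schwartz_smooth)
  moreover have "\<exists>C. \<forall>x. \<bar>x\<bar> ^ k * norm ((vderiv ^^ m) (\<lambda>x. \<phi> (- x)) x) \<le> C" for k m
  proof -
    obtain C where C: "\<And>x. \<bar>x\<bar> ^ k * norm ((vderiv ^^ m) \<phi> x) \<le> C"
      using assms unfolding schwartz_iff by metis
    show ?thesis using C[of "- x" for x] by (auto simp: eq norm_mult norm_power intro!: exI[of _ C])
  qed
  ultimately show ?thesis by (simp add: schwartz_iff)
qed

lemma integrable_inverse_1_plus_square: "integrable lborel (\<lambda>x :: real. inverse (1 + x\<^sup>2))"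
  using Sinc_Integral.integrable_inverse_1_plus_square
  by (simp add: interval_lebesgue_integrable_def set_integrable_def einterval_def)

text \<open>A quadratic remainder for every increment is what the Taylor bound of \<open>cis\<close>
  yields after integration, so this criterion replaces differentiation under the integral sign. It
  also settles the flat point of \<open>bump_exp\<close>.\<close>

lemma has_vector_derivative_quadratic:
  fixes f :: "real \<Rightarrow> 'a :: real_normed_vector"
  assumes "\<And>h. norm (f (x + h) - f x - h *\<^sub>R d) \<le> C * h\<^sup>2"
  shows "(f has_vector_derivative d) (at x)"
  unfolding has_vector_derivative_def has_derivative_at
proof (intro conjI)
  show "bounded_linear (\<lambda>h. h *\<^sub>R d)" by (rule bounded_linear_scaleR_left)
  have lim: "((\<lambda>h. C * \<bar>h\<bar>) \<longlongrightarrow> 0) (at 0)"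
    by (auto intro!: tendsto_eq_intros)
  show "(\<lambda>h. norm (f (x + h) - f x - h *\<^sub>R d) / norm h) \<midarrow>0\<rightarrow> 0"
  proof (rule tendsto_sandwich[OF _ _ tendsto_const lim])
    show "\<forall>\<^sub>F h in at 0. norm (f (x + h) - f x - h *\<^sub>R d) / norm h \<le> C * \<bar>h\<bar>"
    proof (rule eventually_mono[OF eventually_at_ball'[of 1]])
      fix h :: real assume "h \<in> ball 0 1 \<and> h \<noteq> 0 \<and> h \<in> UNIV"
      then have "h \<noteq> 0" by simp
      moreover have "norm (f (x + h) - f x - h *\<^sub>R d) \<le> C * (\<bar>h\<bar> * \<bar>h\<bar>)"
        using assms[of h] by (simp add: power2_eq_square flip: abs_mult)
      ultimately show "norm (f (x + h) - f x - h *\<^sub>R d) / norm h \<le> C * \<bar>h\<bar>"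
        by (simp add: field_simps)
    qed simp
  qed (auto intro!: always_eventually)
qed

lemma power_le_fact_mult_exp:
  fixes y :: real assumes "0 \<le> y"
  shows "y ^ n \<le> fact n * exp y"
proof -
  have "(\<Sum>i\<in>{n}. y ^ i /\<^sub>R fact i) \<le> (\<Sum>i. y ^ i /\<^sub>R fact i)"
    using assms exp_converges[of y] by (intro sum_le_suminf) (auto simp: sums_iff)
  then have "y ^ n / fact n \<le> exp y"
    using exp_converges[of y] by (simp add: sums_iff field_simps)
  then show ?thesis by (simp add: field_simps)
qed

subsection \<open>Smooth cutoffs\<close>

text \<open>The powers of 1/x make the family closed under differentiation: a derivative combines
  the members k + 2 and k + 1, so smoothness is one induction over all k.\<close>

definition bump_exp :: "nat \<Rightarrow> real \<Rightarrow> complex" where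
  "bump_exp k x = (if x > 0 then of_real ((1 / x) ^ k * exp (- (1 / x))) else 0)"

text \<open>The term of order k + 2 in the exponential series at 1/x beats (1/x)^k and leaves a
  factor \<open>x\<^sup>2\<close>, the order that \<open>has_vector_derivative_quadratic\<close>
  asks for at 0.\<close>

lemma norm_bump_exp_le: "norm (bump_exp k x) \<le> fact (k + 2) * x\<^sup>2"
proof (cases "x > 0")
  case True
  have "(1 / x) ^ (k + 2) \<le> fact (k + 2) * exp (1 / x)"
    using power_le_fact_mult_exp[of "1 / x" "k + 2"] True by simp
  then have "(1 / x) ^ (k + 2) * (x\<^sup>2 * exp (- (1 / x))) \<le> fact (k + 2) * exp (1 / x) * (x\<^sup>2 * exp (- (1 / x)))"
    by (intro mult_right_mono) auto
  moreover have "(1 / x) ^ (k + 2) * (x\<^sup>2 * exp (- (1 / x))) = (1 / x) ^ k * exp (- (1 / x))"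
    using True by (simp add: field_simps power2_eq_square)
  moreover have "fact (k + 2) * exp (1 / x) * (x\<^sup>2 * exp (- (1 / x))) = fact (k + 2) * x\<^sup>2 * (exp (1 / x) * exp (- (1 / x)))"
    by (simp only: mult_ac)
  moreover have "exp (1 / x) * exp (- (1 / x)) = 1" by (simp flip: exp_add)
  moreover have "norm (bump_exp k x) = (1 / x) ^ k * exp (- (1 / x))"
    using True by (simp only: bump_exp_def if_True norm_of_real) (simp add: abs_mult)
  ultimately show ?thesis by (simp only: mult_1_right)
qed (auto simp: bump_exp_def)

lemma bump_exp_has_vderiv:
  "(bump_exp k has_vector_derivative bump_exp (k + 2) x - of_nat k * bump_exp (k + 1) x) (at x)"
proof -
  consider "x < 0" | "x = 0" | "x > 0" by linarith
  then show ?thesis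
  proof cases
    case 1
    have "((\<lambda>x. 0) has_vector_derivative (0::complex)) (at x)" by simp
    then have "(bump_exp k has_vector_derivative 0) (at x)"
      by (rule has_vector_derivative_transform_within_open[of _ _ _ "{..<0}"])
         (use 1 in \<open>auto simp: bump_exp_def\<close>)
    then show ?thesis using 1 by (simp add: bump_exp_def)
  next
    case 2
    have "(bump_exp k has_vector_derivative 0) (at x)"
      by (rule has_vector_derivative_quadratic[where C = "fact (k + 2)"])
         (use 2 norm_bump_exp_le[of k] in \<open>simp add: bump_exp_def\<close>)
    then show ?thesis using 2 by (simp add: bump_exp_def)
  next
    case 3
    have der: "((\<lambda>x. (1 / x) ^ k * exp (- (1 / x))) has_real_derivative
        ((1 / x) ^ (k + 2) * exp (- (1 / x)) - of_nat k * ((1 / x) ^ (k + 1) * exp (- (1 / x))))) (at x)"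
    proof (cases k)
      case 0
      show ?thesis unfolding 0
        by (rule derivative_eq_intros refl | use 3 in \<open>simp add: field_simps power2_eq_square\<close>)+
    next
      case (Suc n)
      show ?thesis unfolding Suc
        by (rule derivative_eq_intros refl | use 3 in \<open>simp add: field_simps power2_eq_square\<close>)+
    qed
    have "((\<lambda>x. of_real ((1 / x) ^ k * exp (- (1 / x)))) has_vector_derivative
        (of_real ((1 / x) ^ (k + 2) * exp (- (1 / x)) - of_nat k * ((1 / x) ^ (k + 1) * exp (- (1 / x)))) :: complex)) (at x)"
      using der by (intro has_vector_derivative_of_real) (simp add: has_real_derivative_iff_has_vector_derivative)
    then have "(bump_exp k has_vector_derivative
        (of_real ((1 / x) ^ (k + 2) * exp (- (1 / x)) - of_nat k * ((1 / x) ^ (k + 1) * exp (- (1 / x)))) :: complex)) (at x)"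
      by (rule has_vector_derivative_transform_within_open[of _ _ _ "{0<..}"])
         (use 3 in \<open>auto simp: bump_exp_def\<close>)
    moreover have "(of_real ((1 / x) ^ (k + 2) * exp (- (1 / x)) - of_nat k * ((1 / x) ^ (k + 1) * exp (- (1 / x)))) :: complex)
      = bump_exp (k + 2) x - of_nat k * bump_exp (k + 1) x"
      using 3 unfolding bump_exp_def by (simp only: if_True of_real_diff of_real_mult of_real_of_nat_eq)
    ultimately show ?thesis by simp
  qed
qed

lemma smooth_bump_exp: "smooth (bump_exp k)"
proof -
  have "ndiff m (bump_exp k)" for m
  proof (induction m arbitrary: k)
    case (Suc m)
    have "ndiff m (\<lambda>x. bump_exp (k + 2) x + (- of_nat k) * bump_exp (k + 1) x)"
      by (intro ndiff_add ndiff_mult ndiff_const Suc)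
    then show ?case using bump_exp_has_vderiv[of k] by (intro ndiff_SucI) auto
  qed simp
  then show ?thesis by (simp add: smooth_def)
qed

definition smooth_step :: "real \<Rightarrow> complex" where
  "smooth_step x = bump_exp 0 x * inverse (bump_exp 0 x + bump_exp 0 (1 - x))"

lemma bump_exp_0: "bump_exp 0 x = of_real (if x > 0 then exp (- (1 / x)) else 0)"
  by (simp add: bump_exp_def)

lemma bump_exp_sum_nz: "bump_exp 0 x + bump_exp 0 (1 - x) \<noteq> 0"
proof -
  have "0 < (if x > 0 then exp (- (1 / x)) else 0) + (if 1 - x > 0 then exp (- (1 / (1 - x))) else 0)"
    by (auto simp: add_pos_pos)
  then show ?thesis unfolding bump_exp_0 by (metis less_irrefl of_real_add of_real_eq_0_iff)
qed

lemma smooth_smooth_step: "smooth smooth_step"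
proof -
  have "smooth (\<lambda>x. bump_exp 0 (- 1 * x + 1))" by (rule smooth_affine[OF smooth_bump_exp])
  then have 1: "smooth (\<lambda>x. bump_exp 0 (1 - x))" by simp
  have "smooth (\<lambda>x. bump_exp 0 x * inverse (bump_exp 0 x + bump_exp 0 (1 - x)))"
    by (intro smooth_mult smooth_inverse smooth_add smooth_bump_exp 1 bump_exp_sum_nz)
  then show ?thesis by (simp add: smooth_step_def[abs_def])
qed

lemma smooth_step_eq_0: "x \<le> 0 \<Longrightarrow> smooth_step x = 0"
  by (simp add: smooth_step_def bump_exp_def)

lemma smooth_step_eq_1: "x \<ge> 1 \<Longrightarrow> smooth_step x = 1"
  using bump_exp_sum_nz[of x] by (simp add: smooth_step_def bump_exp_def)

lemma norm_smooth_step_le: "norm (smooth_step x) \<le> 1"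
proof -
  let ?a = "if x > 0 then exp (- (1 / x)) else 0"
  let ?b = "if 1 - x > 0 then exp (- (1 / (1 - x))) else 0"
  have pos: "0 < ?a + ?b" by (auto simp: add_pos_pos)
  have "smooth_step x = of_real (?a * inverse (?a + ?b))"
    unfolding smooth_step_def bump_exp_0 by (simp only: of_real_mult of_real_inverse of_real_add)
  then have "norm (smooth_step x) = \<bar>?a * inverse (?a + ?b)\<bar>" by (simp only: norm_of_real)
  also have "\<dots> = ?a / (?a + ?b)" using pos by (simp add: divide_inverse abs_mult)
  also have "\<dots> \<le> 1" using pos by (subst divide_le_eq_1_pos) auto
  finally show ?thesis .
qed

text \<open>For n > 0 the two ramps have width 1/n and lie inside the interval, so the support does
  not leave it while the functions tend to the indicator of the open interval.\<close>

definition cutoff :: "real \<Rightarrow> real \<Rightarrow> real \<Rightarrow> real \<Rightarrow> complex" where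
  "cutoff n a b x = smooth_step (n * (x - a)) * smooth_step (n * (b - x))"

lemma smooth_cutoff: "smooth (cutoff n a b)"
proof -
  have "smooth (\<lambda>x. smooth_step (n * x + (- n * a)) * smooth_step ((- n) * x + n * b))"
    by (intro smooth_mult smooth_affine smooth_smooth_step)
  then show ?thesis by (simp add: cutoff_def[abs_def] algebra_simps)
qed

lemma norm_cutoff_le: "norm (cutoff n a b x) \<le> 1"
  by (simp add: cutoff_def norm_mult mult_le_one norm_smooth_step_le)

lemma cutoff_eq_0: "n \<ge> 0 \<Longrightarrow> \<not> (a < x \<and> x < b) \<Longrightarrow> cutoff n a b x = 0"
  by (auto simp: cutoff_def smooth_step_eq_0 mult_nonneg_nonpos not_less)

lemma cutoff_eq_1: "n * (x - a) \<ge> 1 \<Longrightarrow> n * (b - x) \<ge> 1 \<Longrightarrow> cutoff n a b x = 1"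
  by (simp add: cutoff_def smooth_step_eq_1)

lemma cutoff_tendsto: "(\<lambda>n. cutoff (real n) a b x) \<longlonglongrightarrow> indicator {a<..<b} x"
proof (cases "a < x \<and> x < b")
  case True
  obtain N where N: "real N * (x - a) \<ge> 1"
    using reals_Archimedean3[of "x - a"] True by (metis diff_gt_0_iff_gt less_imp_le)
  obtain N' where N': "real N' * (b - x) \<ge> 1"
    using reals_Archimedean3[of "b - x"] True by (metis diff_gt_0_iff_gt less_imp_le)
  have "cutoff (real n) a b x = 1" if "n \<ge> max N N'" for n
  proof (rule cutoff_eq_1)
    show "real n * (x - a) \<ge> 1"
      using that True by (intro order_trans[OF N] mult_right_mono) auto
    show "real n * (b - x) \<ge> 1"
      using that True by (intro order_trans[OF N'] mult_right_mono) auto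
  qed
  then have "\<forall>\<^sub>F n in sequentially. cutoff (real n) a b x = 1"
    by (auto simp: eventually_sequentially intro!: exI[of _ "max N N'"])
  then show ?thesis using True by (auto intro: tendsto_eventually)
next
  case False
  then show ?thesis by (simp add: cutoff_eq_0)
qed

lemma vderiv_eq_0_outside:
  assumes "\<And>x. \<bar>x\<bar> > R \<Longrightarrow> f x = 0" "\<bar>x\<bar> > R"
  shows "vderiv f x = 0"
proof -
  have "((\<lambda>x. 0) has_vector_derivative (0::complex)) (at x)" by simp
  moreover have "open {x. \<bar>x\<bar> > R}"
    by (intro open_Collect_less continuous_intros)
  ultimately have "(f has_vector_derivative 0) (at x)"
    by (rule has_vector_derivative_transform_within_open) (use assms in auto)
  then show ?thesis by (simp add: vderiv_def vector_derivative_at)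
qed

lemma funpow_vderiv_eq_0_outside:
  assumes "\<And>x. \<bar>x\<bar> > R \<Longrightarrow> f x = 0"
  shows "\<bar>x\<bar> > R \<Longrightarrow> (vderiv ^^ m) f x = 0"
  by (induction m arbitrary: x) (auto intro: assms vderiv_eq_0_outside)

lemma bounded_compact_support:
  fixes R :: real
  assumes "continuous_on UNIV f" "\<And>x. \<bar>x\<bar> > R \<Longrightarrow> f x = (0::complex)"
  obtains C where "\<And>x. norm (f x) \<le> C"
proof -
  have "compact (f ` {-R..R})"
    using assms(1) by (intro compact_continuous_image) (auto intro: continuous_on_subset)
  then obtain C where C: "\<And>x. x \<in> {-R..R} \<Longrightarrow> norm (f x) \<le> C"
    by (meson compact_imp_bounded bounded_iff imageI)
  have "norm (f x) \<le> max C 0" for x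
    using C[of x] assms(2)[of x] by (cases "\<bar>x\<bar> > R") (auto simp: abs_le_iff not_less)
  then show ?thesis using that by blast
qed

lemma test_functionI:
  assumes "smooth f" "\<And>x. \<bar>x\<bar> > R \<Longrightarrow> f x = 0"
  shows "f \<in> test_functions"
proof -
  have "\<exists>C. \<forall>x. \<bar>x\<bar> ^ k * norm ((vderiv ^^ m) f x) \<le> C" for k m
  proof -
    have "continuous_on UNIV (\<lambda>x. of_real (\<bar>x\<bar> ^ k) * (vderiv ^^ m) f x)"
      by (intro continuous_intros smooth_continuous smooth_funpow_vderiv assms)
    moreover have "of_real (\<bar>x\<bar> ^ k) * (vderiv ^^ m) f x = 0" if "\<bar>x\<bar> > R" for x
      using funpow_vderiv_eq_0_outside[OF assms(2) that] by simp
    ultimately have "\<exists>C. \<forall>x. norm (of_real (\<bar>x\<bar> ^ k) * (vderiv ^^ m) f x) \<le> C"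
      by (rule bounded_compact_support[where R=R]) auto
    then show ?thesis by (auto simp: norm_mult norm_power simp del: of_real_power)
  qed
  then show ?thesis using assms by (auto simp: test_functions_def schwartz_iff)
qed

lemma test_function_schwartz: "f \<in> test_functions \<Longrightarrow> f \<in> schwartz"
  by (simp add: test_functions_def)

lemma cutoff_test_function: "n \<ge> 0 \<Longrightarrow> cutoff n a b \<in> test_functions"
  by (rule test_functionI[OF smooth_cutoff, where R = "\<bar>a\<bar> + \<bar>b\<bar>"]) (auto intro!: cutoff_eq_0)

lemma smooth_measurable: "smooth f \<Longrightarrow> f \<in> borel_measurable borel"
  by (intro borel_measurable_continuous_onI smooth_continuous)

subsection \<open>Locally integrable functions are determined by their distributions\<close>

text \<open>The cutoffs are test functions that tend to the indicator, with the locally integrable d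
  as majorant.\<close>

lemma integral_Ioo_eq_0:
  assumes d: "d \<in> borel_measurable borel" "\<And>R. set_integrable lborel {-R..R} d"
    and eq: "\<And>\<phi>. \<phi> \<in> test_functions \<Longrightarrow> (LINT x|lborel. d x * \<phi> x) = 0"
  shows "(LINT x:{a<..<b}|lborel. d x) = (0 :: complex)"
proof -
  define R where "R = \<bar>a\<bar> + \<bar>b\<bar>"
  have lim: "(\<lambda>n. LINT x|lborel. d x * cutoff (real n) a b x) \<longlonglongrightarrow>
     (LINT x|lborel. d x * indicator {a<..<b} x)"
  proof (rule integral_dominated_convergence[where w = "\<lambda>x. norm (indicator {-R..R} x *\<^sub>R d x)"])
    show "AE x in lborel. (\<lambda>n. d x * cutoff (real n) a b x) \<longlonglongrightarrow> d x * indicator {a<..<b} x"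
      by (intro AE_I2 tendsto_mult tendsto_const cutoff_tendsto)
    show "integrable lborel (\<lambda>x. norm (indicator {-R..R} x *\<^sub>R d x))"
      using d(2)[of R] unfolding set_integrable_def by (rule integrable_norm)
    show "AE x in lborel. norm (d x * cutoff (real n) a b x) \<le> norm (indicator {-R..R} x *\<^sub>R d x)" for n
    proof (rule AE_I2)
      fix x
      show "norm (d x * cutoff (real n) a b x) \<le> norm (indicator {-R..R} x *\<^sub>R d x)"
      proof (cases "a < x \<and> x < b")
        case True
        then have "x \<in> {-R..R}" by (auto simp: R_def)
        then show ?thesis by (simp add: norm_mult mult_left_le norm_cutoff_le)
      next
        case False
        then show ?thesis by (simp add: cutoff_eq_0)
      qed
    qed
  qed (use d smooth_measurable[OF smooth_cutoff] in \<open>auto intro!: borel_measurable_times\<close>)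
  have "(LINT x|lborel. d x * indicator {a<..<b} x) = 0"
    using lim eq[OF cutoff_test_function] by (simp add: LIMSEQ_const_iff)
  then show ?thesis
    unfolding set_lebesgue_integral_def by (simp add: scaleR_conv_of_real mult.commute of_real_indicator)
qed

text \<open>On a bounded window the integrals vanish over half lines, which are stable under
  intersection and generate the Borel sets; hence they vanish over all Borel sets. The window makes
  d integrable, since only local integrability is given.\<close>

lemma AE_eq_0_of_test_functions:
  assumes d: "d \<in> borel_measurable borel" "\<And>R. set_integrable lborel {-R..R} d"
    and eq: "\<And>\<phi>. \<phi> \<in> test_functions \<Longrightarrow> (LINT x|lborel. d x * \<phi> x) = 0"
  shows "AE x in lborel. d x = (0 :: complex)"
proof -
  have "AE x in lborel. indicator {- real n<..<real n} x *\<^sub>R d x = 0" for n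
  proof -
    define R where "R = real n"
    define D where "D x = indicator {- R<..<R} x *\<^sub>R d x" for x
    have int: "integrable lborel D"
      using set_integrable_subset[OF d(2)[of R], of "{-R<..<R}"] unfolding D_def set_integrable_def
      by (simp add: greaterThanLessThan_subseteq_atLeastAtMost_iff)
    have Dset: "set_integrable lborel A D" if "A \<in> sets borel" for A
      using integrable_mult_indicator[OF _ int] that unfolding set_integrable_def by auto
    \<comment> \<open>The vanishing total integral is what closes the family of good sets under
      complements.\<close>
    have total: "(LINT x|lborel. D x) = 0"
      using integral_Ioo_eq_0[OF assms, of "-R" R] by (simp add: D_def set_lebesgue_integral_def)
    have "(LINT x:A|lborel. D x) = 0" if "A \<in> sets lborel" for A
    proof -
      have subset_Pow_UNIV: "range lessThan \<subseteq> Pow (UNIV :: real set)" by auto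
      have A: "A \<in> sigma_sets UNIV (range lessThan)" using that by (simp add: borel_Iio)
      have "Int_stable (range (lessThan :: real \<Rightarrow> _))"
      proof -
        have "{..<a} \<inter> {..<b} = {..<min a b}" for a b :: real by auto
        then show ?thesis by (auto simp: Int_stable_def)
      qed
      from this subset_Pow_UNIV A show ?thesis
      proof (induction rule: sigma_sets_induct_disjoint[consumes 3, case_names basic empty compl union])
        case (basic A')
        then obtain b where A': "A' = {..<b}" by auto
        have "(LINT x:A'|lborel. D x) = (LINT x:{- R<..<min b R}|lborel. d x)"
          unfolding set_lebesgue_integral_def D_def A'
          by (intro Bochner_Integration.integral_cong) (auto simp: indicator_def)
        then show ?case using integral_Ioo_eq_0[OF assms] by simp
      next
        case empty
        then show ?case by (simp add: set_lebesgue_integral_def)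
      next
        case (compl A)
        have "A \<in> sets borel" using compl by (simp add: borel_Iio)
        then have "(LINT x:A \<union> (UNIV - A)|lborel. D x) = (LINT x:A|lborel. D x) + (LINT x:UNIV - A|lborel. D x)"
          by (intro set_integral_Un Dset) auto
        then show ?case using compl total by (simp add: set_lebesgue_integral_def)
      next
        case (union A)
        then have A: "A i \<in> sets borel" for i by (auto simp: borel_Iio)
        have "(LINT x:(\<Union>i. A i)|lborel. D x) = (\<Sum>i. (LINT x:(A i)|lborel. D x))"
          using A union(1) by (intro lebesgue_integral_countable_add Dset) (auto simp: disjoint_family_on_def)
        then show ?case using union by simp
      qed
    qed
    then have "AE x in lborel. D x = 0" by (intro sigma_finite_measure.density_zero[OF lborel.sigma_finite_measure_axioms] int)
    then show ?thesis by (simp add: D_def R_def)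
  qed
  then have "AE x in lborel. \<forall>n. indicator {- real n<..<real n} x *\<^sub>R d x = 0"
    unfolding AE_all_countable by blast
  then show ?thesis
  proof (rule AE_mp, intro AE_I2 impI)
    fix x assume *: "\<forall>n. indicator {- real n<..<real n} x *\<^sub>R d x = 0"
    obtain n where "\<bar>x\<bar> < real n" using reals_Archimedean2 by blast
    then show "d x = 0" using *[rule_format, of n] by (auto simp: indicator_def split: if_splits)
  qed
qed

lemma set_integrable_bounded_mult:
  assumes "set_integrable lborel A (g :: real \<Rightarrow> complex)" "\<And>x. norm (\<phi> x) \<le> C" "\<And>x. x \<notin> A \<Longrightarrow> \<phi> x = 0"
    "g \<in> borel_measurable borel" "\<phi> \<in> borel_measurable borel"
  shows "integrable lborel (\<lambda>x. g x * \<phi> x :: complex)"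
proof (rule Bochner_Integration.integrable_bound)
  show "integrable lborel (\<lambda>x. C * norm (indicator A x *\<^sub>R g x))"
    using assms(1) unfolding set_integrable_def by (intro integrable_mult_right integrable_norm)
  show "AE x in lborel. norm (g x * \<phi> x) \<le> norm (C * norm (indicator A x *\<^sub>R g x))"
  proof (rule AE_I2)
    fix x
    have "0 \<le> C" using order_trans[OF norm_ge_zero assms(2)] .
    show "norm (g x * \<phi> x) \<le> norm (C * norm (indicator A x *\<^sub>R g x))"
    proof (cases "x \<in> A")
      case True
      have "norm (g x) * norm (\<phi> x) \<le> norm (g x) * C" by (intro mult_left_mono assms) auto
      then show ?thesis using True \<open>0 \<le> C\<close> by (simp add: norm_mult abs_mult mult.commute)
    next
      case False
      then show ?thesis using assms(3) by simp
    qed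
  qed
qed (use assms in measurable)

lemma test_function_props:
  assumes "\<phi> \<in> test_functions"
  obtains R C where "\<phi> \<in> borel_measurable borel" "\<And>x. norm (\<phi> x) \<le> C" "\<And>x. x \<notin> {-R..R} \<Longrightarrow> \<phi> x = 0"
    "R > 0"
proof -
  obtain R where R: "\<And>x. \<bar>x\<bar> > R \<Longrightarrow> \<phi> x = 0" using assms by (auto simp: test_functions_def)
  have s: "smooth \<phi>" using assms by (auto simp: test_functions_def schwartz_iff)
  obtain C where "\<And>x. norm (\<phi> x) \<le> C"
    using bounded_compact_support[OF smooth_continuous[OF s] R] by blast
  moreover have "\<phi> x = 0" if "x \<notin> {-(\<bar>R\<bar>+1)..\<bar>R\<bar>+1}" for x using that by (intro R) auto
  ultimately show ?thesis
    by (intro that[of C "\<bar>R\<bar> + 1"]) (auto intro: smooth_measurable[OF s])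
qed

lemma represents_integrable:
  assumes "represents u g" "\<phi> \<in> test_functions"
  shows "integrable lborel (\<lambda>x. g x * \<phi> x)"
proof -
  obtain R C where \<phi>: "\<phi> \<in> borel_measurable borel" "\<And>x. norm (\<phi> x) \<le> C" "\<And>x. x \<notin> {-R..R} \<Longrightarrow> \<phi> x = 0"
    using assms(2) by (rule test_function_props) blast
  show ?thesis
    by (rule set_integrable_bounded_mult[OF _ \<phi>(2,3) _ \<phi>(1)]) (use assms(1) in \<open>auto simp: represents_def\<close>)
qed

lemma represents_unique:
  assumes "represents u g" "represents u h"
  shows "AE x in lborel. g x = h x"
proof -
  have "AE x in lborel. g x - h x = 0"
  proof (rule AE_eq_0_of_test_functions)
    fix \<phi> assume \<phi>: "\<phi> \<in> test_functions"
    have "(LINT x|lborel. (g x - h x) * \<phi> x) = (LINT x|lborel. g x * \<phi> x) - (LINT x|lborel. h x * \<phi> x)"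
      unfolding left_diff_distrib
      by (intro Bochner_Integration.integral_diff represents_integrable[OF assms(1) \<phi>] represents_integrable[OF assms(2) \<phi>])
    then show "(LINT x|lborel. (g x - h x) * \<phi> x) = 0"
      using assms \<phi> by (simp add: represents_def)
  qed (use assms in \<open>auto simp: represents_def\<close>)
  then show ?thesis by simp
qed

section \<open>The Fourier transform on Schwartz functions\<close>

lemma borel_measurable_cis [measurable]:
  assumes "f \<in> borel_measurable M"
  shows "(\<lambda>x. cis (f x)) \<in> borel_measurable M"
  using assms unfolding cis_conv_exp by measurable

lemma cis_has_vector_derivative:
  assumes "(h has_real_derivative h') (at x)"
  shows "((\<lambda>x. cis (h x)) has_vector_derivative (\<i> * of_real h' * cis (h x))) (at x)"
proof -
  have "((\<lambda>x. \<i> * of_real (h x)) has_vector_derivative (\<i> * of_real h')) (at x)"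
    using assms
    by (intro has_vector_derivative_mult_right has_vector_derivative_of_real)
       (simp add: has_real_derivative_iff_has_vector_derivative)
  then have "((exp \<circ> (\<lambda>x. \<i> * of_real (h x))) has_vector_derivative (\<i> * of_real h') * exp (\<i> * of_real (h x))) (at x)"
    by (intro field_vector_diff_chain_at DERIV_exp) auto
  then show ?thesis by (simp add: o_def cis_conv_exp)
qed

lemma norm_cis_minus_1_le: "norm (cis x - 1) \<le> \<bar>x\<bar>"
  using iexp_approx1[of x 0] by (simp add: cis_conv_exp)

lemma norm_cis_diff_le: "norm (cis x - cis y) \<le> \<bar>x - y\<bar>"
proof -
  have "cis x - cis y = cis y * (cis (x - y) - 1)"
    by (simp add: algebra_simps cis_mult)
  then show ?thesis using norm_cis_minus_1_le[of "x - y"] by (simp add: norm_mult)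
qed

lemma integrable_cis_mult:
  assumes "integrable M f" "h \<in> borel_measurable M"
  shows "integrable M (\<lambda>x. cis (h x) * f x)"
  using integrable_norm[OF assms(1)] by (rule Bochner_Integration.integrable_bound)
    (use assms in \<open>auto simp: norm_mult intro!: borel_measurable_times\<close>)

lemma fourier_cis: "fourier \<phi> \<xi> = (LINT x|lborel. cis (- (x * \<xi>)) * \<phi> x)"
  by (simp add: fourier_def cis_conv_exp)

lemma schwartz_measurable: "\<phi> \<in> schwartz \<Longrightarrow> \<phi> \<in> borel_measurable borel"
  by (intro smooth_measurable schwartz_smooth)

lemma inverse_1_plus_square_decay:
  assumes "\<phi> \<in> schwartz"
  obtains C where "C > 0" "\<And>x. norm (\<phi> x) \<le> C * inverse (1 + x\<^sup>2)"
  using schwartz_decay[OF assms, of 2] by (metis divide_inverse power2_abs)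

lemma schwartz_integrable:
  assumes "\<phi> \<in> schwartz"
  shows "integrable lborel \<phi>"
proof -
  obtain C where C: "C > 0" "\<And>x. norm (\<phi> x) \<le> C * inverse (1 + x\<^sup>2)"
    using inverse_1_plus_square_decay[OF assms] by blast
  have "integrable lborel (\<lambda>x. C * inverse (1 + x\<^sup>2))"
    by (intro integrable_mult_right Submission.integrable_inverse_1_plus_square)
  then show ?thesis
    by (rule Bochner_Integration.integrable_bound)
       (use C schwartz_measurable[OF assms] in \<open>auto intro!: AE_I2 order_trans[OF C(2)]\<close>)
qed

lemma schwartz_integrable_cis: "\<phi> \<in> schwartz \<Longrightarrow> integrable lborel (\<lambda>x. cis (- (x * \<xi>)) * \<phi> x)"
  by (rule integrable_cis_mult[OF schwartz_integrable]) auto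

lemma norm_fourier_le: "norm (fourier \<phi> \<xi>) \<le> (LINT x|lborel. norm (\<phi> x))"
proof -
  have "norm (fourier \<phi> \<xi>) \<le> (LINT x|lborel. norm (cis (- (x * \<xi>)) * \<phi> x))"
    unfolding fourier_cis by (rule integral_norm_bound)
  then show ?thesis by (simp add: norm_mult)
qed

lemma schwartz_tendsto_0:
  assumes "\<phi> \<in> schwartz"
  shows "(\<phi> \<longlongrightarrow> 0) at_top" "(\<phi> \<longlongrightarrow> 0) at_bot"
proof -
  obtain C where C: "C > 0" "\<And>x. norm (\<phi> x) \<le> C * inverse (1 + x\<^sup>2)"
    using inverse_1_plus_square_decay[OF assms] by blast
  have "((\<lambda>x::real. C * inverse (1 + x\<^sup>2)) \<longlongrightarrow> 0) at_top" by real_asymp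
  then show "(\<phi> \<longlongrightarrow> 0) at_top" by (rule Lim_null_comparison[rotated]) (use C in auto)
  have "((\<lambda>x::real. C * inverse (1 + x\<^sup>2)) \<longlongrightarrow> 0) at_bot" by real_asymp
  then show "(\<phi> \<longlongrightarrow> 0) at_bot" by (rule Lim_null_comparison[rotated]) (use C in auto)
qed

lemma integral_vector_derivative_eq_0:
  fixes F f :: "real \<Rightarrow> complex"
  assumes "\<And>x. (F has_vector_derivative f x) (at x)" "continuous_on UNIV f" "integrable lborel f"
    "(F \<longlongrightarrow> 0) at_top" "(F \<longlongrightarrow> 0) at_bot"
  shows "(LINT x|lborel. f x) = 0"
proof -
  have "(LBINT x=-\<infinity>..\<infinity>. f x) = 0 - 0"
    by (rule interval_integral_FTC_integrable[where F = F])
       (use assms in \<open>auto simp: ereal_tendsto_simps set_integrable_def einterval_def continuous_on_eq_continuous_at\<close>)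
  then show ?thesis
    by (simp add: interval_lebesgue_integral_def set_lebesgue_integral_def einterval_def)
qed

lemma fourier_vderiv:
  assumes \<phi>: "\<phi> \<in> schwartz"
  shows "fourier (vderiv \<phi>) \<xi> = \<i> * of_real \<xi> * fourier \<phi> \<xi>"
proof -
  let ?e = "\<lambda>x. cis (- (x * \<xi>))"
  have int1: "integrable lborel (\<lambda>x. ?e x * vderiv \<phi> x)" and int2: "integrable lborel (\<lambda>x. ?e x * \<phi> x)"
    using \<phi> by (auto intro!: schwartz_integrable_cis schwartz_vderiv)
  have "(LINT x|lborel. ?e x * vderiv \<phi> x + (\<i> * of_real (- \<xi>)) * (?e x * \<phi> x)) = 0"
  proof (rule integral_vector_derivative_eq_0[where F = "\<lambda>x. ?e x * \<phi> x"])
    fix x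
    have "(?e has_vector_derivative \<i> * of_real (- \<xi>) * ?e x) (at x)"
      by (rule cis_has_vector_derivative) (auto intro!: derivative_eq_intros)
    from has_vector_derivative_mult[OF this smooth_has_vderiv[OF schwartz_smooth[OF \<phi>]]]
    show "((\<lambda>x. ?e x * \<phi> x) has_vector_derivative ?e x * vderiv \<phi> x + (\<i> * of_real (- \<xi>)) * (?e x * \<phi> x)) (at x)"
      by (simp add: mult_ac)
  next
    have "continuous_on UNIV \<phi>" "continuous_on UNIV (vderiv \<phi>)"
      using \<phi> by (auto intro: smooth_continuous smooth_vderiv schwartz_smooth)
    then show "continuous_on UNIV (\<lambda>x. ?e x * vderiv \<phi> x + (\<i> * of_real (- \<xi>)) * (?e x * \<phi> x))"
      by (auto intro!: continuous_intros)
  next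
    show "integrable lborel (\<lambda>x. ?e x * vderiv \<phi> x + (\<i> * of_real (- \<xi>)) * (?e x * \<phi> x))"
      by (intro Bochner_Integration.integrable_add integrable_mult_right int1 int2)
  next
    show "((\<lambda>x. ?e x * \<phi> x) \<longlongrightarrow> 0) at_top" "((\<lambda>x. ?e x * \<phi> x) \<longlongrightarrow> 0) at_bot"
      using schwartz_tendsto_0[OF \<phi>, THEN tendsto_norm_zero]
      by (auto intro!: tendsto_norm_zero_cancel[where f = "\<lambda>x. cis (- (x * \<xi>)) * \<phi> x"] simp: norm_mult)
  qed
  then have "(LINT x|lborel. ?e x * vderiv \<phi> x) = \<i> * of_real \<xi> * (LINT x|lborel. ?e x * \<phi> x)"
    using int1 int2 by (simp add: Bochner_Integration.integral_add)
  then show ?thesis by (simp add: fourier_cis)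
qed

text \<open>The operator that the Fourier transform turns into differentiation.\<close>

definition mult_neg_ix :: "(real \<Rightarrow> complex) \<Rightarrow> real \<Rightarrow> complex" where
  "mult_neg_ix \<phi> x = - \<i> * of_real x * \<phi> x"

lemma schwartz_mult_neg_ix: "\<phi> \<in> schwartz \<Longrightarrow> mult_neg_ix \<phi> \<in> schwartz"
  using schwartz_cmult[OF schwartz_mult_id, of \<phi> "- \<i>"] by (simp add: mult_neg_ix_def[abs_def] mult.assoc)

lemma schwartz_funpow_mult_neg_ix: "\<phi> \<in> schwartz \<Longrightarrow> (mult_neg_ix ^^ m) \<phi> \<in> schwartz"
  by (induction m) (auto intro: schwartz_mult_neg_ix)

lemma fourier_has_vector_derivative:
  assumes \<phi>: "\<phi> \<in> schwartz"
  shows "(fourier \<phi> has_vector_derivative fourier (mult_neg_ix \<phi>) \<xi>) (at \<xi>)"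
proof (rule has_vector_derivative_quadratic[where C = "LINT x|lborel. norm (mult_neg_ix (mult_neg_ix \<phi>) x)"])
  fix h
  let ?g = "\<lambda>x. cis (- (x * (\<xi> + h))) * \<phi> x - cis (- (x * \<xi>)) * \<phi> x - of_real h * (cis (- (x * \<xi>)) * mult_neg_ix \<phi> x)"
  have int: "integrable lborel (\<lambda>x. cis (- (x * \<xi>)) * \<psi> x)" if "\<psi> \<in> schwartz" for \<psi> \<xi>
    using that by (rule schwartz_integrable_cis)
  have "fourier \<phi> (\<xi> + h) - fourier \<phi> \<xi> - h *\<^sub>R fourier (mult_neg_ix \<phi>) \<xi> = (LINT x|lborel. ?g x)"
    unfolding fourier_cis using \<phi> int schwartz_mult_neg_ix[OF \<phi>] by (simp add: scaleR_conv_of_real)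
  also have "norm \<dots> \<le> (LINT x|lborel. h\<^sup>2 * norm (mult_neg_ix (mult_neg_ix \<phi>) x))"
  proof (rule Bochner_Integration.integral_norm_bound_integral)
    show "integrable lborel ?g"
      using \<phi> int schwartz_mult_neg_ix[OF \<phi>] by (intro Bochner_Integration.integrable_diff integrable_mult_right) auto
    show "integrable lborel (\<lambda>x. h\<^sup>2 * norm (mult_neg_ix (mult_neg_ix \<phi>) x))"
      using \<phi> by (intro integrable_mult_right integrable_norm schwartz_integrable schwartz_mult_neg_ix)
    fix x
    have eq: "?g x = cis (- (x * \<xi>)) * \<phi> x * (cis (- (x * h)) - (1 + \<i> * of_real (- (x * h))))"
      by (simp add: mult_neg_ix_def algebra_simps cis_mult)
    have "norm (cis (- (x * h)) - (1 + \<i> * of_real (- (x * h)))) \<le> \<bar>x * h\<bar>\<^sup>2 / 2"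
      using iexp_approx1[of "- (x * h)" 1] by (simp add: cis_conv_exp numeral_2_eq_2)
    also have "\<dots> \<le> h\<^sup>2 * x\<^sup>2" by (simp add: power_mult_distrib)
    finally have "norm (?g x) \<le> norm (\<phi> x) * (h\<^sup>2 * x\<^sup>2)"
      unfolding eq by (simp add: norm_mult mult_left_mono)
    also have "\<dots> = h\<^sup>2 * norm (mult_neg_ix (mult_neg_ix \<phi>) x)"
      by (simp add: mult_neg_ix_def norm_mult power2_eq_square)
    finally show "norm (?g x) \<le> h\<^sup>2 * norm (mult_neg_ix (mult_neg_ix \<phi>) x)" .
  qed
  finally show "norm (fourier \<phi> (\<xi> + h) - fourier \<phi> \<xi> - h *\<^sub>R fourier (mult_neg_ix \<phi>) \<xi>)
      \<le> (LINT x|lborel. norm (mult_neg_ix (mult_neg_ix \<phi>) x)) * h\<^sup>2"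
    by (simp add: mult.commute)
qed

lemma vderiv_fourier: "\<phi> \<in> schwartz \<Longrightarrow> vderiv (fourier \<phi>) = fourier (mult_neg_ix \<phi>)"
  by (rule vderiv_eqI) (rule fourier_has_vector_derivative)

lemma funpow_vderiv_fourier:
  "\<phi> \<in> schwartz \<Longrightarrow> (vderiv ^^ m) (fourier \<phi>) = fourier ((mult_neg_ix ^^ m) \<phi>)"
  by (induction m) (auto simp: vderiv_fourier schwartz_funpow_mult_neg_ix)

lemma power_mult_norm_fourier:
  "\<phi> \<in> schwartz \<Longrightarrow> \<bar>\<xi>\<bar> ^ k * norm (fourier \<phi> \<xi>) = norm (fourier ((vderiv ^^ k) \<phi>) \<xi>)"
  by (induction k) (auto simp: fourier_vderiv norm_mult schwartz_funpow_vderiv mult_ac)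

text \<open>The right side is an L1 norm rather than a seminorm because dominated convergence can
  later drive it to 0, as in \<open>integral_vderiv_cocutoff_tendsto_0\<close>.\<close>

lemma power_mult_norm_vderiv_fourier_le:
  assumes "\<phi> \<in> schwartz"
  shows "\<bar>\<xi>\<bar> ^ k * norm ((vderiv ^^ m) (fourier \<phi>) \<xi>)
    \<le> (LINT x|lborel. norm ((vderiv ^^ k) ((mult_neg_ix ^^ m) \<phi>) x))"
  using assms by (simp add: funpow_vderiv_fourier power_mult_norm_fourier schwartz_funpow_mult_neg_ix norm_fourier_le)

lemma schwartz_fourier:
  assumes "\<phi> \<in> schwartz"
  shows "fourier \<phi> \<in> schwartz"
proof -
  have "smooth (fourier \<phi>)"
    unfolding smooth_iff funpow_vderiv_fourier[OF assms]
    using fourier_has_vector_derivative schwartz_funpow_mult_neg_ix[OF assms]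
    by (blast intro: differentiableI_vector)
  then show ?thesis
    unfolding schwartz_iff using power_mult_norm_vderiv_fourier_le[OF assms] by blast
qed

subsection \<open>Fourier inversion\<close>

lemma integrable_pair_kernel:
  fixes f g :: "real \<Rightarrow> complex" and k :: "real \<times> real \<Rightarrow> complex"
  assumes f: "integrable lborel f" and g: "integrable lborel g"
    and k: "k \<in> borel_measurable (lborel \<Otimes>\<^sub>M lborel)" "\<And>p. norm (k p) \<le> 1"
  shows "integrable (lborel \<Otimes>\<^sub>M lborel) (\<lambda>(x, y). k (x, y) * (f x * g y))"
proof -
  have [measurable]: "f \<in> borel_measurable lborel" "g \<in> borel_measurable lborel" using f g by auto
  have "integrable (lborel \<Otimes>\<^sub>M lborel) (\<lambda>p. f (fst p) * g (snd p))"
  proof (rule lborel_pair.Fubini_integrable)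
    show "integrable lborel (\<lambda>x. LINT y|lborel. norm (f (fst (x, y)) * g (snd (x, y))))"
      using f g by (auto simp: norm_mult)
    show "AE x in lborel. integrable lborel (\<lambda>y. f (fst (x, y)) * g (snd (x, y)))"
      using g by auto
  qed measurable
  then have "integrable (lborel \<Otimes>\<^sub>M lborel) (\<lambda>p. k p * (f (fst p) * g (snd p)))"
    by (rule Bochner_Integration.integrable_bound)
      (use k in \<open>auto simp: norm_mult intro!: AE_I2 mult_left_le_one_le\<close>)
  then show ?thesis by (simp add: case_prod_beta')
qed

text \<open>Every later exchange of two Lebesgue integrals takes this form: two integrable functions
  coupled by a kernel bounded by 1, for instance a character.\<close>

lemma Fubini_kernel:
  fixes f g :: "real \<Rightarrow> complex" and k :: "real \<Rightarrow> real \<Rightarrow> complex"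
  assumes "integrable lborel f" "integrable lborel g"
    and "(\<lambda>p. k (fst p) (snd p)) \<in> borel_measurable (lborel \<Otimes>\<^sub>M lborel)" "\<And>x y. norm (k x y) \<le> 1"
  shows "(LINT x|lborel. f x * (LINT y|lborel. k x y * g y)) = (LINT y|lborel. g y * (LINT x|lborel. k x y * f x))"
proof -
  have "integrable (lborel \<Otimes>\<^sub>M lborel) (\<lambda>(x, y). k x y * (f x * g y))"
    using integrable_pair_kernel[OF assms(1-3)] assms(4) by simp
  from lborel_pair.Fubini_integral[OF this]
  have "(LINT y|lborel. LINT x|lborel. g y * (k x y * f x)) = (LINT x|lborel. LINT y|lborel. f x * (k x y * g y))"
    by (simp add: mult_ac)
  then show ?thesis by simp
qed

lemma integrable_exp_neg_square: "integrable lborel (\<lambda>x::real. exp (- (x\<^sup>2 / 2)))"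
  and integral_exp_neg_square: "(LINT x|lborel. exp (- (x\<^sup>2 / 2))) = sqrt (2 * pi)"
proof -
  have eq: "(\<lambda>x::real. exp (- (x\<^sup>2 / 2))) = (\<lambda>x. sqrt (2 * pi) * std_normal_density x)"
    by (simp add: std_normal_density_def)
  show "integrable lborel (\<lambda>x::real. exp (- (x\<^sup>2 / 2)))"
    unfolding eq by (intro integrable_mult_right integrable_normal_density) simp
  show "(LINT x|lborel. exp (- (x\<^sup>2 / 2))) = sqrt (2 * pi)"
    unfolding eq using integral_normal_density[of 1 0] by simp
qed

lemma integral_cis_gaussian:
  "(LINT x|lborel. cis (t * x) * of_real (exp (- (x\<^sup>2 / 2)))) = of_real (sqrt (2 * pi) * exp (- (t\<^sup>2 / 2)))"
proof -
  have "of_real (exp (- (t\<^sup>2) / 2)) = char std_normal_distribution t"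
    by (simp add: char_std_normal_distribution)
  also have "\<dots> = (LINT x|lborel. std_normal_density x *\<^sub>R iexp (t * x))"
    unfolding char_def by (rule integral_density) auto
  also have "\<dots> = (LINT x|lborel. of_real (1 / sqrt (2 * pi)) * (cis (t * x) * of_real (exp (- (x\<^sup>2 / 2)))))"
    by (intro Bochner_Integration.integral_cong)
       (simp_all add: std_normal_density_def cis_conv_exp scaleR_conv_of_real mult_ac)
  also have "\<dots> = of_real (1 / sqrt (2 * pi)) * (LINT x|lborel. cis (t * x) * of_real (exp (- (x\<^sup>2 / 2))))"
    by simp
  finally show ?thesis by (simp add: field_simps)
qed

text \<open>Gaussian regularisation: inserting \<open>?\<gamma> n\<close> and exchanging the
  integrals turns the left side into an average of \<phi> against a Gaussian of width 1/(n+1) around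
  x. One factor sqrt (2 pi) comes from the transform of the Gaussian and one from its mass.\<close>

lemma fourier_inversion:
  assumes \<phi>: "\<phi> \<in> schwartz"
  shows "(LINT \<xi>|lborel. cis (x * \<xi>) * fourier \<phi> \<xi>) = 2 * of_real pi * \<phi> x"
proof -
  let ?\<gamma> = "\<lambda>n \<xi>. exp (- ((\<xi> / real (Suc n))\<^sup>2 / 2))"
  define I where "I n = (LINT \<xi>|lborel. (cis (x * \<xi>) * of_real (?\<gamma> n \<xi>)) * fourier \<phi> \<xi>)" for n
  have [measurable]: "\<phi> \<in> borel_measurable borel" "fourier \<phi> \<in> borel_measurable borel"
    using \<phi> by (auto intro: schwartz_measurable schwartz_fourier)
  have I_lim: "I \<longlonglongrightarrow> (LINT \<xi>|lborel. cis (x * \<xi>) * fourier \<phi> \<xi>)"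
    unfolding I_def
  proof (rule integral_dominated_convergence[where w = "\<lambda>\<xi>. norm (fourier \<phi> \<xi>)"])
    show "integrable lborel (\<lambda>\<xi>. norm (fourier \<phi> \<xi>))"
      using \<phi> by (intro integrable_norm schwartz_integrable schwartz_fourier)
    show "AE \<xi> in lborel. (\<lambda>n. cis (x * \<xi>) * of_real (?\<gamma> n \<xi>) * fourier \<phi> \<xi>) \<longlonglongrightarrow> cis (x * \<xi>) * fourier \<phi> \<xi>"
    proof (rule AE_I2)
      fix \<xi> :: real
      have "(\<lambda>n. \<xi> / real (Suc n)) \<longlonglongrightarrow> 0" by (rule LIMSEQ_Suc[OF lim_const_over_n])
      then have "(\<lambda>n. ?\<gamma> n \<xi>) \<longlonglongrightarrow> exp (- (0\<^sup>2 / 2))"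
        by (intro tendsto_exp tendsto_minus tendsto_divide tendsto_power tendsto_const) auto
      then have "(\<lambda>n. cis (x * \<xi>) * of_real (?\<gamma> n \<xi>) * fourier \<phi> \<xi>) \<longlonglongrightarrow> cis (x * \<xi>) * of_real (exp (- (0\<^sup>2 / 2))) * fourier \<phi> \<xi>"
        by (intro tendsto_mult tendsto_of_real tendsto_const)
      then show "(\<lambda>n. cis (x * \<xi>) * of_real (?\<gamma> n \<xi>) * fourier \<phi> \<xi>) \<longlonglongrightarrow> cis (x * \<xi>) * fourier \<phi> \<xi>" by simp
    qed
    show "AE \<xi> in lborel. norm (cis (x * \<xi>) * of_real (?\<gamma> n \<xi>) * fourier \<phi> \<xi>) \<le> norm (fourier \<phi> \<xi>)" for n
      by (intro AE_I2) (simp add: norm_mult mult_left_le_one_le)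
  qed measurable
  have I_eq: "I n = of_real (sqrt (2 * pi)) * (LINT z|lborel. \<phi> (x + z / real (Suc n)) * of_real (exp (- (z\<^sup>2 / 2))))" for n
  proof -
    define N where "N = real (Suc n)"
    have N: "N > 0" by (simp add: N_def)
    have g: "?\<gamma> n (0 + N * \<eta>) = exp (- (\<eta>\<^sup>2 / 2))" for \<eta>
      by (simp add: N_def del: of_nat_Suc)
    have int\<gamma>: "integrable lborel (\<lambda>\<xi>. complex_of_real (?\<gamma> n \<xi>))"
    proof -
      have "integrable lborel (\<lambda>\<xi>. exp (- ((0 + (1 / N) * \<xi>)\<^sup>2 / 2)))"
        using N by (intro lborel_integrable_real_affine integrable_exp_neg_square) auto
      then show ?thesis by (intro integrable_of_real) (simp add: N_def)
    qed
    have "I n = (LINT \<xi>|lborel. (cis (x * \<xi>) * of_real (?\<gamma> n \<xi>)) * (LINT y|lborel. cis (- (y * \<xi>)) * \<phi> y))"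
      by (simp add: I_def fourier_cis)
    also have "\<dots> = (LINT y|lborel. \<phi> y * (LINT \<xi>|lborel. cis (- (y * \<xi>)) * (cis (x * \<xi>) * of_real (?\<gamma> n \<xi>))))"
      by (rule Fubini_kernel[OF integrable_cis_mult[OF int\<gamma>] schwartz_integrable[OF \<phi>]]) auto
    also have "\<dots> = (LINT y|lborel. \<phi> y * of_real (N * sqrt (2 * pi) * exp (- ((N * (x - y))\<^sup>2 / 2))))"
    proof (intro Bochner_Integration.integral_cong refl)
      fix y
      have "(LINT \<xi>|lborel. cis (- (y * \<xi>)) * (cis (x * \<xi>) * of_real (?\<gamma> n \<xi>))) =
          (LINT \<xi>|lborel. cis ((x - y) * \<xi>) * of_real (?\<gamma> n \<xi>))"
      proof (intro Bochner_Integration.integral_cong refl)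
        fix \<xi> :: real
        have "cis (- (y * \<xi>)) * cis (x * \<xi>) = cis ((x - y) * \<xi>)"
          by (simp add: cis_mult left_diff_distrib)
        then show "cis (- (y * \<xi>)) * (cis (x * \<xi>) * of_real (?\<gamma> n \<xi>)) = cis ((x - y) * \<xi>) * of_real (?\<gamma> n \<xi>)"
          by (metis mult.assoc)
      qed
      also have "\<dots> = \<bar>N\<bar> *\<^sub>R (LINT \<eta>|lborel. cis ((x - y) * (0 + N * \<eta>)) * of_real (?\<gamma> n (0 + N * \<eta>)))"
        by (rule lborel_integral_real_affine) (use N in auto)
      also have "\<dots> = of_real N * (LINT \<eta>|lborel. cis ((N * (x - y)) * \<eta>) * of_real (exp (- (\<eta>\<^sup>2 / 2))))"
        using N by (simp only: g scaleR_conv_of_real) (simp add: mult_ac)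
      also have "\<dots> = of_real (N * sqrt (2 * pi) * exp (- ((N * (x - y))\<^sup>2 / 2)))"
        unfolding integral_cis_gaussian by simp
      finally show "\<phi> y * (LINT \<xi>|lborel. cis (- (y * \<xi>)) * (cis (x * \<xi>) * of_real (?\<gamma> n \<xi>))) =
        \<phi> y * of_real (N * sqrt (2 * pi) * exp (- ((N * (x - y))\<^sup>2 / 2)))" by simp
    qed
    also have "\<dots> = \<bar>1 / N\<bar> *\<^sub>R (LINT z|lborel. \<phi> (x + (1 / N) * z) *
        of_real (N * sqrt (2 * pi) * exp (- ((N * (x - (x + (1 / N) * z)))\<^sup>2 / 2))))"
      by (rule lborel_integral_real_affine) (use N in auto)
    also have "\<dots> = \<bar>1 / N\<bar> *\<^sub>R (LINT z|lborel. of_real (N * sqrt (2 * pi)) * (\<phi> (x + z / N) * of_real (exp (- (z\<^sup>2 / 2)))))"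
    proof (intro arg_cong[where f = "scaleR \<bar>1 / N\<bar>"] Bochner_Integration.integral_cong refl)
      fix z
      have "N * (x - (x + (1 / N) * z)) = - z" using N by (simp add: right_diff_distrib distrib_left)
      then show "\<phi> (x + (1 / N) * z) * of_real (N * sqrt (2 * pi) * exp (- ((N * (x - (x + (1 / N) * z)))\<^sup>2 / 2)))
        = of_real (N * sqrt (2 * pi)) * (\<phi> (x + z / N) * of_real (exp (- (z\<^sup>2 / 2))))"
        by (simp only: power2_minus) simp
    qed
    also have "\<dots> = of_real (sqrt (2 * pi)) * (LINT z|lborel. \<phi> (x + z / N) * of_real (exp (- (z\<^sup>2 / 2))))"
      using N by (simp add: scaleR_conv_of_real)
    finally show ?thesis by (simp add: N_def)
  qed
  have lim: "(\<lambda>n. LINT z|lborel. \<phi> (x + z / real (Suc n)) * of_real (exp (- (z\<^sup>2 / 2))))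
      \<longlonglongrightarrow> (LINT z|lborel. \<phi> x * of_real (exp (- (z\<^sup>2 / 2))))"
  proof -
    obtain C where C: "C > 0" "\<And>x. norm (\<phi> x) \<le> C / (1 + \<bar>x\<bar> ^ 0)"
      using schwartz_decay[OF \<phi>, where k = 0] by blast
    show ?thesis
    proof (rule integral_dominated_convergence[where w = "\<lambda>z. C * exp (- (z\<^sup>2 / 2))"])
      show "integrable lborel (\<lambda>z. C * exp (- (z\<^sup>2 / 2)))"
        by (intro integrable_mult_right integrable_exp_neg_square)
      show "AE z in lborel. (\<lambda>n. \<phi> (x + z / real (Suc n)) * of_real (exp (- (z\<^sup>2 / 2)))) \<longlonglongrightarrow> \<phi> x * of_real (exp (- (z\<^sup>2 / 2)))"
      proof (rule AE_I2)
        fix z :: real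
        have "isCont \<phi> x"
          using smooth_continuous[OF schwartz_smooth[OF \<phi>], of UNIV] by (simp add: continuous_on_eq_continuous_at)
        moreover have "(\<lambda>n. x + z / real (Suc n)) \<longlonglongrightarrow> x"
          using tendsto_add[OF tendsto_const LIMSEQ_Suc[OF lim_const_over_n[of z]], of x] by simp
        ultimately have "(\<lambda>n. \<phi> (x + z / real (Suc n))) \<longlonglongrightarrow> \<phi> x" by (rule isCont_tendsto_compose)
        then show "(\<lambda>n. \<phi> (x + z / real (Suc n)) * of_real (exp (- (z\<^sup>2 / 2)))) \<longlonglongrightarrow> \<phi> x * of_real (exp (- (z\<^sup>2 / 2)))"
          by (intro tendsto_mult tendsto_const)
      qed
      show "AE z in lborel. norm (\<phi> (x + z / real (Suc n)) * of_real (exp (- (z\<^sup>2 / 2)))) \<le> C * exp (- (z\<^sup>2 / 2))" for n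
      proof (rule AE_I2)
        fix z :: real
        have "norm (\<phi> (x + z / real (Suc n))) \<le> C"
          using C(2)[of "x + z / real (Suc n)"] C(1) by simp
        then show "norm (\<phi> (x + z / real (Suc n)) * of_real (exp (- (z\<^sup>2 / 2)))) \<le> C * exp (- (z\<^sup>2 / 2))"
          by (simp add: norm_mult mult_right_mono)
      qed
    qed measurable
  qed
  have val: "(LINT z|lborel. \<phi> x * complex_of_real (exp (- (z\<^sup>2 / 2)))) = \<phi> x * of_real (sqrt (2 * pi))"
    using integral_exp_neg_square by (simp only: integral_mult_right_zero integral_complex_of_real)
  have "I \<longlonglongrightarrow> of_real (sqrt (2 * pi)) * (\<phi> x * of_real (sqrt (2 * pi)))"
    using tendsto_mult[OF tendsto_const lim[unfolded val], of "of_real (sqrt (2 * pi))"]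
    unfolding I_eq[abs_def] by blast
  with I_lim
  have "(LINT \<xi>|lborel. cis (x * \<xi>) * fourier \<phi> \<xi>) = of_real (sqrt (2 * pi)) * (\<phi> x * of_real (sqrt (2 * pi)))"
    by (rule LIMSEQ_unique)
  also have "\<dots> = of_real (sqrt (2 * pi) * sqrt (2 * pi)) * \<phi> x"
    by (simp only: of_real_mult mult_ac)
  also have "\<dots> = 2 * of_real pi * \<phi> x" by simp
  finally show ?thesis .
qed

definition inv_fourier :: "(real \<Rightarrow> complex) \<Rightarrow> real \<Rightarrow> complex" where
  "inv_fourier \<psi> \<xi> = 1 / (2 * of_real pi) * (LINT x|lborel. cis (x * \<xi>) * \<psi> x)"

lemma inv_fourier_eq: "inv_fourier \<psi> = (\<lambda>\<xi>. 1 / (2 * of_real pi) * fourier \<psi> (- \<xi>))"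
  by (simp add: inv_fourier_def[abs_def] fourier_cis)

lemma schwartz_inv_fourier: "\<psi> \<in> schwartz \<Longrightarrow> inv_fourier \<psi> \<in> schwartz"
  unfolding inv_fourier_eq by (intro schwartz_cmult schwartz_reflect schwartz_fourier)

lemma inv_fourier_fourier:
  assumes "\<phi> \<in> schwartz"
  shows "inv_fourier (fourier \<phi>) = \<phi>"
proof
  fix x
  have "(LINT \<xi>|lborel. cis (\<xi> * x) * fourier \<phi> \<xi>) = 2 * of_real pi * \<phi> x"
    using fourier_inversion[OF assms, of x] by (subst mult.commute)
  then show "inv_fourier (fourier \<phi>) x = \<phi> x" by (simp add: inv_fourier_def)
qed

lemma fourier_inv_fourier:
  assumes "\<psi> \<in> schwartz"
  shows "fourier (inv_fourier \<psi>) = \<psi>"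
proof
  fix x
  have "fourier (inv_fourier \<psi>) x = (LINT \<xi>|lborel. cis (- (\<xi> * x)) * inv_fourier \<psi> \<xi>)"
    by (simp add: fourier_cis)
  also have "\<dots> = \<bar>-1\<bar> *\<^sub>R (LINT \<xi>|lborel. cis (- ((0 + - 1 * \<xi>) * x)) * inv_fourier \<psi> (0 + - 1 * \<xi>))"
    by (rule lborel_integral_real_affine) simp
  also have "\<dots> = (LINT \<xi>|lborel. (1 / (2 * of_real pi)) * (cis (x * \<xi>) * fourier \<psi> \<xi>))"
    unfolding inv_fourier_eq by (simp add: mult.commute[of _ x])
  also have "\<dots> = \<psi> x"
    using fourier_inversion[OF assms] by (simp only: integral_mult_right_zero) simp
  finally show "fourier (inv_fourier \<psi>) x = \<psi> x" .
qed

lemma integrable_mult_L2: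
  fixes f g :: "real \<Rightarrow> complex"
  assumes [measurable]: "f \<in> borel_measurable lborel" "g \<in> borel_measurable lborel"
    and f: "integrable lborel (\<lambda>x. (norm (f x))\<^sup>2)" and g: "integrable lborel (\<lambda>x. (norm (g x))\<^sup>2)"
  shows "integrable lborel (\<lambda>x. f x * g x)"
proof (rule Bochner_Integration.integrable_bound)
  show "integrable lborel (\<lambda>x. (norm (f x))\<^sup>2 + (norm (g x))\<^sup>2)"
    by (intro Bochner_Integration.integrable_add f g)
  show "AE x in lborel. norm (f x * g x) \<le> norm ((norm (f x))\<^sup>2 + (norm (g x))\<^sup>2)"
  proof (rule AE_I2)
    fix x
    have "2 * (norm (f x) * norm (g x)) \<le> (norm (f x))\<^sup>2 + (norm (g x))\<^sup>2"
      using sum_squares_bound[of "norm (f x)" "norm (g x)"] by simp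
    moreover have "0 \<le> norm (f x) * norm (g x)" by simp
    ultimately have "norm (f x) * norm (g x) \<le> (norm (f x))\<^sup>2 + (norm (g x))\<^sup>2" by linarith
    then show "norm (f x * g x) \<le> norm ((norm (f x))\<^sup>2 + (norm (g x))\<^sup>2)"
      by (simp add: norm_mult)
  qed
qed measurable

lemma schwartz_square_integrable:
  assumes "\<phi> \<in> schwartz"
  shows "integrable lborel (\<lambda>x. (norm (\<phi> x))\<^sup>2)"
proof -
  obtain C where C: "C > 0" "\<And>x. norm (\<phi> x) \<le> C / (1 + \<bar>x\<bar> ^ 0)"
    using schwartz_decay[OF assms, where k = 0] by blast
  have [measurable]: "\<phi> \<in> borel_measurable borel" using assms by (rule schwartz_measurable)
  show ?thesis
  proof (rule Bochner_Integration.integrable_bound)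
    show "integrable lborel (\<lambda>x. C * norm (\<phi> x))"
      using assms by (intro integrable_mult_right integrable_norm schwartz_integrable)
    have "norm (\<phi> x) * norm (\<phi> x) \<le> C * norm (\<phi> x)" for x
      using C(2)[of x] C(1) by (intro mult_right_mono) auto
    then show "AE x in lborel. norm ((norm (\<phi> x))\<^sup>2) \<le> norm (C * norm (\<phi> x))"
      using C(1) by (intro AE_I2) (simp add: power2_eq_square abs_mult)
  qed measurable
qed

lemma schwartz_bounded:
  assumes "\<phi> \<in> schwartz"
  obtains C where "C \<ge> 0" "\<And>x. norm ((vderiv ^^ m) \<phi> x) \<le> C"
proof -
  obtain C where C: "C > 0" "\<And>x. norm ((vderiv ^^ m) \<phi> x) \<le> C / (1 + \<bar>x\<bar> ^ 0)"
    using schwartz_decay[OF schwartz_funpow_vderiv[OF assms], where k = 0] by blast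
  have "norm ((vderiv ^^ m) \<phi> x) \<le> C" for x
    using C(1) C(2)[of x] by simp
  then show ?thesis using that[of C] C(1) by simp
qed

subsection \<open>Tempered distributions whose Fourier transform is square integrable\<close>

text \<open>Zero on [-1, 1]. Dilated by 1/(n+1) it vanishes on ever larger intervals, and every
  derivative gains a factor 1/(n+1).\<close>

definition cocutoff :: "real \<Rightarrow> complex" where
  "cocutoff x = 1 + (- 1) * cutoff 1 (- 2) 2 x"

lemma smooth_cocutoff: "smooth cocutoff"
  unfolding cocutoff_def[abs_def] by (intro smooth_add smooth_mult smooth_const smooth_cutoff)

lemma cocutoff_eq_0: "\<bar>x\<bar> \<le> 1 \<Longrightarrow> cocutoff x = 0"
  by (simp add: cocutoff_def cutoff_eq_1)

lemma cocutoff_bounded: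
  obtains C where "C \<ge> 0" "\<And>x. norm ((vderiv ^^ m) cocutoff x) \<le> C"
proof -
  have s: "cutoff 1 (- 2) 2 \<in> schwartz" by (intro test_function_schwartz cutoff_test_function) simp
  obtain C where C: "C \<ge> 0" "\<And>x. norm ((vderiv ^^ m) (cutoff 1 (- 2) 2) x) \<le> C"
    using schwartz_bounded[OF s] by blast
  have "norm ((vderiv ^^ m) (\<lambda>x. 1) x) \<le> (1::real)" for x
    by (cases m) (auto simp: funpow_vderiv_Suc vderiv_const funpow_vderiv_0 simp del: funpow.simps(2))
  moreover have "(vderiv ^^ m) cocutoff = (\<lambda>x. (vderiv ^^ m) (\<lambda>x. 1) x + (vderiv ^^ m) (\<lambda>x. (- 1) * cutoff 1 (- 2) 2 x) x)"
    unfolding cocutoff_def[abs_def]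
    by (rule funpow_vderiv_add) (intro smooth_ndiff smooth_const smooth_mult smooth_cutoff)+
  moreover have "(vderiv ^^ m) (\<lambda>x. (- 1) * cutoff 1 (- 2) 2 x) = (\<lambda>x. (- 1) * (vderiv ^^ m) (cutoff 1 (- 2) 2) x)"
    by (rule funpow_vderiv_cmult[OF smooth_ndiff[OF smooth_cutoff]])
  ultimately have "norm ((vderiv ^^ m) cocutoff x) \<le> 1 + C" for x
    using C(2)[of x] by (auto intro!: order_trans[OF norm_triangle_ineq4] add_mono)
  then show ?thesis using that[of "1 + C"] C(1) by simp
qed

lemma funpow_mult_neg_ix: "(mult_neg_ix ^^ m) \<phi> = (\<lambda>x. (- \<i> * of_real x) ^ m * \<phi> x)"
  by (induction m) (auto simp: mult_neg_ix_def fun_eq_iff)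

lemma schwartz_seminorm_le:
  assumes "\<And>x. \<bar>x\<bar> ^ k * norm ((vderiv ^^ m) \<phi> x) \<le> B"
  shows "schwartz_seminorm k m \<phi> \<le> B"
  unfolding schwartz_seminorm_def using assms by (intro cSUP_least) auto

lemma le_schwartz_seminorm:
  assumes "\<phi> \<in> schwartz"
  shows "\<bar>x\<bar> ^ k * norm ((vderiv ^^ m) \<phi> x) \<le> schwartz_seminorm k m \<phi>"
proof -
  obtain C where "\<And>x. \<bar>x\<bar> ^ k * norm ((vderiv ^^ m) \<phi> x) \<le> C"
    using assms unfolding schwartz_iff by metis
  then have "bdd_above (range (\<lambda>x. \<bar>x\<bar> ^ k * norm ((vderiv ^^ m) \<phi> x)))"
    by (auto intro!: bdd_aboveI)
  then show ?thesis unfolding schwartz_seminorm_def by (intro cSUP_upper) auto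
qed

lemma schwartz_seminorm_nonneg: "\<phi> \<in> schwartz \<Longrightarrow> 0 \<le> schwartz_seminorm k m \<phi>"
  using le_schwartz_seminorm[of \<phi> 0 k m] by (rule order_trans[rotated]) auto

lemma schwartz_cocutoff_mult:
  assumes "\<phi> \<in> schwartz"
  shows "(\<lambda>x. cocutoff (c * x) * \<phi> x) \<in> schwartz"
proof -
  have s: "smooth (\<lambda>x. cocutoff (c * x))"
    using smooth_affine[OF smooth_cocutoff, of c 0] by simp
  have "\<exists>C k. \<forall>x. norm ((vderiv ^^ m) (\<lambda>x. cocutoff (c * x)) x) \<le> C * (1 + \<bar>x\<bar> ^ k)" for m
  proof -
    obtain C where C: "C \<ge> 0" "\<And>x. norm ((vderiv ^^ m) cocutoff x) \<le> C" using cocutoff_bounded by blast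
    have "norm ((vderiv ^^ m) (\<lambda>x. cocutoff (c * x)) x) \<le> \<bar>c\<bar> ^ m * C * (1 + \<bar>x\<bar> ^ 0)" for x
    proof -
      have "norm ((vderiv ^^ m) (\<lambda>x. cocutoff (c * x)) x) = \<bar>c\<bar> ^ m * norm ((vderiv ^^ m) cocutoff (c * x))"
        using funpow_vderiv_affine[OF smooth_ndiff[OF smooth_cocutoff], of m c 0] by (simp add: norm_mult norm_power)
      also have "\<dots> \<le> \<bar>c\<bar> ^ m * C" by (intro mult_left_mono C) auto
      also have "\<dots> \<le> \<bar>c\<bar> ^ m * C * (1 + \<bar>x\<bar> ^ 0)" using C(1) by simp
      finally show ?thesis .
    qed
    then show ?thesis by blast
  qed
  then show ?thesis by (rule schwartz_mult[OF s _ assms])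
qed

text \<open>In each Leibniz term either a derivative falls on the cutoff and brings a factor
  1/(n+1), or none does and the cutoff itself vanishes once n exceeds |x|. The derivatives of \<Phi>
  dominate.\<close>

lemma integral_vderiv_cocutoff_tendsto_0:
  assumes \<Phi>: "\<Phi> \<in> schwartz"
  shows "(\<lambda>n. LINT x|lborel. norm ((vderiv ^^ k) (\<lambda>x. cocutoff (1 / real (Suc n) * x) * \<Phi> x) x)) \<longlonglongrightarrow> 0"
proof -
  have "\<forall>i. \<exists>C. C \<ge> 0 \<and> (\<forall>x. norm ((vderiv ^^ i) cocutoff x) \<le> C)" using cocutoff_bounded by metis
  then obtain B where B: "\<And>i. B i \<ge> 0" "\<And>i x. norm ((vderiv ^^ i) cocutoff x) \<le> B i" by metis
  let ?c = "\<lambda>n x. cocutoff (1 / real (Suc n) * x)"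
  let ?d = "\<lambda>n i x. norm ((vderiv ^^ i) (?c n) x)"
  have deq: "?d n i x = (1 / real (Suc n)) ^ i * norm ((vderiv ^^ i) cocutoff (1 / real (Suc n) * x))" for n i x
    using funpow_vderiv_affine[OF smooth_ndiff[OF smooth_cocutoff], of i "1 / real (Suc n)" 0]
    by (simp add: norm_mult norm_power del: of_nat_Suc of_real_divide)
  have dB: "?d n i x \<le> B i" for n i x
  proof -
    have "(1 / real (Suc n)) ^ i \<le> 1" by (intro power_le_one) auto
    then show ?thesis unfolding deq using B[of i] by (intro order_trans[OF mult_left_le_one_le]) auto
  qed
  have dlim: "(\<lambda>n. ?d n i x) \<longlonglongrightarrow> 0" for i x
  proof (cases i)
    case 0
    obtain N where N: "real N > \<bar>x\<bar>" using reals_Archimedean2 by blast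
    have "?d n i x = 0" if "n \<ge> N" for n
    proof -
      have "\<bar>x\<bar> \<le> real (Suc n)" using N that by simp
      then have "\<bar>1 / real (Suc n) * x\<bar> \<le> 1" by (simp add: field_simps)
      then show ?thesis by (simp add: 0 cocutoff_eq_0)
    qed
    then show ?thesis by (intro tendsto_eventually) (auto simp: eventually_sequentially)
  next
    case (Suc j)
    have "?d n i x \<le> 1 / real (Suc n) * B i" for n
    proof -
      have "(1 / real (Suc n)) ^ i \<le> (1 / real (Suc n)) ^ 1"
        by (intro power_decreasing) (auto simp: Suc)
      then show ?thesis unfolding deq using B[of i] by (intro mult_mono) auto
    qed
    moreover have "(\<lambda>n. 1 / real (Suc n) * B i) \<longlonglongrightarrow> 0"
      using LIMSEQ_Suc[OF lim_const_over_n[of "B i"]] by simp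
    ultimately show ?thesis
      by (intro Lim_null_comparison[of "\<lambda>n. ?d n i x"]) (auto intro!: always_eventually)
  qed
  have sc: "smooth (?c n)" for n using smooth_affine[OF smooth_cocutoff, of "1 / real (Suc n)" 0] by simp
  let ?P = "\<lambda>j x. norm ((vderiv ^^ j) \<Phi> x)"
  have le: "norm ((vderiv ^^ k) (\<lambda>x. ?c n x * \<Phi> x) x) \<le> 2 ^ k * (\<Sum>i\<le>k. \<Sum>j\<le>k. ?d n i x * ?P j x)" for n x
    by (rule norm_funpow_vderiv_mult_le[OF sc schwartz_smooth[OF \<Phi>]])
  have "(\<lambda>n. LINT x|lborel. norm ((vderiv ^^ k) (\<lambda>x. ?c n x * \<Phi> x) x)) \<longlonglongrightarrow> (LINT x|(lborel :: real measure). 0)"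
  proof (rule integral_dominated_convergence[where w = "\<lambda>x. 2 ^ k * (\<Sum>i\<le>k. \<Sum>j\<le>k. B i * ?P j x)"])
    show "integrable lborel (\<lambda>x. 2 ^ k * (\<Sum>i\<le>k. \<Sum>j\<le>k. B i * ?P j x))"
      using \<Phi> by (intro integrable_mult_right Bochner_Integration.integrable_sum integrable_norm schwartz_integrable schwartz_funpow_vderiv)
    show "AE x in lborel. (\<lambda>n. norm ((vderiv ^^ k) (\<lambda>x. ?c n x * \<Phi> x) x)) \<longlonglongrightarrow> 0"
    proof (rule AE_I2)
      fix x
      have "(\<lambda>n. 2 ^ k * (\<Sum>i\<le>k. \<Sum>j\<le>k. ?d n i x * ?P j x)) \<longlonglongrightarrow> 2 ^ k * (\<Sum>i\<le>k. \<Sum>j\<le>k. 0 * ?P j x)"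
        by (intro tendsto_mult tendsto_sum tendsto_const dlim)
      then have "(\<lambda>n. 2 ^ k * (\<Sum>i\<le>k. \<Sum>j\<le>k. ?d n i x * ?P j x)) \<longlonglongrightarrow> 0" by simp
      then show "(\<lambda>n. norm ((vderiv ^^ k) (\<lambda>x. ?c n x * \<Phi> x) x)) \<longlonglongrightarrow> 0"
        by (rule Lim_null_comparison[rotated]) (use le in \<open>auto intro!: always_eventually\<close>)
    qed
    show "AE x in lborel. norm (norm ((vderiv ^^ k) (\<lambda>x. ?c n x * \<Phi> x) x)) \<le> 2 ^ k * (\<Sum>i\<le>k. \<Sum>j\<le>k. B i * ?P j x)" for n
    proof (rule AE_I2)
      fix x
      have "2 ^ k * (\<Sum>i\<le>k. \<Sum>j\<le>k. ?d n i x * ?P j x) \<le> 2 ^ k * (\<Sum>i\<le>k. \<Sum>j\<le>k. B i * ?P j x)"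
        by (intro mult_left_mono sum_mono mult_right_mono dB) auto
      from order_trans[OF le[of n x] this]
      show "norm (norm ((vderiv ^^ k) (\<lambda>x. ?c n x * \<Phi> x) x)) \<le> 2 ^ k * (\<Sum>i\<le>k. \<Sum>j\<le>k. B i * ?P j x)"
        by (simp only: real_norm_def abs_norm_cancel)
    qed
    show "(\<lambda>x. norm ((vderiv ^^ k) (\<lambda>x. ?c n x * \<Phi> x) x)) \<in> borel_measurable lborel" for n
    proof -
      have "(vderiv ^^ k) (\<lambda>x. ?c n x * \<Phi> x) \<in> borel_measurable borel"
        by (rule schwartz_measurable[OF schwartz_funpow_vderiv[OF schwartz_cocutoff_mult[OF \<Phi>]]])
      then show ?thesis by measurable
    qed
  qed simp
  then show ?thesis by simp
qed

lemma tempered_add: "tempered_distribution u \<Longrightarrow> \<phi> \<in> schwartz \<Longrightarrow> \<psi> \<in> schwartz \<Longrightarrow> u (\<lambda>x. \<phi> x + \<psi> x) = u \<phi> + u \<psi>"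
  by (simp add: tempered_distribution_def)

text \<open>Continuity bounds u by finitely many seminorms of the transform, and each of these by an
  L1 norm of derivatives of the function cut off near 0, which tends to 0.\<close>

lemma tempered_fourier_cocutoff_tendsto_0:
  assumes u: "tempered_distribution u" and \<phi>: "\<phi> \<in> schwartz"
  shows "(\<lambda>n. u (fourier (\<lambda>x. cocutoff (1 / real (Suc n) * x) * \<phi> x))) \<longlonglongrightarrow> 0"
proof -
  let ?h = "\<lambda>n x. cocutoff (1 / real (Suc n) * x) * \<phi> x"
  obtain C N where C: "\<And>\<phi>. \<phi> \<in> schwartz \<Longrightarrow> norm (u \<phi>) \<le> C * (\<Sum>k\<le>N. \<Sum>m\<le>N. schwartz_seminorm k m \<phi>)"
    using u unfolding tempered_distribution_def by blast
  have hs: "?h n \<in> schwartz" for n by (rule schwartz_cocutoff_mult[OF \<phi>])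
  let ?I = "\<lambda>n k m. LINT x|lborel. norm ((vderiv ^^ k) (\<lambda>x. cocutoff (1 / real (Suc n) * x) * (mult_neg_ix ^^ m) \<phi> x) x)"
  \<comment> \<open>The multiplier commutes with the cutoff, so the limit can be applied to the
    fixed Schwartz function \<open>(mult_neg_ix ^^ m) \<phi>\<close>.\<close>
  have "(mult_neg_ix ^^ m) (?h n) = (\<lambda>x. cocutoff (1 / real (Suc n) * x) * (mult_neg_ix ^^ m) \<phi> x)" for m n
    by (simp add: funpow_mult_neg_ix fun_eq_iff mult_ac)
  then have semi: "schwartz_seminorm k m (fourier (?h n)) \<le> ?I n k m" for k m n
    using power_mult_norm_vderiv_fourier_le[OF hs] by (intro schwartz_seminorm_le) metis
  have le: "norm (u (fourier (?h n))) \<le> \<bar>C\<bar> * (\<Sum>k\<le>N. \<Sum>m\<le>N. ?I n k m)" for n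
  proof -
    have "norm (u (fourier (?h n))) \<le> C * (\<Sum>k\<le>N. \<Sum>m\<le>N. schwartz_seminorm k m (fourier (?h n)))"
      by (rule C[OF schwartz_fourier[OF hs]])
    also have "\<dots> \<le> \<bar>C\<bar> * (\<Sum>k\<le>N. \<Sum>m\<le>N. schwartz_seminorm k m (fourier (?h n)))"
      by (intro mult_right_mono sum_nonneg schwartz_seminorm_nonneg schwartz_fourier hs) auto
    also have "\<dots> \<le> \<bar>C\<bar> * (\<Sum>k\<le>N. \<Sum>m\<le>N. ?I n k m)"
      by (intro mult_left_mono sum_mono semi) auto
    finally show ?thesis .
  qed
  have "(\<lambda>n. \<bar>C\<bar> * (\<Sum>k\<le>N. \<Sum>m\<le>N. ?I n k m)) \<longlonglongrightarrow> \<bar>C\<bar> * (\<Sum>k\<le>N. \<Sum>m\<le>N. 0)"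
    by (intro tendsto_mult tendsto_sum tendsto_const integral_vderiv_cocutoff_tendsto_0 schwartz_funpow_mult_neg_ix \<phi>)
  then have "(\<lambda>n. \<bar>C\<bar> * (\<Sum>k\<le>N. \<Sum>m\<le>N. ?I n k m)) \<longlonglongrightarrow> 0" by simp
  then show ?thesis
    by (rule Lim_null_comparison[rotated]) (use le in \<open>auto intro!: always_eventually\<close>)
qed

text \<open>The cutoffs \<open>\<chi>(x/n) \<phi>\<close> converge to \<open>\<phi>\<close> in the Schwartz space, so the representation,
  which is only required on test functions, extends to all Schwartz functions.\<close>

lemma tempered_fourier_schwartz:
  assumes u: "tempered_distribution u" and g: "represents (fourier_dist u) g"
    and L2: "integrable lborel (\<lambda>\<xi>. (norm (g \<xi>))\<^sup>2)" and \<phi>: "\<phi> \<in> schwartz"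
  shows "u (fourier \<phi>) = (LINT \<xi>|lborel. g \<xi> * \<phi> \<xi>)"
proof -
  let ?c = "\<lambda>n x. cocutoff (1 / real (Suc n) * x)"
  let ?h = "\<lambda>n x. ?c n x * \<phi> x"
  let ?t = "\<lambda>n x. cutoff 1 (- 2) 2 (1 / real (Suc n) * x) * \<phi> x"
  have [measurable]: "g \<in> borel_measurable borel" "\<phi> \<in> borel_measurable borel"
    using g schwartz_measurable[OF \<phi>] by (auto simp: represents_def)
  have st: "smooth (\<lambda>x. cutoff 1 (- 2) 2 (1 / real (Suc n) * x))" for n
    using smooth_affine[OF smooth_cutoff, of 1 "- 2" 2 "1 / real (Suc n)" 0] by simp
  have tt: "?t n \<in> test_functions" for n
  proof (rule test_functionI[where R = "2 * real (Suc n)"])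
    show "smooth (?t n)" using \<phi> by (intro smooth_mult st schwartz_smooth)
    fix x assume *: "\<bar>x\<bar> > 2 * real (Suc n)"
    have "\<not> (- 2 < 1 / real (Suc n) * x \<and> 1 / real (Suc n) * x < 2)"
      using * by (auto simp: field_simps abs_if split: if_splits)
    then show "?t n x = 0" by (simp add: cutoff_eq_0)
  qed
  have hs: "?h n \<in> schwartz" for n by (rule schwartz_cocutoff_mult[OF \<phi>])
  have ts: "?t n \<in> schwartz" for n using tt by (rule test_function_schwartz)
  have dec: "fourier \<phi> = (\<lambda>\<xi>. fourier (?t n) \<xi> + fourier (?h n) \<xi>)" for n
  proof
    fix \<xi>
    have "fourier (?t n) \<xi> + fourier (?h n) \<xi> = (LINT x|lborel. cis (- (x * \<xi>)) * ?t n x + cis (- (x * \<xi>)) * ?h n x)"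
      unfolding fourier_cis
      by (intro Bochner_Integration.integral_add[symmetric] schwartz_integrable_cis hs ts)
    also have "\<dots> = fourier \<phi> \<xi>"
      unfolding fourier_cis by (intro Bochner_Integration.integral_cong) (auto simp: cocutoff_def algebra_simps)
    finally show "fourier \<phi> \<xi> = fourier (?t n) \<xi> + fourier (?h n) \<xi>" by simp
  qed
  have eq1: "u (fourier \<phi>) = u (fourier (?t n)) + u (fourier (?h n))" for n
    by (rule trans[OF arg_cong[OF dec[of n], of u] tempered_add[OF u schwartz_fourier[OF ts[of n]] schwartz_fourier[OF hs[of n]]]])
  have eq2: "u (fourier (?t n)) = (LINT \<xi>|lborel. g \<xi> * ?t n \<xi>)" for n
    using g tt[of n] unfolding represents_def fourier_dist_def by blast
  have eq: "(LINT \<xi>|lborel. g \<xi> * ?t n \<xi>) = u (fourier \<phi>) - u (fourier (?h n))" for n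
    unfolding eq2[symmetric] by (subst eq1[of n]) (rule add_diff_cancel_right'[symmetric])
  have lim1: "(\<lambda>n. LINT \<xi>|lborel. g \<xi> * ?t n \<xi>) \<longlonglongrightarrow> (LINT \<xi>|lborel. g \<xi> * \<phi> \<xi>)"
  proof (rule integral_dominated_convergence[where w = "\<lambda>\<xi>. norm (g \<xi> * \<phi> \<xi>)"])
    show "integrable lborel (\<lambda>\<xi>. norm (g \<xi> * \<phi> \<xi>))"
      using L2 schwartz_square_integrable[OF \<phi>] by (intro integrable_norm integrable_mult_L2) auto
    show "AE \<xi> in lborel. norm (g \<xi> * ?t n \<xi>) \<le> norm (g \<xi> * \<phi> \<xi>)" for n
      by (intro AE_I2) (simp add: norm_mult mult_left_mono mult_left_le_one_le norm_cutoff_le)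
    show "AE \<xi> in lborel. (\<lambda>n. g \<xi> * ?t n \<xi>) \<longlonglongrightarrow> g \<xi> * \<phi> \<xi>"
    proof (rule AE_I2)
      fix \<xi> :: real
      obtain N where N: "real N > \<bar>\<xi>\<bar>" using reals_Archimedean2 by blast
      have "?t n \<xi> = \<phi> \<xi>" if "n \<ge> N" for n
      proof -
        have "\<bar>\<xi>\<bar> \<le> real (Suc n)" using N that by simp
        then have "\<bar>1 / real (Suc n) * \<xi>\<bar> \<le> 1" by (simp add: field_simps)
        then show ?thesis using cocutoff_eq_0[of "1 / real (Suc n) * \<xi>"] by (simp add: cocutoff_def)
      qed
      then show "(\<lambda>n. g \<xi> * ?t n \<xi>) \<longlonglongrightarrow> g \<xi> * \<phi> \<xi>"
        by (intro tendsto_eventually) (auto simp: eventually_sequentially intro!: exI[of _ N])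
    qed
    show "(\<lambda>\<xi>. g \<xi> * ?t n \<xi>) \<in> borel_measurable lborel" for n
      using smooth_measurable[OF st] by measurable
  qed measurable
  have lim2: "(\<lambda>n. u (fourier \<phi>) - u (fourier (?h n))) \<longlonglongrightarrow> u (fourier \<phi>) - 0"
    by (intro tendsto_diff tendsto_const tempered_fourier_cocutoff_tendsto_0 u \<phi>)
  show ?thesis using LIMSEQ_unique[OF lim1[unfolded eq] lim2] by simp
qed

text \<open>Identifies u with a pointwise limit of truncated inversion integrals: a test function is
  the transform of its inverse transform, which Fubini moves onto the truncated g. The sequence N is
  left free because the sufficiency truncates at integers and the necessity at the ends of
  packets.\<close>

lemma represents_of_limit:
  assumes u: "tempered_distribution u" and g: "represents (fourier_dist u) g"
    and L2: "integrable lborel (\<lambda>\<xi>. (norm (g \<xi>))\<^sup>2)"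
    and N: "filterlim N at_top sequentially"
    and lim: "AE x in lborel. (\<lambda>j. 1 / (2 * of_real pi) * (LINT \<xi>|lborel. cis (x * \<xi>) * (indicator {- N j..N j} \<xi> * g \<xi>))) \<longlonglongrightarrow> f0 x"
    and dom: "AE x in lborel. \<forall>j. norm (LINT \<xi>|lborel. cis (x * \<xi>) * (indicator {- N j..N j} \<xi> * g \<xi>)) \<le> M x"
    and M: "\<And>R. set_integrable lborel {- R..R} M"
    and f0: "f0 \<in> borel_measurable borel"
  shows "represents u f0"
proof -
  let ?g = "\<lambda>j \<xi>. indicator {- N j..N j} \<xi> * g \<xi>"
  define F where "F j x = 1 / (2 * of_real pi) * (LINT \<xi>|lborel. cis (x * \<xi>) * ?g j \<xi>)" for j x
  have [measurable]: "g \<in> borel_measurable borel" "f0 \<in> borel_measurable borel"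
    using g f0 by (auto simp: represents_def)
  have intg: "integrable lborel (?g j)" for j
    using g unfolding represents_def set_integrable_def by (simp add: scaleR_conv_of_real of_real_indicator)
  have dom': "AE x in lborel. \<forall>j. norm (F j x) \<le> M x"
  proof (rule AE_mp[OF dom], intro AE_I2 impI allI)
    fix x j assume *: "\<forall>j. norm (LINT \<xi>|lborel. cis (x * \<xi>) * ?g j \<xi>) \<le> M x"
    have "norm (F j x) = 1 / (2 * pi) * norm (LINT \<xi>|lborel. cis (x * \<xi>) * ?g j \<xi>)"
      by (simp add: F_def norm_mult norm_divide)
    also have "\<dots> \<le> 1 * norm (LINT \<xi>|lborel. cis (x * \<xi>) * ?g j \<xi>)"
      using pi_ge_two by (intro mult_right_mono) auto
    also have "\<dots> \<le> M x" using * by simp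
    finally show "norm (F j x) \<le> M x" .
  qed
  have dom0: "AE x in lborel. norm (f0 x) \<le> M x"
    using lim dom'
  proof eventually_elim
    case (elim x)
    then have "(\<lambda>j. norm (F j x)) \<longlonglongrightarrow> norm (f0 x)" unfolding F_def by (intro tendsto_norm)
    then show ?case by (rule LIMSEQ_le_const2) (use elim in auto)
  qed
  have loc: "set_integrable lborel {- R..R} f0" for R
    unfolding set_integrable_def
  proof (rule Bochner_Integration.integrable_bound)
    show "integrable lborel (\<lambda>x. indicator {- R..R} x *\<^sub>R M x)"
      using M[of R] by (simp add: set_integrable_def)
    show "AE x in lborel. norm (indicator {- R..R} x *\<^sub>R f0 x) \<le> norm (indicator {- R..R} x *\<^sub>R M x)"
      using dom0 by eventually_elim (auto simp: indicator_def)
  qed measurable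
  have Fm[measurable]: "F j \<in> borel_measurable borel" for j
    unfolding F_def[abs_def] by measurable
  have "u \<psi> = (LINT x|lborel. f0 x * \<psi> x)" if \<psi>: "\<psi> \<in> test_functions" for \<psi>
  proof -
    have \<psi>s: "\<psi> \<in> schwartz" using \<psi> by (rule test_function_schwartz)
    obtain R C where RC: "\<psi> \<in> borel_measurable borel" "\<And>x. norm (\<psi> x) \<le> C" "\<And>x. x \<notin> {-R..R} \<Longrightarrow> \<psi> x = 0"
      using test_function_props[OF \<psi>] by metis
    note [measurable] = RC(1)
    let ?\<phi> = "inv_fourier \<psi>"
    have \<phi>: "?\<phi> \<in> schwartz" by (rule schwartz_inv_fourier[OF \<psi>s])
    have [measurable]: "?\<phi> \<in> borel_measurable borel" by (rule schwartz_measurable[OF \<phi>])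
    \<comment> \<open>\<open>inv_fourier \<psi>\<close> is a Schwartz function but in general has no
      compact support, so the representation of the transform is used here beyond test
      functions.\<close>
    have u_eq: "u \<psi> = (LINT \<xi>|lborel. g \<xi> * ?\<phi> \<xi>)"
      using tempered_fourier_schwartz[OF u g L2 \<phi>] fourier_inv_fourier[OF \<psi>s] by simp
    have lim1: "(\<lambda>j. LINT \<xi>|lborel. ?g j \<xi> * ?\<phi> \<xi>) \<longlonglongrightarrow> (LINT \<xi>|lborel. g \<xi> * ?\<phi> \<xi>)"
    proof (rule integral_dominated_convergence[where w = "\<lambda>\<xi>. norm (g \<xi> * ?\<phi> \<xi>)"])
      show "integrable lborel (\<lambda>\<xi>. norm (g \<xi> * ?\<phi> \<xi>))"
        using L2 schwartz_square_integrable[OF \<phi>] by (intro integrable_norm integrable_mult_L2) auto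
      show "AE \<xi> in lborel. (\<lambda>j. ?g j \<xi> * ?\<phi> \<xi>) \<longlonglongrightarrow> g \<xi> * ?\<phi> \<xi>"
      proof (rule AE_I2)
        fix \<xi> :: real
        have "\<forall>\<^sub>F j in sequentially. N j \<ge> \<bar>\<xi>\<bar>" using N by (simp add: filterlim_at_top)
        then have "\<forall>\<^sub>F j in sequentially. ?g j \<xi> * ?\<phi> \<xi> = g \<xi> * ?\<phi> \<xi>"
          by eventually_elim (auto simp: indicator_def)
        then show "(\<lambda>j. ?g j \<xi> * ?\<phi> \<xi>) \<longlonglongrightarrow> g \<xi> * ?\<phi> \<xi>" by (rule tendsto_eventually)
      qed
    qed (auto simp: norm_mult indicator_def)
    moreover have eq: "(LINT \<xi>|lborel. ?g j \<xi> * ?\<phi> \<xi>) = (LINT x|lborel. F j x * \<psi> x)" for j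
    proof -
      have "(LINT \<xi>|lborel. ?g j \<xi> * ?\<phi> \<xi>) =
          1 / (2 * of_real pi) * (LINT \<xi>|lborel. ?g j \<xi> * (LINT x|lborel. cis (x * \<xi>) * \<psi> x))"
        unfolding inv_fourier_def integral_mult_right_zero[symmetric]
        by (intro Bochner_Integration.integral_cong) (auto simp: mult_ac)
      also have "\<dots> = 1 / (2 * of_real pi) * (LINT x|lborel. \<psi> x * (LINT \<xi>|lborel. cis (x * \<xi>) * ?g j \<xi>))"
        by (subst Fubini_kernel[OF intg schwartz_integrable[OF \<psi>s]]) auto
      also have "\<dots> = (LINT x|lborel. F j x * \<psi> x)"
        unfolding F_def integral_mult_right_zero[symmetric]
        by (intro Bochner_Integration.integral_cong) (auto simp: mult_ac)
      finally show ?thesis .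
    qed
    have lim2: "(\<lambda>j. LINT x|lborel. F j x * \<psi> x) \<longlonglongrightarrow> (LINT x|lborel. f0 x * \<psi> x)"
    proof (rule integral_dominated_convergence[where w = "\<lambda>x. C * (indicator {-R..R} x *\<^sub>R M x)"])
      show "integrable lborel (\<lambda>x. C * (indicator {-R..R} x *\<^sub>R M x))"
        using M[of R] unfolding set_integrable_def by (rule integrable_mult_right)
      show "AE x in lborel. (\<lambda>j. F j x * \<psi> x) \<longlonglongrightarrow> f0 x * \<psi> x"
        using lim unfolding F_def by eventually_elim (intro tendsto_mult tendsto_const)
      show "AE x in lborel. norm (F j x * \<psi> x) \<le> C * (indicator {-R..R} x *\<^sub>R M x)" for j
        using dom'
      proof eventually_elim
        case (elim x)
        show ?case
        proof (cases "x \<in> {-R..R}")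
          case True
          have "norm (F j x) * norm (\<psi> x) \<le> M x * C"
            using elim order_trans[OF norm_ge_zero] by (intro mult_mono RC(2)) blast+
          then show ?thesis using True by (simp add: norm_mult mult.commute)
        qed (use RC(3) in simp)
      qed
    qed measurable
    show ?thesis using LIMSEQ_unique[OF lim1[unfolded eq] lim2] u_eq by simp
  qed
  then show ?thesis using loc by (simp add: represents_def)
qed

lemma integrable_inverse_square: "integrable lborel (\<lambda>x::real. (norm (of_real (inverse (1 + x\<^sup>2)) :: complex))\<^sup>2)"
proof (rule Bochner_Integration.integrable_bound[OF Submission.integrable_inverse_1_plus_square])
  have "(inverse (1 + x\<^sup>2))\<^sup>2 \<le> inverse (1 + x\<^sup>2)" for x :: real
  proof -
    have "inverse (1 + x\<^sup>2) \<le> 1" by (intro inverse_le_1_iff[THEN iffD2]) auto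
    then show ?thesis by (simp add: power2_eq_square mult_left_le)
  qed
  then show "AE x::real in lborel. norm ((norm (of_real (inverse (1 + x\<^sup>2)) :: complex))\<^sup>2) \<le> norm (inverse (1 + x\<^sup>2))"
    by (intro AE_I2) (simp only: norm_of_real real_norm_def abs_power2 power2_abs abs_of_nonneg inverse_nonnegative_iff_nonnegative
      add_nonneg_nonneg zero_le_one zero_le_power2)
qed measurable

lemma L2_locally_integrable:
  fixes g :: "real \<Rightarrow> complex"
  assumes [measurable]: "g \<in> borel_measurable borel" and L2: "integrable lborel (\<lambda>\<xi>. (norm (g \<xi>))\<^sup>2)"
  shows "set_integrable lborel {- R..R} g"
proof -
  have "(\<lambda>x. (norm (indicator {-R..R} x :: complex))\<^sup>2) = (indicator {-R..R} :: real \<Rightarrow> real)"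
    by (auto simp: indicator_def fun_eq_iff)
  then have ind: "integrable lborel (\<lambda>x. (norm (indicator {-R..R} x :: complex))\<^sup>2)"
    using emeasure_lborel_Icc_eq[of "-R" R] by (auto split: if_splits)
  have "integrable lborel (\<lambda>\<xi>. g \<xi> * indicator {-R..R} \<xi>)"
    by (rule integrable_mult_L2[OF _ _ L2 ind]) measurable
  then show ?thesis by (simp add: set_integrable_def scaleR_conv_of_real of_real_indicator mult.commute)
qed

text \<open>u pairs g with the inverse transform. Two derivatives of the argument give its inverse
  transform the decay 1/(1+\<xi>^2), which is square integrable and hence integrable against g; so
  seminorms up to order 2 suffice.\<close>

lemma exists_tempered_with_fourier:
  assumes [measurable]: "g \<in> borel_measurable borel" and L2: "integrable lborel (\<lambda>\<xi>. (norm (g \<xi>))\<^sup>2)"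
  shows "\<exists>u. tempered_distribution u \<and> represents (fourier_dist u) g"
proof -
  define u where "u \<psi> = (LINT \<xi>|lborel. g \<xi> * inv_fourier \<psi> \<xi>)" for \<psi>
  define I where "I = (LINT \<xi>|lborel. norm (g \<xi> * of_real (inverse (1 + \<xi>\<^sup>2))))"
  have intI: "integrable lborel (\<lambda>\<xi>. norm (g \<xi> * of_real (inverse (1 + \<xi>\<^sup>2))))"
    by (intro integrable_norm integrable_mult_L2 L2 integrable_inverse_square) measurable
  have int: "integrable lborel (\<lambda>\<xi>. g \<xi> * inv_fourier \<psi> \<xi>)" if "\<psi> \<in> schwartz" for \<psi>
    using that by (intro integrable_mult_L2 L2 schwartz_square_integrable schwartz_inv_fourier)
      (auto dest: schwartz_inv_fourier schwartz_measurable)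
  have add: "u (\<lambda>x. \<phi> x + \<psi> x) = u \<phi> + u \<psi>" if "\<phi> \<in> schwartz" "\<psi> \<in> schwartz" for \<phi> \<psi>
  proof -
    have "inv_fourier (\<lambda>x. \<phi> x + \<psi> x) = (\<lambda>\<xi>. inv_fourier \<phi> \<xi> + inv_fourier \<psi> \<xi>)"
      unfolding inv_fourier_def[abs_def] fun_eq_iff distrib_left
      using that by (auto simp: integrable_cis_mult schwartz_integrable distrib_left)
    then show ?thesis unfolding u_def using int that by (simp add: distrib_left)
  qed
  have scale: "u (\<lambda>x. c * \<psi> x) = c * u \<psi>" for c \<psi>
  proof -
    have "inv_fourier (\<lambda>x. c * \<psi> x) = (\<lambda>\<xi>. c * inv_fourier \<psi> \<xi>)"
      by (simp add: inv_fourier_def[abs_def] mult.left_commute[of _ c])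
    then show ?thesis unfolding u_def by (simp add: mult.left_commute[of _ c])
  qed
  have bound: "norm (u \<psi>) \<le> I * (\<Sum>k\<le>2. \<Sum>m\<le>2. schwartz_seminorm k m \<psi>)" if \<psi>: "\<psi> \<in> schwartz" for \<psi>
  proof -
    define S where "S = (\<Sum>k\<le>2. \<Sum>m\<le>2. schwartz_seminorm k m \<psi>)"
    \<comment> \<open>The weight 1 + x^2 trades a supremum for an L1 norm; pi is the integral of
      1/(1+x^2).\<close>
    have L1: "(LINT x|lborel. norm (w x)) \<le> pi * K"
      if w: "w \<in> schwartz" and K: "\<And>x. (1 + x\<^sup>2) * norm (w x) \<le> K" for w K
    proof -
      have "(LINT x|lborel. norm (w x)) \<le> (LINT x|lborel. K * inverse (1 + x\<^sup>2))"
      proof (rule integral_mono)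
        show "norm (w x) \<le> K * inverse (1 + x\<^sup>2)" for x
          using K[of x] by (simp add: field_simps add_pos_nonneg)
      qed (use w in \<open>auto intro: schwartz_integrable Submission.integrable_inverse_1_plus_square\<close>)
      also have "\<dots> = pi * K"
        using LBINT_inverse_1_plus_square
        by (simp add: interval_lebesgue_integral_def set_lebesgue_integral_def einterval_def)
      finally show ?thesis .
    qed
    have semi: "(1 + x\<^sup>2) * norm ((vderiv ^^ m) \<psi> x) \<le> schwartz_seminorm 0 m \<psi> + schwartz_seminorm 2 m \<psi>" for m x
      using le_schwartz_seminorm[OF \<psi>, of x 0 m] le_schwartz_seminorm[OF \<psi>, of x 2 m]
      by (simp add: distrib_right)
    have "norm (inv_fourier \<psi> \<xi>) \<le> S * inverse (1 + \<xi>\<^sup>2)" for \<xi>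
    proof -
      have 0: "norm (fourier \<psi> (- \<xi>)) \<le> pi * (schwartz_seminorm 0 0 \<psi> + schwartz_seminorm 2 0 \<psi>)"
        using norm_fourier_le[of \<psi>] L1[OF \<psi> semi[of _ 0, simplified]] by (rule order_trans)
      have "\<bar>- \<xi>\<bar> ^ 2 * norm (fourier \<psi> (- \<xi>)) = norm (fourier ((vderiv ^^ 2) \<psi>) (- \<xi>))"
        by (rule power_mult_norm_fourier[OF \<psi>])
      also have "\<dots> \<le> pi * (schwartz_seminorm 0 2 \<psi> + schwartz_seminorm 2 2 \<psi>)"
        using norm_fourier_le[of "(vderiv ^^ 2) \<psi>"] L1[OF schwartz_funpow_vderiv[OF \<psi>] semi] by (rule order_trans)
      finally have "(1 + \<xi>\<^sup>2) * norm (fourier \<psi> (- \<xi>)) \<le> pi *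
          (schwartz_seminorm 0 0 \<psi> + schwartz_seminorm 2 0 \<psi> + schwartz_seminorm 0 2 \<psi> + schwartz_seminorm 2 2 \<psi>)"
        using 0 by (simp add: algebra_simps)
      also have "\<dots> \<le> pi * S"
        using schwartz_seminorm_nonneg[OF \<psi>]
        by (intro mult_left_mono) (auto simp: S_def numeral_2_eq_2 intro!: add_nonneg_nonneg)
      finally have "(1 + \<xi>\<^sup>2) * norm (fourier \<psi> (- \<xi>)) \<le> pi * S" .
      then have "norm (fourier \<psi> (- \<xi>)) \<le> pi * S * inverse (1 + \<xi>\<^sup>2)"
        by (simp add: field_simps add_pos_nonneg)
      moreover have "norm (inv_fourier \<psi> \<xi>) = 1 / (2 * pi) * norm (fourier \<psi> (- \<xi>))"
        by (simp add: inv_fourier_eq norm_mult norm_divide)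
      ultimately have "norm (inv_fourier \<psi> \<xi>) \<le> 1 / (2 * pi) * (pi * S * inverse (1 + \<xi>\<^sup>2))"
        by (simp only:) (intro mult_left_mono, auto)
      also have "\<dots> = (1 / 2) * (S * inverse (1 + \<xi>\<^sup>2))" by simp
      also have "\<dots> \<le> 1 * (S * inverse (1 + \<xi>\<^sup>2))"
        using schwartz_seminorm_nonneg[OF \<psi>]
        by (intro mult_right_mono mult_nonneg_nonneg) (auto simp: S_def intro!: sum_nonneg)
      finally show ?thesis by simp
    qed
    then have *: "norm (g \<xi> * inv_fourier \<psi> \<xi>) \<le> S * norm (g \<xi> * of_real (inverse (1 + \<xi>\<^sup>2)))" for \<xi>
      using mult_left_mono[of "norm (inv_fourier \<psi> \<xi>)" "S * inverse (1 + \<xi>\<^sup>2)" "norm (g \<xi>)"]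
      by (simp add: norm_mult norm_divide norm_inverse mult_ac del: of_real_inverse of_real_add)
    have "norm (u \<psi>) \<le> (LINT \<xi>|lborel. S * norm (g \<xi> * of_real (inverse (1 + \<xi>\<^sup>2))))"
      unfolding u_def
      by (rule Bochner_Integration.integral_norm_bound_integral[OF int[OF \<psi>] integrable_mult_right[OF intI] *])
    then show ?thesis by (simp add: I_def S_def mult.commute)
  qed
  have "tempered_distribution u"
    unfolding tempered_distribution_def using add scale bound by blast
  moreover have "represents (fourier_dist u) g"
    unfolding represents_def fourier_dist_def
    using L2_locally_integrable[OF assms]
    by (auto simp: u_def inv_fourier_fourier test_function_schwartz)
  ultimately show ?thesis by blast
qed

text \<open>The Sobolev bound is known for some representative, \<open>fourier_fun\<close> is a
  possibly different choice; uniqueness almost everywhere carries the bound over.\<close>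

lemma sobolev_fourier_fun:
  assumes "f \<in> sobolev s"
  shows "tempered_distribution f" "represents (fourier_dist f) (fourier_fun f)"
    "integrable lborel (\<lambda>\<xi>. (1 + \<xi>\<^sup>2) powr s * (norm (fourier_fun f \<xi>))\<^sup>2)"
proof -
  obtain g where f: "tempered_distribution f" and g: "represents (fourier_dist f) g"
      "integrable lborel (\<lambda>\<xi>. (1 + \<xi>\<^sup>2) powr s * (norm (g \<xi>))\<^sup>2)"
    using assms by (auto simp: sobolev_def)
  show "tempered_distribution f" by fact
  show rep: "represents (fourier_dist f) (fourier_fun f)"
    unfolding fourier_fun_def by (rule someI[of "represents (fourier_dist f)" g, OF g(1)])
  have [measurable]: "fourier_fun f \<in> borel_measurable borel" using rep by (simp add: represents_def)
  show "integrable lborel (\<lambda>\<xi>. (1 + \<xi>\<^sup>2) powr s * (norm (fourier_fun f \<xi>))\<^sup>2)"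
    using g(2)
  proof (rule integrable_cong_AE_imp)
    show "AE \<xi> in lborel. (1 + \<xi>\<^sup>2) powr s * (norm (g \<xi>))\<^sup>2 = (1 + \<xi>\<^sup>2) powr s * (norm (fourier_fun f \<xi>))\<^sup>2"
      using represents_unique[OF rep g(1)] by eventually_elim simp
  qed measurable
qed

subsection \<open>Van der Corput estimates\<close>

lemma set_integrable_cis:
  fixes \<alpha> \<beta> :: real
  assumes "continuous_on {\<alpha>..\<beta>} \<phi>"
  shows "set_integrable lborel {\<alpha>..\<beta>} (\<lambda>\<xi>. cis (\<phi> \<xi>))"
  unfolding cis_conv_exp
  by (intro borel_integrable_atLeastAtMost' continuous_intros assms)

lemma set_integral_split:
  fixes f :: "real \<Rightarrow> complex"
  assumes "\<alpha> \<le> \<gamma>" "\<gamma> \<le> \<beta>" "set_integrable lborel {\<alpha>..\<beta>} f"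
  shows "(LINT \<xi>:{\<alpha>..\<beta>}|lborel. f \<xi>) = (LINT \<xi>:{\<alpha>..\<gamma>}|lborel. f \<xi>) + (LINT \<xi>:{\<gamma>..\<beta>}|lborel. f \<xi>)"
proof -
  have "{\<alpha>..\<beta>} = {\<alpha>..\<gamma>} \<union> {\<gamma>..\<beta>}" using assms by auto
  moreover have "(LINT \<xi>:{\<alpha>..\<gamma>} \<union> {\<gamma>..\<beta>}|lborel. f \<xi>) = (LINT \<xi>:{\<alpha>..\<gamma>}|lborel. f \<xi>) + (LINT \<xi>:{\<gamma>..\<beta>}|lborel. f \<xi>)"
  proof (rule set_integral_Un_AE)
    show "AE \<xi> in lborel. \<not> (\<xi> \<in> {\<alpha>..\<gamma>} \<and> \<xi> \<in> {\<gamma>..\<beta>})"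
      using AE_lborel_singleton[of \<gamma>] by eventually_elim auto
    show "set_integrable lborel {\<alpha>..\<gamma>} f" "set_integrable lborel {\<gamma>..\<beta>} f"
      using assms by (auto intro: set_integrable_subset)
  qed auto
  ultimately show ?thesis by simp
qed

lemma norm_set_integral_cis_le:
  fixes \<alpha> \<beta> :: real
  assumes "\<alpha> \<le> \<beta>" "continuous_on {\<alpha>..\<beta>} \<phi>"
  shows "norm (LINT \<xi>:{\<alpha>..\<beta>}|lborel. cis (\<phi> \<xi>)) \<le> \<beta> - \<alpha>"
proof -
  have "norm (LINT \<xi>:{\<alpha>..\<beta>}|lborel. cis (\<phi> \<xi>)) \<le> (LINT \<xi>:{\<alpha>..\<beta>}|lborel. norm (cis (\<phi> \<xi>)))"
    by (rule set_integral_norm_bound[OF set_integrable_cis[OF assms(2)]])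
  also have "\<dots> = \<beta> - \<alpha>" using assms(1) by (simp add: set_integral_const)
  finally show ?thesis .
qed

text \<open>Integration by parts with \<open>cis \<phi> = (cis \<phi>)' / (\<i> \<phi>')\<close>. The boundary terms are at most
  \<open>2/m\<close>, and so is the total variation of the monotone function \<open>1/\<phi>'\<close>.\<close>

lemma van_der_Corput_first:
  fixes \<alpha> \<beta> :: real
  assumes "\<alpha> \<le> \<beta>"
    and \<phi>: "\<And>\<xi>. \<xi> \<in> {\<alpha>..\<beta>} \<Longrightarrow> (\<phi> has_real_derivative p \<xi>) (at \<xi>)"
    and p: "\<And>\<xi>. \<xi> \<in> {\<alpha>..\<beta>} \<Longrightarrow> (p has_real_derivative q \<xi>) (at \<xi>)"
    and q: "continuous_on {\<alpha>..\<beta>} q"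
    and m: "m > 0" "\<And>\<xi>. \<xi> \<in> {\<alpha>..\<beta>} \<Longrightarrow> \<bar>p \<xi>\<bar> \<ge> m"
    and sgn: "(\<forall>\<xi>\<in>{\<alpha>..\<beta>}. q \<xi> \<ge> 0) \<or> (\<forall>\<xi>\<in>{\<alpha>..\<beta>}. q \<xi> \<le> 0)"
  shows "norm (LINT \<xi>:{\<alpha>..\<beta>}|lborel. cis (\<phi> \<xi>)) \<le> 4 / m"
proof -
  define w' where "w' \<xi> = - q \<xi> / (p \<xi>)\<^sup>2" for \<xi>
  have p0: "p \<xi> \<noteq> 0" if "\<xi> \<in> {\<alpha>..\<beta>}" for \<xi> using m(2)[OF that] m(1) by auto
  have contp: "continuous_on {\<alpha>..\<beta>} p" and cont\<phi>: "continuous_on {\<alpha>..\<beta>} \<phi>"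
    by (rule DERIV_continuous_on, rule has_field_derivative_at_within, erule p \<phi>)+
  have contw': "continuous_on {\<alpha>..\<beta>} w'"
    unfolding w'_def by (intro continuous_intros contp q) (use p0 in auto)
  have w: "((\<lambda>\<xi>. 1 / p \<xi>) has_real_derivative w' \<xi>) (at \<xi>)" if "\<xi> \<in> {\<alpha>..\<beta>}" for \<xi>
    unfolding w'_def using p0[OF that]
    by (auto intro!: derivative_eq_intros p[OF that] simp: power2_eq_square)
  have int_w: "(LINT \<xi>|lborel. indicator {\<alpha>..\<beta>} \<xi> *\<^sub>R w' \<xi>) = 1 / p \<beta> - 1 / p \<alpha>"
    by (rule integral_FTC_Icc[OF assms(1) _ contw'])
       (auto simp flip: has_real_derivative_iff_has_vector_derivative intro!: has_field_derivative_at_within w)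
  have intw': "set_integrable lborel {\<alpha>..\<beta>} w'" by (intro borel_integrable_atLeastAtMost' contw')
  have "(LINT \<xi>:{\<alpha>..\<beta>}|lborel. \<bar>w' \<xi>\<bar>) \<le> 2 / m"
  proof -
    have b: "\<bar>1 / p \<beta> - 1 / p \<alpha>\<bar> \<le> 2 / m"
    proof -
      have "\<bar>1 / p \<beta>\<bar> \<le> 1 / m" "\<bar>1 / p \<alpha>\<bar> \<le> 1 / m"
        using m(2)[of \<beta>] m(2)[of \<alpha>] m(1) assms(1) by (auto simp: abs_divide intro!: divide_left_mono)
      moreover have "\<bar>1 / p \<beta> - 1 / p \<alpha>\<bar> \<le> \<bar>1 / p \<beta>\<bar> + \<bar>1 / p \<alpha>\<bar>" by (rule abs_triangle_ineq4)
      moreover have "2 / m = 1 / m + 1 / m" by simp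
      ultimately show ?thesis by linarith
    qed
    from sgn show ?thesis
    proof
      assume s: "\<forall>\<xi>\<in>{\<alpha>..\<beta>}. q \<xi> \<ge> 0"
      have "(LINT \<xi>:{\<alpha>..\<beta>}|lborel. \<bar>w' \<xi>\<bar>) = - (LINT \<xi>:{\<alpha>..\<beta>}|lborel. w' \<xi>)"
        unfolding set_lebesgue_integral_def Bochner_Integration.integral_minus[symmetric]
        by (intro Bochner_Integration.integral_cong) (use s in \<open>auto simp: indicator_def w'_def\<close>)
      then show ?thesis using b int_w by (simp add: set_lebesgue_integral_def)
    next
      assume s: "\<forall>\<xi>\<in>{\<alpha>..\<beta>}. q \<xi> \<le> 0"
      have "(LINT \<xi>:{\<alpha>..\<beta>}|lborel. \<bar>w' \<xi>\<bar>) = (LINT \<xi>:{\<alpha>..\<beta>}|lborel. w' \<xi>)"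
        unfolding set_lebesgue_integral_def
        by (intro Bochner_Integration.integral_cong)
           (use s in \<open>auto simp: indicator_def w'_def divide_nonpos_nonneg abs_of_nonpos\<close>)
      then show ?thesis using b int_w by (simp add: set_lebesgue_integral_def)
    qed
  qed
  define W where "W \<xi> = of_real (1 / p \<xi>) * cis (\<phi> \<xi>)" for \<xi>
  have W: "(W has_vector_derivative of_real (w' \<xi>) * cis (\<phi> \<xi>) + \<i> * cis (\<phi> \<xi>)) (at \<xi>)"
    if "\<xi> \<in> {\<alpha>..\<beta>}" for \<xi>
  proof -
    have "((\<lambda>\<xi>. of_real (1 / p \<xi>) :: complex) has_vector_derivative of_real (w' \<xi>)) (at \<xi>)"
      using w[OF that] by (intro has_vector_derivative_of_real) (simp add: has_real_derivative_iff_has_vector_derivative)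
    from has_vector_derivative_mult[OF this cis_has_vector_derivative[OF \<phi>[OF that]]]
    show ?thesis using p0[OF that] by (simp add: W_def[abs_def] add.commute)
  qed
  have contW: "continuous_on {\<alpha>..\<beta>} (\<lambda>\<xi>. of_real (w' \<xi>) * cis (\<phi> \<xi>) + \<i> * cis (\<phi> \<xi>))"
    unfolding cis_conv_exp by (intro continuous_intros contw' cont\<phi>)
  have int1: "set_integrable lborel {\<alpha>..\<beta>} (\<lambda>\<xi>. of_real (w' \<xi>) * cis (\<phi> \<xi>))"
    unfolding cis_conv_exp by (intro borel_integrable_atLeastAtMost' continuous_intros contw' cont\<phi>)
  have int2: "set_integrable lborel {\<alpha>..\<beta>} (\<lambda>\<xi>. cis (\<phi> \<xi>))" by (rule set_integrable_cis[OF cont\<phi>])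
  have "(LINT \<xi>:{\<alpha>..\<beta>}|lborel. of_real (w' \<xi>) * cis (\<phi> \<xi>) + \<i> * cis (\<phi> \<xi>)) = W \<beta> - W \<alpha>"
    unfolding set_lebesgue_integral_def
    by (rule integral_FTC_Icc[OF assms(1) _ contW]) (auto intro!: has_vector_derivative_at_within W)
  then have "(LINT \<xi>:{\<alpha>..\<beta>}|lborel. of_real (w' \<xi>) * cis (\<phi> \<xi>)) + \<i> * (LINT \<xi>:{\<alpha>..\<beta>}|lborel. cis (\<phi> \<xi>)) = W \<beta> - W \<alpha>"
    using set_integral_add(2)[OF int1 set_integrable_mult_right[OF int2, of \<i>]] by simp
  then have "\<i> * (LINT \<xi>:{\<alpha>..\<beta>}|lborel. cis (\<phi> \<xi>)) = (W \<beta> - W \<alpha>) - (LINT \<xi>:{\<alpha>..\<beta>}|lborel. of_real (w' \<xi>) * cis (\<phi> \<xi>))"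
    by (simp add: eq_diff_eq add.commute)
  then have "norm (LINT \<xi>:{\<alpha>..\<beta>}|lborel. cis (\<phi> \<xi>)) = norm ((W \<beta> - W \<alpha>) - (LINT \<xi>:{\<alpha>..\<beta>}|lborel. of_real (w' \<xi>) * cis (\<phi> \<xi>)))"
    by (metis norm_mult norm_ii mult_1)
  also have "\<dots> \<le> (norm (W \<beta>) + norm (W \<alpha>)) + norm (LINT \<xi>:{\<alpha>..\<beta>}|lborel. of_real (w' \<xi>) * cis (\<phi> \<xi>))"
    by (intro order_trans[OF norm_triangle_ineq4] add_mono norm_triangle_ineq4 order_refl)
  also have "norm (LINT \<xi>:{\<alpha>..\<beta>}|lborel. of_real (w' \<xi>) * cis (\<phi> \<xi>)) \<le> (LINT \<xi>:{\<alpha>..\<beta>}|lborel. \<bar>w' \<xi>\<bar>)"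
    using set_integral_norm_bound[OF int1] by (simp add: norm_mult)
  also have "(LINT \<xi>:{\<alpha>..\<beta>}|lborel. \<bar>w' \<xi>\<bar>) \<le> 2 / m" by fact
  finally have "norm (LINT \<xi>:{\<alpha>..\<beta>}|lborel. cis (\<phi> \<xi>)) \<le> (norm (W \<beta>) + norm (W \<alpha>)) + 2 / m"
    by simp
  moreover have "norm (W \<beta>) \<le> 1 / m" "norm (W \<alpha>) \<le> 1 / m"
    using m(2)[of \<beta>] m(2)[of \<alpha>] m(1) assms(1)
    by (auto simp: W_def norm_mult norm_divide abs_divide intro!: divide_left_mono)
  moreover have "4 / m = (1 / m + 1 / m) + 2 / m" by (simp add: add_divide_distrib[symmetric])
  ultimately show ?thesis by linarith
qed

text \<open>The derivative p grows at rate at least m, so |p| is at least sqrt m outside a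
  neighbourhood of radius 1/sqrt m around one point. The first derivative test gives 4/sqrt m on
  either side, the length 2/sqrt m in between: 10 in all.\<close>

lemma van_der_Corput_second_pos:
  assumes "\<alpha> \<le> \<beta>"
    and \<phi>: "\<And>\<xi>. \<xi> \<in> {\<alpha>..\<beta>} \<Longrightarrow> (\<phi> has_real_derivative p \<xi>) (at \<xi>)"
    and p: "\<And>\<xi>. \<xi> \<in> {\<alpha>..\<beta>} \<Longrightarrow> (p has_real_derivative q \<xi>) (at \<xi>)"
    and q: "continuous_on {\<alpha>..\<beta>} q"
    and m: "m > 0" "\<And>\<xi>. \<xi> \<in> {\<alpha>..\<beta>} \<Longrightarrow> q \<xi> \<ge> m"
  shows "norm (LINT \<xi>:{\<alpha>..\<beta>}|lborel. cis (\<phi> \<xi>)) \<le> 10 / sqrt m"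
proof -
  have cont\<phi>: "continuous_on {\<alpha>..\<beta>} \<phi>" and contp: "continuous_on {\<alpha>..\<beta>} p"
    by (rule DERIV_continuous_on, rule has_field_derivative_at_within, erule p \<phi>)+
  have grow: "p \<eta> - p \<xi> \<ge> m * (\<eta> - \<xi>)" if "\<alpha> \<le> \<xi>" "\<xi> \<le> \<eta>" "\<eta> \<le> \<beta>" for \<xi> \<eta>
  proof -
    have "(\<lambda>\<xi>. p \<xi> - m * \<xi>) \<xi> \<le> (\<lambda>\<xi>. p \<xi> - m * \<xi>) \<eta>"
    proof (rule DERIV_nonneg_imp_nondecreasing[OF that(2)])
      fix x assume "\<xi> \<le> x" "x \<le> \<eta>"
      then have x: "x \<in> {\<alpha>..\<beta>}" using that by auto
      show "\<exists>y. ((\<lambda>\<xi>. p \<xi> - m * \<xi>) has_real_derivative y) (at x) \<and> 0 \<le> y"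
        by (intro exI[of _ "q x - m"] conjI)
           (use m(2)[OF x] in \<open>auto intro!: derivative_eq_intros p[OF x]\<close>)
    qed
    then show ?thesis by (simp add: algebra_simps)
  qed
  \<comment> \<open>The zero of p if there is one, otherwise the endpoint at which p is closest to
    zero.\<close>
  obtain c where c: "c \<in> {\<alpha>..\<beta>}" "\<And>\<xi>. c < \<xi> \<Longrightarrow> \<xi> \<le> \<beta> \<Longrightarrow> p \<xi> \<ge> m * (\<xi> - c)"
    "\<And>\<xi>. \<alpha> \<le> \<xi> \<Longrightarrow> \<xi> < c \<Longrightarrow> p \<xi> \<le> - (m * (c - \<xi>))"
  proof -
    consider "p \<beta> \<le> 0" | "p \<alpha> \<ge> 0" | "p \<alpha> \<le> 0" "0 \<le> p \<beta>" by linarith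
    then show ?thesis
    proof cases
      case 1
      have "p \<xi> \<le> - (m * (\<beta> - \<xi>))" if "\<alpha> \<le> \<xi>" "\<xi> < \<beta>" for \<xi> using grow[of \<xi> \<beta>] that 1 by simp
      then show ?thesis using that[of \<beta>] assms(1) by auto
    next
      case 2
      have "p \<xi> \<ge> m * (\<xi> - \<alpha>)" if "\<alpha> < \<xi>" "\<xi> \<le> \<beta>" for \<xi> using grow[of \<alpha> \<xi>] that 2 by simp
      then show ?thesis using that[of \<alpha>] assms(1) by auto
    next
      case 3
      obtain c where c: "\<alpha> \<le> c" "c \<le> \<beta>" "p c = 0" using IVT'[of p \<alpha> 0 \<beta>] 3 assms(1) contp by auto
      have "p \<xi> \<ge> m * (\<xi> - c)" if "c < \<xi>" "\<xi> \<le> \<beta>" for \<xi> using grow[of c \<xi>] that c by simp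
      moreover have "p \<xi> \<le> - (m * (c - \<xi>))" if "\<alpha> \<le> \<xi>" "\<xi> < c" for \<xi> using grow[of \<xi> c] that c by simp
      ultimately show ?thesis using that[of c] c by auto
    qed
  qed
  \<comment> \<open>This radius balances the trivial bound 2r near c against the bound of order 1/(m
    r) away from it.\<close>
  define r where "r = 1 / sqrt m"
  have r: "r > 0" "m * r = sqrt m" using m(1) by (auto simp: r_def real_div_sqrt)
  have q0: "q \<xi> \<ge> 0" if "\<xi> \<in> {\<alpha>..\<beta>}" for \<xi> using m(1) m(2)[OF that] by simp
  define \<gamma>1 where "\<gamma>1 = max \<alpha> (c - r)"
  define \<gamma>2 where "\<gamma>2 = min \<beta> (c + r)"
  have ord: "\<alpha> \<le> \<gamma>1" "\<gamma>1 \<le> \<gamma>2" "\<gamma>2 \<le> \<beta>" "\<gamma>2 - \<gamma>1 \<le> 2 * r"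
    using c(1) r(1) by (auto simp: \<gamma>1_def \<gamma>2_def)
  have sub: "continuous_on {\<alpha>'..\<beta>'} \<phi>" "continuous_on {\<alpha>'..\<beta>'} q" if "\<alpha> \<le> \<alpha>'" "\<beta>' \<le> \<beta>" for \<alpha>' \<beta>'
    using that by (auto intro: continuous_on_subset[OF cont\<phi>] continuous_on_subset[OF q])
  have "norm (LINT \<xi>:{\<alpha>..\<gamma>1}|lborel. cis (\<phi> \<xi>)) \<le> 4 / sqrt m"
  proof (cases "\<alpha> \<le> c - r")
    case True
    then have g: "\<gamma>1 = c - r" by (simp add: \<gamma>1_def)
    show ?thesis
    proof (rule van_der_Corput_first[where p = p and q = q])
      fix \<xi> assume \<xi>: "\<xi> \<in> {\<alpha>..\<gamma>1}"
      then have "p \<xi> \<le> - (m * (c - \<xi>))" using r(1) by (intro c(3)) (auto simp: g)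
      also have "\<dots> \<le> - (m * r)" using \<xi> m(1) by (auto simp: g)
      finally show "sqrt m \<le> \<bar>p \<xi>\<bar>" using r(2) by simp
    qed (use ord \<phi> p q0 m(1) sub in auto)
  next
    case False
    then have "\<gamma>1 = \<alpha>" by (simp add: \<gamma>1_def)
    then show ?thesis using norm_set_integral_cis_le[of \<alpha> \<gamma>1 \<phi>] sub(1)[of \<alpha> \<gamma>1] ord m(1)
      by (intro order_trans[OF norm_set_integral_cis_le]) auto
  qed
  moreover have "norm (LINT \<xi>:{\<gamma>2..\<beta>}|lborel. cis (\<phi> \<xi>)) \<le> 4 / sqrt m"
  proof (cases "c + r \<le> \<beta>")
    case True
    then have g: "\<gamma>2 = c + r" by (simp add: \<gamma>2_def)
    show ?thesis
    proof (rule van_der_Corput_first[where p = p and q = q])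
      fix \<xi> assume \<xi>: "\<xi> \<in> {\<gamma>2..\<beta>}"
      have "m * r \<le> m * (\<xi> - c)" using \<xi> m(1) by (auto simp: g)
      also have "\<dots> \<le> p \<xi>" using \<xi> r(1) by (intro c(2)) (auto simp: g)
      finally show "sqrt m \<le> \<bar>p \<xi>\<bar>" using r(2) by simp
    qed (use ord \<phi> p q0 m(1) sub in auto)
  next
    case False
    then have "\<gamma>2 = \<beta>" by (simp add: \<gamma>2_def)
    then show ?thesis using sub(1)[of \<gamma>2 \<beta>] ord m(1)
      by (intro order_trans[OF norm_set_integral_cis_le]) auto
  qed
  moreover have "norm (LINT \<xi>:{\<gamma>1..\<gamma>2}|lborel. cis (\<phi> \<xi>)) \<le> 2 / sqrt m"
    using norm_set_integral_cis_le[of \<gamma>1 \<gamma>2 \<phi>] sub(1)[of \<gamma>1 \<gamma>2] ord by (simp add: r_def)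
  moreover have "(LINT \<xi>:{\<alpha>..\<beta>}|lborel. cis (\<phi> \<xi>)) = (LINT \<xi>:{\<alpha>..\<gamma>1}|lborel. cis (\<phi> \<xi>)) +
      ((LINT \<xi>:{\<gamma>1..\<gamma>2}|lborel. cis (\<phi> \<xi>)) + (LINT \<xi>:{\<gamma>2..\<beta>}|lborel. cis (\<phi> \<xi>)))"
    using ord sub(1) by (subst set_integral_split[of \<alpha> \<gamma>1 \<beta>], simp, simp, simp add: set_integrable_cis)
      (subst set_integral_split[of \<gamma>1 \<gamma>2 \<beta>], auto intro!: set_integrable_cis)
  ultimately have "norm (LINT \<xi>:{\<alpha>..\<beta>}|lborel. cis (\<phi> \<xi>)) \<le> 4 / sqrt m + (2 / sqrt m + 4 / sqrt m)"
    by (simp only:) (intro norm_triangle_mono)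
  then show ?thesis by (simp add: add_divide_distrib[symmetric])
qed

lemma van_der_Corput_second:
  assumes "\<alpha> \<le> \<beta>"
    and \<phi>: "\<And>\<xi>. \<xi> \<in> {\<alpha>..\<beta>} \<Longrightarrow> (\<phi> has_real_derivative p \<xi>) (at \<xi>)"
    and p: "\<And>\<xi>. \<xi> \<in> {\<alpha>..\<beta>} \<Longrightarrow> (p has_real_derivative q \<xi>) (at \<xi>)"
    and q: "continuous_on {\<alpha>..\<beta>} q"
    and m: "m > 0" "(\<forall>\<xi>\<in>{\<alpha>..\<beta>}. q \<xi> \<ge> m) \<or> (\<forall>\<xi>\<in>{\<alpha>..\<beta>}. q \<xi> \<le> - m)"
  shows "norm (LINT \<xi>:{\<alpha>..\<beta>}|lborel. cis (\<phi> \<xi>)) \<le> 10 / sqrt m"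
  using m(2)
proof
  assume "\<forall>\<xi>\<in>{\<alpha>..\<beta>}. q \<xi> \<ge> m"
  then show ?thesis using assms by (intro van_der_Corput_second_pos[where p = p and q = q]) auto
next
  assume *: "\<forall>\<xi>\<in>{\<alpha>..\<beta>}. q \<xi> \<le> - m"
  have "(LINT \<xi>:{\<alpha>..\<beta>}|lborel. cis (- \<phi> \<xi>)) = cnj (LINT \<xi>:{\<alpha>..\<beta>}|lborel. cis (\<phi> \<xi>))"
    unfolding set_lebesgue_integral_def by (subst Bochner_Integration.integral_cnj[symmetric]) (simp add: cis_cnj)
  moreover have "norm (LINT \<xi>:{\<alpha>..\<beta>}|lborel. cis (- \<phi> \<xi>)) \<le> 10 / sqrt m"
  proof (rule van_der_Corput_second_pos[where p = "\<lambda>\<xi>. - p \<xi>" and q = "\<lambda>\<xi>. - q \<xi>"])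
    fix \<xi> assume "\<xi> \<in> {\<alpha>..\<beta>}"
    then show "m \<le> - q \<xi>" using * by force
  qed (use assms in \<open>auto intro: DERIV_minus continuous_on_minus\<close>)
  ultimately show ?thesis by simp
qed

subsection \<open>The dyadic kernel\<close>

text \<open>If the slope contributed by t is at most half of |x|, the phase has no stationary point
  and the first derivative test applies. Otherwise |x| is at most 2 \<rho> L powr (a - 1), and since
  the symbol is a power, a large slope forces a second derivative of size at least a multiple of |x|
  / L.\<close>

lemma kernel_half_line_bound:
  fixes a :: real
  assumes a: "0 < a" "a < 1" and L: "1 \<le> L" "L \<le> U" "U \<le> 2 * L" and x: "x \<noteq> 0" and t: "\<bar>t\<bar> \<le> \<rho>"
    and e: "0 < e" "e \<le> 1"
  shows "norm (LINT \<xi>:{L..U}|lborel. cis (x * \<xi> + t * \<bar>\<xi>\<bar> powr a)) \<le>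
    8 * (L powr e * \<bar>x\<bar> powr (e - 1)) +
    30 / sqrt (1 - a) * (if \<bar>x\<bar> \<le> 2 * \<rho> * L powr (a - 1) then sqrt L * \<bar>x\<bar> powr (- 1 / 2) else 0)"
proof -
  define \<phi> where "\<phi> \<xi> = x * \<xi> + t * \<bar>\<xi>\<bar> powr a" for \<xi>
  define p where "p \<xi> = x + t * (a * \<xi> powr (a - 1))" for \<xi>
  define q where "q \<xi> = t * (a * ((a - 1) * \<xi> powr (a - 2)))" for \<xi>
  let ?A = "8 * (L powr e * \<bar>x\<bar> powr (e - 1))"
  let ?B = "30 / sqrt (1 - a) * (if \<bar>x\<bar> \<le> 2 * \<rho> * L powr (a - 1) then sqrt L * \<bar>x\<bar> powr (- 1 / 2) else 0)"
  have d\<phi>: "(\<phi> has_real_derivative p \<xi>) (at \<xi>)" if "\<xi> \<in> {L..U}" for \<xi>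
  proof -
    have "((\<lambda>\<xi>. x * \<xi> + t * \<xi> powr a) has_real_derivative p \<xi>) (at \<xi>)"
      unfolding p_def using that L by (auto intro!: derivative_eq_intros)
    then show ?thesis
      by (rule has_field_derivative_transform_within_open[of _ _ _ "{0<..}"])
         (use that L in \<open>auto simp: \<phi>_def\<close>)
  qed
  have dp: "(p has_real_derivative q \<xi>) (at \<xi>)" if "\<xi> \<in> {L..U}" for \<xi>
    unfolding p_def[abs_def] q_def using that L by (auto intro!: derivative_eq_intros)
  have cq: "continuous_on {L..U} q"
    unfolding q_def[abs_def] using L by (intro continuous_intros) auto
  have c\<phi>: "continuous_on {L..U} \<phi>"
    by (rule DERIV_continuous_on, rule has_field_derivative_at_within, erule d\<phi>)
  have B0: "?B \<ge> 0" using a L by auto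
  have A0: "?A \<ge> 0" by simp
  have "norm (LINT \<xi>:{L..U}|lborel. cis (\<phi> \<xi>)) \<le> ?A + ?B"
  proof (cases "\<bar>t\<bar> * a * L powr (a - 1) \<le> \<bar>x\<bar> / 2")
    case True
    have sgn: "(\<forall>\<xi>\<in>{L..U}. q \<xi> \<ge> 0) \<or> (\<forall>\<xi>\<in>{L..U}. q \<xi> \<le> 0)"
    proof (cases "t \<ge> 0")
      case True
      then have "q \<xi> \<le> 0" for \<xi> unfolding q_def using a by (intro mult_nonneg_nonpos mult_nonpos_nonneg) auto
      then show ?thesis by blast
    next
      case False
      then have "q \<xi> \<ge> 0" for \<xi> unfolding q_def using a by (intro mult_nonpos_nonpos mult_nonneg_nonpos mult_nonpos_nonneg) auto
      then show ?thesis by blast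
    qed
    have "norm (LINT \<xi>:{L..U}|lborel. cis (\<phi> \<xi>)) \<le> 4 / (\<bar>x\<bar> / 2)"
    proof (rule van_der_Corput_first[OF L(2) d\<phi> dp cq _ _ sgn])
      fix \<xi> assume \<xi>: "\<xi> \<in> {L..U}"
      have "\<xi> powr (a - 1) \<le> L powr (a - 1)" using \<xi> L a by (intro powr_mono2') auto
      then have "\<bar>t\<bar> * a * \<xi> powr (a - 1) \<le> \<bar>t\<bar> * a * L powr (a - 1)" using a by (intro mult_left_mono) auto
      then have "\<bar>t * (a * \<xi> powr (a - 1))\<bar> \<le> \<bar>x\<bar> / 2" using True a by (simp add: abs_mult mult.assoc)
      then show "\<bar>x\<bar> / 2 \<le> \<bar>p \<xi>\<bar>" unfolding p_def by linarith
    qed (use x in auto)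
    then have 1: "norm (LINT \<xi>:{L..U}|lborel. cis (\<phi> \<xi>)) \<le> 8 / \<bar>x\<bar>" by simp
    have 2: "norm (LINT \<xi>:{L..U}|lborel. cis (\<phi> \<xi>)) \<le> L"
      using norm_set_integral_cis_le[OF L(2) c\<phi>] L by simp
    define X where "X = norm (LINT \<xi>:{L..U}|lborel. cis (\<phi> \<xi>))"
    have "X \<le> ?A"
    proof (cases "X = 0")
      case False
      then have X: "X > 0" by (simp add: X_def)
      \<comment> \<open>The bounds X <= L and X <= 8/|x| are interpolated geometrically: |x| powr (e
        - 1) is integrable at 0, at the price of an arbitrarily small power of L.\<close>
      have "X = X powr e * X powr (1 - e)" using X by (simp flip: powr_add)
      also have "\<dots> \<le> L powr e * (8 / \<bar>x\<bar>) powr (1 - e)"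
        using 1 2 X e by (intro mult_mono powr_mono2) (auto simp: X_def)
      also have "(8 / \<bar>x\<bar>) powr (1 - e) = 8 powr (1 - e) * \<bar>x\<bar> powr (e - 1)"
        using x by (simp add: powr_divide powr_minus_divide[symmetric] divide_powr_uminus)
      also have "L powr e * (8 powr (1 - e) * \<bar>x\<bar> powr (e - 1)) \<le> L powr e * (8 powr 1 * \<bar>x\<bar> powr (e - 1))"
        using e by (intro mult_left_mono mult_right_mono powr_mono) auto
      finally show ?thesis by simp
    qed simp
    then show ?thesis using B0 by (simp add: X_def)
  next
    case False
    have t0: "\<bar>t\<bar> > 0" using False by (cases "t = 0") auto
    have "\<bar>x\<bar> < 2 * (\<bar>t\<bar> * a * L powr (a - 1))" using False by simp
    also have "\<dots> \<le> 2 * (\<rho> * 1 * L powr (a - 1))" using t a by (intro mult_left_mono mult_right_mono mult_mono) auto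
    finally have xr: "\<bar>x\<bar> \<le> 2 * \<rho> * L powr (a - 1)" by simp
    \<comment> \<open>The factor 8 is 2 * 4: one half from the negated case condition, and 2 powr (a
      - 2) >= 1/4 for comparing \<xi> <= 2L with L.\<close>
    define m where "m = (1 - a) * \<bar>x\<bar> / (8 * L)"
    have m0: "m > 0" using a x L by (simp add: m_def)
    have qm: "\<bar>q \<xi>\<bar> \<ge> m" if \<xi>: "\<xi> \<in> {L..U}" for \<xi>
    proof -
      have "m = (1 - a) * (\<bar>x\<bar> / 2) * (1 / (4 * L))" by (simp add: m_def)
      also have "\<dots> \<le> (1 - a) * (\<bar>t\<bar> * a * L powr (a - 1)) * (1 / (4 * L))"
        using False a L by (intro mult_right_mono mult_left_mono) auto
      also have "\<dots> = (1 - a) * \<bar>t\<bar> * a * (L powr (a - 2) * (1 / 4))"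
      proof -
        have "L powr (a - 1) = L powr (a - 2) * L" using L powr_add[of L "a - 2" 1] by simp
        then show ?thesis using L by simp
      qed
      also have "\<dots> \<le> (1 - a) * \<bar>t\<bar> * a * \<xi> powr (a - 2)"
      proof -
        have "L powr (a - 2) * (1 / 4) \<le> L powr (a - 2) * 2 powr (a - 2)"
          using a powr_mono[of "-2" "a - 2" "2::real"] by (intro mult_left_mono) (auto simp: powr_minus)
        also have "\<dots> = (2 * L) powr (a - 2)" using L by (simp add: powr_mult mult.commute)
        also have "\<dots> \<le> \<xi> powr (a - 2)" using \<xi> L a by (intro powr_mono2') auto
        finally show ?thesis using a by (intro mult_left_mono) auto
      qed
      also have "\<dots> = \<bar>q \<xi>\<bar>" using a by (simp add: q_def abs_mult mult_ac)
      finally show ?thesis .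
    qed
    have sgn: "(\<forall>\<xi>\<in>{L..U}. q \<xi> \<ge> m) \<or> (\<forall>\<xi>\<in>{L..U}. q \<xi> \<le> - m)"
    proof (cases "t \<ge> 0")
      case True
      then have "q \<xi> \<le> 0" for \<xi> unfolding q_def using a by (intro mult_nonneg_nonpos mult_nonpos_nonneg) auto
      then have "q \<xi> \<le> - m" if "\<xi> \<in> {L..U}" for \<xi>
        using qm[OF that] \<open>\<And>\<xi>. q \<xi> \<le> 0\<close>[of \<xi>] by simp
      then show ?thesis by blast
    next
      case False
      then have "q \<xi> \<ge> 0" for \<xi> unfolding q_def using a by (intro mult_nonpos_nonpos mult_nonneg_nonpos mult_nonpos_nonneg) auto
      then show ?thesis using qm by auto
    qed
    have "norm (LINT \<xi>:{L..U}|lborel. cis (\<phi> \<xi>)) \<le> 10 / sqrt m"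
      by (rule van_der_Corput_second[OF L(2) d\<phi> dp cq m0 sgn])
    also have "\<dots> = 10 * sqrt 8 / sqrt (1 - a) * (sqrt L * \<bar>x\<bar> powr (- 1 / 2))"
    proof -
      have "sqrt m = sqrt (1 - a) * sqrt \<bar>x\<bar> / (sqrt 8 * sqrt L)"
        by (simp only: m_def real_sqrt_divide real_sqrt_mult)
      moreover have "\<bar>x\<bar> powr (- 1 / 2) = 1 / sqrt \<bar>x\<bar>"
        using powr_minus_divide[of "\<bar>x\<bar>" "1 / 2"] by (simp add: powr_half_sqrt)
      ultimately show ?thesis by (simp only:) simp
    qed
    also have "\<dots> \<le> 30 / sqrt (1 - a) * (sqrt L * \<bar>x\<bar> powr (- 1 / 2))"
    proof -
      have "sqrt 8 \<le> (3::real)" by (rule real_le_lsqrt) auto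
      then show ?thesis using a L by (intro mult_right_mono divide_right_mono) auto
    qed
    also have "\<dots> = ?B" using xr by simp
    also have "\<dots> \<le> ?A + ?B" using A0 by linarith
    finally show ?thesis .
  qed
  then show ?thesis by (simp add: \<phi>_def)
qed

lemma borel_measurable_cnj [measurable (raw)]:
  assumes "f \<in> borel_measurable M"
  shows "(\<lambda>x. cnj (f x)) \<in> borel_measurable M"
  by (rule measurable_compose[OF assms borel_measurable_continuous_onI]) (intro continuous_intros)

lemma set_integral_abs_powr:
  fixes c p :: real
  assumes "p > - 1" "c \<ge> 0"
  shows "set_integrable lborel {- c..c} (\<lambda>x. \<bar>x\<bar> powr p)"
    and "(LINT x:{- c..c}|lborel. \<bar>x\<bar> powr p) = 2 * (c powr (p + 1) / (p + 1))"
proof -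
  let ?I = "c powr (p + 1) / (p + 1)"
  let ?f = "\<lambda>x. indicator {0..c} x * \<bar>x\<bar> powr p :: real"
  have I0: "?I \<ge> 0" using assms by simp
  have "((\<lambda>x. \<bar>x\<bar> powr p) has_integral ?I) {0..c}"
    by (rule has_integral_eq[OF _ has_integral_powr_from_0[OF assms]]) auto
  then have "((\<lambda>x. if x \<in> {0..c} then \<bar>x\<bar> powr p else 0) has_integral ?I) UNIV"
    by (simp only: has_integral_restrict_UNIV)
  moreover have "(\<lambda>x. if x \<in> {0..c} then \<bar>x\<bar> powr p else 0) = ?f" by (auto simp: indicator_def)
  ultimately have "(?f has_integral ?I) UNIV" by simp
  then have nn: "(\<integral>\<^sup>+x. ennreal (?f x) \<partial>lborel) = ennreal ?I"
    by (intro nn_integral_has_integral_lborel) auto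
  have i1: "integrable lborel ?f"
    by (rule integrableI_nonneg) (auto simp: nn)
  have v1: "(LINT x|lborel. ?f x) = ?I"
    by (rule integral_eq_nn_integral[THEN trans]) (auto simp: nn I0)
  have i2: "integrable lborel (\<lambda>x. ?f (0 + (- 1) * x))"
    by (intro lborel_integrable_real_affine i1) simp
  have v2: "(LINT x|lborel. ?f (0 + (- 1) * x)) = ?I"
    using lborel_integral_real_affine[of "- 1" ?f 0] v1 by simp
  have AE: "AE x in lborel. indicator {- c..c} x *\<^sub>R \<bar>x\<bar> powr p = ?f x + ?f (0 + (- 1) * x)"
    using AE_lborel_singleton[of 0] by eventually_elim (auto simp: indicator_def)
  show "set_integrable lborel {- c..c} (\<lambda>x. \<bar>x\<bar> powr p)"
    unfolding set_integrable_def
    by (subst integrable_cong_AE[OF _ _ AE]) (use i1 i2 in \<open>auto intro!: Bochner_Integration.integrable_add\<close>)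
  have "(LINT x:{- c..c}|lborel. \<bar>x\<bar> powr p) = (LINT x|lborel. ?f x + ?f (0 + (- 1) * x))"
    unfolding set_lebesgue_integral_def by (rule integral_cong_AE[OF _ _ AE]) measurable
  also have "\<dots> = ?I + ?I" using i1 i2 v1 v2 by (subst Bochner_Integration.integral_add) auto
  finally show "(LINT x:{- c..c}|lborel. \<bar>x\<bar> powr p) = 2 * ?I" by simp
qed

text \<open>Up to a factor 2, a majorant in x - y of the kernel of \<open>TT*\<close> on one shell.
  The first term is the nonstationary part; the second lives where a stationary point may
  occur.\<close>

definition dyadic_kernel :: "real \<Rightarrow> real \<Rightarrow> real \<Rightarrow> real \<Rightarrow> real \<Rightarrow> real" where
  "dyadic_kernel a e L \<rho> x = 8 * (L powr e * \<bar>x\<bar> powr (e - 1)) +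
    30 / sqrt (1 - a) * (if \<bar>x\<bar> \<le> 2 * \<rho> * L powr (a - 1) then sqrt L * \<bar>x\<bar> powr (- 1 / 2) else 0)"

lemma dyadic_kernel_minus: "dyadic_kernel a e L \<rho> (- x) = dyadic_kernel a e L \<rho> x"
  by (simp add: dyadic_kernel_def)

lemma dyadic_kernel_nonneg: "a < 1 \<Longrightarrow> 0 \<le> L \<Longrightarrow> 0 \<le> dyadic_kernel a e L \<rho> x"
  by (simp add: dyadic_kernel_def)

lemma borel_measurable_dyadic_kernel [measurable]: "dyadic_kernel a e L \<rho> \<in> borel_measurable borel"
  unfolding dyadic_kernel_def by measurable

text \<open>The negative half of the shell is the positive half with x replaced by -x, hence the
  factor 2. The upper end U is free because truncations cut through the shell; it may even lie below
  L, where the integral is 0.\<close>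

lemma dyadic_kernel_bound:
  assumes a: "0 < a" "a < 1" and L: "1 \<le> L" "U \<le> 2 * L" and x: "x \<noteq> 0" and t: "\<bar>t\<bar> \<le> \<rho>"
    and e: "0 < e" "e \<le> 1"
  shows "norm (LINT \<xi>|lborel. (if L \<le> \<bar>\<xi>\<bar> \<and> \<bar>\<xi>\<bar> \<le> U then cis (x * \<xi> + t * \<bar>\<xi>\<bar> powr a) else 0))
    \<le> 2 * dyadic_kernel a e L \<rho> x"
proof (cases "L \<le> U")
  case False
  then have "(\<lambda>\<xi>::real. if L \<le> \<bar>\<xi>\<bar> \<and> \<bar>\<xi>\<bar> \<le> U then cis (x * \<xi> + t * \<bar>\<xi>\<bar> powr a) else 0) = (\<lambda>\<xi>. 0)"
    by (auto simp: fun_eq_iff)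
  then show ?thesis using dyadic_kernel_nonneg[of a L e \<rho> x] a L by simp
next
  case True
  let ?g = "\<lambda>x \<xi>. indicator {L..U} \<xi> *\<^sub>R cis (x * \<xi> + t * \<bar>\<xi>\<bar> powr a)"
  have i: "integrable lborel (?g x)" for x
  proof -
    have "continuous_on {L..U} (\<lambda>\<xi>. x * \<xi> + t * \<bar>\<xi>\<bar> powr a)"
      using L by (intro continuous_intros) auto
    then show ?thesis using set_integrable_cis unfolding set_integrable_def by blast
  qed
  have i2: "integrable lborel (\<lambda>\<xi>. ?g (- x) (0 + (- 1) * \<xi>))"
    by (intro lborel_integrable_real_affine i) simp
  have "(if L \<le> \<bar>\<xi>\<bar> \<and> \<bar>\<xi>\<bar> \<le> U then cis (x * \<xi> + t * \<bar>\<xi>\<bar> powr a) else 0) =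
      ?g x \<xi> + ?g (- x) (0 + (- 1) * \<xi>)" for \<xi>
    using L by (auto simp: indicator_def)
  then have "(LINT \<xi>|lborel. (if L \<le> \<bar>\<xi>\<bar> \<and> \<bar>\<xi>\<bar> \<le> U then cis (x * \<xi> + t * \<bar>\<xi>\<bar> powr a) else 0)) =
      (LINT \<xi>|lborel. ?g x \<xi>) + (LINT \<xi>|lborel. ?g (- x) (0 + (- 1) * \<xi>))"
    using i i2 by (simp only: Bochner_Integration.integral_add)
  also have "(LINT \<xi>|lborel. ?g (- x) (0 + (- 1) * \<xi>)) = (LINT \<xi>|lborel. ?g (- x) \<xi>)"
    using lborel_integral_real_affine[of "- 1" "?g (- x)" 0] by simp
  also have "norm ((LINT \<xi>|lborel. ?g x \<xi>) + (LINT \<xi>|lborel. ?g (- x) \<xi>)) \<le> dyadic_kernel a e L \<rho> x + dyadic_kernel a e L \<rho> (- x)"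
    using kernel_half_line_bound[OF a L(1) True L(2) _ t e, of x] kernel_half_line_bound[OF a L(1) True L(2) _ t e, of "- x"] x
    unfolding dyadic_kernel_def set_lebesgue_integral_def by (intro norm_triangle_mono) auto
  finally show ?thesis by (simp add: dyadic_kernel_minus)
qed

text \<open>The singularity |x| powr (- 1/2) up to R = 2 \<rho> L powr (a - 1) has mass 4 sqrt R,
  and sqrt L * sqrt R is a multiple of sqrt (\<rho> L powr a). The constant is uniform in L and
  \<rho>.\<close>

lemma integral_dyadic_kernel:
  assumes a: "0 < a" "a < 1" and e: "0 < e" "e \<le> 1" and c: "0 \<le> c"
  obtains C where "C > 0"
    "\<And>L \<rho>. 1 \<le> L \<Longrightarrow> 0 \<le> \<rho> \<Longrightarrow> set_integrable lborel {- c..c} (dyadic_kernel a e L \<rho>)"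
    "\<And>L \<rho>. 1 \<le> L \<Longrightarrow> 0 \<le> \<rho> \<Longrightarrow> (LINT x:{- c..c}|lborel. dyadic_kernel a e L \<rho> x) \<le> C * (L powr e + sqrt (\<rho> * L powr a))"
proof -
  define C1 where "C1 = 8 * (2 * (c powr e / e))"
  define C2 where "C2 = 30 / sqrt (1 - a) * (4 * sqrt 2)"
  have C: "C1 \<ge> 0" "C2 > 0" using e a c by (auto simp: C1_def C2_def)
  have "set_integrable lborel {- c..c} (dyadic_kernel a e L \<rho>) \<and>
    (LINT x:{- c..c}|lborel. dyadic_kernel a e L \<rho> x) \<le> (C1 + C2) * (L powr e + sqrt (\<rho> * L powr a))"
    if L: "1 \<le> L" and \<rho>: "0 \<le> \<rho>" for L \<rho>
  proof -
    define R where "R = 2 * \<rho> * L powr (a - 1)"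
    have R: "R \<ge> 0" using \<rho> by (simp add: R_def)
    let ?g = "\<lambda>x. if \<bar>x\<bar> \<le> R then \<bar>x\<bar> powr (- 1 / 2) else 0 :: real"
    have g_eq: "?g = (\<lambda>x. indicator {- R..R} x *\<^sub>R \<bar>x\<bar> powr (- 1 / 2))"
      by (auto simp: indicator_def fun_eq_iff abs_le_iff)
    have gi: "integrable lborel ?g"
      unfolding g_eq using set_integral_abs_powr(1)[of "- 1 / 2" R] R by (simp add: set_integrable_def)
    have gv: "(LINT x|lborel. ?g x) = 4 * sqrt R"
      unfolding g_eq using set_integral_abs_powr(2)[of "- 1 / 2" R] R
      by (simp add: set_lebesgue_integral_def powr_half_sqrt)
    have gs: "set_integrable lborel {- c..c} ?g"
      unfolding set_integrable_def by (rule integrable_mult_indicator[OF _ gi]) simp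
    have gle: "(LINT x:{- c..c}|lborel. ?g x) \<le> 4 * sqrt R"
      unfolding gv[symmetric] set_lebesgue_integral_def
      by (rule integral_mono[OF integrable_mult_indicator[OF _ gi] gi]) (auto simp: indicator_def)
    have fs: "set_integrable lborel {- c..c} (\<lambda>x. \<bar>x\<bar> powr (e - 1))"
      and fv: "(LINT x:{- c..c}|lborel. \<bar>x\<bar> powr (e - 1)) = 2 * (c powr e / e)"
      using set_integral_abs_powr[of "e - 1" c] e c by auto
    have K: "dyadic_kernel a e L \<rho> = (\<lambda>x. 8 * L powr e * \<bar>x\<bar> powr (e - 1) + 30 / sqrt (1 - a) * sqrt L * ?g x)"
      by (auto simp: dyadic_kernel_def R_def fun_eq_iff)
    have s1: "set_integrable lborel {- c..c} (\<lambda>x. 8 * L powr e * \<bar>x\<bar> powr (e - 1))"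
      and s2: "set_integrable lborel {- c..c} (\<lambda>x. 30 / sqrt (1 - a) * sqrt L * ?g x)"
      by (intro set_integrable_mult_right fs gs)+
    have int: "set_integrable lborel {- c..c} (dyadic_kernel a e L \<rho>)"
      unfolding K by (intro set_integral_add(1) s1 s2)
    have "(LINT x:{- c..c}|lborel. dyadic_kernel a e L \<rho> x) = 8 * L powr e * (2 * (c powr e / e)) + 30 / sqrt (1 - a) * sqrt L * (LINT x:{- c..c}|lborel. ?g x)"
      unfolding K set_integral_add(2)[OF s1 s2] by (simp only: set_integral_mult_right fv)
    also have "\<dots> \<le> 8 * L powr e * (2 * (c powr e / e)) + 30 / sqrt (1 - a) * sqrt L * (4 * sqrt R)"
      using a L by (intro add_left_mono mult_left_mono gle) auto
    also have "\<dots> = C1 * L powr e + C2 * sqrt (\<rho> * L powr a)"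
    proof -
      have "L * R = 2 * (\<rho> * L powr a)"
        using L powr_add[of L "a - 1" 1] by (simp add: R_def)
      then have "sqrt L * sqrt R = sqrt 2 * sqrt (\<rho> * L powr a)" by (simp flip: real_sqrt_mult)
      then have "30 / sqrt (1 - a) * sqrt L * (4 * sqrt R) = 30 / sqrt (1 - a) * (4 * (sqrt 2 * sqrt (\<rho> * L powr a)))"
        by (metis mult.assoc mult.left_commute)
      then show ?thesis by (simp only: C1_def C2_def mult_ac)
    qed
    also have "\<dots> \<le> (C1 + C2) * (L powr e + sqrt (\<rho> * L powr a))"
      using C \<rho> by (simp add: algebra_simps)
    finally show ?thesis using int by blast
  qed
  then show ?thesis using that[of "C1 + C2"] C by auto
qed

subsection \<open>The maximal estimate\<close>

text \<open>Arithmetic-geometric mean with a free weight c, then c = sqrt B / sqrt A. If A or B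
  vanishes, letting c depend on X forces X = 0.\<close>

lemma integral_Cauchy_Schwarz:
  fixes f g :: "real \<Rightarrow> complex"
  assumes [measurable]: "f \<in> borel_measurable lborel" "g \<in> borel_measurable lborel"
    and f: "integrable lborel (\<lambda>x. (norm (f x))\<^sup>2)" and g: "integrable lborel (\<lambda>x. (norm (g x))\<^sup>2)"
  shows "norm (LINT x|lborel. f x * g x) \<le> sqrt (LINT x|lborel. (norm (f x))\<^sup>2) * sqrt (LINT x|lborel. (norm (g x))\<^sup>2)"
proof -
  define A where "A = (LINT x|lborel. (norm (f x))\<^sup>2)"
  define B where "B = (LINT x|lborel. (norm (g x))\<^sup>2)"
  define X where "X = norm (LINT x|lborel. f x * g x)"
  have nn: "A \<ge> 0" "B \<ge> 0" "X \<ge> 0" by (auto simp: A_def B_def X_def)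
  have le: "X \<le> c / 2 * A + 1 / (2 * c) * B" if "c > 0" for c
  proof -
    have "X \<le> (LINT x|lborel. c / 2 * (norm (f x))\<^sup>2 + 1 / (2 * c) * (norm (g x))\<^sup>2)"
      unfolding X_def
    proof (rule Bochner_Integration.integral_norm_bound_integral)
      show "integrable lborel (\<lambda>x. f x * g x)" by (rule integrable_mult_L2) (use f g in auto)
      show "integrable lborel (\<lambda>x. c / 2 * (norm (f x))\<^sup>2 + 1 / (2 * c) * (norm (g x))\<^sup>2)"
        by (intro Bochner_Integration.integrable_add integrable_mult_right f g)
      fix x
      have "0 \<le> (c * norm (f x) - norm (g x))\<^sup>2 / (2 * c)" using that by simp
      also have "\<dots> = c / 2 * (norm (f x))\<^sup>2 + 1 / (2 * c) * (norm (g x))\<^sup>2 - norm (f x) * norm (g x)"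
        using that by (simp add: power2_eq_square field_simps)
      finally show "norm (f x * g x) \<le> c / 2 * (norm (f x))\<^sup>2 + 1 / (2 * c) * (norm (g x))\<^sup>2"
        by (simp add: norm_mult)
    qed
    also have "\<dots> = c / 2 * A + 1 / (2 * c) * B"
      using f g by (simp add: A_def B_def)
    finally show ?thesis .
  qed
  have "X \<le> sqrt A * sqrt B"
  proof (cases "X = 0")
    case False
    then have X: "X > 0" using nn by simp
    have "A \<noteq> 0"
    proof
      assume "A = 0"
      \<comment> \<open>With A = 0 only the second term is left, and this c makes it smaller than X
        / 2.\<close>
      then have "X \<le> B * X / (2 * (B + 1))" using le[of "(B + 1) / X"] X nn by (simp add: field_simps)
      then have "X * (2 * (B + 1)) \<le> B * X" using nn by (simp add: pos_le_divide_eq)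
      then have "X * (B + 2) \<le> 0" by (simp add: algebra_simps)
      then show False using X nn by (simp add: mult_le_0_iff)
    qed
    moreover have "B \<noteq> 0"
    proof
      assume "B = 0"
      then have "X \<le> X / (A + 1) / 2 * A" using le[of "X / (A + 1)"] X nn by simp
      then have "X * (2 * (A + 1)) \<le> A * X" using nn by (simp add: field_simps)
      then have "X * (A + 2) \<le> 0" by (simp add: algebra_simps)
      then show False using X nn by (simp add: mult_le_0_iff)
    qed
    ultimately have pos: "sqrt A > 0" "sqrt B > 0" using nn by auto
    have "X \<le> (sqrt B / sqrt A) / 2 * (sqrt A * sqrt A) + 1 / (2 * (sqrt B / sqrt A)) * (sqrt B * sqrt B)"
      using le[of "sqrt B / sqrt A"] pos nn by simp
    also have "\<dots> = sqrt A * sqrt B" using pos by (simp add: field_simps)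
    finally show ?thesis .
  qed (use nn in simp)
  then show ?thesis by (simp add: A_def B_def X_def)
qed

text \<open>The \<open>TT*\<close> argument: the square of the norm of the adjoint is an integral of the kernel
  of \<open>TT*\<close>, and only the trivial bound on the dual function is used.\<close>

lemma TTstar_bound:
  fixes E :: "real \<Rightarrow> real \<Rightarrow> complex"
  assumes E: "(\<lambda>p. E (fst p) (snd p)) \<in> borel_measurable (lborel \<Otimes>\<^sub>M lborel)"
    and E1: "\<And>x \<xi>. norm (E x \<xi>) \<le> 1"
    and suppx: "\<And>x \<xi>. x \<notin> {- b..b} \<Longrightarrow> E x \<xi> = 0"
    and supp\<xi>: "\<And>x \<xi>. \<xi> \<notin> {- K..K} \<Longrightarrow> E x \<xi> = 0"
    and h[measurable]: "h \<in> borel_measurable borel" and hL2: "integrable lborel (\<lambda>\<xi>. (norm (h \<xi>))\<^sup>2)"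
    and kernel: "\<And>x y. x \<noteq> y \<Longrightarrow> norm (LINT \<xi>|lborel. E x \<xi> * cnj (E y \<xi>)) \<le> G (x - y)"
    and G: "set_integrable lborel {- (2 * b)..2 * b} G" "\<And>x. 0 \<le> G x" "G \<in> borel_measurable borel"
    and b: "b > 0"
  shows "norm (LINT x|lborel. LINT \<xi>|lborel. E x \<xi> * h \<xi>) \<le>
    sqrt (2 * b * (LINT x:{- (2 * b)..2 * b}|lborel. G x)) * sqrt (LINT \<xi>|lborel. (norm (h \<xi>))\<^sup>2)"
proof -
  note [measurable] = G(3)
  have Em[measurable (raw)]: "(\<lambda>w. E (f w) (g w)) \<in> borel_measurable M"
    if "f \<in> borel_measurable M" "g \<in> borel_measurable M" for f g and M :: "'z measure"
    using measurable_compose[OF measurable_Pair[of f M lborel g lborel] E] that by simp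
  \<comment> \<open>B and J repeat the supports of E as integrable factors, since
    \<open>Fubini_kernel\<close> exchanges integrals against integrable functions.\<close>
  define B :: "real \<Rightarrow> complex" where "B x = indicator {- b..b} x" for x
  define J :: "real \<Rightarrow> complex" where "J \<xi> = indicator {- K..K} \<xi>" for \<xi>
  have [measurable]: "B \<in> borel_measurable borel" "J \<in> borel_measurable borel"
    unfolding B_def[abs_def] J_def[abs_def] by measurable
  define I where "I = (LINT x:{- (2 * b)..2 * b}|lborel. G x)"
  have ind: "integrable lborel (\<lambda>x. indicator {- c..c} x :: complex)" for c :: real
  proof -
    have "integrable lborel (\<lambda>x. complex_of_real (indicator {- c..c} x))"
      using emeasure_lborel_Icc_eq[of "- c" c]
      by (intro integrable_of_real integrable_real_indicator) (auto split: if_splits)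
    then show ?thesis by (simp add: of_real_indicator)
  qed
  have Bi: "integrable lborel B" unfolding B_def[abs_def] by (rule ind)
  have EB: "E x \<xi> * B x = E x \<xi>" for x \<xi> using suppx[of x \<xi>] by (auto simp: B_def indicator_def)
  have EJ: "E x \<xi> * J \<xi> = E x \<xi>" for x \<xi> using supp\<xi>[of \<xi> x] by (auto simp: J_def indicator_def)
  define T where "T \<xi> = (LINT x|lborel. E x \<xi>)" for \<xi>
  have Tm[measurable]: "T \<in> borel_measurable borel"
    unfolding T_def[abs_def] by measurable
  have Tle: "norm (T \<xi>) \<le> 2 * b" for \<xi>
  proof -
    have "norm (T \<xi>) \<le> (LINT x|lborel. norm (B x))"
      unfolding T_def
    proof (rule Bochner_Integration.integral_norm_bound_integral)
      show "integrable lborel (\<lambda>x. E x \<xi>)"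
        by (rule Bochner_Integration.integrable_bound[OF Bi])
           (use E1 suppx in \<open>auto simp: B_def indicator_def\<close>)
      show "norm (E x \<xi>) \<le> norm (B x)" for x using E1 suppx by (auto simp: B_def indicator_def)
    qed (intro integrable_norm Bi)
    also have "(LINT x|lborel. norm (B x)) = (LINT x|lborel. indicator {- b..b} x)"
      by (intro Bochner_Integration.integral_cong) (auto simp: B_def indicator_def)
    also have "\<dots> = 2 * b" using b by simp
    finally show ?thesis .
  qed
  have T0: "T \<xi> = 0" if "\<xi> \<notin> {- K..K}" for \<xi> using supp\<xi>[OF that] by (simp add: T_def)
  have TL2: "integrable lborel (\<lambda>\<xi>. (norm (T \<xi>))\<^sup>2)"
  proof (rule Bochner_Integration.integrable_bound)
    show "integrable lborel (\<lambda>\<xi>. (2 * b)\<^sup>2 * (norm (J \<xi>)))"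
      unfolding J_def[abs_def] by (intro integrable_mult_right integrable_norm ind)
    have "(norm (T \<xi>))\<^sup>2 \<le> (2 * b)\<^sup>2 * norm (J \<xi>)" for \<xi>
      using T0[of \<xi>] power_mono[OF Tle norm_ge_zero, of \<xi> 2] by (auto simp: J_def indicator_def)
    then show "AE \<xi> in lborel. norm ((norm (T \<xi>))\<^sup>2) \<le> norm ((2 * b)\<^sup>2 * norm (J \<xi>))"
      by (intro AE_I2) simp
  qed measurable
  have hJ: "integrable lborel (\<lambda>\<xi>. h \<xi> * J \<xi>)"
    using L2_locally_integrable[OF h hL2, of K]
    by (simp add: set_integrable_def J_def scaleR_conv_of_real of_real_indicator mult.commute)
  \<comment> \<open>Duality: the double integral pairs h with T, the transpose applied to the
    constant 1 on the window.\<close>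
  have "(LINT x|lborel. LINT \<xi>|lborel. E x \<xi> * h \<xi>) = (LINT x|lborel. B x * (LINT \<xi>|lborel. E x \<xi> * (h \<xi> * J \<xi>)))"
  proof (intro Bochner_Integration.integral_cong refl)
    fix x
    have "E x \<xi> * (h \<xi> * J \<xi>) = E x \<xi> * h \<xi>" for \<xi> using EJ[of x \<xi>] by (metis mult.assoc mult.commute)
    then have eq: "(\<lambda>\<xi>. E x \<xi> * (h \<xi> * J \<xi>)) = (\<lambda>\<xi>. E x \<xi> * h \<xi>)" by blast
    show "(LINT \<xi>|lborel. E x \<xi> * h \<xi>) = B x * (LINT \<xi>|lborel. E x \<xi> * (h \<xi> * J \<xi>))"
      unfolding eq using suppx[of x] by (cases "x \<in> {- b..b}") (simp_all add: B_def)
  qed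
  also have "\<dots> = (LINT \<xi>|lborel. h \<xi> * J \<xi> * (LINT x|lborel. E x \<xi> * B x))"
    by (rule Fubini_kernel[OF Bi hJ E E1])
  also have "\<dots> = (LINT \<xi>|lborel. h \<xi> * T \<xi>)"
    unfolding EB T_def[symmetric]
    by (intro Bochner_Integration.integral_cong) (use T0 in \<open>auto simp: J_def indicator_def\<close>)
  finally have eq: "(LINT x|lborel. LINT \<xi>|lborel. E x \<xi> * h \<xi>) = (LINT \<xi>|lborel. h \<xi> * T \<xi>)" .
  have TJi: "integrable lborel (\<lambda>\<xi>. J \<xi> * cnj (T \<xi>))"
  proof (rule Bochner_Integration.integrable_bound)
    show "integrable lborel (\<lambda>\<xi>. 2 * b * norm (J \<xi>))"
      unfolding J_def[abs_def] by (intro integrable_mult_right integrable_norm ind)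
    show "AE \<xi> in lborel. norm (J \<xi> * cnj (T \<xi>)) \<le> norm (2 * b * norm (J \<xi>))"
      using Tle b by (intro AE_I2) (auto simp: norm_mult J_def indicator_def)
  qed measurable
  \<comment> \<open>Expanding the conjugate of T produces the kernel of \<open>TT*\<close>. It is
    bounded only off the diagonal, which is a null set for fixed x, and x - y stays within 2b
    because both points lie in the window.\<close>
  have inner: "norm (LINT \<xi>|lborel. E x \<xi> * (J \<xi> * cnj (T \<xi>))) \<le> I" if x: "x \<in> {- b..b}" for x
  proof -
    have EJi: "integrable lborel (\<lambda>\<xi>. E x \<xi> * J \<xi>)"
      by (rule Bochner_Integration.integrable_bound[OF ind[of K]])
         (use E1 in \<open>auto simp: J_def indicator_def\<close>)
    have "(LINT \<xi>|lborel. E x \<xi> * (J \<xi> * cnj (T \<xi>))) = (LINT \<xi>|lborel. (E x \<xi> * J \<xi>) * (LINT y|lborel. cnj (E y \<xi>) * B y))"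
    proof (intro Bochner_Integration.integral_cong refl)
      fix \<xi>
      have "cnj (E y \<xi>) * B y = cnj (E y \<xi>)" for y using suppx[of y \<xi>] by (auto simp: B_def indicator_def)
      then have eq: "(\<lambda>y. cnj (E y \<xi>) * B y) = (\<lambda>y. cnj (E y \<xi>))" by blast
      have "(LINT y|lborel. cnj (E y \<xi>) * B y) = cnj (T \<xi>)" unfolding eq by (simp add: T_def)
      then show "E x \<xi> * (J \<xi> * cnj (T \<xi>)) = (E x \<xi> * J \<xi>) * (LINT y|lborel. cnj (E y \<xi>) * B y)"
        by (simp add: mult.assoc)
    qed
    also have "\<dots> = (LINT y|lborel. B y * (LINT \<xi>|lborel. cnj (E y \<xi>) * (E x \<xi> * J \<xi>)))"
      by (rule Fubini_kernel[OF EJi Bi]) (use E1 in auto)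
    also have "\<dots> = (LINT y|lborel. B y * (LINT \<xi>|lborel. E x \<xi> * cnj (E y \<xi>)))"
      unfolding EJ by (simp add: mult.commute)
    also have "norm \<dots> \<le> (LINT y|lborel. indicator {- (2 * b)..2 * b} (x + (- 1) * y) *\<^sub>R G (x + (- 1) * y))"
    proof (rule integral_norm_bound[THEN order_trans], rule integral_mono_AE)
      show "integrable lborel (\<lambda>y. indicator {- (2 * b)..2 * b} (x + (- 1) * y) *\<^sub>R G (x + (- 1) * y))"
        using G(1) unfolding set_integrable_def by (rule lborel_integrable_real_affine) simp
      have le: "norm (B y * (LINT \<xi>|lborel. E x \<xi> * cnj (E y \<xi>))) \<le> indicator {- (2 * b)..2 * b} (x + (- 1) * y) *\<^sub>R G (x + (- 1) * y)"
        if "y \<noteq> x" for y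
        using kernel[of x y] x that G(2)[of "x - y"] by (auto simp: B_def indicator_def)
      show "AE y in lborel. norm (B y * (LINT \<xi>|lborel. E x \<xi> * cnj (E y \<xi>))) \<le> indicator {- (2 * b)..2 * b} (x + (- 1) * y) *\<^sub>R G (x + (- 1) * y)"
        using AE_lborel_singleton[of x] by eventually_elim (rule le)
      then show "integrable lborel (\<lambda>y. norm (B y * (LINT \<xi>|lborel. E x \<xi> * cnj (E y \<xi>))))"
        using G(1) G(2) unfolding set_integrable_def
        by (intro Bochner_Integration.integrable_bound[OF lborel_integrable_real_affine[OF G(1)[unfolded set_integrable_def], of "- 1" x]]) auto
    qed
    also have "\<dots> = I"
      using lborel_integral_real_affine[of "- 1" "\<lambda>z. indicator {- (2 * b)..2 * b} z *\<^sub>R G z" x]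
      by (simp add: I_def set_lebesgue_integral_def)
    finally show ?thesis .
  qed
  \<comment> \<open>The squared norm of T becomes an integral over the window of quantities bounded
    by I, hence at most 2 b I.\<close>
  have "of_real (LINT \<xi>|lborel. (norm (T \<xi>))\<^sup>2) = (LINT \<xi>|lborel. (J \<xi> * cnj (T \<xi>)) * (LINT x|lborel. E x \<xi> * B x))"
    unfolding EB T_def[symmetric] integral_complex_of_real[symmetric]
    by (intro Bochner_Integration.integral_cong refl)
       (use T0 in \<open>auto simp: J_def indicator_def complex_norm_square[unfolded of_real_power] mult.commute\<close>)
  also have "\<dots> = (LINT x|lborel. B x * (LINT \<xi>|lborel. E x \<xi> * (J \<xi> * cnj (T \<xi>))))"
    by (rule Fubini_kernel[OF Bi TJi E E1, symmetric])
  also have "norm \<dots> \<le> (LINT x|lborel. I * indicator {- b..b} x)"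
  proof (rule Bochner_Integration.integral_norm_bound_integral)
    have ii: "integrable lborel (\<lambda>x. indicator {- b..b} x :: real)"
      using emeasure_lborel_Icc_eq[of "- b" b] by (intro integrable_real_indicator) (auto split: if_splits)
    then show "integrable lborel (\<lambda>x. I * indicator {- b..b} x)" by (rule integrable_mult_right)
    show le: "norm (B x * (LINT \<xi>|lborel. E x \<xi> * (J \<xi> * cnj (T \<xi>)))) \<le> I * indicator {- b..b} x" for x
      using inner[of x] by (auto simp: B_def indicator_def)
    show "integrable lborel (\<lambda>x. B x * (LINT \<xi>|lborel. E x \<xi> * (J \<xi> * cnj (T \<xi>))))"
      by (rule Bochner_Integration.integrable_bound[OF integrable_mult_right[OF ii, of I]])
         (use le in \<open>auto intro!: AE_I2 order_trans[OF le]\<close>)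
  qed
  also have "\<dots> = 2 * b * I" using b by simp
  finally have TI: "(LINT \<xi>|lborel. (norm (T \<xi>))\<^sup>2) \<le> 2 * b * I" by simp
  have "norm (LINT \<xi>|lborel. h \<xi> * T \<xi>) \<le> sqrt (LINT \<xi>|lborel. (norm (h \<xi>))\<^sup>2) * sqrt (LINT \<xi>|lborel. (norm (T \<xi>))\<^sup>2)"
    by (rule integral_Cauchy_Schwarz) (use hL2 TL2 in auto)
  also have "\<dots> \<le> sqrt (LINT \<xi>|lborel. (norm (h \<xi>))\<^sup>2) * sqrt (2 * b * I)"
    by (intro mult_left_mono real_sqrt_le_mono TI) auto
  finally show ?thesis unfolding eq by (simp add: I_def mult.commute)
qed

section \<open>The evolution of dyadic pieces and its maximal function\<close>

definition schr :: "real \<Rightarrow> (real \<Rightarrow> complex) \<Rightarrow> real \<Rightarrow> real \<Rightarrow> complex" where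
  "schr a g t x = (LINT \<xi>|lborel. cis (x * \<xi> + t * \<bar>\<xi>\<bar> powr a) * g \<xi>)"

lemma borel_measurable_schr [measurable]:
  assumes [measurable]: "g \<in> borel_measurable borel"
  shows "(\<lambda>x. schr a g t x) \<in> borel_measurable borel"
  unfolding schr_def by measurable

lemma norm_schr_le:
  assumes "integrable lborel g"
  shows "norm (schr a g t x) \<le> (LINT \<xi>|lborel. norm (g \<xi>))"
  unfolding schr_def
  by (rule Bochner_Integration.integral_norm_bound_integral)
     (use assms in \<open>auto simp: norm_mult intro!: integrable_cis_mult\<close>)

definition trunc :: "real \<Rightarrow> (real \<Rightarrow> complex) \<Rightarrow> real \<Rightarrow> complex" where
  "trunc N g \<xi> = indicator {- N..N} \<xi> * g \<xi>"

lemma borel_measurable_trunc [measurable]: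
  assumes [measurable]: "g \<in> borel_measurable borel"
  shows "trunc N g \<in> borel_measurable borel"
  unfolding trunc_def[abs_def] by measurable

lemma norm_trunc_le: "norm (trunc N g \<xi>) \<le> norm (g \<xi>)"
  by (auto simp: trunc_def indicator_def)

lemma integrable_trunc: "integrable lborel g \<Longrightarrow> integrable lborel (trunc N g)"
  by (rule Bochner_Integration.integrable_bound[of _ g]) (auto simp: norm_trunc_le)

text \<open>The shell is closed and L is real, so both the half-open dyadic pieces and packets at
  arbitrary real frequencies fit.\<close>

definition dyadic_supp :: "real \<Rightarrow> (real \<Rightarrow> complex) \<Rightarrow> bool" where
  "dyadic_supp L h \<longleftrightarrow> h \<in> borel_measurable borel \<and> integrable lborel (\<lambda>\<xi>. (norm (h \<xi>))\<^sup>2) \<and>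
    (\<forall>\<xi>. \<not> (L \<le> \<bar>\<xi>\<bar> \<and> \<bar>\<xi>\<bar> \<le> 2 * L) \<longrightarrow> h \<xi> = 0)"

lemma dyadic_supp_integrable:
  assumes "dyadic_supp L h"
  shows "integrable lborel h"
proof -
  have "set_integrable lborel {- (2 * L)..2 * L} h"
    using assms by (intro L2_locally_integrable) (auto simp: dyadic_supp_def)
  moreover have "(\<lambda>\<xi>. indicator {- (2 * L)..2 * L} \<xi> *\<^sub>R h \<xi>) = h"
    using assms by (auto simp: dyadic_supp_def indicator_def fun_eq_iff abs_le_iff)
  ultimately show ?thesis by (simp add: set_integrable_def)
qed

definition L2norm :: "(real \<Rightarrow> complex) \<Rightarrow> real" where
  "L2norm h = sqrt (LINT \<xi>|lborel. (norm (h \<xi>))\<^sup>2)"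

lemma L2norm_nonneg: "0 \<le> L2norm h"
  by (simp add: L2norm_def)

lemma cnj_sgn_mult: "cnj (sgn w) * w = of_real (norm w)"
proof -
  have "cnj (sgn w) * w = of_real (inverse (norm w)) * (w * cnj w)"
    by (simp add: sgn_div_norm scaleR_conv_of_real)
  also have "\<dots> = of_real (inverse (norm w) * (norm w)\<^sup>2)"
    by (simp only: complex_norm_square[symmetric] of_real_mult)
  also have "\<dots> = of_real (norm w)" by (cases "w = 0") (simp_all add: power2_eq_square)
  finally show ?thesis .
qed

text \<open>Linearisation: at each point a nearly maximal parameter is selected measurably, as the
  least index in the countable family.\<close>

lemma maximal_countable:
  fixes a L e b \<rho> :: real and t N :: "nat \<Rightarrow> real"
  assumes a: "0 < a" "a < 1" and L: "1 \<le> L" and e: "0 < e" "e \<le> 1" and b: "b > 0"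
    and t: "\<And>i j. \<bar>t i - t j\<bar> \<le> \<rho>" and h: "dyadic_supp L h"
  defines "M \<equiv> \<lambda>x. SUP i::nat. norm (schr a (trunc (N i) h) (t i) x)"
  assumes K: "set_integrable lborel {- (2 * b)..2 * b} (dyadic_kernel a e L \<rho>)"
  shows "M \<in> borel_measurable borel" "\<And>i x. norm (schr a (trunc (N i) h) (t i) x) \<le> M x"
    "set_integrable lborel {- b..b} M"
    "(LINT x:{- b..b}|lborel. M x) \<le>
       2 * sqrt (4 * b * (LINT x:{- (2 * b)..2 * b}|lborel. dyadic_kernel a e L \<rho> x)) * L2norm h"
proof -
  define u where "u i x = schr a (trunc (N i) h) (t i) x" for i x
  define H where "H = (LINT \<xi>|lborel. norm (h \<xi>))"
  have hm[measurable]: "h \<in> borel_measurable borel" and hL2: "integrable lborel (\<lambda>\<xi>. (norm (h \<xi>))\<^sup>2)"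
    and hs: "\<And>\<xi>. \<not> (L \<le> \<bar>\<xi>\<bar> \<and> \<bar>\<xi>\<bar> \<le> 2 * L) \<Longrightarrow> h \<xi> = 0"
    using h by (auto simp: dyadic_supp_def)
  have hi: "integrable lborel h" by (rule dyadic_supp_integrable[OF h])
  have um[measurable]: "u i \<in> borel_measurable borel" for i
    unfolding u_def by measurable
  have uH: "norm (u i x) \<le> H" for i x
  proof -
    have "norm (u i x) \<le> (LINT \<xi>|lborel. norm (trunc (N i) h \<xi>))"
      unfolding u_def by (intro norm_schr_le integrable_trunc hi)
    also have "\<dots> \<le> H"
      unfolding H_def by (intro integral_mono integrable_norm integrable_trunc hi norm_trunc_le)
    finally show ?thesis .
  qed
  have bdd: "bdd_above (range (\<lambda>i. norm (u i x)))" for x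
    using uH by (auto intro!: bdd_aboveI[of _ H])
  have M_def': "M = (\<lambda>x. SUP i. norm (u i x))" by (simp add: M_def u_def)
  show Mm[measurable]: "M \<in> borel_measurable borel"
    unfolding M_def' by (rule borel_measurable_cSUP) (use bdd in auto)
  have le: "norm (u i x) \<le> M x" for i x
    unfolding M_def' by (rule cSUP_upper[OF _ bdd]) simp
  then show "norm (schr a (trunc (N i) h) (t i) x) \<le> M x" for i x by (simp add: u_def)
  have M0: "0 \<le> M x" for x using order_trans[OF norm_ge_zero le] .
  have MH: "M x \<le> H" for x unfolding M_def' by (rule cSUP_least) (use uH in auto)
  have ind: "integrable lborel (\<lambda>x. indicator {- b..b} x :: real)"
    using emeasure_lborel_Icc_eq[of "- b" b] by (intro integrable_real_indicator) (auto split: if_splits)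
  show Mi: "set_integrable lborel {- b..b} M"
    unfolding set_integrable_def
  proof (rule Bochner_Integration.integrable_bound)
    show "integrable lborel (\<lambda>x. H * indicator {- b..b} x)" by (rule integrable_mult_right[OF ind])
    show "AE x in lborel. norm (indicator {- b..b} x *\<^sub>R M x) \<le> norm (H * indicator {- b..b} x)"
      using M0 MH order_trans[OF M0 MH] by (intro AE_I2) (auto simp: indicator_def)
  qed measurable
  \<comment> \<open>The supremum need not be attained, hence the factor 2; where it is 0 any index
    will do.\<close>
  have ex: "\<exists>i. M x \<le> 2 * norm (u i x)" for x
  proof (cases "M x = 0")
    case False
    then have "M x / 2 < (SUP i. norm (u i x))" using M0[of x] by (simp add: M_def')
    then obtain i where "M x / 2 < norm (u i x)" using less_cSUP_iff[OF UNIV_not_empty bdd] by blast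
    then show ?thesis by (intro exI[of _ i]) simp
  qed auto
  define idx where "idx x = (LEAST i. M x \<le> 2 * norm (u i x))" for x
  have idx: "M x \<le> 2 * norm (u (idx x) x)" for x
    unfolding idx_def by (rule LeastI_ex[OF ex])
  have idxm[measurable]: "idx \<in> measurable borel (count_space UNIV)"
    unfolding idx_def[abs_def] by measurable
  have [measurable]: "(\<lambda>x. t (idx x)) \<in> borel_measurable borel" "(\<lambda>x. N (idx x)) \<in> borel_measurable borel"
    by (rule measurable_compose[OF idxm], simp)+
  have [measurable]: "(\<lambda>x. u (idx x) x) \<in> borel_measurable borel"
    by (rule measurable_compose_countable[OF um idxm])
  \<comment> \<open>The unimodular dual function turns the selected value into its norm, so that the
    double integral below is a local L1 norm.\<close>
  define z where "z x = indicator {- b..b} x * cnj (sgn (u (idx x) x))" for x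
  have zm[measurable]: "z \<in> borel_measurable borel"
    unfolding z_def[abs_def] sgn_div_norm by measurable
  have z1: "norm (z x) \<le> 1" for x by (auto simp: z_def indicator_def norm_sgn)
  \<comment> \<open>The selected truncation becomes part of the kernel as the upper end
    \<open>min (N (idx x)) (2 * L)\<close>; its dependence on x is harmless, since the kernel bound
    holds for every upper end.\<close>
  define E where "E x \<xi> = z x * (if L \<le> \<bar>\<xi>\<bar> \<and> \<bar>\<xi>\<bar> \<le> min (N (idx x)) (2 * L)
     then cis (x * \<xi> + t (idx x) * \<bar>\<xi>\<bar> powr a) else 0)" for x \<xi>
  have Eh: "(LINT \<xi>|lborel. E x \<xi> * h \<xi>) = of_real (indicator {- b..b} x * norm (u (idx x) x))" for x
  proof -
    have "(LINT \<xi>|lborel. E x \<xi> * h \<xi>) = (LINT \<xi>|lborel. z x * (cis (x * \<xi> + t (idx x) * \<bar>\<xi>\<bar> powr a) * trunc (N (idx x)) h \<xi>))"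
    proof (intro Bochner_Integration.integral_cong refl)
      fix \<xi>
      show "E x \<xi> * h \<xi> = z x * (cis (x * \<xi> + t (idx x) * \<bar>\<xi>\<bar> powr a) * trunc (N (idx x)) h \<xi>)"
        using hs[of \<xi>] by (cases "L \<le> \<bar>\<xi>\<bar> \<and> \<bar>\<xi>\<bar> \<le> 2 * L") (auto simp: E_def trunc_def indicator_def abs_le_iff)
    qed
    also have "\<dots> = z x * u (idx x) x" by (simp add: u_def schr_def)
    also have "\<dots> = of_real (indicator {- b..b} x * norm (u (idx x) x))"
      by (simp add: z_def mult.assoc cnj_sgn_mult of_real_indicator)
    finally show ?thesis .
  qed
  have "norm (LINT x|lborel. LINT \<xi>|lborel. E x \<xi> * h \<xi>) \<le>
    sqrt (2 * b * (LINT x:{- (2 * b)..2 * b}|lborel. 2 * dyadic_kernel a e L \<rho> x)) * sqrt (LINT \<xi>|lborel. (norm (h \<xi>))\<^sup>2)"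
  proof (rule TTstar_bound[where K = "2 * L"])
    show "(\<lambda>p. E (fst p) (snd p)) \<in> borel_measurable (lborel \<Otimes>\<^sub>M lborel)"
      unfolding E_def by measurable
    show "norm (E x \<xi>) \<le> 1" for x \<xi> using z1[of x] by (auto simp: E_def norm_mult)
    show "E x \<xi> = 0" if "x \<notin> {- b..b}" for x \<xi> using that by (auto simp: E_def z_def)
    show "E x \<xi> = 0" if "\<xi> \<notin> {- (2 * L)..2 * L}" for x \<xi> using that by (auto simp: E_def abs_le_iff)
    show "set_integrable lborel {- (2 * b)..2 * b} (\<lambda>x. 2 * dyadic_kernel a e L \<rho> x)"
      by (intro set_integrable_mult_right K)
    show "norm (LINT \<xi>|lborel. E x \<xi> * cnj (E y \<xi>)) \<le> 2 * dyadic_kernel a e L \<rho> (x - y)" if "x \<noteq> y" for x y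
    proof -
      \<comment> \<open>Two truncations of one shell overlap in a truncation of that shell, so
        \<open>dyadic_kernel_bound\<close> applies with the smaller upper end.\<close>
      define U where "U = min (min (N (idx x)) (N (idx y))) (2 * L)"
      have "E x \<xi> * cnj (E y \<xi>) = (z x * cnj (z y)) * (if L \<le> \<bar>\<xi>\<bar> \<and> \<bar>\<xi>\<bar> \<le> U then
          cis ((x - y) * \<xi> + (t (idx x) - t (idx y)) * \<bar>\<xi>\<bar> powr a) else 0)" for \<xi>
      proof (cases "L \<le> \<bar>\<xi>\<bar> \<and> \<bar>\<xi>\<bar> \<le> U")
        case True
        have "cis (x * \<xi> + t (idx x) * \<bar>\<xi>\<bar> powr a) * cnj (cis (y * \<xi> + t (idx y) * \<bar>\<xi>\<bar> powr a)) =
           cis ((x - y) * \<xi> + (t (idx x) - t (idx y)) * \<bar>\<xi>\<bar> powr a)"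
          by (simp add: cis_cnj cis_mult algebra_simps)
        then show ?thesis using True by (simp add: E_def U_def mult_ac)
      qed (auto simp: E_def U_def)
      then have "norm (LINT \<xi>|lborel. E x \<xi> * cnj (E y \<xi>)) = norm (z x * cnj (z y)) *
         norm (LINT \<xi>|lborel. (if L \<le> \<bar>\<xi>\<bar> \<and> \<bar>\<xi>\<bar> \<le> U then
          cis ((x - y) * \<xi> + (t (idx x) - t (idx y)) * \<bar>\<xi>\<bar> powr a) else 0))"
        by (simp add: norm_mult)
      also have "\<dots> \<le> 1 * (2 * dyadic_kernel a e L \<rho> (x - y))"
        using z1[of x] z1[of y] that L
        by (intro mult_mono dyadic_kernel_bound a e t) (auto simp: norm_mult mult_le_one U_def)
      finally show ?thesis by simp
    qed
  qed (use hL2 b a L in \<open>auto intro!: dyadic_kernel_nonneg\<close>)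
  moreover have "(LINT x|lborel. LINT \<xi>|lborel. E x \<xi> * h \<xi>) = of_real (LINT x|lborel. indicator {- b..b} x * norm (u (idx x) x))"
    unfolding Eh integral_complex_of_real ..
  moreover have "(LINT x|lborel. indicator {- b..b} x * norm (u (idx x) x)) \<ge> (LINT x:{- b..b}|lborel. M x) / 2"
  proof -
    have "(LINT x:{- b..b}|lborel. M x) \<le> (LINT x|lborel. 2 * (indicator {- b..b} x * norm (u (idx x) x)))"
      unfolding set_lebesgue_integral_def
    proof (rule integral_mono)
      show "integrable lborel (\<lambda>x. indicator {- b..b} x *\<^sub>R M x)" using Mi by (simp add: set_integrable_def)
      show "integrable lborel (\<lambda>x. 2 * (indicator {- b..b} x * norm (u (idx x) x)))"
      proof (intro integrable_mult_right Bochner_Integration.integrable_bound[OF integrable_mult_right[OF ind, of H]])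
        show "AE x in lborel. norm (indicator {- b..b} x * norm (u (idx x) x)) \<le> norm (H * indicator {- b..b} x)"
          using uH order_trans[OF norm_ge_zero uH] by (intro AE_I2) (auto simp: indicator_def)
      qed measurable
      show "indicator {- b..b} x *\<^sub>R M x \<le> 2 * (indicator {- b..b} x * norm (u (idx x) x))" for x
        using idx[of x] by (auto simp: indicator_def)
    qed
    then show ?thesis by simp
  qed
  ultimately have "(LINT x:{- b..b}|lborel. M x) / 2 \<le>
      sqrt (2 * b * (2 * (LINT x:{- (2 * b)..2 * b}|lborel. dyadic_kernel a e L \<rho> x))) * L2norm h"
    by (simp add: L2norm_def)
  then show "(LINT x:{- b..b}|lborel. M x) \<le>
       2 * sqrt (4 * b * (LINT x:{- (2 * b)..2 * b}|lborel. dyadic_kernel a e L \<rho> x)) * L2norm h"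
    by (simp add: mult.assoc)
qed

text \<open>The supremum over all times in an interval and all truncations, taken over a countable
  dense set of parameters.\<close>

definition schr_max :: "real \<Rightarrow> (real \<Rightarrow> complex) \<Rightarrow> real \<Rightarrow> real \<Rightarrow> real \<Rightarrow> real" where
  "schr_max a h t1 t2 x = (SUP i::nat. norm (schr a (trunc (of_rat (snd (from_nat i :: rat \<times> rat))) h)
     (max t1 (min t2 (of_rat (fst (from_nat i :: rat \<times> rat))))) x))"

lemma rat_seq_tendsto:
  fixes x :: real
  obtains r :: "nat \<Rightarrow> rat" where "(\<lambda>n. of_rat (r n)) \<longlonglongrightarrow> x"
proof -
  have "\<forall>n. \<exists>q::rat. x < of_rat q \<and> of_rat q < x + 1 / real (Suc n)"
    by (intro allI of_rat_dense) simp
  then obtain r :: "nat \<Rightarrow> rat" where r: "\<And>n. x < of_rat (r n)" "\<And>n. of_rat (r n) < x + 1 / real (Suc n)"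
    by metis
  have "(\<lambda>n. x + 1 / real (Suc n)) \<longlonglongrightarrow> x + 0"
    by (intro tendsto_add tendsto_const LIMSEQ_Suc[OF lim_const_over_n])
  then have "(\<lambda>n. of_rat (r n)) \<longlonglongrightarrow> x"
    by (intro tendsto_sandwich[OF _ _ tendsto_const, of x "\<lambda>n. of_rat (r n)" _ "\<lambda>n. x + 1 / real (Suc n)"])
       (use r in \<open>auto intro!: always_eventually less_imp_le\<close>)
  then show ?thesis using that by blast
qed

text \<open>The sharp truncation jumps only at the frequencies N and -N; at every other one it is
  eventually constant, so the integral depends continuously on N as well as on t.\<close>

lemma schr_trunc_tendsto:
  assumes h: "integrable lborel h" and t: "t' \<longlonglongrightarrow> t" and N: "N' \<longlonglongrightarrow> N"
  shows "(\<lambda>n. schr a (trunc (N' n) h) (t' n) x) \<longlonglongrightarrow> schr a (trunc N h) t x"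
  unfolding schr_def
proof (rule integral_dominated_convergence[where w = "\<lambda>\<xi>. norm (h \<xi>)"])
  have [measurable]: "h \<in> borel_measurable borel" using h by auto
  show "(\<lambda>\<xi>. cis (x * \<xi> + t * \<bar>\<xi>\<bar> powr a) * trunc N h \<xi>) \<in> borel_measurable lborel"
    "(\<lambda>\<xi>. cis (x * \<xi> + t' n * \<bar>\<xi>\<bar> powr a) * trunc (N' n) h \<xi>) \<in> borel_measurable lborel" for n
    by measurable
  show "integrable lborel (\<lambda>\<xi>. norm (h \<xi>))" using h by simp
  show "AE \<xi> in lborel. norm (cis (x * \<xi> + t' n * \<bar>\<xi>\<bar> powr a) * trunc (N' n) h \<xi>) \<le> norm (h \<xi>)" for n
    by (intro AE_I2) (simp add: norm_mult norm_trunc_le)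
  show "AE \<xi> in lborel. (\<lambda>n. cis (x * \<xi> + t' n * \<bar>\<xi>\<bar> powr a) * trunc (N' n) h \<xi>) \<longlonglongrightarrow> cis (x * \<xi> + t * \<bar>\<xi>\<bar> powr a) * trunc N h \<xi>"
    using AE_lborel_singleton[of N] AE_lborel_singleton[of "- N"]
  proof eventually_elim
    case (elim \<xi>)
    have "\<forall>\<^sub>F n in sequentially. trunc (N' n) h \<xi> = trunc N h \<xi>"
    proof (cases "\<bar>\<xi>\<bar> < N")
      case True
      have "\<forall>\<^sub>F n in sequentially. \<bar>\<xi>\<bar> < N' n" using order_tendstoD(1)[OF N True] .
      then show ?thesis by eventually_elim (use True in \<open>auto simp: trunc_def indicator_def\<close>)
    next
      case False
      then have "N < \<bar>\<xi>\<bar>" using elim by (auto simp: abs_if split: if_splits)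
      have "\<forall>\<^sub>F n in sequentially. N' n < \<bar>\<xi>\<bar>" using order_tendstoD(2)[OF N \<open>N < \<bar>\<xi>\<bar>\<close>] .
      then show ?thesis by eventually_elim (use \<open>N < \<bar>\<xi>\<bar>\<close> in \<open>auto simp: trunc_def indicator_def\<close>)
    qed
    then have "(\<lambda>n. trunc (N' n) h \<xi>) \<longlonglongrightarrow> trunc N h \<xi>" by (rule tendsto_eventually)
    moreover have "(\<lambda>n. cis (x * \<xi> + t' n * \<bar>\<xi>\<bar> powr a)) \<longlonglongrightarrow> cis (x * \<xi> + t * \<bar>\<xi>\<bar> powr a)"
      by (intro tendsto_cis tendsto_add tendsto_mult tendsto_const t)
    ultimately show ?case by (intro tendsto_mult)
  qed
qed

lemma schr_max_props:
  assumes a: "0 < a" "a < 1" and L: "1 \<le> L" and h: "dyadic_supp L h" and t: "t1 \<le> t2"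
  shows "schr_max a h t1 t2 \<in> borel_measurable borel"
    "\<And>t N x. t1 \<le> t \<Longrightarrow> t \<le> t2 \<Longrightarrow> norm (schr a (trunc N h) t x) \<le> schr_max a h t1 t2 x"
    "\<And>b. b > 0 \<Longrightarrow> set_integrable lborel {- b..b} (schr_max a h t1 t2)"
proof -
  \<comment> \<open>Clamping the rationals, rather than selecting those in the interval, keeps the
    family nonempty when \<open>t1 = t2\<close> is irrational.\<close>
  let ?t = "\<lambda>i. max t1 (min t2 (of_rat (fst (from_nat i :: rat \<times> rat))))"
  have td: "\<bar>?t i - ?t j\<bar> \<le> t2 - t1" for i j using t by auto
  \<comment> \<open>Only integrability of the kernel is at stake here, hence the choice e =
    1.\<close>
  have K: "set_integrable lborel {- (2 * b)..2 * b} (dyadic_kernel a 1 L (t2 - t1))" if "b > 0" for b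
    using integral_dyadic_kernel[OF a, of 1 "2 * b"] that L t by (metis diff_ge_0_iff_ge less_imp_le zero_le_mult_iff zero_le_numeral zero_less_one order_refl)
  let ?N = "\<lambda>i. of_rat (snd (from_nat i :: rat \<times> rat))"
  have eq: "schr_max a h t1 t2 = (\<lambda>x. SUP i. norm (schr a (trunc (?N i) h) (?t i) x))"
    by (simp add: schr_max_def fun_eq_iff)
  note mc = maximal_countable[where N = ?N and t = ?t, OF a L zero_less_one order_refl _ td h K, folded eq]
  show "schr_max a h t1 t2 \<in> borel_measurable borel" by (rule mc(1)[of 1]) auto
  show "set_integrable lborel {- b..b} (schr_max a h t1 t2)" if "b > 0" for b using mc(3)[of b] that by simp
  fix t N x :: real assume tt: "t1 \<le> t" "t \<le> t2"
  obtain r :: "nat \<Rightarrow> rat" where r: "(\<lambda>n. of_rat (r n)) \<longlonglongrightarrow> t" using rat_seq_tendsto[of t] by blast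
  obtain s :: "nat \<Rightarrow> rat" where s: "(\<lambda>n. of_rat (s n)) \<longlonglongrightarrow> N" using rat_seq_tendsto[of N] by blast
  have "(\<lambda>n. max t1 (min t2 (of_rat (r n)))) \<longlonglongrightarrow> max t1 (min t2 t)"
    by (intro tendsto_max tendsto_min tendsto_const r)
  then have r': "(\<lambda>n. max t1 (min t2 (of_rat (r n)))) \<longlonglongrightarrow> t" using tt by simp
  have "(\<lambda>n. norm (schr a (trunc (of_rat (s n)) h) (max t1 (min t2 (of_rat (r n)))) x)) \<longlonglongrightarrow> norm (schr a (trunc N h) t x)"
    by (intro tendsto_norm schr_trunc_tendsto dyadic_supp_integrable[OF h] r' s)
  moreover have "norm (schr a (trunc (of_rat (s n)) h) (max t1 (min t2 (of_rat (r n)))) x) \<le> schr_max a h t1 t2 x" for n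
    using mc(2)[of 1 "to_nat (r n, s n)" x] unfolding eq by simp
  ultimately show "norm (schr a (trunc N h) t x) \<le> schr_max a h t1 t2 x"
    by (intro LIMSEQ_le_const2) auto
qed

text \<open>The kernel mass with \<rho> = t2 - t1 enters under a square root. The constant depends
  on a, e and b alone, which is what makes the sum over shells and time blocks possible.\<close>

lemma schr_max_estimate:
  assumes a: "0 < a" "a < 1" and e: "0 < e" "e \<le> 1" and b: "b > 0"
  obtains C where "C > 0"
    "\<And>L h t1 t2. 1 \<le> L \<Longrightarrow> dyadic_supp L h \<Longrightarrow> t1 \<le> t2 \<Longrightarrow>
      (LINT x:{- b..b}|lborel. schr_max a h t1 t2 x) \<le> C * sqrt (L powr e + sqrt ((t2 - t1) * L powr a)) * L2norm h"
proof -
  obtain C where C: "C > 0"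
    "\<And>L \<rho>. 1 \<le> L \<Longrightarrow> 0 \<le> \<rho> \<Longrightarrow> set_integrable lborel {- (2 * b)..2 * b} (dyadic_kernel a e L \<rho>)"
    "\<And>L \<rho>. 1 \<le> L \<Longrightarrow> 0 \<le> \<rho> \<Longrightarrow> (LINT x:{- (2 * b)..2 * b}|lborel. dyadic_kernel a e L \<rho> x) \<le> C * (L powr e + sqrt (\<rho> * L powr a))"
    using integral_dyadic_kernel[OF a e, of "2 * b"] b by auto
  show ?thesis
  proof (rule that[of "2 * sqrt (4 * b * C)"])
    show "2 * sqrt (4 * b * C) > 0" using b C(1) by simp
    fix L h t1 t2 assume L: "1 \<le> L" and h: "dyadic_supp L h" and t: "t1 \<le> (t2::real)"
    let ?t = "\<lambda>i. max t1 (min t2 (of_rat (fst (from_nat i :: rat \<times> rat))))"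
    have td: "\<bar>?t i - ?t j\<bar> \<le> t2 - t1" for i j using t by auto
    have K: "set_integrable lborel {- (2 * b)..2 * b} (dyadic_kernel a e L (t2 - t1))" using C(2) L t by simp
    have "(LINT x:{- b..b}|lborel. schr_max a h t1 t2 x) \<le>
       2 * sqrt (4 * b * (LINT x:{- (2 * b)..2 * b}|lborel. dyadic_kernel a e L (t2 - t1) x)) * L2norm h"
      unfolding schr_max_def by (rule maximal_countable(4)[OF a L e b td h K])
    also have "\<dots> \<le> 2 * sqrt (4 * b * (C * (L powr e + sqrt ((t2 - t1) * L powr a)))) * L2norm h"
      using b L t by (intro mult_right_mono mult_left_mono real_sqrt_le_mono C(3) L2norm_nonneg) auto
    also have "\<dots> = 2 * sqrt (4 * b * C) * sqrt (L powr e + sqrt ((t2 - t1) * L powr a)) * L2norm h"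
      by (simp add: real_sqrt_mult mult.assoc)
    finally show "(LINT x:{- b..b}|lborel. schr_max a h t1 t2 x) \<le>
      2 * sqrt (4 * b * C) * sqrt (L powr e + sqrt ((t2 - t1) * L powr a)) * L2norm h" .
  qed
qed

section \<open>Time differences and the weighted maximal function\<close>

lemma dyadic_supp_bounded:
  assumes h: "dyadic_supp L h" and q: "q \<in> borel_measurable borel"
    and le: "\<And>\<xi>. L \<le> \<bar>\<xi>\<bar> \<Longrightarrow> \<bar>\<xi>\<bar> \<le> 2 * L \<Longrightarrow> norm (q \<xi> :: complex) \<le> c"
    and c: "c \<ge> 0"
  shows "dyadic_supp L (\<lambda>\<xi>. q \<xi> * h \<xi>)" "L2norm (\<lambda>\<xi>. q \<xi> * h \<xi>) \<le> c * L2norm h"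
proof -
  have [measurable]: "h \<in> borel_measurable borel" "q \<in> borel_measurable borel"
    and hi: "integrable lborel (\<lambda>\<xi>. (norm (h \<xi>))\<^sup>2)"
    and hs: "\<And>\<xi>. \<not> (L \<le> \<bar>\<xi>\<bar> \<and> \<bar>\<xi>\<bar> \<le> 2 * L) \<Longrightarrow> h \<xi> = 0"
    using h q by (auto simp: dyadic_supp_def)
  have le2: "(norm (q \<xi> * h \<xi>))\<^sup>2 \<le> c\<^sup>2 * (norm (h \<xi>))\<^sup>2" for \<xi>
  proof (cases "L \<le> \<bar>\<xi>\<bar> \<and> \<bar>\<xi>\<bar> \<le> 2 * L")
    case True
    then show ?thesis using le[of \<xi>] by (auto simp: norm_mult power_mult_distrib intro!: mult_right_mono power_mono)
  qed (simp add: hs)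
  have ci: "integrable lborel (\<lambda>\<xi>. c\<^sup>2 * (norm (h \<xi>))\<^sup>2)" by (rule integrable_mult_right[OF hi])
  have int: "integrable lborel (\<lambda>\<xi>. (norm (q \<xi> * h \<xi>))\<^sup>2)"
    by (rule Bochner_Integration.integrable_bound[OF ci]) (use le2 in auto)
  then show "dyadic_supp L (\<lambda>\<xi>. q \<xi> * h \<xi>)" using hs by (auto simp: dyadic_supp_def)
  have "(LINT \<xi>|lborel. (norm (q \<xi> * h \<xi>))\<^sup>2) \<le> c\<^sup>2 * (LINT \<xi>|lborel. (norm (h \<xi>))\<^sup>2)"
    using integral_mono[OF int ci le2] by simp
  then have "L2norm (\<lambda>\<xi>. q \<xi> * h \<xi>) \<le> sqrt (c\<^sup>2 * (LINT \<xi>|lborel. (norm (h \<xi>))\<^sup>2))"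
    unfolding L2norm_def by (rule real_sqrt_le_mono)
  then show "L2norm (\<lambda>\<xi>. q \<xi> * h \<xi>) \<le> c * L2norm h"
    using c by (simp add: L2norm_def real_sqrt_mult)
qed

text \<open>Up to the factor \<open>\<i>\<close>, the time derivative on the frequency side.\<close>

definition freq_mult :: "real \<Rightarrow> (real \<Rightarrow> complex) \<Rightarrow> real \<Rightarrow> complex" where
  "freq_mult a h \<xi> = of_real (\<bar>\<xi>\<bar> powr a) * h \<xi>"

lemma dyadic_supp_freq_mult:
  assumes "dyadic_supp L h" "0 \<le> a"
  shows "dyadic_supp L (freq_mult a h)" "L2norm (freq_mult a h) \<le> (2 * L) powr a * L2norm h"
proof -
  have le: "norm (of_real (\<bar>\<xi>\<bar> powr a) :: complex) \<le> (2 * L) powr a" if "\<bar>\<xi>\<bar> \<le> 2 * L" for \<xi>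
    using that assms(2) by (auto intro!: powr_mono2)
  show "dyadic_supp L (freq_mult a h)" "L2norm (freq_mult a h) \<le> (2 * L) powr a * L2norm h"
    unfolding freq_mult_def[abs_def] using dyadic_supp_bounded[OF assms(1) _ le, of "\<lambda>\<xi>. \<xi>"] 
    by (auto intro!: dyadic_supp_bounded[OF assms(1)] le)
qed

lemma norm_cis_taylor_le: "norm (cis y - 1 - \<i> * of_real y) \<le> y\<^sup>2"
proof -
  have "norm (cis y - (1 + \<i> * of_real y)) \<le> \<bar>y\<bar>\<^sup>2 / 2"
    using iexp_approx1[of y 1] by (simp add: cis_conv_exp numeral_2_eq_2)
  moreover have "\<bar>y\<bar>\<^sup>2 / 2 \<le> y\<^sup>2" by simp
  ultimately show ?thesis unfolding diff_diff_eq by linarith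
qed

lemma schr_has_time_derivative:
  assumes h: "integrable lborel h" "integrable lborel (freq_mult a h)" "integrable lborel (freq_mult a (freq_mult a h))"
  shows "((\<lambda>t. schr a h t x) has_vector_derivative \<i> * schr a (freq_mult a h) t x) (at t)"
proof (rule has_vector_derivative_quadratic[where C = "LINT \<xi>|lborel. norm (freq_mult a (freq_mult a h) \<xi>)"])
  fix \<eta>
  have [measurable]: "h \<in> borel_measurable borel" using h by auto
  let ?e = "\<lambda>t \<xi>. cis (x * \<xi> + t * \<bar>\<xi>\<bar> powr a)"
  have int: "integrable lborel (\<lambda>\<xi>. ?e t \<xi> * k \<xi>)" if "integrable lborel k" for t k
    by (rule integrable_cis_mult[OF that]) simp
  let ?g = "\<lambda>\<xi>. ?e (t + \<eta>) \<xi> * h \<xi> - ?e t \<xi> * h \<xi> - of_real \<eta> * \<i> * (?e t \<xi> * freq_mult a h \<xi>)"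
  have eq: "schr a h (t + \<eta>) x - schr a h t x - \<eta> *\<^sub>R (\<i> * schr a (freq_mult a h) t x) = (LINT \<xi>|lborel. ?g \<xi>)"
    unfolding schr_def using int[OF h(1)] int[OF h(2)] by (simp add: scaleR_conv_of_real mult.assoc)
  have "norm (LINT \<xi>|lborel. ?g \<xi>) \<le> (LINT \<xi>|lborel. norm (freq_mult a (freq_mult a h) \<xi>) * \<eta>\<^sup>2)"
  proof (rule Bochner_Integration.integral_norm_bound_integral)
    show "integrable lborel ?g"
      by (intro Bochner_Integration.integrable_diff integrable_mult_right int h)
    show "integrable lborel (\<lambda>\<xi>. norm (freq_mult a (freq_mult a h) \<xi>) * \<eta>\<^sup>2)"
      by (intro integrable_mult_left integrable_norm h)
    fix \<xi>
    let ?q = "\<bar>\<xi>\<bar> powr a"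
    have "?g \<xi> = ?e t \<xi> * h \<xi> * (cis (\<eta> * ?q) - 1 - \<i> * of_real (\<eta> * ?q))"
    proof -
      have "?e (t + \<eta>) \<xi> = ?e t \<xi> * cis (\<eta> * ?q)" by (simp add: cis_mult algebra_simps)
      then show ?thesis by (simp add: freq_mult_def algebra_simps)
    qed
    then have "norm (?g \<xi>) = norm (h \<xi>) * norm (cis (\<eta> * ?q) - 1 - \<i> * of_real (\<eta> * ?q))"
      by (simp add: norm_mult)
    also have "\<dots> \<le> norm (h \<xi>) * (\<eta> * ?q)\<^sup>2"
      by (intro mult_left_mono norm_cis_taylor_le) auto
    also have "\<dots> = norm (freq_mult a (freq_mult a h) \<xi>) * \<eta>\<^sup>2"
      by (simp add: freq_mult_def norm_mult power2_eq_square)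
    finally show "norm (?g \<xi>) \<le> norm (freq_mult a (freq_mult a h) \<xi>) * \<eta>\<^sup>2" .
  qed
  then show "norm (schr a h (t + \<eta>) x - schr a h t x - \<eta> *\<^sub>R (\<i> * schr a (freq_mult a h) t x))
      \<le> (LINT \<xi>|lborel. norm (freq_mult a (freq_mult a h) \<xi>)) * \<eta>\<^sup>2"
    unfolding eq by (simp only: integral_mult_left_zero)
qed

lemma freq_mult_trunc: "freq_mult a (trunc N h) = trunc N (freq_mult a h)"
  by (simp add: fun_eq_iff freq_mult_def trunc_def)

text \<open>Mean value inequality: the time derivative is \<open>\<i>\<close> times the evolution of
  another function on the same shell, with the same truncation, so one maximal function bounds it
  for all t and N.\<close>

lemma schr_time_difference_le:
  assumes a: "0 < a" "a < 1" and L: "1 \<le> L" and h: "dyadic_supp L h" and t: "\<bar>t\<bar> \<le> \<tau>"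
  shows "norm (schr a (trunc N h) t x - schr a (trunc N h) 0 x) \<le> \<bar>t\<bar> * schr_max a (freq_mult a h) (- \<tau>) \<tau> x"
proof -
  have h2: "dyadic_supp L (freq_mult a h)" and h3: "dyadic_supp L (freq_mult a (freq_mult a h))"
    using h a by (auto intro!: dyadic_supp_freq_mult)
  have der: "((\<lambda>t. schr a (trunc N h) t x) has_vector_derivative \<i> * schr a (trunc N (freq_mult a h)) t x) (at t)" for t
    unfolding freq_mult_trunc[symmetric]
    by (rule schr_has_time_derivative)
       (simp_all add: freq_mult_trunc integrable_trunc dyadic_supp_integrable[OF h]
         dyadic_supp_integrable[OF h2] dyadic_supp_integrable[OF h3])
  have "norm (schr a (trunc N h) t x - schr a (trunc N h) 0 x) \<le> schr_max a (freq_mult a h) (- \<tau>) \<tau> x * norm (t - 0)"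
  proof (rule differentiable_bound[where S = "{- \<tau>..\<tau>}"])
    fix r assume r: "r \<in> {- \<tau>..\<tau>}"
    let ?d = "\<i> * schr a (trunc N (freq_mult a h)) r x"
    show "((\<lambda>t. schr a (trunc N h) t x) has_derivative (\<lambda>h. h *\<^sub>R ?d)) (at r within {- \<tau>..\<tau>})"
      using der[of r] unfolding has_vector_derivative_def by (rule has_derivative_at_withinI)
    have "norm ?d \<le> schr_max a (freq_mult a h) (- \<tau>) \<tau> x"
      using schr_max_props(2)[OF a L h2, of "- \<tau>" \<tau> r N x] r t by (simp add: norm_mult)
    then show "onorm (\<lambda>h. h *\<^sub>R ?d) \<le> schr_max a (freq_mult a h) (- \<tau>) \<tau> x"
      by (intro onorm_le) (simp add: mult.commute mult_left_mono)
  qed (use t in auto)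
  then show ?thesis by (simp add: mult.commute)
qed

text \<open>A majorant, for 0 < |t| <= 1 and every truncation, of the weighted time difference of a
  piece on the k-th shell. The first term serves |t| <= 2 powr (- (a k)), where the derivative is
  used and |t| powr (1 - \<delta>) remains. Summand j serves |t| between 2 powr (- (j+1)) and 2 powr
  (- j); its factor 2 stands for the values at t and at 0.\<close>

definition rate_max :: "real \<Rightarrow> real \<Rightarrow> nat \<Rightarrow> (real \<Rightarrow> complex) \<Rightarrow> real \<Rightarrow> real" where
  "rate_max a \<delta> k h x =
    2 powr (- (a * real k * (1 - \<delta>))) * schr_max a (freq_mult a h) (- (2 powr (- (a * real k)))) (2 powr (- (a * real k))) x +
    (\<Sum>j\<le>nat \<lfloor>a * real k\<rfloor>. 2 * 2 powr (real (Suc j) * \<delta>) * schr_max a h (- (2 powr (- real j))) (2 powr (- real j)) x)"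

lemma schr_max_nonneg:
  assumes "0 < a" "a < 1" "1 \<le> L" "dyadic_supp L h" "t1 \<le> t2"
  shows "0 \<le> schr_max a h t1 t2 x"
  by (rule order_trans[OF norm_ge_zero schr_max_props(2)[OF assms order_refl assms(5), of 0]])

lemma rate_max_nonneg:
  assumes "0 < a" "a < 1" "dyadic_supp (2 ^ k) h"
  shows "0 \<le> rate_max a \<delta> k h x"
proof -
  have L: "1 \<le> (2::real) ^ k" by simp
  have h2: "dyadic_supp (2 ^ k) (freq_mult a h)" using assms by (auto intro!: dyadic_supp_freq_mult)
  have "0 \<le> schr_max a (freq_mult a h) (- (2 powr (- (a * real k)))) (2 powr (- (a * real k))) x"
    by (rule schr_max_nonneg[OF assms(1,2) L h2]) simp
  moreover have "0 \<le> schr_max a h (- (2 powr (- real j))) (2 powr (- real j)) x" for j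
    by (rule schr_max_nonneg[OF assms(1,2) L assms(3)]) simp
  ultimately show ?thesis unfolding rate_max_def
    by (intro add_nonneg_nonneg sum_nonneg mult_nonneg_nonneg) auto
qed

lemma rate_max_bound:
  assumes a: "0 < a" "a < 1" and \<delta>: "0 \<le> \<delta>" "\<delta> < 1" and h: "dyadic_supp (2 ^ k) h" and t: "0 < \<bar>t\<bar>" "\<bar>t\<bar> \<le> 1"
  shows "\<bar>t\<bar> powr (- \<delta>) * norm (schr a (trunc N h) t x - schr a (trunc N h) 0 x) \<le> rate_max a \<delta> k h x"
proof -
  have L: "1 \<le> (2::real) ^ k" by simp
  let ?\<tau> = "2 powr (- (a * real k))"
  let ?D = "norm (schr a (trunc N h) t x - schr a (trunc N h) 0 x)"
  have h2: "dyadic_supp (2 ^ k) (freq_mult a h)" using h a by (auto intro!: dyadic_supp_freq_mult)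
  have A0: "0 \<le> 2 powr (- (a * real k * (1 - \<delta>))) * schr_max a (freq_mult a h) (- ?\<tau>) ?\<tau> x"
    by (intro mult_nonneg_nonneg schr_max_nonneg[OF a L h2]) auto
  have B0: "0 \<le> 2 * 2 powr (real (Suc j) * \<delta>) * schr_max a h (- (2 powr (- real j))) (2 powr (- real j)) x" for j
    by (intro mult_nonneg_nonneg schr_max_nonneg[OF a L h]) auto
  show ?thesis
  proof (cases "\<bar>t\<bar> \<le> ?\<tau>")
    case True
    have "\<bar>t\<bar> powr (- \<delta>) * ?D \<le> \<bar>t\<bar> powr (- \<delta>) * (\<bar>t\<bar> * schr_max a (freq_mult a h) (- ?\<tau>) ?\<tau> x)"
      by (intro mult_left_mono schr_time_difference_le[OF a L h True]) auto
    also have "\<dots> = \<bar>t\<bar> powr (1 - \<delta>) * schr_max a (freq_mult a h) (- ?\<tau>) ?\<tau> x"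
      using t(1) powr_add[of "\<bar>t\<bar>" "- \<delta>" 1] by simp
    also have "\<dots> \<le> ?\<tau> powr (1 - \<delta>) * schr_max a (freq_mult a h) (- ?\<tau>) ?\<tau> x"
      using True \<delta> by (intro mult_right_mono powr_mono2 schr_max_nonneg[OF a L h2]) auto
    also have "?\<tau> powr (1 - \<delta>) = 2 powr (- (a * real k * (1 - \<delta>)))" by (simp add: powr_powr)
    also have "2 powr (- (a * real k * (1 - \<delta>))) * schr_max a (freq_mult a h) (- ?\<tau>) ?\<tau> x \<le> rate_max a \<delta> k h x"
      unfolding rate_max_def by (simp only: le_add_same_cancel1) (intro sum_nonneg B0)
    finally show ?thesis .
  next
    case False
    \<comment> \<open>The dyadic position of t: the integer part of y is the index of the summand
      that contains t.\<close>
    define y where "y = - log 2 \<bar>t\<bar>"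
    have ty: "\<bar>t\<bar> = 2 powr (- y)" using t(1) by (simp add: y_def)
    have y: "0 \<le> y" "y < a * real k"
    proof -
      have "2 powr (- y) \<le> 2 powr 0" using t(2) ty by simp
      then show "0 \<le> y" by (subst (asm) powr_le_cancel_iff) auto
      have "2 powr (- (a * real k)) < 2 powr (- y)" using False ty by simp
      then show "y < a * real k" by (subst (asm) powr_less_cancel_iff) auto
    qed
    define j where "j = nat \<lfloor>y\<rfloor>"
    have j: "real j \<le> y" "y \<le> real (Suc j)" "j \<le> nat \<lfloor>a * real k\<rfloor>"
      using y by (auto simp: j_def of_nat_nat intro!: nat_mono floor_mono) linarith
    have tj: "\<bar>t\<bar> \<le> 2 powr (- real j)" unfolding ty using j by (intro powr_mono) auto
    let ?m = "schr_max a h (- (2 powr (- real j))) (2 powr (- real j)) x"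
    have "\<bar>t\<bar> powr (- \<delta>) = 2 powr (y * \<delta>)" by (simp add: ty powr_powr)
    also have "\<dots> \<le> 2 powr (real (Suc j) * \<delta>)" using j \<delta> by (intro powr_mono mult_right_mono) auto
    finally have t\<delta>: "\<bar>t\<bar> powr (- \<delta>) \<le> 2 powr (real (Suc j) * \<delta>)" .
    have D: "?D \<le> ?m + ?m"
      using tj by (intro order_trans[OF norm_triangle_ineq4] add_mono schr_max_props(2)[OF a L h]) auto
    have "\<bar>t\<bar> powr (- \<delta>) * ?D \<le> 2 powr (real (Suc j) * \<delta>) * (?m + ?m)"
      by (intro mult_mono t\<delta> D) auto
    also have "\<dots> = 2 * 2 powr (real (Suc j) * \<delta>) * ?m" by simp
    also have "\<dots> \<le> (\<Sum>j\<le>nat \<lfloor>a * real k\<rfloor>. 2 * 2 powr (real (Suc j) * \<delta>) * schr_max a h (- (2 powr (- real j))) (2 powr (- real j)) x)"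
      by (rule member_le_sum[of j]) (use j B0 in auto)
    also have "\<dots> \<le> rate_max a \<delta> k h x"
      unfolding rate_max_def using A0 by simp
    finally show ?thesis .
  qed
qed

lemma set_integral_sum:
  fixes f :: "'i \<Rightarrow> 'a \<Rightarrow> real"
  assumes "\<And>i. i \<in> I \<Longrightarrow> set_integrable M A (f i)"
  shows "set_integrable M A (\<lambda>x. \<Sum>i\<in>I. f i x)"
    "(LINT x:A|M. (\<Sum>i\<in>I. f i x)) = (\<Sum>i\<in>I. LINT x:A|M. f i x)"
  unfolding set_integrable_def set_lebesgue_integral_def scaleR_sum_right
  using assms unfolding set_integrable_def
  by (auto intro!: Bochner_Integration.integrable_sum Bochner_Integration.integral_sum)

lemma rate_max_measurable:
  assumes a: "0 < a" "a < 1" and h: "dyadic_supp (2 ^ k) h" and b: "b > 0"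
  shows "set_integrable lborel {- b..b} (rate_max a \<delta> k h)" "rate_max a \<delta> k h \<in> borel_measurable borel"
proof -
  have L: "1 \<le> (2::real) ^ k" by simp
  have h2: "dyadic_supp (2 ^ k) (freq_mult a h)" using h a by (auto intro!: dyadic_supp_freq_mult)
  show "set_integrable lborel {- b..b} (rate_max a \<delta> k h)"
    unfolding rate_max_def
    by (intro set_integral_add(1) set_integral_sum(1) set_integrable_mult_right schr_max_props(3)[OF a L h2]
        schr_max_props(3)[OF a L h] b) auto
  have [measurable]: "schr_max a h (- (2 powr (- real j))) (2 powr (- real j)) \<in> borel_measurable borel" for j
    by (rule schr_max_props(1)[OF a L h]) auto
  have [measurable]: "schr_max a (freq_mult a h) (- (2 powr (- (a * real k)))) (2 powr (- (a * real k))) \<in> borel_measurable borel"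
    by (rule schr_max_props(1)[OF a L h2]) auto
  show "rate_max a \<delta> k h \<in> borel_measurable borel"
    unfolding rate_max_def[abs_def] by measurable
qed

text \<open>Every time block is bounded by the same power of the frequency: the derivative term has
  exponent \<delta> a k, block j has j \<delta> + (a k - j) / 4, and both are at most max (1/4)
  \<delta> * a k up to a constant. At most k + 1 blocks occur, hence \<open>real (Suc k)\<close>;
  e/2 is the loss of the kernel.\<close>

lemma rate_max_estimate:
  assumes a: "0 < a" "a < 1" and \<delta>: "0 \<le> \<delta>" "\<delta> < 1" and e: "0 < e" "e \<le> 1" and b: "b > 0"
  obtains C where "C > 0"
    "\<And>k h. dyadic_supp (2 ^ k) h \<Longrightarrow> (LINT x:{- b..b}|lborel. rate_max a \<delta> k h x) \<le>
      C * real (Suc k) * 2 powr (real k * (max (1 / 4) \<delta> * a + e / 2)) * L2norm h"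
proof -
  obtain C where C: "C > 0"
    "\<And>L h t1 t2. 1 \<le> L \<Longrightarrow> dyadic_supp L h \<Longrightarrow> t1 \<le> t2 \<Longrightarrow>
      (LINT x:{- b..b}|lborel. schr_max a h t1 t2 x) \<le> C * sqrt (L powr e + sqrt ((t2 - t1) * L powr a)) * L2norm h"
    using schr_max_estimate[OF a e b] by blast
  define \<kappa> where "\<kappa> = max (1 / 4) \<delta>"
  have "(LINT x:{- b..b}|lborel. rate_max a \<delta> k h x) \<le>
      12 * C * real (Suc k) * 2 powr (real k * (\<kappa> * a + e / 2)) * L2norm h" if h: "dyadic_supp (2 ^ k) h" for k h
  proof -
    have L: "1 \<le> (2::real) ^ k" by simp
    have Lp: "(2::real) ^ k = 2 powr real k" by (simp add: powr_realpow)
    have h2: "dyadic_supp (2 ^ k) (freq_mult a h)" and n2: "L2norm (freq_mult a h) \<le> (2 * 2 ^ k) powr a * L2norm h"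
      using h a by (auto intro!: dyadic_supp_freq_mult)
    have n2': "L2norm (freq_mult a h) \<le> 2 * 2 powr (a * real k) * L2norm h"
    proof (rule order_trans[OF n2 mult_right_mono[OF _ L2norm_nonneg]])
      have "(2 * 2 ^ k) powr a = 2 powr a * 2 powr (a * real k)" by (simp add: Lp powr_mult powr_powr mult.commute)
      also have "\<dots> \<le> 2 powr 1 * 2 powr (a * real k)" using a by (intro mult_right_mono powr_mono) auto
      finally show "(2 * 2 ^ k) powr a \<le> 2 * 2 powr (a * real k)" by simp
    qed
    define P where "P = 2 powr (real k * (\<kappa> * a + e / 2))"
    have P0: "P \<ge> 0" by (simp add: P_def)
    \<comment> \<open>For times up to 2 powr (- r) with r <= a k both summands under the root are at
      least 1 up to constants, so their sum is controlled by their product, and the root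
      splits.\<close>
    have est: "sqrt ((2 ^ k) powr e + sqrt ((2 powr (- r) - - (2 powr (- r))) * (2 ^ k) powr a)) \<le> 2 * 2 powr (real k * (e / 2) + (a * real k - r) / 4)"
      if r: "r \<le> a * real k" for r
    proof -
      let ?y = "(a * real k - r) / 2"
      have y0: "?y \<ge> 0" using r by simp
      have "(2 powr (- r) - - (2 powr (- r))) * (2 ^ k) powr a = 2 powr 1 * 2 powr (a * real k - r)"
        by (simp add: Lp powr_powr powr_add[symmetric] powr_diff powr_minus field_simps)
      also have "\<dots> \<le> (2 * 2 powr ?y)\<^sup>2"
      proof -
        have "(2 * 2 powr ?y)\<^sup>2 = 4 * 2 powr (a * real k - r)"
          by (simp add: power2_eq_square powr_add[symmetric])
        then show ?thesis by simp
      qed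
      finally have "sqrt ((2 powr (- r) - - (2 powr (- r))) * (2 ^ k) powr a) \<le> 2 * 2 powr ?y"
        by (intro real_le_lsqrt) auto
      moreover have "2 powr ?y \<le> 2 powr (real k * e) * 2 powr ?y" "2 powr (real k * e) \<le> 2 powr (real k * e) * 2 powr ?y"
        using y0 e by (auto simp: powr_add[symmetric] intro!: powr_mono)
      moreover have "(2 ^ k) powr e = 2 powr (real k * e)" by (simp add: Lp powr_powr)
      moreover have "0 \<le> 2 powr (real k * e) * 2 powr ?y" by simp
      ultimately have "(2 ^ k) powr e + sqrt ((2 powr (- r) - - (2 powr (- r))) * (2 ^ k) powr a) \<le> 4 * (2 powr (real k * e) * 2 powr ?y)"
        by linarith
      also have "\<dots> = (2 * 2 powr (real k * (e / 2) + (a * real k - r) / 4))\<^sup>2"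
      proof -
        let ?c = "real k * (e / 2) + (a * real k - r) / 4"
        have "real k * e + ?y = ?c + ?c" by (simp add: field_simps)
        then have "2 powr (real k * e) * 2 powr ?y = 2 powr ?c * 2 powr ?c" by (metis powr_add)
        then show ?thesis by (simp only: power2_eq_square)
      qed
      finally show ?thesis by (intro real_le_lsqrt) auto
    qed
    have A: "2 powr (- (a * real k * (1 - \<delta>))) * (LINT x:{- b..b}|lborel. schr_max a (freq_mult a h) (- (2 powr (- (a * real k)))) (2 powr (- (a * real k))) x)
        \<le> 4 * C * P * L2norm h"
    proof -
      have "(LINT x:{- b..b}|lborel. schr_max a (freq_mult a h) (- (2 powr (- (a * real k)))) (2 powr (- (a * real k))) x)
         \<le> C * sqrt ((2 ^ k) powr e + sqrt ((2 powr (- (a * real k)) - - (2 powr (- (a * real k)))) * (2 ^ k) powr a)) * L2norm (freq_mult a h)"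
        by (rule C(2)[OF L h2]) auto
      also have "\<dots> \<le> C * (2 * 2 powr (real k * (e / 2) + (a * real k - a * real k) / 4)) * (2 * 2 powr (a * real k) * L2norm h)"
        using C(1) a by (intro mult_mono mult_left_mono est n2') (auto simp: L2norm_nonneg)
      also have "\<dots> = C * (2 * 2 powr (real k * (e / 2))) * (2 * 2 powr (a * real k) * L2norm h)"
        by (simp only: diff_self div_0 add_0_right)
      finally have "(LINT x:{- b..b}|lborel. schr_max a (freq_mult a h) (- (2 powr (- (a * real k)))) (2 powr (- (a * real k))) x)
         \<le> C * (2 * 2 powr (real k * (e / 2))) * (2 * 2 powr (a * real k) * L2norm h)" .
      then have "2 powr (- (a * real k * (1 - \<delta>))) * (LINT x:{- b..b}|lborel. schr_max a (freq_mult a h) (- (2 powr (- (a * real k)))) (2 powr (- (a * real k))) x)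
         \<le> 2 powr (- (a * real k * (1 - \<delta>))) * (C * (2 * 2 powr (real k * (e / 2))) * (2 * 2 powr (a * real k) * L2norm h))"
        by (intro mult_left_mono) auto
      also have "\<dots> = 4 * C * 2 powr (real k * (\<delta> * a + e / 2)) * L2norm h"
      proof -
        have ex: "real k * (\<delta> * a + e / 2) = - (a * real k * (1 - \<delta>)) + (real k * (e / 2) + a * real k)"
          by (simp add: field_simps)
        show ?thesis by (simp only: ex powr_add) (simp add: mult_ac)
      qed
      also have "\<dots> \<le> 4 * C * P * L2norm h"
        unfolding P_def \<kappa>_def using C(1) a by (intro mult_right_mono mult_left_mono powr_mono L2norm_nonneg add_right_mono) auto
      finally show ?thesis .
    qed
    have B: "2 * 2 powr (real (Suc j) * \<delta>) * (LINT x:{- b..b}|lborel. schr_max a h (- (2 powr (- real j))) (2 powr (- real j)) x)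
        \<le> 8 * C * P * L2norm h" if j: "j \<le> nat \<lfloor>a * real k\<rfloor>" for j
    proof -
      have jr: "real j \<le> a * real k" using j a by (simp add: le_nat_floor le_nat_iff le_floor_iff)
      have "(LINT x:{- b..b}|lborel. schr_max a h (- (2 powr (- real j))) (2 powr (- real j)) x)
         \<le> C * sqrt ((2 ^ k) powr e + sqrt ((2 powr (- real j) - - (2 powr (- real j))) * (2 ^ k) powr a)) * L2norm h"
        by (rule C(2)[OF L h]) auto
      also have "\<dots> \<le> C * (2 * 2 powr (real k * (e / 2) + (a * real k - real j) / 4)) * L2norm h"
        using C(1) by (intro mult_right_mono mult_left_mono est jr) (auto simp: L2norm_nonneg)
      finally have "2 * 2 powr (real (Suc j) * \<delta>) * (LINT x:{- b..b}|lborel. schr_max a h (- (2 powr (- real j))) (2 powr (- real j)) x)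
         \<le> 2 * 2 powr (real (Suc j) * \<delta>) * (C * (2 * 2 powr (real k * (e / 2) + (a * real k - real j) / 4)) * L2norm h)"
        by (intro mult_left_mono) auto
      also have "\<dots> = 4 * C * 2 powr (real (Suc j) * \<delta> + (real k * (e / 2) + (a * real k - real j) / 4)) * L2norm h"
        by (simp only: powr_add) simp
      also have "\<dots> \<le> 4 * C * 2 powr (1 + real k * (\<kappa> * a + e / 2)) * L2norm h"
      proof (intro mult_right_mono mult_left_mono powr_mono L2norm_nonneg)
        \<comment> \<open>Both \<delta> and 1/4 are raised to \<kappa>, after which the dependence
          on j cancels; the extra 1 pays for \<open>Suc j\<close>.\<close>
        have "real (Suc j) * \<delta> \<le> real j * \<kappa> + 1"
        proof -
          have "real j * \<delta> \<le> real j * \<kappa>" by (intro mult_left_mono) (auto simp: \<kappa>_def)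
          then show ?thesis using \<delta> by (simp add: distrib_right)
        qed
        moreover have "(a * real k - real j) * (1 / 4) \<le> (a * real k - real j) * \<kappa>"
          using jr by (intro mult_left_mono) (auto simp: \<kappa>_def)
        moreover have "real j * \<kappa> + (a * real k - real j) * \<kappa> = real k * (\<kappa> * a)" by (simp add: algebra_simps)
        ultimately show "real (Suc j) * \<delta> + (real k * (e / 2) + (a * real k - real j) / 4) \<le> 1 + real k * (\<kappa> * a + e / 2)"
          unfolding distrib_left by linarith
      qed (use C(1) in auto)
      also have "\<dots> = 8 * C * P * L2norm h" by (simp add: P_def powr_add)
      finally show ?thesis .
    qed
    have int1: "set_integrable lborel {- b..b} (schr_max a (freq_mult a h) (- (2 powr (- (a * real k)))) (2 powr (- (a * real k))))"
      by (rule schr_max_props(3)[OF a L h2 _ b]) auto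
    have int2: "set_integrable lborel {- b..b} (schr_max a h (- (2 powr (- real j))) (2 powr (- real j)))" for j
      by (rule schr_max_props(3)[OF a L h _ b]) auto
    have "(LINT x:{- b..b}|lborel. rate_max a \<delta> k h x) =
       2 powr (- (a * real k * (1 - \<delta>))) * (LINT x:{- b..b}|lborel. schr_max a (freq_mult a h) (- (2 powr (- (a * real k)))) (2 powr (- (a * real k))) x) +
       (\<Sum>j\<le>nat \<lfloor>a * real k\<rfloor>. 2 * 2 powr (real (Suc j) * \<delta>) * (LINT x:{- b..b}|lborel. schr_max a h (- (2 powr (- real j))) (2 powr (- real j)) x))"
      unfolding rate_max_def
      by (subst set_integral_add(2))
         (auto intro!: set_integral_sum(1) set_integrable_mult_right int1 int2 simp: set_integral_sum(2) int2 simp del: of_nat_Suc)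
    also have "\<dots> \<le> 4 * C * P * L2norm h + (\<Sum>j\<le>nat \<lfloor>a * real k\<rfloor>. 8 * C * P * L2norm h)"
      by (intro add_mono A sum_mono B) auto
    also have "\<dots> = 4 * C * P * L2norm h + real (Suc (nat \<lfloor>a * real k\<rfloor>)) * (8 * C * P * L2norm h)" by simp
    also have "\<dots> \<le> real (Suc k) * (4 * C * P * L2norm h) + real (Suc k) * (8 * C * P * L2norm h)"
    proof (intro add_mono mult_right_mono)
      have X: "0 \<le> C * P * L2norm h" using C(1) P0 by (intro mult_nonneg_nonneg) (auto simp: L2norm_nonneg)
      then show "4 * C * P * L2norm h \<le> real (Suc k) * (4 * C * P * L2norm h)" 
        by (intro mult_le_cancel_right1[THEN iffD2]) (auto simp: mult.assoc)
      show "0 \<le> 8 * C * P * L2norm h" using X by simp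
      have "a * real k \<le> 1 * real k" using a by (intro mult_right_mono) auto
      then have "\<lfloor>a * real k\<rfloor> \<le> int k" by (simp add: floor_le_iff)
      then show "real (Suc (nat \<lfloor>a * real k\<rfloor>)) \<le> real (Suc k)" by simp
    qed
    also have "\<dots> = 12 * C * real (Suc k) * P * L2norm h" by (simp add: algebra_simps)
    finally show ?thesis by (simp only: P_def)
  qed
  then show ?thesis using that[of "12 * C"] C(1) by (auto simp: \<kappa>_def)
qed

subsection \<open>Sufficiency\<close>

lemma AE_summable_of_integrals:
  fixes M :: "nat \<Rightarrow> real \<Rightarrow> real"
  assumes M: "\<And>k. set_integrable lborel A (M k)" "\<And>k x. 0 \<le> M k x"
    and sum: "summable (\<lambda>k. LINT x:A|lborel. M k x)"
  shows "AE x in lborel. x \<in> A \<longrightarrow> summable (\<lambda>k. M k x)"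
    "set_integrable lborel A (\<lambda>x. \<Sum>k. M k x)"
proof -
  define F where "F k x = indicator A x *\<^sub>R M k x" for k x
  have Fi: "integrable lborel (F k)" for k using M(1) by (simp add: F_def[abs_def] set_integrable_def)
  then have [measurable]: "F k \<in> borel_measurable lborel" for k by auto
  have F0: "0 \<le> F k x" for k x using M(2) by (simp add: F_def)
  have sumF: "summable (\<lambda>k. LINT x|lborel. F k x)" using sum by (simp add: F_def set_lebesgue_integral_def)
  have "(\<integral>\<^sup>+x. (\<Sum>k. ennreal (F k x)) \<partial>lborel) = (\<Sum>k. \<integral>\<^sup>+x. ennreal (F k x) \<partial>lborel)"
    by (rule nn_integral_suminf) measurable
  also have "\<dots> = (\<Sum>k. ennreal (LINT x|lborel. F k x))"
    by (intro arg_cong[where f = suminf] ext nn_integral_eq_integral Fi AE_I2 F0)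
  also have "\<dots> \<noteq> \<infinity>"
    unfolding infinity_ennreal_def
    by (rule ennreal_suminf_neq_top[OF sumF]) (intro Bochner_Integration.integral_nonneg F0)
  finally have "(\<integral>\<^sup>+x. (\<Sum>k. ennreal (F k x)) \<partial>lborel) \<noteq> \<infinity>" .
  then have "AE x in lborel. (\<Sum>k. ennreal (F k x)) \<noteq> \<infinity>"
    by (intro nn_integral_noteq_infinite) measurable
  then have AEF: "AE x in lborel. summable (\<lambda>k. F k x)"
    by eventually_elim (auto intro!: summable_suminf_not_top F0)
  then show "AE x in lborel. x \<in> A \<longrightarrow> summable (\<lambda>k. M k x)"
    by eventually_elim (auto simp: F_def)
  have "integrable lborel (\<lambda>x. \<Sum>k. F k x)"
    by (rule integrable_suminf[OF Fi]) (use AEF F0 sumF in auto)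
  moreover have "(\<Sum>k. F k x) = indicator A x *\<^sub>R (\<Sum>k. M k x)" for x
    by (simp add: F_def indicator_def)
  ultimately show "set_integrable lborel A (\<lambda>x. \<Sum>k. M k x)" by (simp add: set_integrable_def)
qed

text \<open>Linear in |t| at every x, which beats |t| powr \<delta> because \<delta> < 1. The
  integral may be huge, but for one fixed piece its size does not matter.\<close>

lemma schr_time_difference_L1:
  assumes g: "integrable lborel g" "integrable lborel (freq_mult a g)"
  shows "norm (schr a g t x - schr a g 0 x) \<le> \<bar>t\<bar> * (LINT \<xi>|lborel. norm (freq_mult a g \<xi>))"
proof -
  have eq: "schr a g t x - schr a g 0 x =
    (LINT \<xi>|lborel. cis (x * \<xi> + t * \<bar>\<xi>\<bar> powr a) * g \<xi> - cis (x * \<xi> + 0 * \<bar>\<xi>\<bar> powr a) * g \<xi>)"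
    unfolding schr_def by (intro Bochner_Integration.integral_diff[symmetric] integrable_cis_mult g) auto
  have "norm (LINT \<xi>|lborel. cis (x * \<xi> + t * \<bar>\<xi>\<bar> powr a) * g \<xi> - cis (x * \<xi> + 0 * \<bar>\<xi>\<bar> powr a) * g \<xi>)
    \<le> (LINT \<xi>|lborel. \<bar>t\<bar> * norm (freq_mult a g \<xi>))"
  proof (rule Bochner_Integration.integral_norm_bound_integral)
    show "integrable lborel (\<lambda>\<xi>. cis (x * \<xi> + t * \<bar>\<xi>\<bar> powr a) * g \<xi> - cis (x * \<xi> + 0 * \<bar>\<xi>\<bar> powr a) * g \<xi>)"
      by (intro Bochner_Integration.integrable_diff integrable_cis_mult g) auto
    show "integrable lborel (\<lambda>\<xi>. \<bar>t\<bar> * norm (freq_mult a g \<xi>))" using g by simp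
    fix \<xi>
    have "norm (cis (x * \<xi> + t * \<bar>\<xi>\<bar> powr a) - cis (x * \<xi> + 0 * \<bar>\<xi>\<bar> powr a)) \<le> \<bar>t * \<bar>\<xi>\<bar> powr a\<bar>"
      using norm_cis_diff_le[of "x * \<xi> + t * \<bar>\<xi>\<bar> powr a" "x * \<xi> + 0 * \<bar>\<xi>\<bar> powr a"] by simp
    then have "norm (cis (x * \<xi> + t * \<bar>\<xi>\<bar> powr a) - cis (x * \<xi> + 0 * \<bar>\<xi>\<bar> powr a)) * norm (g \<xi>) \<le> \<bar>t * \<bar>\<xi>\<bar> powr a\<bar> * norm (g \<xi>)"
      by (rule mult_right_mono) simp
    then show "norm (cis (x * \<xi> + t * \<bar>\<xi>\<bar> powr a) * g \<xi> - cis (x * \<xi> + 0 * \<bar>\<xi>\<bar> powr a) * g \<xi>) \<le> \<bar>t\<bar> * norm (freq_mult a g \<xi>)"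
      unfolding left_diff_distrib[symmetric] norm_mult freq_mult_def by (simp add: abs_mult mult.assoc)
  qed
  then show ?thesis unfolding eq by simp
qed

lemma schroedinger_trunc_eq:
  "schroedinger_trunc a f x t N = 1 / (2 * of_real pi) * schr a (trunc N (fourier_fun f)) t x"
proof -
  have "(LINT \<xi>:{- N..N}|lborel. exp (\<i> * of_real (x * \<xi> + t * \<bar>\<xi>\<bar> powr a)) * fourier_fun f \<xi>)
    = schr a (trunc N (fourier_fun f)) t x"
    unfolding schr_def set_lebesgue_integral_def
    by (intro Bochner_Integration.integral_cong) (auto simp: trunc_def indicator_def cis_conv_exp)
  then show ?thesis by (simp add: schroedinger_trunc_def)
qed

lemma one_plus_square_powr_ge:
  fixes s L \<xi> :: real
  assumes "0 \<le> s" "0 < L" "L \<le> \<bar>\<xi>\<bar>"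
  shows "L powr (2 * s) \<le> (1 + \<xi>\<^sup>2) powr s"
proof -
  have "L powr (2 * s) = (L\<^sup>2) powr s"
    using assms by (simp add: powr_powr[symmetric] powr_numeral)
  also have "\<dots> \<le> (1 + \<xi>\<^sup>2) powr s"
  proof (rule powr_mono2)
    have "L\<^sup>2 \<le> \<bar>\<xi>\<bar>\<^sup>2" using assms by (intro power_mono) auto
    then show "L\<^sup>2 \<le> 1 + \<xi>\<^sup>2" by simp
  qed (use assms in auto)
  finally show ?thesis .
qed

lemma sobolev_L2:
  assumes "0 \<le> s" "f \<in> sobolev s"
  shows "fourier_fun f \<in> borel_measurable borel" "integrable lborel (\<lambda>\<xi>. (norm (fourier_fun f \<xi>))\<^sup>2)"
proof -
  show [measurable]: "fourier_fun f \<in> borel_measurable borel"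
    using sobolev_fourier_fun(2)[OF assms(2)] by (simp add: represents_def)
  show "integrable lborel (\<lambda>\<xi>. (norm (fourier_fun f \<xi>))\<^sup>2)"
  proof (rule Bochner_Integration.integrable_bound[OF sobolev_fourier_fun(3)[OF assms(2)]])
    have "1 \<le> (1 + \<xi>\<^sup>2) powr s" for \<xi> :: real
      using assms(1) by (intro ge_one_powr_ge_zero) auto
    then have "1 * (norm (fourier_fun f \<xi>))\<^sup>2 \<le> (1 + \<xi>\<^sup>2) powr s * (norm (fourier_fun f \<xi>))\<^sup>2" for \<xi>
      by (intro mult_right_mono) auto
    then show "AE \<xi> in lborel. norm ((norm (fourier_fun f \<xi>))\<^sup>2) \<le> norm ((1 + \<xi>\<^sup>2) powr s * (norm (fourier_fun f \<xi>))\<^sup>2)"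
      by (intro AE_I2) simp
  qed measurable
qed

definition dyadic_piece :: "(real \<Rightarrow> complex) \<Rightarrow> nat \<Rightarrow> real \<Rightarrow> complex" where
  "dyadic_piece g k \<xi> = (if 2 ^ k \<le> \<bar>\<xi>\<bar> \<and> \<bar>\<xi>\<bar> < 2 ^ Suc k then g \<xi> else 0)"

definition low_piece :: "(real \<Rightarrow> complex) \<Rightarrow> real \<Rightarrow> complex" where
  "low_piece g \<xi> = (if \<bar>\<xi>\<bar> < 1 then g \<xi> else 0)"

lemma sum_dyadic_pieces:
  "low_piece g \<xi> + (\<Sum>k<n. dyadic_piece g k \<xi>) = (if \<bar>\<xi>\<bar> < 2 ^ n then g \<xi> else 0)"
proof (induction n)
  case (Suc n)
  have "low_piece g \<xi> + (\<Sum>k<Suc n. dyadic_piece g k \<xi>) = (low_piece g \<xi> + (\<Sum>k<n. dyadic_piece g k \<xi>)) + dyadic_piece g n \<xi>"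
    by simp
  also have "\<dots> = (if \<bar>\<xi>\<bar> < 2 ^ Suc n then g \<xi> else 0)"
  proof -
    have "\<bar>\<xi>\<bar> < 2 ^ Suc n" if "\<bar>\<xi>\<bar> < 2 ^ n"
      using that zero_less_power[of "2::real" n] unfolding power_Suc by linarith
    then show ?thesis unfolding Suc by (auto simp: dyadic_piece_def simp del: power_Suc)
  qed
  finally show ?case .
qed (simp add: low_piece_def)

text \<open>At almost every x the majorants \<open>M k x\<close> of the pieces are summable.
  Tannery's theorem is then used twice with the same majorant: for the truncation tending to
  infinity, which gives existence of the solution, and for t tending to 0, which gives the rate. The
  representative f0 is the limit of the truncations at t = 0.\<close>

lemma sufficiency:
  assumes a: "0 < a" "a < 1" and \<delta>: "0 \<le> \<delta>" "\<delta> < 1" and s: "max (1 / 4) \<delta> * a < s" and f: "f \<in> sobolev s"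
  shows "converges_ae_with_rate a \<delta> f"
proof -
  define \<kappa> where "\<kappa> = max (1 / 4) \<delta>"
  have \<kappa>: "0 < \<kappa> * a" using a by (simp add: \<kappa>_def)
  have s0: "0 \<le> s" using s \<kappa> by (simp add: \<kappa>_def)
  \<comment> \<open>Of the slack e, one half pays for the loss e/2 in the maximal estimates and the
    other half is the geometric decay \<open>q ^ k\<close> of the pieces.\<close>
  define e where "e = min 1 (s - \<kappa> * a)"
  have e: "0 < e" "e \<le> 1" "\<kappa> * a + e \<le> s" using s by (auto simp: e_def \<kappa>_def)
  define g where "g = fourier_fun f"
  have u: "tempered_distribution f" and gr: "represents (fourier_dist f) g"
    and gs: "integrable lborel (\<lambda>\<xi>. (1 + \<xi>\<^sup>2) powr s * (norm (g \<xi>))\<^sup>2)"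
    using sobolev_fourier_fun[OF f] by (auto simp: g_def)
  have gm[measurable]: "g \<in> borel_measurable borel" and gL2: "integrable lborel (\<lambda>\<xi>. (norm (g \<xi>))\<^sup>2)"
    using sobolev_L2[OF s0 f] by (auto simp: g_def)
  define S where "S = sqrt (LINT \<xi>|lborel. (1 + \<xi>\<^sup>2) powr s * (norm (g \<xi>))\<^sup>2)"
  have S0: "S \<ge> 0" by (simp add: S_def)
  let ?p = "dyadic_piece g"
  have pm[measurable]: "?p k \<in> borel_measurable borel" "low_piece g \<in> borel_measurable borel" for k
    unfolding dyadic_piece_def[abs_def] low_piece_def[abs_def] by measurable
  have pd: "dyadic_supp (2 ^ k) (?p k)" for k
    unfolding dyadic_supp_def
  proof (intro conjI pm allI impI)
    show "integrable lborel (\<lambda>\<xi>. (norm (?p k \<xi>))\<^sup>2)"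
      by (rule Bochner_Integration.integrable_bound[OF gL2]) (auto simp: dyadic_piece_def)
  qed (auto simp: dyadic_piece_def)
  have pn: "L2norm (?p k) \<le> 2 powr (- (real k * s)) * S" for k
  proof -
    have le: "(norm (?p k \<xi>))\<^sup>2 \<le> (2 powr (- (real k * s)))\<^sup>2 * ((1 + \<xi>\<^sup>2) powr s * (norm (g \<xi>))\<^sup>2)" for \<xi>
    proof (cases "2 ^ k \<le> \<bar>\<xi>\<bar>")
      case True
      have "(2 ^ k) powr (2 * s) \<le> (1 + \<xi>\<^sup>2) powr s" using one_plus_square_powr_ge[OF s0 _ True] by simp
      moreover have "(2 ^ k) powr (2 * s) = (2 powr (real k * s))\<^sup>2"
        by (simp add: powr_realpow[symmetric] powr_powr power2_eq_square powr_add[symmetric] mult_ac)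
      ultimately have "1 \<le> (2 powr (- (real k * s)))\<^sup>2 * (1 + \<xi>\<^sup>2) powr s"
        by (simp add: powr_minus field_simps)
      then have "1 * (norm (g \<xi>))\<^sup>2 \<le> (2 powr (- (real k * s)))\<^sup>2 * (1 + \<xi>\<^sup>2) powr s * (norm (g \<xi>))\<^sup>2"
        by (intro mult_right_mono) auto
      then show ?thesis by (auto simp: dyadic_piece_def mult.assoc)
    qed (simp add: dyadic_piece_def)
    have "(LINT \<xi>|lborel. (norm (?p k \<xi>))\<^sup>2) \<le> (LINT \<xi>|lborel. (2 powr (- (real k * s)))\<^sup>2 * ((1 + \<xi>\<^sup>2) powr s * (norm (g \<xi>))\<^sup>2))"
      by (rule integral_mono[OF _ integrable_mult_right[OF gs] le]) (use pd[of k] in \<open>simp add: dyadic_supp_def\<close>)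
    also have "\<dots> = (2 powr (- (real k * s)))\<^sup>2 * (LINT \<xi>|lborel. (1 + \<xi>\<^sup>2) powr s * (norm (g \<xi>))\<^sup>2)"
      by simp
    finally have "L2norm (?p k) \<le> sqrt ((2 powr (- (real k * s)))\<^sup>2 * (LINT \<xi>|lborel. (1 + \<xi>\<^sup>2) powr s * (norm (g \<xi>))\<^sup>2))"
      unfolding L2norm_def by (rule real_sqrt_le_mono)
    then show ?thesis by (simp add: real_sqrt_mult S_def)
  qed
  have L: "1 \<le> (2::real) ^ k" for k by simp
  \<comment> \<open>\<open>rate_max\<close> controls only differences from time 0; the second term
    controls the truncations at time 0 itself.\<close>
  define M where "M k x = rate_max a \<delta> k (?p k) x + schr_max a (?p k) 0 0 x" for k x
  have R0: "0 \<le> rate_max a \<delta> k (?p k) x" and Z0: "0 \<le> schr_max a (?p k) 0 0 x" for k x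
    by (rule rate_max_nonneg[OF a pd], rule schr_max_nonneg[OF a L pd order_refl])
  have M0: "0 \<le> M k x" for k x using R0 Z0 by (simp add: M_def)
  have Mint: "set_integrable lborel {- b..b} (M k)" if "b > 0" for b k
    unfolding M_def[abs_def]
    by (intro set_integral_add(1) rate_max_measurable(1)[OF a pd that] schr_max_props(3)[OF a L pd order_refl that])
  have Msum: "summable (\<lambda>k. LINT x:{- b..b}|lborel. M k x)" if b: "b > 0" for b
  proof -
    obtain C1 where C1: "C1 > 0" "\<And>k h. dyadic_supp (2 ^ k) h \<Longrightarrow> (LINT x:{- b..b}|lborel. rate_max a \<delta> k h x) \<le>
      C1 * real (Suc k) * 2 powr (real k * (\<kappa> * a + e / 2)) * L2norm h"
      using rate_max_estimate[OF a \<delta> e(1,2) b] unfolding \<kappa>_def by blast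
    obtain C2 where C2: "C2 > 0" "\<And>L h t1 t2. 1 \<le> L \<Longrightarrow> dyadic_supp L h \<Longrightarrow> t1 \<le> t2 \<Longrightarrow>
      (LINT x:{- b..b}|lborel. schr_max a h t1 t2 x) \<le> C2 * sqrt (L powr e + sqrt ((t2 - t1) * L powr a)) * L2norm h"
      using schr_max_estimate[OF a e(1,2) b] by blast
    define q where "q = 2 powr (- (e / 2))"
    have q: "0 < q" "q < 1" using e powr_less_mono[of "- (e / 2)" 0 "2::real"] by (auto simp: q_def)
    have le: "(LINT x:{- b..b}|lborel. M k x) \<le> (C1 + C2) * S * (real (Suc k) * q ^ k)" for k
    proof -
      have 0: "(LINT x:{- b..b}|lborel. M k x) = (LINT x:{- b..b}|lborel. rate_max a \<delta> k (?p k) x) + (LINT x:{- b..b}|lborel. schr_max a (?p k) 0 0 x)"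
        unfolding M_def by (rule set_integral_add(2)[OF rate_max_measurable(1)[OF a pd b] schr_max_props(3)[OF a L pd order_refl b]])
      have ex: "2 powr (real k * (\<kappa> * a + e / 2)) * L2norm (?p k) \<le> q ^ k * S"
      proof -
        have "2 powr (real k * (\<kappa> * a + e / 2)) * L2norm (?p k) \<le> 2 powr (real k * (\<kappa> * a + e / 2)) * (2 powr (- (real k * s)) * S)"
          by (intro mult_left_mono pn) auto
        also have "\<dots> = 2 powr (real k * (\<kappa> * a + e / 2) + - (real k * s)) * S" by (simp only: powr_add mult.assoc)
        also have "\<dots> \<le> 2 powr (real k * (- (e / 2))) * S"
        proof (intro mult_right_mono powr_mono S0)
          have "real k * (\<kappa> * a + e / 2 - s) \<le> real k * (- (e / 2))" using e(3) by (intro mult_left_mono) auto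
          then show "real k * (\<kappa> * a + e / 2) + - (real k * s) \<le> real k * (- (e / 2))" by (simp add: right_diff_distrib)
        qed auto
        also have "2 powr (real k * (- (e / 2))) = q ^ k"
          by (simp add: q_def powr_realpow[symmetric] powr_powr mult.commute)
        finally show ?thesis .
      qed
      have "(LINT x:{- b..b}|lborel. rate_max a \<delta> k (?p k) x) \<le> C1 * real (Suc k) * (2 powr (real k * (\<kappa> * a + e / 2)) * L2norm (?p k))"
        using C1(2)[OF pd] by (simp add: mult.assoc)
      also have "\<dots> \<le> C1 * real (Suc k) * (q ^ k * S)"
        using C1(1) by (intro mult_left_mono ex) auto
      finally have 1: "(LINT x:{- b..b}|lborel. rate_max a \<delta> k (?p k) x) \<le> C1 * real (Suc k) * (q ^ k * S)" .
      have "(LINT x:{- b..b}|lborel. schr_max a (?p k) 0 0 x) \<le> C2 * sqrt ((2 ^ k) powr e + sqrt ((0 - 0) * (2 ^ k) powr a)) * L2norm (?p k)"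
        by (rule C2(2)[OF L pd order_refl])
      also have "sqrt ((2 ^ k) powr e + sqrt ((0 - 0) * (2 ^ k) powr a)) = 2 powr (real k * (e / 2))"
      proof -
        have "(2 ^ k) powr e = (2 powr (real k * (e / 2)))\<^sup>2"
          by (simp add: powr_realpow[symmetric] powr_powr power2_eq_square powr_add[symmetric] mult.commute)
        then show ?thesis by simp
      qed
      also have "C2 * 2 powr (real k * (e / 2)) * L2norm (?p k) \<le> C2 * 2 powr (real k * (\<kappa> * a + e / 2)) * L2norm (?p k)"
        using C2(1) \<kappa> by (intro mult_right_mono mult_left_mono powr_mono L2norm_nonneg) auto
      also have "\<dots> \<le> C2 * (q ^ k * S)"
        using C2(1) ex by (simp add: mult.assoc mult_left_mono)
      also have "\<dots> \<le> C2 * real (Suc k) * (q ^ k * S)"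
      proof (rule mult_right_mono)
        show "C2 \<le> C2 * real (Suc k)" using C2(1) by simp
        show "0 \<le> q ^ k * S" using q S0 by simp
      qed
      finally have 2: "(LINT x:{- b..b}|lborel. schr_max a (?p k) 0 0 x) \<le> C2 * real (Suc k) * (q ^ k * S)" .
      show ?thesis unfolding 0 using add_mono[OF 1 2] by (simp only: algebra_simps)
    qed
    have "summable (\<lambda>k. real (Suc k) * q ^ k)"
      using geometric_deriv_sums[of q] q by (simp add: sums_iff)
    then have "summable (\<lambda>k. (C1 + C2) * S * (real (Suc k) * q ^ k))" by (rule summable_mult)
    then show ?thesis
      by (rule summable_comparison_test'[where N = 0])
         (use le M0 in \<open>auto simp: set_lebesgue_integral_def integral_nonneg_AE\<close>)
  qed
  have AEb: "AE x in lborel. \<forall>n::nat. x \<in> {- real (Suc n)..real (Suc n)} \<longrightarrow> summable (\<lambda>k. M k x)"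
    unfolding AE_all_countable
    by (intro allI AE_summable_of_integrals(1) Mint Msum M0) auto
  have AE: "AE x in lborel. summable (\<lambda>k. M k x)"
    using AEb
  proof eventually_elim
    case (elim x)
    obtain n where "\<bar>x\<bar> < real n" using reals_Archimedean2 by blast
    then have "x \<in> {- real (Suc n)..real (Suc n)}" by auto
    then show ?case using elim by blast
  qed
  have lowi: "integrable lborel (low_piece g)" "integrable lborel (freq_mult a (low_piece g))"
  proof -
    have "set_integrable lborel {- 1..1} g" by (rule L2_locally_integrable[OF gm gL2])
    then show i: "integrable lborel (low_piece g)"
      unfolding set_integrable_def
      by (rule Bochner_Integration.integrable_bound) (auto simp: low_piece_def indicator_def)
    have "\<bar>\<xi>\<bar> powr a \<le> 1" if "\<bar>\<xi>\<bar> < 1" for \<xi> :: real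
      using powr_mono2[of a "\<bar>\<xi>\<bar>" 1] that a by simp
    then show "integrable lborel (freq_mult a (low_piece g))"
      by (intro Bochner_Integration.integrable_bound[OF i])
         (auto simp: freq_mult_def[abs_def] low_piece_def norm_mult mult_left_le_one_le)
  qed
  have pi: "integrable lborel (?p k)" "integrable lborel (freq_mult a (?p k))" for k
    using pd[of k] a by (auto intro!: dyadic_supp_integrable[where L = "2 ^ k"] dyadic_supp_freq_mult)
  define Ls where "Ls t x = schr a (low_piece g) t x + (\<Sum>k. schr a (?p k) t x)" for t x
  have bnd: "norm (schr a (trunc N (?p k)) t x) \<le> M k x" if t: "\<bar>t\<bar> \<le> 1" for N k t x
  proof (cases "t = 0")
    case True
    then show ?thesis using schr_max_props(2)[OF a L pd order_refl, of 0 0 N k x for k] R0[of k x]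
      by (simp add: M_def add_increasing)
  next
    case False
    let ?d = "norm (schr a (trunc N (?p k)) t x - schr a (trunc N (?p k)) 0 x)"
    \<comment> \<open>For |t| <= 1 the weight is at least 1, so the weighted bound also bounds the
      bare difference.\<close>
    have "1 \<le> \<bar>t\<bar> powr (- \<delta>)"
      using False t \<delta> powr_mono2'[of "- \<delta>" "\<bar>t\<bar>" 1] by simp
    then have "1 * ?d \<le> \<bar>t\<bar> powr (- \<delta>) * ?d" by (intro mult_right_mono) auto
    also have "\<dots> \<le> rate_max a \<delta> k (?p k) x"
      using False t by (intro rate_max_bound[OF a \<delta> pd]) auto
    finally have "?d \<le> rate_max a \<delta> k (?p k) x" by simp
    moreover have "norm (schr a (trunc N (?p k)) 0 x) \<le> schr_max a (?p k) 0 0 x"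
      by (rule schr_max_props(2)[OF a L pd order_refl]) auto
    moreover have "norm (schr a (trunc N (?p k)) t x) \<le> ?d + norm (schr a (trunc N (?p k)) 0 x)"
      using norm_triangle_ineq[of "schr a (trunc N (?p k)) t x - schr a (trunc N (?p k)) 0 x" "schr a (trunc N (?p k)) 0 x"] by simp
    ultimately show ?thesis by (simp add: M_def)
  qed
  \<comment> \<open>For fixed N only finitely many shells meet [-N, N], so the series is a finite
    sum and needs no convergence argument.\<close>
  have dec: "schr a (trunc N g) t x = schr a (trunc N (low_piece g)) t x + (\<Sum>k. schr a (trunc N (?p k)) t x)" for N t x
  proof -
    obtain n where n: "N < 2 ^ n" using real_arch_pow[of 2 N] by auto
    have "schr a (trunc N (?p k)) t x = 0" if "k \<notin> {..<n}" for k
    proof -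
      have "2 ^ n \<le> (2::real) ^ k" using that by (intro power_increasing) auto
      with n have "N < 2 ^ k" by linarith
      then have "trunc N (?p k) = (\<lambda>\<xi>. 0)" by (auto simp: trunc_def dyadic_piece_def indicator_def fun_eq_iff)
      then show ?thesis by (simp add: schr_def)
    qed
    then have "(\<Sum>k. schr a (trunc N (?p k)) t x) = (\<Sum>k<n. schr a (trunc N (?p k)) t x)"
      by (intro suminf_finite) auto
    moreover have "trunc N g \<xi> = trunc N (low_piece g) \<xi> + (\<Sum>k<n. trunc N (?p k) \<xi>)" for \<xi>
      using sum_dyadic_pieces[of g \<xi> n] n by (auto simp: trunc_def indicator_def)
    then have "schr a (trunc N g) t x = schr a (trunc N (low_piece g)) t x + (\<Sum>k<n. schr a (trunc N (?p k)) t x)"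
      unfolding schr_def
      by (simp add: distrib_left sum_distrib_left integrable_cis_mult integrable_trunc lowi pi)
    ultimately show ?thesis by simp
  qed
  \<comment> \<open>The majorant is uniform in N and in |t| <= 1, so the exceptional set of x does
    not depend on t.\<close>
  have limN: "((\<lambda>N. schr a (trunc N g) t x) \<longlongrightarrow> Ls t x) at_top"
    if x: "summable (\<lambda>k. M k x)" and t: "\<bar>t\<bar> \<le> 1" for t x
    unfolding dec Ls_def
  proof (rule tendsto_add)
    have "\<forall>\<^sub>F N in at_top. trunc N (low_piece g) = low_piece g"
      using eventually_ge_at_top[of 1]
      by eventually_elim (auto simp: trunc_def low_piece_def indicator_def fun_eq_iff)
    then show "((\<lambda>N. schr a (trunc N (low_piece g)) t x) \<longlongrightarrow> schr a (low_piece g) t x) at_top"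
      by (intro tendsto_eventually) (auto elim: eventually_mono)
    have "((\<lambda>N. schr a (trunc N (?p k)) t x) \<longlongrightarrow> schr a (?p k) t x) at_top" for k
    proof -
      have "\<forall>\<^sub>F N in at_top. trunc N (?p k) = ?p k"
        using eventually_ge_at_top[of "2 ^ Suc k"]
        by eventually_elim (auto simp: trunc_def dyadic_piece_def indicator_def fun_eq_iff)
      then show ?thesis by (intro tendsto_eventually) (auto elim: eventually_mono)
    qed
    then show "((\<lambda>N. \<Sum>k. schr a (trunc N (?p k)) t x) \<longlongrightarrow> (\<Sum>k. schr a (?p k) t x)) at_top"
      using bnd[OF t] x
      by (intro tannerys_theorem[where M = "\<lambda>k. M k x", THEN conjunct2, THEN conjunct2]) (auto intro!: always_eventually)
  qed
  define f0 where "f0 x = 1 / (2 * of_real pi) * Ls 0 x" for x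
  have f0m: "f0 \<in> borel_measurable borel"
    unfolding f0_def[abs_def] Ls_def by measurable
  define Mt where "Mt x = (LINT \<xi>|lborel. norm (low_piece g \<xi>)) + (\<Sum>k. M k x)" for x
  have rep: "represents f f0"
  proof (rule represents_of_limit[OF u gr gL2, where N = real and M = Mt])
    show "filterlim real at_top sequentially" by (rule filterlim_real_sequentially)
    have eq: "(LINT \<xi>|lborel. cis (x * \<xi>) * (indicator {- N..N} \<xi> * g \<xi>)) = schr a (trunc N g) 0 x" for x N
      by (simp add: schr_def trunc_def)
    show "AE x in lborel. (\<lambda>j. 1 / (2 * of_real pi) * (LINT \<xi>|lborel. cis (x * \<xi>) * (indicator {- real j..real j} \<xi> * g \<xi>))) \<longlonglongrightarrow> f0 x"
      using AE
    proof eventually_elim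
      case (elim x)
      have "(\<lambda>j. schr a (trunc (real j) g) 0 x) \<longlonglongrightarrow> Ls 0 x"
        by (rule filterlim_compose[OF limN[OF elim] filterlim_real_sequentially]) simp
      then show ?case unfolding eq f0_def by (intro tendsto_mult tendsto_const)
    qed
    show "AE x in lborel. \<forall>j. norm (LINT \<xi>|lborel. cis (x * \<xi>) * (indicator {- real j..real j} \<xi> * g \<xi>)) \<le> Mt x"
      using AE
    proof eventually_elim
      case (elim x)
      have "norm (schr a (trunc N g) 0 x) \<le> Mt x" for N
      proof -
        have "norm (schr a (trunc N (low_piece g)) 0 x) \<le> (LINT \<xi>|lborel. norm (trunc N (low_piece g) \<xi>))"
          by (intro norm_schr_le integrable_trunc lowi)
        also have "\<dots> \<le> (LINT \<xi>|lborel. norm (low_piece g \<xi>))"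
          by (intro integral_mono integrable_norm integrable_trunc lowi norm_trunc_le)
        finally have 1: "norm (schr a (trunc N (low_piece g)) 0 x) \<le> (LINT \<xi>|lborel. norm (low_piece g \<xi>))" .
        have 2: "norm (\<Sum>k. schr a (trunc N (?p k)) 0 x) \<le> (\<Sum>k. M k x)"
          by (rule norm_suminf_le[OF _ elim]) (rule bnd, simp)
        show ?thesis unfolding dec Mt_def by (rule norm_triangle_mono[OF 1 2])
      qed
      then show ?case unfolding eq by blast
    qed
    show "set_integrable lborel {- R..R} Mt" for R
    proof -
      have "set_integrable lborel {- (\<bar>R\<bar> + 1)..\<bar>R\<bar> + 1} Mt"
        unfolding Mt_def[abs_def]
        by (intro set_integral_add(1) AE_summable_of_integrals(2) Mint Msum M0 borel_integrable_atLeastAtMost') auto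
      then show ?thesis by (rule set_integrable_subset) auto
    qed
  qed (rule f0m)
  have conv: "((\<lambda>t. of_real (\<bar>t\<bar> powr (- \<delta>)) * (Ls t x - Ls 0 x)) \<longlongrightarrow> 0) (at 0)"
    if x: "summable (\<lambda>k. M k x)" for x
  proof -
    have small: "((\<lambda>t. of_real (\<bar>t\<bar> powr (- \<delta>)) * (schr a h t x - schr a h 0 x)) \<longlongrightarrow> 0) (at 0)"
      if h: "integrable lborel h" "integrable lborel (freq_mult a h)" for h
    proof (rule Lim_null_comparison)
      let ?I = "LINT \<xi>|lborel. norm (freq_mult a h \<xi>)"
      show "\<forall>\<^sub>F t in at 0. norm (of_real (\<bar>t\<bar> powr (- \<delta>)) * (schr a h t x - schr a h 0 x)) \<le> \<bar>t\<bar> powr (1 - \<delta>) * ?I"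
        using eventually_at_ball'[OF zero_less_one, of "0::real" UNIV]
      proof eventually_elim
        case (elim t)
        then have t: "\<bar>t\<bar> > 0" by simp
        have "norm (of_real (\<bar>t\<bar> powr (- \<delta>)) * (schr a h t x - schr a h 0 x)) \<le> \<bar>t\<bar> powr (- \<delta>) * (\<bar>t\<bar> * ?I)"
          unfolding norm_mult using schr_time_difference_L1[OF h, of t x] by (simp add: mult_left_mono)
        also have "\<dots> = \<bar>t\<bar> powr (1 - \<delta>) * ?I" using t powr_add[of "\<bar>t\<bar>" "- \<delta>" 1] by simp
        finally show ?case .
      qed
      have "((\<lambda>t. \<bar>t\<bar> powr (1 - \<delta>) * ?I) \<longlongrightarrow> \<bar>0\<bar> powr (1 - \<delta>) * ?I) (at (0::real))"
        using \<delta> by (intro tendsto_intros) auto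
      then show "((\<lambda>t. \<bar>t\<bar> powr (1 - \<delta>) * ?I) \<longlongrightarrow> 0) (at 0)" by simp
    qed
    let ?c = "\<lambda>t. complex_of_real (\<bar>t\<bar> powr (- \<delta>))"
    have bd: "norm (schr a (?p k) t x) \<le> M k x" if "\<bar>t\<bar> \<le> 1" for k t
    proof -
      have "trunc (2 ^ Suc k) (?p k) = ?p k" by (auto simp: trunc_def dyadic_piece_def indicator_def fun_eq_iff)
      then show ?thesis using bnd[OF that, of "2 ^ Suc k" k x] by simp
    qed
    have sm: "summable (\<lambda>k. schr a (?p k) t x)" if "\<bar>t\<bar> \<le> 1" for t
      by (rule summable_comparison_test'[OF x, where N = 0]) (rule bd[OF that])
    have bd2: "norm (?c t * (schr a (?p k) t x - schr a (?p k) 0 x)) \<le> M k x" if "0 < \<bar>t\<bar>" "\<bar>t\<bar> \<le> 1" for k t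
    proof -
      have "trunc (2 ^ Suc k) (?p k) = ?p k" by (auto simp: trunc_def dyadic_piece_def indicator_def fun_eq_iff)
      then show ?thesis using rate_max_bound[OF a \<delta> pd[of k] that, of "2 ^ Suc k" x] Z0[of k x] by (simp add: norm_mult M_def)
    qed
    have ev: "\<forall>\<^sub>F t in at (0::real). 0 < \<bar>t\<bar> \<and> \<bar>t\<bar> \<le> 1"
      using eventually_at_ball'[OF zero_less_one, of "0::real" UNIV] by eventually_elim auto
    \<comment> \<open>Each single piece tends to 0 by the linear bound; \<open>bd2\<close> supplies
      the majorant that allows summation over k.\<close>
    have "((\<lambda>t. \<Sum>k. ?c t * (schr a (?p k) t x - schr a (?p k) 0 x)) \<longlongrightarrow> (\<Sum>k. 0)) (at 0)"
    proof (rule tannerys_theorem[where M = "\<lambda>k. M k x", THEN conjunct2, THEN conjunct2])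
      show "((\<lambda>t. ?c t * (schr a (?p k) t x - schr a (?p k) 0 x)) \<longlongrightarrow> 0) (at 0)" for k
        by (rule small[OF pi])
      show "\<forall>\<^sub>F (k, t) in at_top \<times>\<^sub>F at 0. norm (?c t * (schr a (?p k) t x - schr a (?p k) 0 x)) \<le> M k x"
      proof -
        have "\<forall>\<^sub>F (k::nat, t) in at_top \<times>\<^sub>F at (0::real). 0 < \<bar>t\<bar> \<and> \<bar>t\<bar> \<le> 1"
          using ev by (subst eventually_prod2) auto
        then show ?thesis by eventually_elim (use bd2 in auto)
      qed
    qed (use x in auto)
    then have "((\<lambda>t. ?c t * (schr a (low_piece g) t x - schr a (low_piece g) 0 x) + (\<Sum>k. ?c t * (schr a (?p k) t x - schr a (?p k) 0 x))) \<longlongrightarrow> 0 + 0) (at 0)"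
      by (intro tendsto_add small[OF lowi]) simp
    moreover have "\<forall>\<^sub>F t in at 0. ?c t * (schr a (low_piece g) t x - schr a (low_piece g) 0 x) + (\<Sum>k. ?c t * (schr a (?p k) t x - schr a (?p k) 0 x))
        = ?c t * (Ls t x - Ls 0 x)"
      using ev
    proof eventually_elim
      case (elim t)
      have "(\<Sum>k. ?c t * (schr a (?p k) t x - schr a (?p k) 0 x)) = ?c t * ((\<Sum>k. schr a (?p k) t x) - (\<Sum>k. schr a (?p k) 0 x))"
        using sm[of t] sm[of 0] elim by (simp add: suminf_mult suminf_diff summable_diff)
      then show ?case by (simp add: Ls_def algebra_simps)
    qed
    ultimately show ?thesis by (simp add: tendsto_cong)
  qed
  show ?thesis
    unfolding converges_ae_with_rate_def
  proof (intro exI[of _ f0] conjI rep)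
    show "AE x in lborel. (\<forall>\<^sub>F t in at 0. schroedinger_defined a f x t) \<and>
        ((\<lambda>t. of_real (\<bar>t\<bar> powr (- \<delta>)) * (schroedinger a f x t - f0 x)) \<longlongrightarrow> 0) (at 0)"
      using AE
    proof eventually_elim
      case (elim x)
      have lim: "(schroedinger_trunc a f x t \<longlongrightarrow> 1 / (2 * of_real pi) * Ls t x) at_top" if "\<bar>t\<bar> \<le> 1" for t
        unfolding schroedinger_trunc_eq[abs_def] g_def[symmetric]
        by (intro tendsto_mult tendsto_const limN elim that)
      have ev: "\<forall>\<^sub>F t in at (0::real). \<bar>t\<bar> \<le> 1"
        using eventually_at_ball'[OF zero_less_one, of "0::real" UNIV] by eventually_elim auto
      have "\<forall>\<^sub>F t in at 0. schroedinger_defined a f x t"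
        using ev by eventually_elim (use lim in \<open>auto simp: schroedinger_defined_def\<close>)
      moreover have "\<forall>\<^sub>F t in at 0. 1 / (2 * of_real pi) * (of_real (\<bar>t\<bar> powr (- \<delta>)) * (Ls t x - Ls 0 x)) =
          of_real (\<bar>t\<bar> powr (- \<delta>)) * (schroedinger a f x t - f0 x)"
        using ev
      proof eventually_elim
        case (elim t)
        have "schroedinger a f x t = 1 / (2 * of_real pi) * Ls t x"
          unfolding schroedinger_def by (rule tendsto_Lim[OF _ lim[OF elim]]) simp
        then show ?case by (simp add: f0_def algebra_simps)
      qed
      moreover have "((\<lambda>t. 1 / (2 * of_real pi) * (of_real (\<bar>t\<bar> powr (- \<delta>)) * (Ls t x - Ls 0 x))) \<longlongrightarrow> 1 / (2 * of_real pi) * 0) (at 0)"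
        by (intro tendsto_mult tendsto_const conv elim)
      ultimately show ?case by (simp add: tendsto_cong)
    qed
  qed
qed

subsection \<open>Necessity: the gliding hump\<close>

text \<open>Packets at arbitrarily high frequency, arbitrarily small in the Sobolev norm, that are
  displaced by A at every x of the unit interval at one of finitely many arbitrarily short times.
  The allowance \<open>norm (schr a g 0 x)\<close> is there because a focusing comb is only known to
  be large at time t, not far from its initial value. Finiteness of F lets later packets be chosen
  small relative to all earlier test times.\<close>

definition hump :: "real \<Rightarrow> real \<Rightarrow> real \<Rightarrow> bool" where
  "hump a \<delta> s \<longleftrightarrow> (\<forall>\<epsilon>>0. \<forall>A. \<forall>\<tau>>0. \<forall>R. \<exists>L\<ge>R. \<exists>g F. 1 \<le> L \<and> dyadic_supp L g \<and> L powr s * L2norm g \<le> \<epsilon> \<and>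
     finite F \<and> (\<forall>t\<in>F. 0 < \<bar>t\<bar> \<and> \<bar>t\<bar> \<le> \<tau>) \<and>
     (\<forall>x\<in>{0..1}. \<exists>t\<in>F. A - norm (schr a g 0 x) \<le> \<bar>t\<bar> powr (- \<delta>) * norm (schr a g t x - schr a g 0 x)))"

text \<open>The next packet depends on all earlier ones only through the last frequency and two
  running sums, which are carried in the state so that a dependent choice on single states is
  enough.\<close>

lemma hump_sequence:
  assumes a: "0 < a" and \<delta>: "0 \<le> \<delta>" "\<delta> < 1" and h: "hump a \<delta> s"
  obtains L :: "nat \<Rightarrow> real" and g F where
    "\<And>n. 1 \<le> L n" "\<And>n. dyadic_supp (L n) (g n)" "\<And>n. finite (F n)" "\<And>n. 2 * L n + 1 \<le> L (Suc n)"
    "\<And>n. L (Suc n) powr s * L2norm (g (Suc n)) \<le> (1 / 2) ^ n / (1 + (\<Sum>k\<le>n. \<Sum>t\<in>F k. \<bar>t\<bar> powr (- \<delta>)))"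
    "\<And>n t. t \<in> F n \<Longrightarrow> 0 < \<bar>t\<bar>"
    "\<And>n t. t \<in> F (Suc n) \<Longrightarrow> \<bar>t\<bar> \<le> 1 / real (Suc n)"
    "\<And>n t. t \<in> F (Suc n) \<Longrightarrow> \<bar>t\<bar> powr (1 - \<delta>) * (\<Sum>k\<le>n. LINT \<xi>|lborel. norm (freq_mult a (g k) \<xi>)) \<le> 1"
    "\<And>n x. x \<in> {0..1} \<Longrightarrow> \<exists>t\<in>F (Suc n). real n - norm (schr a (g (Suc n)) 0 x) \<le> \<bar>t\<bar> powr (- \<delta>) * norm (schr a (g (Suc n)) t x - schr a (g (Suc n)) 0 x)"
    "L 0 = 1" "g 0 = (\<lambda>\<xi>. 0)"
proof -
  define I where "I g = (LINT \<xi>|lborel. norm (freq_mult a g \<xi>))" for g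
  define q where "q F = (\<Sum>t\<in>F. \<bar>t\<bar> powr (- \<delta>))" for F :: "real set"
  have I0: "0 \<le> I g" for g by (simp add: I_def)
  have q0: "0 \<le> q F" for F by (simp add: q_def sum_nonneg)
  \<comment> \<open>The last two components of a state become the sums over all packets so far of
    \<open>I\<close> and of \<open>q\<close>; the clause for n = 0 starts them correctly.\<close>
  define PP where "PP n st = (case st of (L, g, F, P, Q) \<Rightarrow> 1 \<le> L \<and> dyadic_supp L g \<and> finite F \<and> (\<forall>t\<in>F. 0 < \<bar>t\<bar>) \<and> 0 \<le> P \<and> 0 \<le> Q \<and>
      (n = 0 \<longrightarrow> L = 1 \<and> g = (\<lambda>\<xi>. 0) \<and> P = I g \<and> Q = q F))"
    for n :: nat and st :: "real \<times> (real \<Rightarrow> complex) \<times> real set \<times> real \<times> real"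
  define QQ where "QQ n st st' = (case st of (L, g, F, P, Q) \<Rightarrow> case st' of (L', g', F', P', Q') \<Rightarrow>
      2 * L + 1 \<le> L' \<and> L' powr s * L2norm g' \<le> (1 / 2) ^ n / (1 + Q) \<and>
      (\<forall>t\<in>F'. \<bar>t\<bar> \<le> 1 / real (Suc n) \<and> \<bar>t\<bar> powr (1 - \<delta>) * P \<le> 1) \<and>
      (\<forall>x\<in>{0..1}. \<exists>t\<in>F'. real n - norm (schr a g' 0 x) \<le> \<bar>t\<bar> powr (- \<delta>) * norm (schr a g' t x - schr a g' 0 x)) \<and>
      P' = P + I g' \<and> Q' = Q + q F')"
    for n :: nat and st st' :: "real \<times> (real \<Rightarrow> complex) \<times> real set \<times> real \<times> real"
  have "\<exists>f. \<forall>n. PP n (f n) \<and> QQ n (f n) (f (Suc n))"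
  proof (rule dependent_nat_choice)
    have "dyadic_supp 1 (\<lambda>\<xi>. 0)" by (simp add: dyadic_supp_def)
    then show "\<exists>st. PP 0 st"
      by (intro exI[of _ "(1, \<lambda>\<xi>. 0, {}, I (\<lambda>\<xi>. 0), q {})"]) (simp add: PP_def I0 q0)
  next
    fix st :: "real \<times> (real \<Rightarrow> complex) \<times> real set \<times> real \<times> real" and n
    assume "PP n st"
    moreover obtain L g F P Q where st: "st = (L, g, F, P, Q)" by (cases st) auto
    ultimately have P: "0 \<le> P" and Q: "0 \<le> Q" by (auto simp: PP_def)
    \<comment> \<open>The power 1/(1 - \<delta>) is chosen so that |t| powr (1 - \<delta>) * P <= 1
      for |t| <= \<tau>: earlier packets move by at most 1 after weighting.\<close>
    define \<tau> where "\<tau> = min (1 / real (Suc n)) ((1 / (1 + P)) powr (1 / (1 - \<delta>)))"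
    have \<tau>: "\<tau> > 0" using P by (simp add: \<tau>_def)
    have eps: "(1 / 2) ^ n / (1 + Q) > 0" using Q by (simp add: add_pos_nonneg)
    obtain L' g' F' where *: "2 * L + 1 \<le> L'" "1 \<le> L'" "dyadic_supp L' g'" "L' powr s * L2norm g' \<le> (1 / 2) ^ n / (1 + Q)"
      "finite F'" "\<forall>t\<in>F'. 0 < \<bar>t\<bar> \<and> \<bar>t\<bar> \<le> \<tau>"
      "\<forall>x\<in>{0..1}. \<exists>t\<in>F'. real n - norm (schr a g' 0 x) \<le> \<bar>t\<bar> powr (- \<delta>) * norm (schr a g' t x - schr a g' 0 x)"
      using h eps \<tau> unfolding hump_def by metis
    have tP: "\<bar>t\<bar> powr (1 - \<delta>) * P \<le> 1" if "t \<in> F'" for t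
    proof -
      have "\<bar>t\<bar> \<le> (1 / (1 + P)) powr (1 / (1 - \<delta>))" using * that by (auto simp: \<tau>_def)
      then have "\<bar>t\<bar> powr (1 - \<delta>) \<le> ((1 / (1 + P)) powr (1 / (1 - \<delta>))) powr (1 - \<delta>)"
        using \<delta> by (intro powr_mono2) auto
      also have "\<dots> = 1 / (1 + P)" using \<delta> P by (simp add: powr_powr)
      finally have "\<bar>t\<bar> powr (1 - \<delta>) * P \<le> 1 / (1 + P) * P" by (rule mult_right_mono[OF _ P])
      also have "\<dots> \<le> 1" using P by simp
      finally show ?thesis .
    qed
    show "\<exists>st'. PP (Suc n) st' \<and> QQ n st st'"
      using * P Q I0 q0 tP by (intro exI[of _ "(L', g', F', P + I g', Q + q F')"]) (auto simp: PP_def QQ_def st \<tau>_def)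
  qed
  then obtain f where f: "\<And>n. PP n (f n)" "\<And>n. QQ n (f n) (f (Suc n))" by blast
  define L where "L n = fst (f n)" for n
  define g where "g n = fst (snd (f n))" for n
  define F where "F n = fst (snd (snd (f n)))" for n
  define P where "P n = fst (snd (snd (snd (f n))))" for n
  define Q where "Q n = snd (snd (snd (snd (f n))))" for n
  have fn: "f n = (L n, g n, F n, P n, Q n)" for n
    by (simp add: L_def g_def F_def P_def Q_def)
  note PPn = f(1)[unfolded PP_def fn prod.case]
  note QQn = f(2)[unfolded QQ_def fn prod.case]
  have Pn: "P n = (\<Sum>k\<le>n. I (g k))" for n
  proof (induction n)
    case 0
    then show ?case using PPn[of 0] by simp
  next
    case (Suc n)
    then show ?case using QQn[of n] by simp
  qed
  have Qn: "Q n = (\<Sum>k\<le>n. q (F k))" for n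
  proof (induction n)
    case 0
    then show ?case using PPn[of 0] by simp
  next
    case (Suc n)
    then show ?case using QQn[of n] by simp
  qed
  show ?thesis
  proof (rule that[of L g F])
    show "L 0 = 1" "g 0 = (\<lambda>\<xi>. 0)" using PPn[of 0] by auto
    show "1 \<le> L n" "dyadic_supp (L n) (g n)" "finite (F n)" for n using PPn[of n] by auto
    show "2 * L n + 1 \<le> L (Suc n)" for n using QQn[of n] by auto
    show "L (Suc n) powr s * L2norm (g (Suc n)) \<le> (1 / 2) ^ n / (1 + (\<Sum>k\<le>n. \<Sum>t\<in>F k. \<bar>t\<bar> powr (- \<delta>)))" for n
      using QQn[of n] unfolding Qn q_def by auto
    show "0 < \<bar>t\<bar>" if "t \<in> F n" for n t using PPn[of n] that by auto
    show "\<bar>t\<bar> \<le> 1 / real (Suc n)" if "t \<in> F (Suc n)" for n t using QQn[of n] that by auto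
    show "\<bar>t\<bar> powr (1 - \<delta>) * (\<Sum>k\<le>n. LINT \<xi>|lborel. norm (freq_mult a (g k) \<xi>)) \<le> 1" if "t \<in> F (Suc n)" for n t
      using QQn[of n] that unfolding Pn I_def by auto
    show "\<exists>t\<in>F (Suc n). real n - norm (schr a (g (Suc n)) 0 x) \<le> \<bar>t\<bar> powr (- \<delta>) * norm (schr a (g (Suc n)) t x - schr a (g (Suc n)) 0 x)"
      if "x \<in> {0..1}" for n x
      using QQn[of n] that by blast
  qed
qed

text \<open>A fixed time is the degenerate interval \<open>t1 = t2\<close>. The kernel mass is then
  of order L powr e, whose root L powr (e/2) is below L powr s for e = min 1 s.\<close>

lemma schr_L1_estimate:
  assumes a: "0 < a" "a < 1" and s: "0 < s" and b: "b > 0"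
  obtains C where "C > 0"
    "\<And>L h t. 1 \<le> L \<Longrightarrow> dyadic_supp L h \<Longrightarrow> set_integrable lborel {- b..b} (\<lambda>x. norm (schr a h t x))"
    "\<And>L h t. 1 \<le> L \<Longrightarrow> dyadic_supp L h \<Longrightarrow> (LINT x:{- b..b}|lborel. norm (schr a h t x)) \<le> C * (L powr s * L2norm h)"
proof -
  define e where "e = min 1 s"
  have e: "0 < e" "e \<le> 1" using s by (auto simp: e_def)
  obtain C where C: "C > 0" "\<And>L h t1 t2. 1 \<le> L \<Longrightarrow> dyadic_supp L h \<Longrightarrow> t1 \<le> t2 \<Longrightarrow>
      (LINT x:{- b..b}|lborel. schr_max a h t1 t2 x) \<le> C * sqrt (L powr e + sqrt ((t2 - t1) * L powr a)) * L2norm h"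
    using schr_max_estimate[OF a e b] by blast
  have le: "norm (schr a h t x) \<le> schr_max a h t t x" if L: "1 \<le> L" and h: "dyadic_supp L h" for L h t x
  proof -
    have "trunc (2 * L) h \<xi> = h \<xi>" for \<xi>
    proof (cases "h \<xi> = 0")
      case False
      then have "\<bar>\<xi>\<bar> \<le> 2 * L" using h by (auto simp: dyadic_supp_def)
      then show ?thesis by (simp add: trunc_def indicator_def abs_le_iff)
    qed (simp add: trunc_def)
    then have "trunc (2 * L) h = h" by blast
    then show ?thesis using schr_max_props(2)[OF a L h order_refl, of t t "2 * L" x] by simp
  qed
  have int: "set_integrable lborel {- b..b} (\<lambda>x. norm (schr a h t x))" if L: "1 \<le> L" and h: "dyadic_supp L h" for L h t
    unfolding set_integrable_def
  proof (rule Bochner_Integration.integrable_bound)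
    have [measurable]: "h \<in> borel_measurable borel" using h by (simp add: dyadic_supp_def)
    show "integrable lborel (\<lambda>x. indicator {- b..b} x *\<^sub>R schr_max a h t t x)"
      using schr_max_props(3)[OF a L h order_refl b] by (simp add: set_integrable_def)
    show "AE x in lborel. norm (indicator {- b..b} x *\<^sub>R norm (schr a h t x)) \<le> norm (indicator {- b..b} x *\<^sub>R schr_max a h t t x)"
      using order_trans[OF le[OF L h] abs_ge_self] by (intro AE_I2) (auto simp: indicator_def)
    show "(\<lambda>x. indicator {- b..b} x *\<^sub>R norm (schr a h t x)) \<in> borel_measurable lborel" by measurable
  qed
  have "(LINT x:{- b..b}|lborel. norm (schr a h t x)) \<le> C * (L powr s * L2norm h)" if L: "1 \<le> L" and h: "dyadic_supp L h" for L h t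
  proof -
    have "(LINT x:{- b..b}|lborel. norm (schr a h t x)) \<le> (LINT x:{- b..b}|lborel. schr_max a h t t x)"
      by (rule set_integral_mono[OF int[OF L h] schr_max_props(3)[OF a L h order_refl b]]) (rule le[OF L h])
    also have "\<dots> \<le> C * sqrt (L powr e + sqrt ((t - t) * L powr a)) * L2norm h"
      by (rule C(2)[OF L h order_refl])
    also have "\<dots> \<le> C * L powr s * L2norm h"
    proof (intro mult_right_mono mult_left_mono L2norm_nonneg)
      have "sqrt (L powr e) = L powr (e / 2)" using L by (simp add: powr_half_sqrt[symmetric] powr_powr)
      also have "\<dots> \<le> L powr s" using L s by (intro powr_mono) (auto simp: e_def)
      finally show "sqrt (L powr e + sqrt ((t - t) * L powr a)) \<le> L powr s" by simp
    qed (use C(1) in simp)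
    finally show ?thesis by (simp add: mult.assoc)
  qed
  then show ?thesis using that[of C] C(1) int by blast
qed

lemma fourier_fun_AE:
  assumes "represents (fourier_dist u) g"
  shows "AE \<xi> in lborel. fourier_fun u \<xi> = g \<xi>"
proof -
  have "represents (fourier_dist u) (fourier_fun u)"
    unfolding fourier_fun_def by (rule someI[of "represents (fourier_dist u)" g, OF assms])
  then show ?thesis by (rule represents_unique[OF _ assms])
qed

lemma schr_cong_AE:
  assumes "g \<in> borel_measurable borel" "h \<in> borel_measurable borel" "AE \<xi> in lborel. g \<xi> = h \<xi>"
  shows "schr a g t x = schr a h t x"
  unfolding schr_def
proof (rule integral_cong_AE)
  note [measurable] = assms(1,2)
  show "(\<lambda>\<xi>. cis (x * \<xi> + t * \<bar>\<xi>\<bar> powr a) * g \<xi>) \<in> borel_measurable lborel"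
    "(\<lambda>\<xi>. cis (x * \<xi> + t * \<bar>\<xi>\<bar> powr a) * h \<xi>) \<in> borel_measurable lborel" by measurable
  show "AE \<xi> in lborel. cis (x * \<xi> + t * \<bar>\<xi>\<bar> powr a) * g \<xi> = cis (x * \<xi> + t * \<bar>\<xi>\<bar> powr a) * h \<xi>"
    using assms(3) by eventually_elim simp
qed

lemma AE_lborel_obtain:
  assumes "AE x in lborel. P x"
  obtains x :: real where "x \<in> {0..1}" "P x"
proof -
  have "\<not> (AE x in lborel. x \<notin> {0..1::real})"
  proof
    assume "AE x in lborel. x \<notin> {0..1::real}"
    then have "emeasure lborel {x \<in> space lborel. \<not> (x \<notin> {0..1::real})} = 0"
      by (subst (asm) AE_iff_measurable[OF _ refl]) auto
    moreover have "{x \<in> space lborel. \<not> (x \<notin> {0..1::real})} = {0..1}" by auto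
    ultimately show False by simp
  qed
  then have "\<not> (\<forall>x. P x \<longrightarrow> x \<notin> {0..1})" using assms by (metis (mono_tags, lifting) AE_mp AE_I2)
  then show ?thesis using that by blast
qed

lemma norm_middle_le:
  fixes u b c d :: complex
  assumes "u = b + (d + c)"
  shows "norm d \<le> norm u + (norm b + norm c)"
proof -
  have "d = u - (b + c)" using assms by simp
  then have "norm d \<le> norm u + norm (b + c)" by (simp only: norm_triangle_ineq4)
  then show ?thesis using norm_triangle_ineq[of b c] by linarith
qed

text \<open>At a test time of packet n + 1 that packet alone contributes about n. The earlier
  packets are too slow for so short a time and contribute at most 1. The later ones are so small,
  even weighted by all earlier test times, that they are summable at almost every x. Thus the
  weighted difference is unbounded along test times tending to 0.\<close>

lemma gliding_hump:
  assumes a: "0 < a" "a < 1" and \<delta>: "0 \<le> \<delta>" "\<delta> < 1" and s: "0 < s" and h: "hump a \<delta> s"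
  shows "\<exists>f\<in>sobolev s. \<not> converges_ae_with_rate a \<delta> f"
proof (rule hump_sequence[OF a(1) \<delta> h])
  fix L :: "nat \<Rightarrow> real" and g F
  assume L1: "\<And>n. 1 \<le> L n" and gd: "\<And>n. dyadic_supp (L n) (g n)"
    and Ff: "\<And>n. finite (F n)" and Lstep: "\<And>n. 2 * L n + 1 \<le> L (Suc n)"
    and small: "\<And>n. L (Suc n) powr s * L2norm (g (Suc n)) \<le> (1 / 2) ^ n / (1 + (\<Sum>k\<le>n. \<Sum>t\<in>F k. \<bar>t\<bar> powr (- \<delta>)))"
    and F0: "\<And>n t. t \<in> F n \<Longrightarrow> 0 < \<bar>t\<bar>"
    and F1: "\<And>n t. t \<in> F (Suc n) \<Longrightarrow> \<bar>t\<bar> \<le> 1 / real (Suc n)"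
    and F2: "\<And>n t. t \<in> F (Suc n) \<Longrightarrow> \<bar>t\<bar> powr (1 - \<delta>) * (\<Sum>k\<le>n. LINT \<xi>|lborel. norm (freq_mult a (g k) \<xi>)) \<le> 1"
    and big: "\<And>n x. x \<in> {0..1} \<Longrightarrow> \<exists>t\<in>F (Suc n). real n - norm (schr a (g (Suc n)) 0 x) \<le> \<bar>t\<bar> powr (- \<delta>) * norm (schr a (g (Suc n)) t x - schr a (g (Suc n)) 0 x)"
    and g0: "g 0 = (\<lambda>\<xi>. 0)"
  have gm[measurable]: "g n \<in> borel_measurable borel" for n using gd by (simp add: dyadic_supp_def)
  have gsupp: "L n \<le> \<bar>\<xi>\<bar>" "\<bar>\<xi>\<bar> \<le> 2 * L n" if "g n \<xi> \<noteq> 0" for n \<xi>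
    using gd[of n] that by (auto simp: dyadic_supp_def)
  \<comment> \<open>Consecutive shells are separated, so at most one packet is nonzero at any
    frequency, and truncating at \<open>2 * L n\<close> keeps exactly the packets up to n.\<close>
  have Lmono: "2 * L i < L j" if "i < j" for i j
    using that
  proof (induction j)
    case (Suc j)
    show ?case
    proof (cases "i = j")
      case True
      then show ?thesis using Lstep[of j] by simp
    next
      case False
      then have "2 * L i < L j" using Suc by simp
      also have "\<dots> \<le> L (Suc j)" using Lstep[of j] L1[of j] by simp
      finally show ?thesis .
    qed
  qed simp
  have Ln: "real n \<le> L n" for n
  proof (induction n)
    case 0 then show ?case using L1[of 0] by simp
  next
    case (Suc n) then show ?case using Lstep[of n] L1[of n] by simp
  qed
  have disj: "g j \<xi> = 0" if "g i \<xi> \<noteq> 0" "i \<noteq> j" for i j \<xi>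
  proof (rule ccontr)
    assume "g j \<xi> \<noteq> 0"
    then show False using gsupp[OF that(1)] gsupp[of j \<xi>] that(2) Lmono[of i j] Lmono[of j i]
      by (cases "i < j") (auto simp: not_less)
  qed
  define G where "G \<xi> = (\<Sum>j. g j \<xi>)" for \<xi>
  have Gm[measurable]: "G \<in> borel_measurable borel" unfolding G_def[abs_def] by measurable
  have Gi: "G \<xi> = g i \<xi>" if "g i \<xi> \<noteq> 0" for i \<xi>
    unfolding G_def using disj[OF that] by (subst suminf_finite[of "{i}"]) auto
  have truncG: "trunc (2 * L n) G \<xi> = (\<Sum>j\<le>n. g j \<xi>)" for n \<xi>
  proof (cases "\<exists>i\<le>n. g i \<xi> \<noteq> 0")
    case True
    then obtain i where i: "i \<le> n" "g i \<xi> \<noteq> 0" by blast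
    have "(\<Sum>j\<le>n. g j \<xi>) = (\<Sum>j\<in>{i}. g j \<xi>)"
      using i disj[OF i(2)] by (intro sum.mono_neutral_right) auto
    moreover have "\<bar>\<xi>\<bar> \<le> 2 * L n"
      using gsupp(2)[OF i(2)] Lmono[of i n] L1[of n] i(1) by (cases "i = n") auto
    ultimately show ?thesis using Gi[OF i(2)] by (auto simp: trunc_def indicator_def abs_le_iff)
  next
    case False
    then have "(\<Sum>j\<le>n. g j \<xi>) = 0" by (intro sum.neutral) auto
    moreover have "G \<xi> = 0" if "\<bar>\<xi>\<bar> \<le> 2 * L n"
    proof -
      have "g j \<xi> = 0" for j
      proof (cases "j \<le> n")
        case True then show ?thesis using False by blast
      next
        case jn: False
        then show ?thesis using gsupp(1)[of j \<xi>] Lmono[of n j] that by force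
      qed
      then show ?thesis by (simp add: G_def)
    qed
    ultimately show ?thesis by (auto simp: trunc_def indicator_def abs_le_iff)
  qed
  define eps where "eps n = L n powr s * L2norm (g n)" for n
  define q where "q k = (\<Sum>t\<in>F k. \<bar>t\<bar> powr (- \<delta>))" for k
  have q0: "0 \<le> q k" for k by (simp add: q_def sum_nonneg)
  have eps0: "0 \<le> eps n" for n by (simp add: eps_def L2norm_nonneg)
  have epsQ: "eps (Suc n) * (1 + (\<Sum>k\<le>n. q k)) \<le> (1 / 2) ^ n" for n
  proof -
    have "0 < 1 + (\<Sum>k\<le>n. q k)" using q0 by (simp add: add_pos_nonneg sum_nonneg)
    then show ?thesis using small[of n] by (simp add: eps_def q_def pos_le_divide_eq)
  qed
  have eps_le: "eps (Suc n) \<le> (1 / 2) ^ n" for n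
  proof -
    have "eps (Suc n) * 1 \<le> eps (Suc n) * (1 + (\<Sum>k\<le>n. q k))" using eps0 q0 by (intro mult_left_mono) (auto simp: sum_nonneg)
    then show ?thesis using epsQ[of n] by simp
  qed
  have GL2: "integrable lborel (\<lambda>\<xi>. (1 + \<xi>\<^sup>2) powr s * (norm (G \<xi>))\<^sup>2)"
  proof -
    define M where "M j \<xi> = (1 + \<xi>\<^sup>2) powr s * (norm (g j \<xi>))\<^sup>2" for j \<xi>
    have M0: "0 \<le> M j \<xi>" for j \<xi> by (simp add: M_def)
    have Mle: "M j \<xi> \<le> 5 powr s * (L j powr s)\<^sup>2 * (norm (g j \<xi>))\<^sup>2" for j \<xi>
    proof (cases "g j \<xi> = 0")
      case False
      have "\<xi>\<^sup>2 \<le> (2 * L j)\<^sup>2" using gsupp(2)[OF False] by (metis abs_ge_zero power2_abs power_mono)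
      moreover have "1 \<le> (L j)\<^sup>2" using L1[of j] by (simp add: one_le_power)
      ultimately have "1 + \<xi>\<^sup>2 \<le> 5 * (L j)\<^sup>2" by (simp add: power_mult_distrib)
      then have "(1 + \<xi>\<^sup>2) powr s \<le> (5 * (L j)\<^sup>2) powr s" using s by (intro powr_mono2) auto
      also have "\<dots> = 5 powr s * (L j powr s)\<^sup>2"
        using L1[of j] by (simp add: powr_mult power2_eq_square)
      finally show ?thesis unfolding M_def by (intro mult_right_mono) auto
    qed (simp add: M_def)
    have g2: "integrable lborel (\<lambda>\<xi>. (norm (g j \<xi>))\<^sup>2)" for j using gd[of j] by (simp add: dyadic_supp_def)
    have Mi: "integrable lborel (M j)" for j
      by (rule Bochner_Integration.integrable_bound[OF integrable_mult_right[OF g2[of j], of "5 powr s * (L j powr s)\<^sup>2"]])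
         (use M0 Mle in \<open>auto simp: M_def[abs_def]\<close>)
    have "(LINT \<xi>|lborel. M j \<xi>) \<le> 5 powr s * (eps j)\<^sup>2" for j
    proof -
      have "(LINT \<xi>|lborel. M j \<xi>) \<le> (LINT \<xi>|lborel. 5 powr s * (L j powr s)\<^sup>2 * (norm (g j \<xi>))\<^sup>2)"
        by (rule integral_mono[OF Mi integrable_mult_right[OF g2] Mle])
      also have "\<dots> = 5 powr s * (eps j)\<^sup>2" by (simp add: eps_def L2norm_def power_mult_distrib)
      finally show ?thesis .
    qed
    moreover have sm: "summable (\<lambda>j. 5 powr s * (eps j)\<^sup>2)"
    proof (rule summable_mult)
      have "(eps (Suc j))\<^sup>2 \<le> (1 / 4) ^ j" for j
      proof -
        have "(eps (Suc j))\<^sup>2 \<le> ((1 / 2) ^ j)\<^sup>2" by (intro power_mono eps_le eps0)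
        also have "\<dots> = (1 / 4) ^ j" by (simp add: power2_eq_square flip: power_mult_distrib)
        finally show ?thesis .
      qed
      then have "summable (\<lambda>j. (eps (Suc j))\<^sup>2)"
        by (intro summable_comparison_test'[OF summable_geometric[of "1 / 4"], where N = 0]) auto
      then show "summable (\<lambda>j. (eps j)\<^sup>2)" using summable_Suc_iff[of "\<lambda>j. (eps j)\<^sup>2"] by blast
    qed
    ultimately have "summable (\<lambda>j. LINT \<xi>|lborel. M j \<xi>)"
      by (intro summable_comparison_test'[OF sm, where N = 0])
         (simp add: M0 Bochner_Integration.integral_nonneg)
    then have "set_integrable lborel UNIV (\<lambda>\<xi>. \<Sum>j. M j \<xi>)"
      by (intro AE_summable_of_integrals(2)) (auto simp: set_integrable_def set_lebesgue_integral_def Mi M0)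
    moreover have "(\<Sum>j. M j \<xi>) = (1 + \<xi>\<^sup>2) powr s * (norm (G \<xi>))\<^sup>2" for \<xi>
    proof (cases "\<exists>i. g i \<xi> \<noteq> 0")
      case True
      then obtain i where i: "g i \<xi> \<noteq> 0" by blast
      have "(\<Sum>j. M j \<xi>) = M i \<xi>" using disj[OF i] by (subst suminf_finite[of "{i}"]) (auto simp: M_def)
      then show ?thesis using Gi[OF i] by (simp add: M_def)
    qed (simp add: M_def G_def)
    ultimately show ?thesis by (simp add: set_integrable_def)
  qed
  have GL2': "integrable lborel (\<lambda>\<xi>. (norm (G \<xi>))\<^sup>2)"
  proof (rule Bochner_Integration.integrable_bound[OF GL2])
    have "1 \<le> (1 + \<xi>\<^sup>2) powr s" for \<xi> :: real
      using s by (intro ge_one_powr_ge_zero) auto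
    then have "1 * (norm (G \<xi>))\<^sup>2 \<le> (1 + \<xi>\<^sup>2) powr s * (norm (G \<xi>))\<^sup>2" for \<xi>
      by (intro mult_right_mono) auto
    then show "AE \<xi> in lborel. norm ((norm (G \<xi>))\<^sup>2) \<le> norm ((1 + \<xi>\<^sup>2) powr s * (norm (G \<xi>))\<^sup>2)"
      by (intro AE_I2) simp
  qed measurable
  obtain u where u: "tempered_distribution u" and ur: "represents (fourier_dist u) G"
    using exists_tempered_with_fourier[OF Gm GL2'] by blast
  have us: "u \<in> sobolev s" using u ur GL2 by (auto simp: sobolev_def)
  have ff: "fourier_fun u \<in> borel_measurable borel"
    using sobolev_fourier_fun(2)[OF us] by (simp add: represents_def)
  have trunc_u: "schr a (trunc N (fourier_fun u)) t x = schr a (trunc N G) t x" for N t x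
    using ff fourier_fun_AE[OF ur] by (intro schr_cong_AE) (auto simp: trunc_def elim: eventually_mono)
  have gi: "integrable lborel (g n)" for n by (rule dyadic_supp_integrable[OF gd])
  define S where "S j t x = schr a (g j) t x" for j t x
  have SG: "schr a (trunc (2 * L n) G) t x = (\<Sum>j\<le>n. S j t x)" for n t x
  proof -
    have "trunc (2 * L n) G = (\<lambda>\<xi>. \<Sum>j\<le>n. g j \<xi>)" using truncG by blast
    then show ?thesis unfolding S_def schr_def by (simp add: sum_distrib_left integrable_cis_mult gi)
  qed
  have L_lim: "filterlim (\<lambda>n. 2 * L n) at_top sequentially"
  proof (rule filterlim_at_top_mono[OF filterlim_real_sequentially])
    show "\<forall>\<^sub>F n in sequentially. real n \<le> 2 * L n"
      using Ln L1 by (intro always_eventually allI) (smt (verit))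
  qed
  \<comment> \<open>W j collects the value of packet j at time 0 and its weighted size at every test
    time of an earlier packet. The factor with the sum of \<open>q k\<close> in \<open>epsQ\<close>
    was reserved for this sum.\<close>
  define W where "W j x = norm (S j 0 x) + (\<Sum>k<j. \<Sum>t\<in>F k. \<bar>t\<bar> powr (- \<delta>) * (norm (S j t x) + norm (S j 0 x)))" for j x
  have W0: "0 \<le> W j x" for j x
    unfolding W_def by (intro add_nonneg_nonneg sum_nonneg mult_nonneg_nonneg) auto
  have S0W: "norm (S j 0 x) \<le> W j x" for j x
    unfolding W_def by (simp add: sum_nonneg)
  have StW: "\<bar>t\<bar> powr (- \<delta>) * (norm (S j t x) + norm (S j 0 x)) \<le> W j x" if "t \<in> F k" "k < j" for t k j x
  proof -
    have "\<bar>t\<bar> powr (- \<delta>) * (norm (S j t x) + norm (S j 0 x)) \<le> (\<Sum>t\<in>F k. \<bar>t\<bar> powr (- \<delta>) * (norm (S j t x) + norm (S j 0 x)))"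
      using that Ff by (intro member_le_sum) auto
    also have "\<dots> \<le> (\<Sum>k<j. \<Sum>t\<in>F k. \<bar>t\<bar> powr (- \<delta>) * (norm (S j t x) + norm (S j 0 x)))"
      using that by (intro member_le_sum sum_nonneg) auto
    also have "\<dots> \<le> W j x" by (simp add: W_def)
    finally show ?thesis .
  qed
  have Wint: "set_integrable lborel {- b..b} (W j)" and Wsum: "summable (\<lambda>j. LINT x:{- b..b}|lborel. W j x)" if b: "b > 0" for b j
  proof -
    obtain C where C: "C > 0"
      "\<And>L h t. 1 \<le> L \<Longrightarrow> dyadic_supp L h \<Longrightarrow> set_integrable lborel {- b..b} (\<lambda>x. norm (schr a h t x))"
      "\<And>L h t. 1 \<le> L \<Longrightarrow> dyadic_supp L h \<Longrightarrow> (LINT x:{- b..b}|lborel. norm (schr a h t x)) \<le> C * (L powr s * L2norm h)"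
      using schr_L1_estimate[OF a s b] by blast
    have Si: "set_integrable lborel {- b..b} (\<lambda>x. norm (S j t x))" for j t unfolding S_def by (rule C(2)[OF L1 gd])
    have Sle: "(LINT x:{- b..b}|lborel. norm (S j t x)) \<le> C * eps j" for j t
      unfolding S_def eps_def by (rule C(3)[OF L1 gd])
    have i1: "set_integrable lborel {- b..b} (\<lambda>x. \<bar>t\<bar> powr (- \<delta>) * (norm (S j t x) + norm (S j 0 x)))" for t j
      by (intro set_integrable_mult_right set_integral_add(1) Si)
    have i2: "set_integrable lborel {- b..b} (\<lambda>x. \<Sum>k<j. \<Sum>t\<in>F k. \<bar>t\<bar> powr (- \<delta>) * (norm (S j t x) + norm (S j 0 x)))" for j
      by (intro set_integral_sum(1) i1)
    show Wi: "set_integrable lborel {- b..b} (W j)" for j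
      unfolding W_def[abs_def] by (intro set_integral_add(1) Si i2)
    have Wle: "(LINT x:{- b..b}|lborel. W j x) \<le> 2 * C * (eps j * (1 + (\<Sum>k<j. q k)))" for j
    proof -
      have t: "(LINT x:{- b..b}|lborel. \<bar>t\<bar> powr (- \<delta>) * (norm (S j t x) + norm (S j 0 x))) \<le> \<bar>t\<bar> powr (- \<delta>) * (2 * C * eps j)" for t
      proof -
        have "(LINT x:{- b..b}|lborel. norm (S j t x) + norm (S j 0 x)) \<le> C * eps j + C * eps j"
          unfolding set_integral_add(2)[OF Si Si] by (intro add_mono Sle)
        then show ?thesis unfolding set_integral_mult_right by (intro mult_left_mono) auto
      qed
      have "(LINT x:{- b..b}|lborel. W j x) = (LINT x:{- b..b}|lborel. norm (S j 0 x)) +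
         (\<Sum>k<j. \<Sum>t\<in>F k. LINT x:{- b..b}|lborel. \<bar>t\<bar> powr (- \<delta>) * (norm (S j t x) + norm (S j 0 x)))"
        unfolding W_def set_integral_add(2)[OF Si i2]
        by (subst set_integral_sum(2), intro set_integral_sum(1) i1, subst set_integral_sum(2), rule i1, rule refl)
      also have "\<dots> \<le> C * eps j + (\<Sum>k<j. \<Sum>t\<in>F k. \<bar>t\<bar> powr (- \<delta>) * (2 * C * eps j))"
        by (intro add_mono sum_mono Sle t)
      also have "\<dots> = C * eps j + (\<Sum>k<j. q k) * (2 * C * eps j)"
        by (simp add: q_def sum_distrib_right)
      also have "\<dots> \<le> 2 * C * (eps j * (1 + (\<Sum>k<j. q k)))"
        using C(1) eps0[of j] by (simp add: algebra_simps)
      finally show ?thesis .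
    qed
    have "(LINT x:{- b..b}|lborel. W (Suc j) x) \<le> 2 * C * (1 / 2) ^ j" for j
    proof (rule order_trans[OF Wle[of "Suc j", unfolded lessThan_Suc_atMost]])
      show "2 * C * (eps (Suc j) * (1 + (\<Sum>k\<le>j. q k))) \<le> 2 * C * (1 / 2) ^ j"
        using C(1) by (intro mult_left_mono epsQ) auto
    qed
    then have "summable (\<lambda>j. LINT x:{- b..b}|lborel. W (Suc j) x)"
      by (intro summable_comparison_test'[OF summable_mult[OF summable_geometric[of "1 / 2"], of "2 * C"], where N = 0])
         (auto simp: set_lebesgue_integral_def integral_nonneg_AE W0)
    then show "summable (\<lambda>j. LINT x:{- b..b}|lborel. W j x)"
      using summable_Suc_iff[of "\<lambda>j. LINT x:{- b..b}|lborel. W j x"] by blast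
  qed
  have AEb: "AE x in lborel. \<forall>n::nat. x \<in> {- real (Suc n)..real (Suc n)} \<longrightarrow> summable (\<lambda>k. W k x)"
    unfolding AE_all_countable
    by (intro allI AE_summable_of_integrals(1) Wint Wsum W0) auto
  have AE: "AE x in lborel. summable (\<lambda>k. W k x)"
    using AEb
  proof eventually_elim
    case (elim x)
    obtain n where "\<bar>x\<bar> < real n" using reals_Archimedean2 by blast
    then have "x \<in> {- real (Suc n)..real (Suc n)}" by auto
    then show ?case using elim by blast
  qed
  define f1 where "f1 x = 1 / (2 * of_real pi) * (\<Sum>j. S j 0 x)" for x
  have f1m: "f1 \<in> borel_measurable borel"
    unfolding f1_def[abs_def] S_def by measurable
  have sumS0: "(\<lambda>n. \<Sum>j\<le>n. S j 0 x) \<longlonglongrightarrow> (\<Sum>j. S j 0 x)" if "summable (\<lambda>k. W k x)" for x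
  proof -
    have "summable (\<lambda>j. S j 0 x)"
      by (rule summable_comparison_test'[OF that, where N = 0]) (rule S0W)
    then show ?thesis by (rule summable_LIMSEQ')
  qed
  have rep: "represents u f1"
  proof (rule represents_of_limit[OF u ur GL2' L_lim, where M = "\<lambda>x. \<Sum>k. W k x"])
    have eq: "(LINT \<xi>|lborel. cis (x * \<xi>) * (indicator {- N..N} \<xi> * G \<xi>)) = schr a (trunc N G) 0 x" for x N
      by (simp add: schr_def trunc_def)
    show "AE x in lborel. (\<lambda>j. 1 / (2 * of_real pi) * (LINT \<xi>|lborel. cis (x * \<xi>) * (indicator {- (2 * L j)..2 * L j} \<xi> * G \<xi>))) \<longlonglongrightarrow> f1 x"
      unfolding eq SG f1_def using AE by eventually_elim (intro tendsto_mult tendsto_const sumS0)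
    show "AE x in lborel. \<forall>j. norm (LINT \<xi>|lborel. cis (x * \<xi>) * (indicator {- (2 * L j)..2 * L j} \<xi> * G \<xi>)) \<le> (\<Sum>k. W k x)"
      unfolding eq SG using AE
    proof eventually_elim
      case (elim x)
      have "norm (\<Sum>j\<le>n. S j 0 x) \<le> (\<Sum>k. W k x)" for n
      proof -
        have "norm (\<Sum>j\<le>n. S j 0 x) \<le> (\<Sum>j\<le>n. W j x)" by (rule order_trans[OF norm_sum sum_mono]) (rule S0W)
        also have "\<dots> \<le> (\<Sum>k. W k x)" by (rule sum_le_suminf[OF elim]) (auto simp: W0)
        finally show ?thesis .
      qed
      then show ?case by blast
    qed
    show "set_integrable lborel {- R..R} (\<lambda>x. \<Sum>k. W k x)" for R
    proof -
      have "set_integrable lborel {- (\<bar>R\<bar> + 1)..\<bar>R\<bar> + 1} (\<lambda>x. \<Sum>k. W k x)"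
        by (intro AE_summable_of_integrals(2) Wint Wsum W0) auto
      then show ?thesis by (rule set_integrable_subset) auto
    qed
  qed (rule f1m)
  have "\<not> converges_ae_with_rate a \<delta> u"
  proof
    assume "converges_ae_with_rate a \<delta> u"
    then obtain f0 where f0: "represents u f0" and conv: "AE x in lborel.
        (\<forall>\<^sub>F t in at 0. schroedinger_defined a u x t) \<and>
        ((\<lambda>t. of_real (\<bar>t\<bar> powr (-\<delta>)) * (schroedinger a u x t - f0 x)) \<longlongrightarrow> 0) (at 0)"
      unfolding converges_ae_with_rate_def by blast
    have "AE x in lborel. f0 x = f1 x" by (rule represents_unique[OF f0 rep])
    then have "AE x in lborel. f0 x = f1 x \<and> summable (\<lambda>k. W k x) \<and> (\<forall>\<^sub>F t in at 0. schroedinger_defined a u x t) \<and>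
        ((\<lambda>t. of_real (\<bar>t\<bar> powr (-\<delta>)) * (schroedinger a u x t - f0 x)) \<longlongrightarrow> 0) (at 0)"
      using AE conv by eventually_elim auto
    then obtain x where x: "x \<in> {0..1}" and f01: "f0 x = f1 x" and Wx: "summable (\<lambda>k. W k x)"
      and def: "\<forall>\<^sub>F t in at 0. schroedinger_defined a u x t"
      and lim: "((\<lambda>t. of_real (\<bar>t\<bar> powr (-\<delta>)) * (schroedinger a u x t - f0 x)) \<longlongrightarrow> 0) (at 0)"
      by (rule AE_lborel_obtain) blast
    obtain t where t: "\<And>n. t n \<in> F (Suc n)"
      "\<And>n. real n - norm (S (Suc n) 0 x) \<le> \<bar>t n\<bar> powr (- \<delta>) * norm (S (Suc n) (t n) x - S (Suc n) 0 x)"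
      using big[OF x] unfolding S_def by metis
    have tlim: "filterlim t (at 0) sequentially"
    proof (rule filterlim_atI)
      have "(\<lambda>n. 1 / real (Suc n)) \<longlonglongrightarrow> 0" by (rule LIMSEQ_Suc[OF lim_const_over_n])
      then show "t \<longlonglongrightarrow> 0"
        by (rule Lim_null_comparison[rotated]) (use F1[OF t(1)] in \<open>auto intro!: always_eventually\<close>)
      show "\<forall>\<^sub>F n in sequentially. t n \<noteq> 0" using F0[OF t(1)] by (intro always_eventually) auto
    qed
    define Wt where "Wt = (\<Sum>k. W k x)"
    \<comment> \<open>The loss 1 is due to the packets up to n; the loss Wt covers the packets
      beyond n + 1 and the value of packet n + 1 at time 0.\<close>
    have lower: "real n - 1 - Wt \<le> 2 * pi * norm (of_real (\<bar>t n\<bar> powr (-\<delta>)) * (schroedinger a u x (t n) - f0 x))"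
      if d: "schroedinger_defined a u x (t n)" for n
    proof -
      define r where "r = \<bar>t n\<bar> powr (- \<delta>)"
      have r0: "0 \<le> r" by (simp add: r_def)
      obtain l where l: "(schroedinger_trunc a u x (t n) \<longlongrightarrow> l) at_top"
        using d by (auto simp: schroedinger_defined_def)
      then have sl: "schroedinger a u x (t n) = l"
        unfolding schroedinger_def by (intro tendsto_Lim) auto
      \<comment> \<open>The limit over all truncations exists by assumption, so it may be computed
        along \<open>2 * L m\<close>, where only complete packets occur.\<close>
      have "(\<lambda>m. schroedinger_trunc a u x (t n) (2 * L m)) \<longlonglongrightarrow> l"
        by (rule filterlim_compose[OF l L_lim])
      then have "(\<lambda>m. 1 / (2 * of_real pi) * (\<Sum>j\<le>m. S j (t n) x)) \<longlonglongrightarrow> l"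
        unfolding schroedinger_trunc_eq trunc_u SG .
      moreover have "(\<lambda>m. 1 / (2 * of_real pi) * (\<Sum>j\<le>m. S j 0 x)) \<longlonglongrightarrow> f0 x"
        unfolding f01 f1_def by (intro tendsto_mult tendsto_const sumS0 Wx)
      ultimately have "(\<lambda>m. 1 / (2 * of_real pi) * (\<Sum>j\<le>m. S j (t n) x) - 1 / (2 * of_real pi) * (\<Sum>j\<le>m. S j 0 x)) \<longlonglongrightarrow> l - f0 x"
        by (rule tendsto_diff)
      then have lim2: "(\<lambda>m. 2 * pi * norm (of_real r * (1 / (2 * of_real pi) * (\<Sum>j\<le>m. S j (t n) x) - 1 / (2 * of_real pi) * (\<Sum>j\<le>m. S j 0 x))))
          \<longlonglongrightarrow> 2 * pi * norm (of_real r * (l - f0 x))"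
        by (intro tendsto_mult tendsto_norm tendsto_const)
      have ge: "real n - 1 - Wt \<le> 2 * pi * norm (of_real r * (1 / (2 * of_real pi) * (\<Sum>j\<le>m. S j (t n) x) - 1 / (2 * of_real pi) * (\<Sum>j\<le>m. S j 0 x)))"
        if m: "Suc n \<le> m" for m
      proof -
        let ?D = "\<lambda>j. S j (t n) x - S j 0 x"
        have D_low: "r * norm (\<Sum>j\<le>n. ?D j) \<le> 1"
        proof -
          have "norm (\<Sum>j\<le>n. ?D j) \<le> (\<Sum>j\<le>n. \<bar>t n\<bar> * (LINT \<xi>|lborel. norm (freq_mult a (g j) \<xi>)))"
            unfolding S_def using a
            by (intro order_trans[OF norm_sum] sum_mono schr_time_difference_L1 gi dyadic_supp_integrable[OF dyadic_supp_freq_mult(1)[OF gd]]) auto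
          also have "\<dots> = \<bar>t n\<bar> * (\<Sum>j\<le>n. LINT \<xi>|lborel. norm (freq_mult a (g j) \<xi>))" by (simp add: sum_distrib_left)
          finally have "r * norm (\<Sum>j\<le>n. ?D j) \<le> r * (\<bar>t n\<bar> * (\<Sum>j\<le>n. LINT \<xi>|lborel. norm (freq_mult a (g j) \<xi>)))"
            using r0 by (rule mult_left_mono)
          also have "\<dots> = \<bar>t n\<bar> powr (1 - \<delta>) * (\<Sum>j\<le>n. LINT \<xi>|lborel. norm (freq_mult a (g j) \<xi>))"
            using F0[OF t(1), of n] powr_add[of "\<bar>t n\<bar>" "- \<delta>" 1] by (simp add: r_def)
          also have "\<dots> \<le> 1" by (rule F2[OF t(1)])
          finally show ?thesis .
        qed
        have D_high: "r * norm (\<Sum>j\<in>{Suc (Suc n)..m}. ?D j) \<le> (\<Sum>j\<in>{Suc (Suc n)..m}. W j x)"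
        proof -
          have "r * norm (\<Sum>j\<in>{Suc (Suc n)..m}. ?D j) \<le> r * (\<Sum>j\<in>{Suc (Suc n)..m}. norm (S j (t n) x) + norm (S j 0 x))"
            using r0 by (intro mult_left_mono order_trans[OF norm_sum] sum_mono norm_triangle_ineq4)
          also have "\<dots> \<le> (\<Sum>j\<in>{Suc (Suc n)..m}. W j x)"
            unfolding sum_distrib_left r_def by (intro sum_mono StW[OF t(1)]) auto
          finally show ?thesis .
        qed
        have split: "(\<Sum>j\<le>m. ?D j) = (\<Sum>j\<le>n. ?D j) + (?D (Suc n) + (\<Sum>j\<in>{Suc (Suc n)..m}. ?D j))"
        proof -
          have "{..m} = {..n} \<union> ({Suc n} \<union> {Suc (Suc n)..m})" using m by auto
          then show ?thesis by (simp add: sum.union_disjoint)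
        qed
        have tri: "norm (?D (Suc n)) \<le> norm (\<Sum>j\<le>m. ?D j) + (norm (\<Sum>j\<le>n. ?D j) + norm (\<Sum>j\<in>{Suc (Suc n)..m}. ?D j))"
          by (rule norm_middle_le[OF split])
        have "W (Suc n) x + (\<Sum>j\<in>{Suc (Suc n)..m}. W j x) = (\<Sum>j\<in>{Suc n..m}. W j x)"
          by (rule sum.atLeast_Suc_atMost[OF m, symmetric])
        also have "\<dots> \<le> Wt" unfolding Wt_def by (rule sum_le_suminf[OF Wx]) (auto simp: W0)
        finally have Wle: "W (Suc n) x + (\<Sum>j\<in>{Suc (Suc n)..m}. W j x) \<le> Wt" .
        have "real n \<le> r * norm (?D (Suc n)) + W (Suc n) x"
          using t(2)[of n] S0W[of "Suc n" x] by (simp add: r_def)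
        also have "r * norm (?D (Suc n)) \<le> r * norm (\<Sum>j\<le>m. ?D j) + (r * norm (\<Sum>j\<le>n. ?D j) + r * norm (\<Sum>j\<in>{Suc (Suc n)..m}. ?D j))"
          using mult_left_mono[OF tri r0] by (simp add: distrib_left)
        finally have "real n - 1 - Wt \<le> r * norm (\<Sum>j\<le>m. ?D j)"
          using D_low D_high Wle by linarith
        also have "r * norm (\<Sum>j\<le>m. ?D j) = 2 * pi * norm (of_real r * (1 / (2 * of_real pi) * (\<Sum>j\<le>m. S j (t n) x) - 1 / (2 * of_real pi) * (\<Sum>j\<le>m. S j 0 x)))"
        proof -
          have "of_real r * (1 / (2 * of_real pi) * (\<Sum>j\<le>m. S j (t n) x) - 1 / (2 * of_real pi) * (\<Sum>j\<le>m. S j 0 x)) =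
             of_real (r / (2 * pi)) * (\<Sum>j\<le>m. ?D j)"
            by (simp add: sum_subtractf right_diff_distrib)
          then show ?thesis using r0 by (simp add: norm_mult norm_divide)
        qed
        finally show ?thesis .
      qed
      have "real n - 1 - Wt \<le> 2 * pi * norm (of_real r * (l - f0 x))"
        by (rule LIMSEQ_le_const[OF lim2]) (intro exI[of _ "Suc n"] allI impI ge)
      then show ?thesis by (simp add: r_def sl)
    qed
    have "(\<lambda>n. of_real (\<bar>t n\<bar> powr (-\<delta>)) * (schroedinger a u x (t n) - f0 x)) \<longlonglongrightarrow> 0"
      by (rule filterlim_compose[OF lim tlim])
    then have lim3: "(\<lambda>n. 2 * pi * norm (of_real (\<bar>t n\<bar> powr (-\<delta>)) * (schroedinger a u x (t n) - f0 x))) \<longlonglongrightarrow> 2 * pi * norm (0 :: complex)"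
      by (intro tendsto_mult tendsto_const tendsto_norm)
    have "\<forall>\<^sub>F n in sequentially. 2 * pi * norm (of_real (\<bar>t n\<bar> powr (-\<delta>)) * (schroedinger a u x (t n) - f0 x)) < 1"
      by (rule order_tendstoD(2)[OF lim3]) simp
    moreover have "\<forall>\<^sub>F n in sequentially. schroedinger_defined a u x (t n)"
      using def tlim by (simp add: filterlim_iff)
    moreover have "\<forall>\<^sub>F n in sequentially. real n > Wt + 2"
      using filterlim_real_sequentially by (simp add: filterlim_at_top_dense)
    ultimately have "\<forall>\<^sub>F n in sequentially. False"
    proof eventually_elim
      case (elim n)
      then show ?case using lower[of n] by linarith
    qed
    then show False by simp
  qed
  then show ?thesis using us by blast
qed

section \<open>Construction of humps: single packets and combs\<close>

lemma norm_weighted_integral_ge: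
  fixes k :: "real \<Rightarrow> complex" and g :: "real \<Rightarrow> real"
  assumes k[measurable]: "k \<in> borel_measurable borel" and kb: "\<And>\<xi>. norm (k \<xi>) \<le> B"
    and g: "integrable lborel g" "\<And>\<xi>. 0 \<le> g \<xi>"
    and close: "\<And>\<xi>. g \<xi> \<noteq> 0 \<Longrightarrow> norm (k \<xi> - v) \<le> r"
  shows "(norm v - r) * (LINT \<xi>|lborel. g \<xi>) \<le> norm (LINT \<xi>|lborel. k \<xi> * of_real (g \<xi>))"
proof -
  have [measurable]: "g \<in> borel_measurable borel" using g by auto
  have gi: "integrable lborel (\<lambda>\<xi>. of_real (g \<xi>) :: complex)" using g by simp
  have ki: "integrable lborel (\<lambda>\<xi>. k \<xi> * of_real (g \<xi>))"
  proof (rule Bochner_Integration.integrable_bound)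
    show "integrable lborel (\<lambda>\<xi>. B * g \<xi>)" using g by simp
    have "norm (k \<xi>) * g \<xi> \<le> B * g \<xi>" for \<xi> using kb g by (intro mult_right_mono) auto
    then show "AE \<xi> in lborel. norm (k \<xi> * of_real (g \<xi>)) \<le> norm (B * g \<xi>)"
      using g(2) order_trans[OF norm_ge_zero kb] by (intro AE_I2) (simp add: norm_mult)
  qed measurable
  have eq: "(LINT \<xi>|lborel. (k \<xi> - v) * of_real (g \<xi>)) = (LINT \<xi>|lborel. k \<xi> * of_real (g \<xi>)) - v * of_real (LINT \<xi>|lborel. g \<xi>)"
    using ki gi by (simp add: left_diff_distrib)
  have di: "integrable lborel (\<lambda>\<xi>. (k \<xi> - v) * of_real (g \<xi>))"
    unfolding left_diff_distrib by (intro Bochner_Integration.integrable_diff ki integrable_mult_right gi)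
  have "norm (LINT \<xi>|lborel. (k \<xi> - v) * of_real (g \<xi>)) \<le> (LINT \<xi>|lborel. r * g \<xi>)"
  proof (rule Bochner_Integration.integral_norm_bound_integral[OF di])
    show "integrable lborel (\<lambda>\<xi>. r * g \<xi>)" using g by simp
    fix \<xi>
    show "norm ((k \<xi> - v) * of_real (g \<xi>)) \<le> r * g \<xi>"
      using close[of \<xi>] g(2)[of \<xi>] by (cases "g \<xi> = 0") (auto simp: norm_mult intro!: mult_right_mono)
  qed
  then have 1: "norm ((LINT \<xi>|lborel. k \<xi> * of_real (g \<xi>)) - v * of_real (LINT \<xi>|lborel. g \<xi>)) \<le> r * (LINT \<xi>|lborel. g \<xi>)"
    unfolding eq by simp
  have "norm (v * of_real (LINT \<xi>|lborel. g \<xi>)) = norm v * (LINT \<xi>|lborel. g \<xi>)"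
    using g(2) by (simp add: norm_mult)
  moreover have "norm (v * of_real (LINT \<xi>|lborel. g \<xi>)) - norm (LINT \<xi>|lborel. k \<xi> * of_real (g \<xi>))
      \<le> norm ((LINT \<xi>|lborel. k \<xi> * of_real (g \<xi>)) - v * of_real (LINT \<xi>|lborel. g \<xi>))"
    by (metis norm_minus_commute norm_triangle_ineq2)
  ultimately show ?thesis using 1 by (simp add: left_diff_distrib)
qed

text \<open>The mean value theorem, once for the values and once for the slopes. The factors a and 1
  - a are at most 1 and are dropped. The first bound measures curvature along a comb, the second the
  phase variation over one packet.\<close>

lemma powr_affine_approx:
  fixes a N h :: real
  assumes a: "0 < a" "a < 1" and N: "0 < N" and h: "0 \<le> h"
  shows "\<bar>(N + h) powr a - N powr a - a * N powr (a - 1) * h\<bar> \<le> N powr (a - 2) * h\<^sup>2"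
    and "\<bar>(N + h) powr a - N powr a\<bar> \<le> N powr (a - 1) * h"
proof -
  have slope: "\<bar>(N + h) powr (a - 1) - N powr (a - 1)\<bar> \<le> N powr (a - 2) * h" if "0 \<le> h" for h
  proof (cases "h = 0")
    case False
    then have "N < N + h" using that by simp
    have d: "((\<lambda>x. x powr (a - 1)) has_real_derivative (a - 1) * x powr (a - 2)) (at x)" if "N \<le> x" for x
      using that N by (auto intro!: derivative_eq_intros)
    obtain z where z: "N < z" "z < N + h" "(N + h) powr (a - 1) - N powr (a - 1) = (N + h - N) * ((a - 1) * z powr (a - 2))"
      using MVT2[OF \<open>N < N + h\<close> d] by auto
    have "\<bar>(N + h) powr (a - 1) - N powr (a - 1)\<bar> = h * ((1 - a) * z powr (a - 2))"
      unfolding z(3) using a that by (simp add: abs_mult)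
    also have "\<dots> \<le> h * (1 * N powr (a - 2))"
      using a z N that by (intro mult_left_mono mult_mono powr_mono2') auto
    finally show ?thesis by (simp add: mult.commute)
  qed simp
  show "\<bar>(N + h) powr a - N powr a - a * N powr (a - 1) * h\<bar> \<le> N powr (a - 2) * h\<^sup>2"
  proof (cases "h = 0")
    case False
    then have "N < N + h" using h by simp
    let ?f = "\<lambda>x. x powr a - N powr a - a * N powr (a - 1) * (x - N)"
    have d: "(?f has_real_derivative a * (x powr (a - 1) - N powr (a - 1))) (at x)" if "N \<le> x" for x
      using that N by (auto intro!: derivative_eq_intros simp: algebra_simps)
    obtain z where z: "N < z" "z < N + h" "?f (N + h) - ?f N = (N + h - N) * (a * (z powr (a - 1) - N powr (a - 1)))"
      using MVT2[OF \<open>N < N + h\<close> d] by auto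
    have "\<bar>?f (N + h)\<bar> = h * (a * \<bar>z powr (a - 1) - N powr (a - 1)\<bar>)"
      using z(3) a h by (simp add: abs_mult)
    also have "\<dots> \<le> h * (1 * (N powr (a - 2) * h))"
    proof (intro mult_left_mono mult_mono)
      have "\<bar>z powr (a - 1) - N powr (a - 1)\<bar> \<le> N powr (a - 2) * (z - N)" using slope[of "z - N"] z by simp
      also have "\<dots> \<le> N powr (a - 2) * h" using z by (intro mult_left_mono) auto
      finally show "\<bar>z powr (a - 1) - N powr (a - 1)\<bar> \<le> N powr (a - 2) * h" .
    qed (use a h in auto)
    finally show ?thesis by (simp add: power2_eq_square mult_ac)
  qed simp
  show "\<bar>(N + h) powr a - N powr a\<bar> \<le> N powr (a - 1) * h"
  proof (cases "h = 0")
    case False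
    then have "N < N + h" using h by simp
    have d: "((\<lambda>x. x powr a) has_real_derivative a * x powr (a - 1)) (at x)" if "N \<le> x" for x
      using that N by (auto intro!: derivative_eq_intros)
    obtain z where z: "N < z" "z < N + h" "(N + h) powr a - N powr a = (N + h - N) * (a * z powr (a - 1))"
      using MVT2[OF \<open>N < N + h\<close> d] by auto
    have "\<bar>(N + h) powr a - N powr a\<bar> = h * (a * z powr (a - 1))"
      unfolding z(3) using a h by (simp add: abs_mult)
    also have "\<dots> \<le> h * (1 * N powr (a - 1))"
      using a z N h by (intro mult_left_mono mult_mono powr_mono2') auto
    finally show ?thesis by (simp add: mult.commute)
  qed simp
qed

lemma indicator_hump:
  fixes A :: "real set" and c N :: real
  assumes A: "A \<in> sets borel" "emeasure lborel A = ennreal w" "0 \<le> w" and sub: "\<And>\<xi>. \<xi> \<in> A \<Longrightarrow> N \<le> \<xi> \<and> \<xi> \<le> 2 * N"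
    and N: "0 < N" and c: "0 \<le> c"
  defines "g \<equiv> \<lambda>\<xi>. c * indicator A \<xi>"
  shows "integrable lborel g" "(LINT \<xi>|lborel. g \<xi>) = c * w"
    "dyadic_supp N (\<lambda>\<xi>. of_real (g \<xi>))" "L2norm (\<lambda>\<xi>. of_real (g \<xi>)) = c * sqrt w"
proof -
  have Ai: "integrable lborel (indicator A :: real \<Rightarrow> real)"
    using A by (intro integrable_real_indicator) auto
  have Av: "(LINT \<xi>|lborel. indicator A \<xi>) = w"
    using A by (simp add: measure_def)
  show "integrable lborel g" unfolding g_def using Ai by simp
  show "(LINT \<xi>|lborel. g \<xi>) = c * w" unfolding g_def using Av by simp
  have sq: "(norm (complex_of_real (g \<xi>)))\<^sup>2 = c\<^sup>2 * indicator A \<xi>" for \<xi>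
    by (auto simp: g_def indicator_def power2_eq_square)
  show "dyadic_supp N (\<lambda>\<xi>. of_real (g \<xi>))"
    unfolding dyadic_supp_def sq
  proof (intro conjI allI impI)
    show "(\<lambda>\<xi>. complex_of_real (g \<xi>)) \<in> borel_measurable borel"
      unfolding g_def using A(1) by measurable
    show "integrable lborel (\<lambda>\<xi>. c\<^sup>2 * indicator A \<xi>)" using Ai by simp
    fix \<xi> assume "\<not> (N \<le> \<bar>\<xi>\<bar> \<and> \<bar>\<xi>\<bar> \<le> 2 * N)"
    then have "\<xi> \<notin> A" using sub[of \<xi>] N by auto
    then show "complex_of_real (g \<xi>) = 0" by (simp add: g_def)
  qed
  show "L2norm (\<lambda>\<xi>. of_real (g \<xi>)) = c * sqrt w"
    unfolding L2norm_def sq using Av c by (simp add: real_sqrt_mult)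
qed

lemma eventually_powr_ge:
  fixes p :: real
  assumes "p > 0"
  shows "\<forall>\<^sub>F N in at_top. (B :: real) \<le> N powr p"
proof (rule eventually_mono[OF eventually_ge_at_top])
  fix N :: real assume "\<bar>B\<bar> powr (1 / p) \<le> N"
  then have "(\<bar>B\<bar> powr (1 / p)) powr p \<le> N powr p" using assms by (intro powr_mono2) auto
  then show "B \<le> N powr p" using assms by (simp add: powr_powr)
qed

text \<open>A single frequency packet at frequency about \<open>N\<close>, observed at the time \<open>\<pi> N powr (- a)\<close> at
  which the evolution has turned its phase by half a period.\<close>

lemma hump_rate:
  assumes a: "0 < a" "a < 1" and \<delta>: "0 \<le> \<delta>" "\<delta> < 1" and s: "0 < s" "s < \<delta> * a"
  shows "hump a \<delta> s"
  unfolding hump_def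
proof (intro allI impI)
  fix \<epsilon> A \<tau> R :: real
  assume eps: "0 < \<epsilon>" and tau: "0 < \<tau>"
  have "\<forall>\<^sub>F N in at_top. 8 \<le> N \<and> R \<le> N \<and> pi / \<tau> \<le> N powr a \<and> 16 * \<bar>A\<bar> / \<epsilon> \<le> N powr (\<delta> * a - s)"
    using a s by (intro eventually_conj eventually_ge_at_top eventually_powr_ge) auto
  then obtain N where N: "8 \<le> N" "R \<le> N" "pi / \<tau> \<le> N powr a" "16 * \<bar>A\<bar> / \<epsilon> \<le> N powr (\<delta> * a - s)"
    by (metis (mono_tags, lifting) eventually_at_top_linorder order_refl)
  \<comment> \<open>A packet of height c and width 1/4 has norm c/2, so its weighted norm is
    \<epsilon>/2.\<close>
  define c where "c = \<epsilon> * N powr (- s)"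
  have c: "0 \<le> c" using eps by (simp add: c_def)
  define g where "g = (\<lambda>\<xi>. c * indicator {N..N + 1 / 4} \<xi>)"
  have N0: "0 < N" using N(1) by simp
  have em: "emeasure lborel {N..N + 1 / 4} = ennreal (1 / 4)" by simp
  have sub: "N \<le> \<xi> \<and> \<xi> \<le> 2 * N" if "\<xi> \<in> {N..N + 1 / 4}" for \<xi> using that N(1) by auto
  have w0: "(0::real) \<le> 1 / 4" and ms: "{N..N + 1 / 4} \<in> sets borel" by auto
  have gp: "integrable lborel g" "(LINT \<xi>|lborel. g \<xi>) = c * (1 / 4)"
    "dyadic_supp N (\<lambda>\<xi>. of_real (g \<xi>))" "L2norm (\<lambda>\<xi>. of_real (g \<xi>)) = c * sqrt (1 / 4)"
    unfolding g_def by (rule indicator_hump[OF ms em w0 sub N0 c]; simp)+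
  \<comment> \<open>At frequency N the time phase is exactly pi; over the packet it varies by at
    most pi/(4N).\<close>
  define t where "t = pi * N powr (- a)"
  have t0: "0 < t" using N by (simp add: t_def)
  have tt: "t \<le> \<tau>" using N tau by (simp add: t_def powr_minus field_simps)
  show "\<exists>L\<ge>R. \<exists>g F. 1 \<le> L \<and> dyadic_supp L g \<and> L powr s * L2norm g \<le> \<epsilon> \<and>
     finite F \<and> (\<forall>t\<in>F. 0 < \<bar>t\<bar> \<and> \<bar>t\<bar> \<le> \<tau>) \<and>
     (\<forall>x\<in>{0..1}. \<exists>t\<in>F. A - norm (schr a g 0 x) \<le> \<bar>t\<bar> powr (- \<delta>) * norm (schr a g t x - schr a g 0 x))"
  proof (intro exI[of _ N] exI[of _ "\<lambda>\<xi>. complex_of_real (g \<xi>)"] exI[of _ "{t}"] conjI ballI)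
    show "N powr s * L2norm (\<lambda>\<xi>. complex_of_real (g \<xi>)) \<le> \<epsilon>"
    proof -
      have "sqrt (1 / 4) = (1 / 2 :: real)" by (simp add: real_sqrt_divide)
      then have "N powr s * L2norm (\<lambda>\<xi>. complex_of_real (g \<xi>)) = \<epsilon> * (N powr s * N powr (- s)) / 2"
        unfolding gp(4) c_def by simp
      also have "N powr s * N powr (- s) = 1" using N by (simp flip: powr_add)
      finally show ?thesis using eps by simp
    qed
    fix x :: real assume x: "x \<in> {0..1}"
    let ?G = "\<lambda>\<xi>. complex_of_real (g \<xi>)"
    let ?k = "\<lambda>\<xi>. cis (x * \<xi> + t * \<bar>\<xi>\<bar> powr a) - cis (x * \<xi> + 0 * \<bar>\<xi>\<bar> powr a)"
    have diff: "schr a ?G t x - schr a ?G 0 x = (LINT \<xi>|lborel. ?k \<xi> * of_real (g \<xi>))"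
      unfolding schr_def left_diff_distrib
      by (intro Bochner_Integration.integral_diff[symmetric] integrable_cis_mult) (use gp(1) in auto)
    \<comment> \<open>On the packet the difference of the two phases is close to -2 cis (x N): the
      time factor is off by at most 1/4 and the space factor, doubled, by 1/2. Half of the modulus 2
      therefore survives.\<close>
    have "(norm (- 2 * cis (x * N)) - 1) * (LINT \<xi>|lborel. g \<xi>) \<le> norm (LINT \<xi>|lborel. ?k \<xi> * of_real (g \<xi>))"
    proof (rule norm_weighted_integral_ge[where B = 2])
      show "norm (?k \<xi>) \<le> 2" for \<xi> by (rule order_trans[OF norm_triangle_ineq4]) simp
      show "0 \<le> g \<xi>" for \<xi> using c by (simp add: g_def)
      fix \<xi> assume "g \<xi> \<noteq> 0"
      then have \<xi>: "N \<le> \<xi>" "\<xi> \<le> N + 1 / 4" by (auto simp: g_def indicator_def split: if_splits)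
      have "\<bar>\<xi> powr a - N powr a\<bar> \<le> N powr (a - 1) * (\<xi> - N)"
        using powr_affine_approx(2)[OF a, of N "\<xi> - N"] N \<xi> by simp
      also have "\<dots> \<le> N powr (a - 1) * (1 / 4)" using \<xi> by (intro mult_left_mono) auto
      finally have "t * \<bar>\<xi> powr a - N powr a\<bar> \<le> t * (N powr (a - 1) * (1 / 4))" using t0 by (intro mult_left_mono) auto
      also have "t * (N powr (a - 1) * (1 / 4)) = pi / (4 * N)"
        using N by (simp add: t_def powr_diff powr_minus field_simps)
      also have "pi / (4 * N) \<le> 1 / 4" using N pi_less_4 by (simp add: field_simps)
      finally have close: "t * \<bar>\<xi> powr a - N powr a\<bar> \<le> 1 / 4" .
      have 1: "\<bar>t * \<bar>\<xi>\<bar> powr a - pi\<bar> \<le> 1 / 4"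
      proof -
        have "t * N powr a = pi" using N by (simp add: t_def powr_minus)
        then have "t * \<bar>\<xi>\<bar> powr a - pi = t * (\<xi> powr a - N powr a)" using \<xi> N by (simp add: right_diff_distrib)
        then show ?thesis using close t0 by (simp add: abs_mult)
      qed
      have e1: "norm (cis (t * \<bar>\<xi>\<bar> powr a) - cis pi) \<le> 1 / 4" using norm_cis_diff_le 1 by (rule order_trans)
      have e2: "norm (cis (x * \<xi>) - cis (x * N)) \<le> 1 / 4"
      proof -
        have "\<bar>x * \<xi> - x * N\<bar> = x * (\<xi> - N)" using x \<xi> by (simp add: right_diff_distrib[symmetric] abs_mult)
        also have "\<dots> \<le> 1 * (1 / 4)" using x \<xi> by (intro mult_mono) auto
        finally show ?thesis using norm_cis_diff_le[of "x * \<xi>" "x * N"] by simp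
      qed
      have "?k \<xi> - - 2 * cis (x * N) = cis (x * \<xi>) * (cis (t * \<bar>\<xi>\<bar> powr a) - cis pi) + - 2 * (cis (x * \<xi>) - cis (x * N))"
        by (simp add: cis_mult[symmetric] algebra_simps)
      also have "norm \<dots> \<le> 1 / 4 + 2 * (1 / 4)"
      proof (rule norm_triangle_mono)
        show "norm (cis (x * \<xi>) * (cis (t * \<bar>\<xi>\<bar> powr a) - cis pi)) \<le> 1 / 4"
          using e1 unfolding norm_mult by simp
        have "norm (- 2 * (cis (x * \<xi>) - cis (x * N))) = 2 * norm (cis (x * \<xi>) - cis (x * N))"
          unfolding norm_mult by simp
        then show "norm (- 2 * (cis (x * \<xi>) - cis (x * N))) \<le> 2 * (1 / 4)" using e2 by linarith
      qed
      finally show "norm (?k \<xi> - - 2 * cis (x * N)) \<le> 1" by simp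
    qed (use gp in auto)
    then have low: "c / 4 \<le> norm (schr a ?G t x - schr a ?G 0 x)"
      unfolding diff gp(2) by (simp add: norm_mult)
    have "\<bar>A\<bar> \<le> N powr (\<delta> * a) * (c / 16)"
    proof -
      have "\<bar>A\<bar> \<le> N powr (\<delta> * a - s) * \<epsilon> / 16" using N(4) eps by (simp add: field_simps)
      also have "\<dots> = N powr (\<delta> * a) * (c / 16)"
        using N by (simp add: c_def powr_diff powr_minus field_simps)
      finally show ?thesis .
    qed
    also have "\<dots> \<le> (4 * t powr (- \<delta>)) * (c / 16)"
    proof (intro mult_right_mono)
      have "t powr (- \<delta>) = pi powr (- \<delta>) * N powr (\<delta> * a)"
        using N by (simp add: t_def powr_mult powr_powr mult.commute)
      moreover have "1 / 4 \<le> pi powr (- \<delta>)"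
      proof -
        have "pi powr (- 1) \<le> pi powr (- \<delta>)" using \<delta> pi_ge_two by (intro powr_mono) auto
        moreover have "1 / 4 \<le> pi powr (- 1)" using pi_less_4 pi_gt_zero by (simp add: powr_minus field_simps)
        ultimately show ?thesis by linarith
      qed
      moreover have "1 / 4 * N powr (\<delta> * a) \<le> pi powr (- \<delta>) * N powr (\<delta> * a)"
        using calculation(2) by (rule mult_right_mono) simp
      ultimately have "1 / 4 * N powr (\<delta> * a) \<le> t powr (- \<delta>)" by linarith
      then show "N powr (\<delta> * a) \<le> 4 * t powr (- \<delta>)" by simp
    qed (use c in simp)
    also have "\<dots> = t powr (- \<delta>) * (c / 4)" by simp
    also have "\<dots> \<le> t powr (- \<delta>) * norm (schr a ?G t x - schr a ?G 0 x)"
      by (intro mult_left_mono low) auto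
    also have "\<dots> = \<bar>t\<bar> powr (- \<delta>) * norm (schr a ?G t x - schr a ?G 0 x)" using t0 by simp
    finally have "\<bar>A\<bar> \<le> \<bar>t\<bar> powr (- \<delta>) * norm (schr a ?G t x - schr a ?G 0 x)" .
    then have "A - norm (schr a ?G 0 x) \<le> \<bar>t\<bar> powr (- \<delta>) * norm (schr a ?G t x - schr a ?G 0 x)"
      using norm_ge_zero[of "schr a ?G 0 x"] by linarith
    then show "\<exists>t\<in>{t}. A - norm (schr a ?G 0 x) \<le> \<bar>t\<bar> powr (- \<delta>) * norm (schr a ?G t x - schr a ?G 0 x)"
      by (rule bexI[OF _ singletonI])
  next
    fix t' assume "t' \<in> {t}"
    then show "0 < \<bar>t'\<bar>" "\<bar>t'\<bar> \<le> \<tau>" using t0 tt by auto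
  qed (use N(1,2) gp(3) in simp_all)
qed

lemma emeasure_comb:
  fixes N D w :: real
  assumes "0 \<le> w" "w < D"
  shows "emeasure lborel (\<Union>l<m. {N + D * real l..N + D * real l + w}) = ennreal (real m * w)"
proof -
  have sep: "N + D * real k + w < N + D * real l" if "k < l" for k l
  proof -
    have "D * (real k + 1) \<le> D * real l" using that assms by (intro mult_left_mono) auto
    then show ?thesis using assms by (simp add: algebra_simps)
  qed
  have "disjoint_family_on (\<lambda>l. {N + D * real l..N + D * real l + w}) {..<m}"
    unfolding disjoint_family_on_def
  proof (intro ballI impI)
    fix k l :: nat assume "k \<noteq> l"
    then consider "k < l" | "l < k" by linarith
    then show "{N + D * real k..N + D * real k + w} \<inter> {N + D * real l..N + D * real l + w} = {}"
      by cases (use sep in fastforce)+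
  qed
  then have "(\<Sum>l<m. emeasure lborel {N + D * real l..N + D * real l + w}) = emeasure lborel (\<Union>l<m. {N + D * real l..N + D * real l + w})"
    by (intro sum_emeasure) auto
  moreover have "emeasure lborel {N + D * real l..N + D * real l + w} = ennreal w" for l
    using assms by simp
  ultimately show ?thesis using assms by (simp add: ennreal_mult ennreal_of_nat_eq_real_of_nat)
qed

text \<open>x is reduced modulo d and the remainder is rounded up to a multiple of d/n.\<close>

lemma grid_approx:
  fixes x d :: real
  assumes x: "0 \<le> x" "x \<le> 1" and d: "0 < d" and n: "0 < n"
  obtains i j where "i \<in> {1..n}" "0 \<le> d * of_int j" "d * of_int j \<le> 1"
    "\<bar>x - d * of_int j - d * real i / real n\<bar> \<le> d / real n"
proof -
  define j where "j = \<lfloor>x / d\<rfloor>"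
  define y where "y = (x / d - of_int j) * real n"
  have y: "0 \<le> y" "y < real n" using n unfolding y_def j_def
    by (auto simp: mult_less_cancel_right2) linarith
  \<comment> \<open>Rounding up keeps i >= 1, so that the time attached to i is nonzero.\<close>
  define i where "i = nat \<lfloor>y\<rfloor> + 1"
  have iy: "y < real i" "real i \<le> y + 1" using y(1) by (auto simp: i_def) linarith
  show ?thesis
  proof (rule that)
    have "real i < real n + 1" using iy y by linarith
    then have "i < n + 1" by linarith
    then show "i \<in> {1..n}" by (simp add: i_def)
    have "0 \<le> j" using x d by (simp add: j_def)
    then show "0 \<le> d * of_int j" using d by simp
    have "d * of_int j \<le> d * (x / d)" using d unfolding j_def by (intro mult_left_mono) auto
    then show "d * of_int j \<le> 1" using x d by simp
    have "x - d * of_int j - d * real i / real n = (y - real i) * (d / real n)"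
      using d n by (simp add: y_def field_simps)
    also have "\<bar>\<dots>\<bar> = \<bar>y - real i\<bar> * (d / real n)" using d by (simp add: abs_mult)
    also have "\<dots> \<le> 1 * (d / real n)" using iy d by (intro mult_right_mono) auto
    finally show "\<bar>x - d * of_int j - d * real i / real n\<bar> \<le> d / real n" by simp
  qed
qed

text \<open>Stationary comb: for \<open>t = - y N powr (1 - a) / a\<close> the linear part of the phase in \<open>h\<close> is
  \<open>(x - y) h\<close>, and shifting \<open>x\<close> by \<open>j d\<close> changes the phase on the teeth \<open>h \<approx> D l\<close>, \<open>D d = 2 \<pi>\<close>, only by
  multiples of \<open>2 \<pi>\<close>.\<close>

lemma comb_phase:
  fixes a N D d x y t h H \<eta> e :: real and j :: int and l :: nat
  assumes a: "0 < a" "a < 1" and N: "0 < N" and D: "D * d = 2 * pi"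
    and h: "h = D * real l + \<eta>" "0 \<le> h" "h \<le> H" and eta: "0 \<le> \<eta>"
    and j: "0 \<le> d * of_int j" "d * of_int j \<le> 1" and xy: "\<bar>x - d * of_int j - y\<bar> \<le> e"
    and t: "t = - (y * N powr (1 - a) / a)" "\<bar>t\<bar> \<le> 1"
  shows "norm (cis (x * (N + h) + t * (N + h) powr a) - cis (x * N + t * N powr a))
    \<le> \<eta> + e * H + N powr (a - 2) * H\<^sup>2"
proof -
  define r where "r = (N + h) powr a - N powr a - a * N powr (a - 1) * h"
  have r: "\<bar>r\<bar> \<le> N powr (a - 2) * h\<^sup>2" unfolding r_def by (rule powr_affine_approx(1)[OF a N h(2)])
  \<comment> \<open>The phase error left after removing 2 pi j l: the width of the tooth, the
    distance of the reduced position from y, and the curvature of the symbol.\<close>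
  define E where "E = d * of_int j * \<eta> + (x - d * of_int j - y) * h + t * r"
  have e0: "0 \<le> e" using xy by linarith
  have "N powr (1 - a) * N powr (a - 1) = 1" using N by (simp flip: powr_add)
  then have ta: "t * (a * N powr (a - 1)) = - y" using a unfolding t(1) by (simp add: field_simps)
  have "x * (N + h) + t * (N + h) powr a = x * N + t * N powr a + x * h + t * (a * N powr (a - 1)) * h + t * r"
    by (simp add: r_def algebra_simps)
  also have "\<dots> = x * N + t * N powr a + E + (x - (x - d * of_int j)) * (D * real l)"
    unfolding ta E_def h(1) by (simp add: algebra_simps)
  also have "(x - (x - d * of_int j)) * (D * real l) = D * d * (of_int j * real l)" by simp
  also have "\<dots> = 2 * pi * of_int (j * int l)" unfolding D by simp
  finally have ph: "x * (N + h) + t * (N + h) powr a = (x * N + t * N powr a + E) + 2 * pi * of_int (j * int l)" .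
  have "cis (x * (N + h) + t * (N + h) powr a) = cis (x * N + t * N powr a + E) * cis (2 * pi * of_int (j * int l))"
    unfolding ph by (rule cis_mult[symmetric])
  also have "cis (2 * pi * of_int (j * int l)) = 1" by (rule cis_multiple_2pi) (rule Ints_of_int)
  finally have "norm (cis (x * (N + h) + t * (N + h) powr a) - cis (x * N + t * N powr a)) \<le> \<bar>E\<bar>"
    using norm_cis_diff_le[of "x * N + t * N powr a + E" "x * N + t * N powr a"] by simp
  also have "\<bar>E\<bar> \<le> \<bar>d * of_int j * \<eta>\<bar> + \<bar>(x - d * of_int j - y) * h\<bar> + \<bar>t * r\<bar>" unfolding E_def by linarith
  also have "\<bar>d * of_int j * \<eta>\<bar> \<le> 1 * \<eta>" unfolding abs_mult[of "d * of_int j"] using j eta by (intro mult_mono) auto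
  also have "\<bar>(x - d * of_int j - y) * h\<bar> \<le> e * H" unfolding abs_mult using xy h e0 by (intro mult_mono) auto
  also have "\<bar>t * r\<bar> \<le> 1 * (N powr (a - 2) * H\<^sup>2)"
    unfolding abs_mult
  proof (intro mult_mono t(2))
    show "\<bar>r\<bar> \<le> N powr (a - 2) * H\<^sup>2"
      using r h by (rule_tac order_trans[OF r]) (intro mult_left_mono power_mono, auto)
  qed auto
  finally show ?thesis by simp
qed

text \<open>With m teeth the value at a focus is of order c m while the L2 norm is of order c sqrt
  m, a gain of sqrt m. The curvature error N powr (a - 2) * H^2 limits the length H of the comb to
  order N powr (1 - a/2). As the teeth are about N powr (1 - a) apart, m is of order N powr (a/2),
  and the gain N powr (a/4) beats N powr s.\<close>

lemma hump_max:
  assumes a: "0 < a" "a < 1" and \<delta>: "0 \<le> \<delta>" "\<delta> < 1" and s: "0 < s" "s < a / 4"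
  shows "hump a \<delta> s"
  unfolding hump_def
proof (intro allI impI)
  fix \<epsilon> A \<tau>' R :: real
  assume eps: "0 < \<epsilon>" and tau': "0 < \<tau>'"
  \<comment> \<open>Times at most 1 serve twice: in the curvature error of
    \<open>comb_phase\<close>, and to make the weight |t| powr (- \<delta>) at least 1.\<close>
  define \<tau> where "\<tau> = min \<tau>' 1"
  have tau: "0 < \<tau>" "\<tau> \<le> 1" "\<tau> \<le> \<tau>'" using tau' by (auto simp: \<tau>_def)
  \<comment> \<open>Chosen so that the comb length \<open>D * Y\<close> is N powr (1 - a/2) / 2, the
    value at which the curvature error is exactly 1/4.\<close>
  define \<kappa> where "\<kappa> = a * \<tau> / (8 * pi)"
  have k0: "0 < \<kappa>" using a tau by (simp add: \<kappa>_def)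
  have "\<forall>\<^sub>F N in at_top. 1 \<le> N \<and> R \<le> N \<and> 1 / (2 * \<kappa>) \<le> N powr (a / 2) \<and> 8 * \<bar>A\<bar> / (\<epsilon> * sqrt \<kappa>) \<le> N powr (a / 4 - s)"
    using a s by (intro eventually_conj eventually_ge_at_top eventually_powr_ge) auto
  then obtain N where N: "1 \<le> N" "R \<le> N" "1 / (2 * \<kappa>) \<le> N powr (a / 2)" "8 * \<bar>A\<bar> / (\<epsilon> * sqrt \<kappa>) \<le> N powr (a / 4 - s)"
    by (metis (mono_tags, lifting) eventually_at_top_linorder order_refl)
  have N0: "0 < N" using N by simp
  \<comment> \<open>The distance travelled in time \<tau> at the group velocity a * N powr (a - 1):
    the available times move the focus over one full spatial period d of the comb.\<close>
  define d where "d = a * \<tau> * N powr (a - 1)"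
  have d: "0 < d" "d \<le> 1"
  proof -
    show "0 < d" using a tau N0 by (simp add: d_def)
    have "N powr (a - 1) \<le> N powr 0" using N a by (intro powr_mono) auto
    then have "a * \<tau> * N powr (a - 1) \<le> 1 * 1 * 1" using a tau N0 by (intro mult_mono) auto
    then show "d \<le> 1" by (simp add: d_def)
  qed
  define D where "D = 2 * pi / d"
  have Dd: "D * d = 2 * pi" using d by (simp add: D_def)
  have D1: "1 \<le> D" using d pi_ge_two by (simp add: D_def field_simps)
  define Y where "Y = 2 * \<kappa> * N powr (a / 2)"
  have Y1: "1 \<le> Y" using N(3) k0 by (simp add: Y_def field_simps)
  define m where "m = nat \<lfloor>Y\<rfloor>"
  have m: "real m \<le> Y" "Y / 2 \<le> real m" "1 \<le> m"
  proof -
    have "1 \<le> \<lfloor>Y\<rfloor>" using Y1 by simp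
    then have "real m = of_int \<lfloor>Y\<rfloor>" "1 \<le> real_of_int \<lfloor>Y\<rfloor>" by (auto simp: m_def)
    then show "real m \<le> Y" "Y / 2 \<le> real m" "1 \<le> m" by linarith+
  qed
  define H where "H = D * real m"
  have DY: "D * Y = N powr (1 - a / 2) / 2"
  proof -
    have e: "N powr (1 - a / 2) * N powr (a - 1) = N powr (a / 2)" using N0 by (simp flip: powr_add)
    have "D * Y = 2 * pi * (a * \<tau> / (4 * pi)) * N powr (a / 2) / d" unfolding D_def Y_def \<kappa>_def by simp
    also have "\<dots> = (a * \<tau> * N powr (a - 1)) * N powr (1 - a / 2) / (2 * d)" unfolding e[symmetric] by simp
    also have "\<dots> = N powr (1 - a / 2) / 2" unfolding d_def[symmetric] using d by simp
    finally show ?thesis .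
  qed
  have H: "0 \<le> H" "H \<le> N powr (1 - a / 2) / 2"
  proof -
    show "0 \<le> H" using D1 by (simp add: H_def)
    have "H \<le> D * Y" unfolding H_def using m D1 by (intro mult_left_mono) auto
    then show "H \<le> N powr (1 - a / 2) / 2" unfolding DY .
  qed
  have HN: "H \<le> N"
  proof -
    have "N powr (1 - a / 2) \<le> N powr 1" using N a by (intro powr_mono) auto
    then show ?thesis using H N by simp
  qed
  have Hsq: "N powr (a - 2) * H\<^sup>2 \<le> 1 / 4"
  proof -
    have "H\<^sup>2 \<le> (N powr (1 - a / 2) / 2)\<^sup>2" using H by (intro power_mono) auto
    also have "\<dots> = N powr (2 - a) / 4"
      using N0 by (simp add: power_divide power2_eq_square flip: powr_add)
    finally have "N powr (a - 2) * H\<^sup>2 \<le> N powr (a - 2) * (N powr (2 - a) / 4)" by (intro mult_left_mono) auto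
    also have "\<dots> = 1 / 4" using N0 by (simp flip: powr_add)
    finally show ?thesis .
  qed
  \<comment> \<open>The grid of times is fine enough that the rounding error d/n, multiplied by the
    comb length H = D m, is at most 2 pi m / n <= 1/8.\<close>
  define n where "n = nat \<lceil>16 * pi * real m\<rceil>"
  have n: "16 * pi * real m \<le> real n" unfolding n_def by (rule real_nat_ceiling_ge)
  have "0 < 16 * pi * real m" using m(3) by simp
  then have n0: "0 < n" using n by (auto intro: Nat.gr0I)
  have dnH: "d / real n * H \<le> 1 / 8"
  proof -
    have "d / real n * H = D * d * real m / real n" by (simp add: H_def)
    also have "\<dots> \<le> 1 / 8" unfolding Dd using n n0 by (simp add: field_simps)
    finally show ?thesis .
  qed
  define S where "S = (\<Union>l<m. {N + D * real l..N + D * real l + 1 / 16})"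
  have tooth: "D * real l + \<eta> \<le> H" if "l < m" "\<eta> \<le> 1" for l \<eta>
  proof -
    have "D * (real l + 1) \<le> D * real m" using that D1 by (intro mult_left_mono) auto
    then show ?thesis using D1 that by (simp add: H_def algebra_simps)
  qed
  define w where "w = real m * (1 / 16)"
  have w: "0 \<le> w" by (simp add: w_def)
  have Sm: "S \<in> sets borel" by (simp add: S_def)
  have Se: "emeasure lborel S = ennreal w"
    unfolding S_def w_def by (rule emeasure_comb) (use D1 in auto)
  have Ssub: "N \<le> \<xi> \<and> \<xi> \<le> 2 * N" if xS: "\<xi> \<in> S" for \<xi>
  proof -
    obtain l where l: "l < m" "N + D * real l \<le> \<xi>" "\<xi> \<le> N + D * real l + 1 / 16"
      using xS unfolding S_def by (elim UN_E) auto
    have "0 \<le> D * real l" using D1 by simp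
    then show ?thesis using l tooth[OF l(1), of "1 / 16"] HN by simp
  qed
  \<comment> \<open>The L2 norm is c * sqrt m / 4, so the weighted norm is exactly
    \<epsilon>.\<close>
  define c where "c = 4 * \<epsilon> * N powr (- s) / sqrt (real m)"
  have c: "0 \<le> c" using eps by (simp add: c_def)
  define g where "g = (\<lambda>\<xi>. c * indicator S \<xi>)"
  have gp: "integrable lborel g" "(LINT \<xi>|lborel. g \<xi>) = c * w"
    "dyadic_supp N (\<lambda>\<xi>. of_real (g \<xi>))" "L2norm (\<lambda>\<xi>. of_real (g \<xi>)) = c * sqrt w"
    unfolding g_def by (rule indicator_hump[OF Sm Se w Ssub N0 c]; simp)+
  let ?G = "\<lambda>\<xi>. complex_of_real (g \<xi>)"
  define F where "F = (\<lambda>i. - (d * real i / real n * N powr (1 - a) / a)) ` {1..n}"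
  have Ft: "0 < \<bar>t\<bar> \<and> \<bar>t\<bar> \<le> \<tau>" if tF: "t \<in> F" for t
  proof -
    obtain i where i: "1 \<le> i" "i \<le> n" "t = - (d * real i / real n * N powr (1 - a) / a)"
      using tF unfolding F_def by (elim imageE) auto
    have pos: "0 < d * real i / real n * N powr (1 - a) / a" using i d n0 N0 a by simp
    have "d * real i / real n * N powr (1 - a) / a = real i / real n * (d * N powr (1 - a) / a)" by simp
    also have "\<dots> \<le> 1 * (d * N powr (1 - a) / a)" using i n0 d a by (intro mult_right_mono) auto
    also have "\<dots> = \<tau>"
    proof -
      have "N powr (a - 1) * N powr (1 - a) = 1" using N0 by (simp flip: powr_add)
      then show ?thesis using a by (simp add: d_def)
    qed
    finally show ?thesis using pos unfolding i(3) by linarith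
  qed
  have sm: "sqrt (real m) * sqrt (real m) = real m" by simp
  have sm0: "0 < sqrt (real m)" using m(3) by simp
  have A: "\<bar>A\<bar> \<le> c * w / 2"
  proof -
    have "\<kappa> * N powr (a / 2) \<le> real m" using m(2) by (simp add: Y_def)
    then have "sqrt (\<kappa> * N powr (a / 2)) \<le> sqrt (real m)" by simp
    moreover have "sqrt (N powr (a / 2)) = N powr (a / 4)" using N0 by (simp add: powr_half_sqrt[symmetric] powr_powr)
    ultimately have q: "sqrt \<kappa> * N powr (a / 4) \<le> sqrt (real m)" by (simp add: real_sqrt_mult)
    have "\<bar>A\<bar> \<le> N powr (a / 4 - s) * (\<epsilon> * sqrt \<kappa>) / 8" using N(4) eps k0 by (simp add: field_simps)
    also have "N powr (a / 4 - s) = N powr (a / 4) * N powr (- s)" by (simp flip: powr_add)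
    also have "N powr (a / 4) * N powr (- s) * (\<epsilon> * sqrt \<kappa>) / 8 = \<epsilon> * N powr (- s) / 8 * (sqrt \<kappa> * N powr (a / 4))" by simp
    also have "\<dots> \<le> \<epsilon> * N powr (- s) / 8 * sqrt (real m)" using q eps by (intro mult_left_mono) auto
    also have "\<dots> = c * w / 2" unfolding c_def w_def using sm0 sm by (simp add: field_simps)
    finally show ?thesis .
  qed
  show "\<exists>L\<ge>R. \<exists>g F. 1 \<le> L \<and> dyadic_supp L g \<and> L powr s * L2norm g \<le> \<epsilon> \<and>
     finite F \<and> (\<forall>t\<in>F. 0 < \<bar>t\<bar> \<and> \<bar>t\<bar> \<le> \<tau>') \<and>
     (\<forall>x\<in>{0..1}. \<exists>t\<in>F. A - norm (schr a g 0 x) \<le> \<bar>t\<bar> powr (- \<delta>) * norm (schr a g t x - schr a g 0 x))"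
  proof (rule exI[of _ N], rule conjI[OF N(2)], rule exI[of _ ?G], rule exI[of _ F], intro conjI ballI)
    show "N powr s * L2norm ?G \<le> \<epsilon>"
    proof -
      have sw: "sqrt w = sqrt (real m) / 4" by (simp add: w_def real_sqrt_divide)
      then have "N powr s * L2norm ?G = \<epsilon> * (N powr s * N powr (- s))"
        unfolding gp(4) c_def using sm0 by (simp only: sw) (simp add: field_simps)
      also have "N powr s * N powr (- s) = 1" using N0 by (simp flip: powr_add)
      finally show ?thesis by simp
    qed
    fix x :: real assume x: "x \<in> {0..1}"
    then have x01: "0 \<le> x" "x \<le> 1" by auto
    obtain i j where i: "i \<in> {1..n}" and j: "0 \<le> d * of_int j" "d * of_int j \<le> 1"
      and ij: "\<bar>x - d * of_int j - d * real i / real n\<bar> \<le> d / real n"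
      using grid_approx[OF x01 d(1) n0] by blast
    define t where "t = - (d * real i / real n * N powr (1 - a) / a)"
    have tF: "t \<in> F" unfolding F_def t_def using i by (rule_tac imageI)
    have t1: "\<bar>t\<bar> \<le> 1" "0 < \<bar>t\<bar>" using Ft[OF tF] tau by auto
    have "(norm (cis (x * N + t * N powr a)) - 1 / 2) * (LINT \<xi>|lborel. g \<xi>) \<le> norm (LINT \<xi>|lborel. cis (x * \<xi> + t * \<bar>\<xi>\<bar> powr a) * of_real (g \<xi>))"
    proof (rule norm_weighted_integral_ge[where B = 1])
      show "0 \<le> g \<xi>" for \<xi> using c by (simp add: g_def)
      fix \<xi> assume "g \<xi> \<noteq> 0"
      then have "\<xi> \<in> S" by (auto simp: g_def indicator_def split: if_splits)
      then obtain l where l: "l < m" "N + D * real l \<le> \<xi>" "\<xi> \<le> N + D * real l + 1 / 16" unfolding S_def by (elim UN_E) auto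
      define \<eta> where "\<eta> = \<xi> - N - D * real l"
      have eta: "0 \<le> \<eta>" "\<eta> \<le> 1 / 16" using l by (auto simp: \<eta>_def)
      have h: "\<xi> - N = D * real l + \<eta>" by (simp add: \<eta>_def)
      have h1: "0 \<le> \<xi> - N" "\<xi> - N \<le> H" unfolding h using eta D1 tooth[OF l(1), of \<eta>] by auto
      have "norm (cis (x * (N + (\<xi> - N)) + t * (N + (\<xi> - N)) powr a) - cis (x * N + t * N powr a))
          \<le> \<eta> + d / real n * H + N powr (a - 2) * H\<^sup>2"
        by (rule comb_phase[OF a N0 Dd h h1 eta(1) j ij t_def t1(1)])
      \<comment> \<open>Tooth width 1/16, grid 1/8 and curvature 1/4 add up to 7/16.\<close>
      also have "\<dots> \<le> 1 / 2" using eta dnH Hsq by simp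
      finally show "norm (cis (x * \<xi> + t * \<bar>\<xi>\<bar> powr a) - cis (x * N + t * N powr a)) \<le> 1 / 2"
        using h1 N0 by simp
    qed (use gp in auto)
    then have low: "c * w / 2 \<le> norm (schr a ?G t x)"
      unfolding gp(2) schr_def by simp
    have t2: "1 \<le> \<bar>t\<bar> powr (- \<delta>)"
      using powr_mono2'[of "- \<delta>" "\<bar>t\<bar>" 1] t1 \<delta> by simp
    \<comment> \<open>Nothing is known about the value at time 0; it is moved to the left, as the
      definition of \<open>hump\<close> permits.\<close>
    have "A - norm (schr a ?G 0 x) \<le> norm (schr a ?G t x - schr a ?G 0 x)"
      using low A norm_triangle_ineq2[of "schr a ?G t x" "schr a ?G 0 x"] by linarith
    also have "\<dots> \<le> \<bar>t\<bar> powr (- \<delta>) * norm (schr a ?G t x - schr a ?G 0 x)"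
      using mult_right_mono[OF t2 norm_ge_zero] by simp
    finally show "\<exists>t\<in>F. A - norm (schr a ?G 0 x) \<le> \<bar>t\<bar> powr (- \<delta>) * norm (schr a ?G t x - schr a ?G 0 x)"
      using tF by blast
  next
    show "finite F" by (simp add: F_def)
    fix t assume "t \<in> F"
    then show "0 < \<bar>t\<bar>" "\<bar>t\<bar> \<le> \<tau>'" using Ft[of t] tau(3) by auto
  qed (use N(1) gp(3) in simp_all)
qed

lemma sobolev_antimono:
  assumes "s \<le> s'"
  shows "sobolev s' \<subseteq> sobolev s"
proof
  fix f assume "f \<in> sobolev s'"
  then obtain g where f: "tempered_distribution f" and g: "represents (fourier_dist f) g"
    and i: "integrable lborel (\<lambda>\<xi>. (1 + \<xi>\<^sup>2) powr s' * (norm (g \<xi>))\<^sup>2)"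
    by (auto simp: sobolev_def)
  have [measurable]: "g \<in> borel_measurable borel" using g by (simp add: represents_def)
  have "integrable lborel (\<lambda>\<xi>. (1 + \<xi>\<^sup>2) powr s * (norm (g \<xi>))\<^sup>2)"
  proof (rule Bochner_Integration.integrable_bound[OF i])
    have "(1 + \<xi>\<^sup>2) powr s * (norm (g \<xi>))\<^sup>2 \<le> (1 + \<xi>\<^sup>2) powr s' * (norm (g \<xi>))\<^sup>2" for \<xi>
      using assms by (intro mult_right_mono powr_mono) auto
    then show "AE \<xi> in lborel. norm ((1 + \<xi>\<^sup>2) powr s * (norm (g \<xi>))\<^sup>2) \<le> norm ((1 + \<xi>\<^sup>2) powr s' * (norm (g \<xi>))\<^sup>2)"
      by (intro AE_I2) simp
  qed measurable
  then show "f \<in> sobolev s" using f g by (auto simp: sobolev_def)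
qed

text \<open>A positive s' strictly between s and the critical value is used, since
  \<open>gliding_hump\<close> works with positive order. Its counterexample belongs to
  \<open>sobolev s\<close> as well, which also covers s <= 0. The larger of 1/4 and \<delta> selects
  the kind of hump.\<close>

lemma necessity:
  assumes a: "0 < a" "a < 1" and \<delta>: "0 \<le> \<delta>" "\<delta> < 1" and s: "s < max (1 / 4) \<delta> * a"
  shows "\<exists>f\<in>sobolev s. \<not> converges_ae_with_rate a \<delta> f"
proof -
  have "max s 0 < max (1 / 4) \<delta> * a" using a s by (simp add: zero_less_mult_iff)
  then obtain s' where s': "max s 0 < s'" "s' < max (1 / 4) \<delta> * a" using dense by blast
  then have s0: "0 < s'" by simp
  have "hump a \<delta> s'"
  proof (cases "1 / 4 \<le> \<delta>")
    case True
    then show ?thesis using s0 s' by (intro hump_rate a \<delta>) (auto simp: max_def)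
  next
    case False
    then show ?thesis using s0 s' by (intro hump_max a \<delta>) (auto simp: max_def)
  qed
  then have "\<exists>f\<in>sobolev s'. \<not> converges_ae_with_rate a \<delta> f"
    by (intro gliding_hump a \<delta> s0)
  then show ?thesis using sobolev_antimono[of s s'] s' by auto
qed

theorem theorem1p4:
  fixes a \<delta> s :: real
  assumes "0 < a" and "a < 1" and "0 \<le> \<delta>" and "\<delta> < 1"
  shows "(max (1/4) \<delta> * a < s \<longrightarrow> (\<forall>f\<in>sobolev s. converges_ae_with_rate a \<delta> f)) \<and>
         ((\<forall>f\<in>sobolev s. converges_ae_with_rate a \<delta> f) \<longrightarrow> max (1/4) \<delta> * a \<le> s)"
proof (intro conjI impI ballI)
  show "converges_ae_with_rate a \<delta> f" if "max (1/4) \<delta> * a < s" "f \<in> sobolev s" for f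
    using that by (rule sufficiency[OF assms])
  assume all: "\<forall>f\<in>sobolev s. converges_ae_with_rate a \<delta> f"
  show "max (1/4) \<delta> * a \<le> s"
  proof (rule ccontr)
    assume "\<not> max (1/4) \<delta> * a \<le> s"
    then have "s < max (1/4) \<delta> * a" by simp
    from necessity[OF assms this] all show False by blast
  qed
qed

end
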